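(* Let $\varphi_1,\dots,\varphi_t$ be finitely many endomorphisms of an abelian group $A$. Then every $\varphi_i$ is inertial if and only if there is a subgroup $A_0$ of finite index in $A$ such that (a) or (b) holds: (a) each $\varphi_i$ acts on $A_0$ as multiplication by an integer $m_i\in\mathbb{Z}$, i.e. $\varphi_i(x)=m_ix$ for all $x\in A_0$; (b) $A_0=B\oplus D\oplus C$ and there exist finite sets of primes $\pi\subseteq\pi_1$ such that: (i) $B\oplus D$ is the $\pi_1$-component of $A_0$, where $B$ is bounded and $D$ is a divisible $\pi'$-group of finite rank; (ii) $C$ is a $\mathbb{Q}^{\pi}[\varphi_1,\dots,\varphi_t]$-module (i.e. $C$ is a $\mathbb{Q}^\pi$-module invariant under all $\varphi_i$) having a submodule $V\cong\mathbb{Q}^\pi\oplus\dots\oplus\mathbb{Q}^\pi$ (finitely many summands) such that $C/V$ is a $\pi_1$-divisible $\pi'$-group; (iii) each $\varphi_i$ acts by (possibly different) multiplications on $B$, on $D$, on $V$ and on $C/V$; (iv) each $\varphi_i$ acts as the rational multiplication $\frac{m_i}{n_i}\in\mathbb{Q}$ on $V$ and on every $p$-component of $D$ for which the $p$-component of $C/V$ is infinite, and $\pi=\pi(n_1\cdots n_t)$.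
   Context: Abelian groups are written additively. An endomorphism $\varphi$ of an abelian group $A$ is inertial if $(\varphi(X)+X)/X$ is finite for every subgroup $X\le A$. For a set of primes $\pi$: $\pi'$ is the complementary set of primes; $A_\pi$ (the $\pi$-component) is the set of elements of $A$ whose order is a $\pi$-number; a group is $\pi$-divisible if $pA=A$ for all $p\in\pi$; $\mathbb{Q}^\pi$ is the ring of rationals whose denominators are $\pi$-numbers; $\pi(n)$ is the set of prime divisors of $n$. A group is bounded if $nA=0$ for some $n\ge1$. Multiplications: on a periodic group (or periodic section), a multiplication is the componentwise action of an element $(\alpha_p)_p\in\prod_p\mathbb{Z}_p$ ($\mathbb{Z}_p$ the $p$-adic integers), $\alpha_p$ acting on the $p$-component in the natural way; on a group $H$ that is $\pi(n)$-divisible with $H_{\pi(n)}=0$, the multiplication by $\frac{m}{n}$ ($m,n$ coprime integers) is the well-defined map $\varphi$ with $\varphi(nx)=mx$. Saying that $\varphi$ acts as a multiplication on a subgroup or section means that subgroup/section is $\varphi$-invariant and the induced map is such a multiplication. *)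

theory Defs
  imports Complex_Main "HOL-Computational_Algebra.Primes"
begin

text \<open>The abelian group A is the whole of a type 'a of class ab_group_add.\<close>

definition zmult :: "int \<Rightarrow> 'a::ab_group_add \<Rightarrow> 'a" where
  "zmult n x = (if 0 \<le> n then (\<Sum>_\<in>{..<nat n}. x) else - (\<Sum>_\<in>{..<nat (- n)}. x))"

definition endo :: "('a::ab_group_add \<Rightarrow> 'a) \<Rightarrow> bool" where
  "endo f \<longleftrightarrow> (\<forall>x y. f (x + y) = f x + f y)"

definition subgrp :: "'a::ab_group_add set \<Rightarrow> bool" where
  "subgrp H \<longleftrightarrow> 0 \<in> H \<and> (\<forall>x\<in>H. \<forall>y\<in>H. x + y \<in> H) \<and> (\<forall>x\<in>H. - x \<in> H)"

definition coset :: "'a::ab_group_add \<Rightarrow> 'a set \<Rightarrow> 'a set" where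
  "coset a H = {a + h | h. h \<in> H}"

definition sumset :: "'a::ab_group_add set \<Rightarrow> 'a set \<Rightarrow> 'a set" where
  "sumset S T = {s + t | s t. s \<in> S \<and> t \<in> T}"

definition finite_index :: "'a::ab_group_add set \<Rightarrow> bool" where
  "finite_index H \<longleftrightarrow> finite {coset a H | a. True}"

definition inertial :: "('a::ab_group_add \<Rightarrow> 'a) \<Rightarrow> bool" where
  "inertial f \<longleftrightarrow> (\<forall>X. subgrp X \<longrightarrow> finite {coset y X | y. y \<in> sumset (f ` X) X})"

definition pi_number :: "nat set \<Rightarrow> nat \<Rightarrow> bool" where
  "pi_number \<pi> n \<longleftrightarrow> n > 0 \<and> (\<forall>p. prime p \<and> p dvd n \<longrightarrow> p \<in> \<pi>)"

definition prime_divs :: "nat \<Rightarrow> nat set" where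
  "prime_divs n = {p. prime p \<and> p dvd n}"

definition comp :: "nat set \<Rightarrow> 'a::ab_group_add set \<Rightarrow> 'a set" where
  "comp \<pi> H = {x \<in> H. \<exists>n. pi_number \<pi> n \<and> zmult (int n) x = 0}"

definition bounded_grp :: "'a::ab_group_add set \<Rightarrow> bool" where
  "bounded_grp H \<longleftrightarrow> (\<exists>n::nat. n \<ge> 1 \<and> (\<forall>x\<in>H. zmult (int n) x = 0))"

definition divisible_grp :: "'a::ab_group_add set \<Rightarrow> bool" where
  "divisible_grp H \<longleftrightarrow> (\<forall>n::nat. n \<ge> 1 \<longrightarrow> (\<forall>x\<in>H. \<exists>y\<in>H. zmult (int n) y = x))"

definition pi_divisible :: "nat set \<Rightarrow> 'a::ab_group_add set \<Rightarrow> bool" where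
  "pi_divisible \<pi> H \<longleftrightarrow> (\<forall>p\<in>\<pi>. \<forall>x\<in>H. \<exists>y\<in>H. zmult (int p) y = x)"

definition pi_group :: "nat set \<Rightarrow> 'a::ab_group_add set \<Rightarrow> bool" where
  "pi_group \<pi> H \<longleftrightarrow> (\<forall>x\<in>H. \<exists>n. pi_number \<pi> n \<and> zmult (int n) x = 0)"

definition zspan :: "'a::ab_group_add set \<Rightarrow> 'a set" where
  "zspan F = {(\<Sum>s\<in>F. zmult (c s) s) | c. True}"

definition finite_rank :: "'a::ab_group_add set \<Rightarrow> bool" where
  "finite_rank H \<longleftrightarrow> (\<exists>r::nat. \<forall>F. finite F \<and> F \<subseteq> H \<longrightarrow>
      (\<exists>G. finite G \<and> card G \<le> r \<and> zspan G = zspan F))"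

definition Qpi :: "nat set \<Rightarrow> rat set" where
  "Qpi \<pi> = {of_int a / of_nat b | a b. pi_number \<pi> b}"

text \<open>Q^pi-module structure on an abelian group (unique if it exists).\<close>
definition Qpi_module :: "nat set \<Rightarrow> 'a::ab_group_add set \<Rightarrow> bool" where
  "Qpi_module \<pi> H \<longleftrightarrow> subgrp H \<and> (\<forall>p\<in>\<pi>. \<forall>x\<in>H. \<exists>!y. y \<in> H \<and> zmult (int p) y = x)"

definition Qpi_vec :: "nat set \<Rightarrow> nat \<Rightarrow> (nat \<Rightarrow> rat) set" where
  "Qpi_vec \<pi> k = {g. (\<forall>j<k. g j \<in> Qpi \<pi>) \<and> (\<forall>j\<ge>k. g j = 0)}"

definition iso_Qpi_sum :: "nat set \<Rightarrow> 'a::ab_group_add set \<Rightarrow> bool" where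
  "iso_Qpi_sum \<pi> V \<longleftrightarrow> (\<exists>k f. bij_betw f (Qpi_vec \<pi> k) V \<and>
      (\<forall>g\<in>Qpi_vec \<pi> k. \<forall>h\<in>Qpi_vec \<pi> k. f (\<lambda>j. g j + h j) = f g + f h))"

text \<open>p-adic integers, represented by compatible residues alpha p k modulo p^k.\<close>
definition padic_family :: "(nat \<Rightarrow> nat \<Rightarrow> int) \<Rightarrow> bool" where
  "padic_family \<alpha> \<longleftrightarrow> (\<forall>p k. prime p \<longrightarrow> \<alpha> p k mod (int p ^ k) = \<alpha> p (Suc k) mod (int p ^ k))"

text \<open>f acts as a multiplication on the periodic section S/T (T a subgroup of S):
  S and T are f-invariant, S/T is periodic, and for some (alpha_p) in prod_p Z_p,
  f acts as alpha_p on the p-component of S/T.\<close>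
definition acts_mult :: "('a::ab_group_add \<Rightarrow> 'a) \<Rightarrow> 'a set \<Rightarrow> 'a set \<Rightarrow> bool" where
  "acts_mult f S T \<longleftrightarrow> f ` S \<subseteq> S \<and> f ` T \<subseteq> T \<and>
     (\<forall>x\<in>S. \<exists>n::nat. n \<ge> 1 \<and> zmult (int n) x \<in> T) \<and>
     (\<exists>\<alpha>. padic_family \<alpha> \<and>
        (\<forall>x\<in>S. \<forall>p k. prime p \<and> zmult (int p ^ k) x \<in> T \<longrightarrow> f x - zmult (\<alpha> p k) x \<in> T))"

definition acts_ratmult :: "('a::ab_group_add \<Rightarrow> 'a) \<Rightarrow> int \<Rightarrow> nat \<Rightarrow> 'a set \<Rightarrow> bool" where
  "acts_ratmult f m n H \<longleftrightarrow> f ` H \<subseteq> H \<and> n \<ge> 1 \<and> coprime m (int n) \<and>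
     pi_divisible (prime_divs n) H \<and> comp (prime_divs n) H \<subseteq> {0} \<and>
     (\<forall>x\<in>H. f (zmult (int n) x) = zmult m x)"

text \<open>p-component of the section S/T (as a set of representatives in S).\<close>
definition sec_pcomp :: "nat \<Rightarrow> 'a::ab_group_add set \<Rightarrow> 'a set \<Rightarrow> 'a set" where
  "sec_pcomp p S T = {x \<in> S. \<exists>k. zmult (int p ^ k) x \<in> T}"

definition direct3 :: "'a::ab_group_add set \<Rightarrow> 'a set \<Rightarrow> 'a set \<Rightarrow> bool" where
  "direct3 B D C \<longleftrightarrow> (\<forall>b\<in>B. \<forall>d\<in>D. \<forall>c\<in>C. b + d + c = 0 \<longrightarrow> b = 0 \<and> d = 0 \<and> c = 0)"

end

theory Submission
  imports Defs "HOL-Library.FuncSet"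
begin

text \<open>
  Inertiality only needs to be tested on the subgroups of a subgroup of finite index. In case (b) one
  compares \<open>X \<le> D \<oplus> C\<close> with its multiples: \<open>n\<^sub>i \<phi>\<^sub>i - m\<^sub>i\<close> kills \<open>V\<close> and acts on \<open>(D \<oplus> C) / V\<close> by multiplications,
  while \<open>X / p X\<close> is finite for all \<open>p \<in> \<pi>\<^sub>1\<close> because \<open>V\<close> has finite rank and \<open>D \<oplus> C\<close> has a finite
  \<open>p\<close>-socle.

  Conversely, every element outside the torsion subgroup has a multiple on which an inertial \<open>\<phi>\<close> is a
  fraction \<open>m / n\<close>, the same for all elements modulo torsion. If the torsion-free rank is infinite, then
  \<open>n = 1\<close>, and \<open>\<phi> - m\<close> has finite image, since otherwise infinitely many of its values could be taken at
  independent elements; this is case (a). If the rank is finite, the \<open>p\<close>-components for \<open>p\<close> dividing \<open>n\<close>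
  are bounded, so some multiple of \<open>A\<close> contains a torsion-free \<open>V\<close> with periodic \<open>A / V\<close> on which all
  \<open>\<phi>\<^sub>i\<close> are fractions. An inductive choice of elements shows that each \<open>\<phi>\<^sub>i\<close> acts on some \<open>Y / V\<close> as a
  multiplication, where \<open>A / Y\<close> has finite socle. Hence for almost all \<open>p\<close> the \<open>p\<close>-component of \<open>A / V\<close> lies
  in \<open>Y / V\<close>. For each remaining \<open>p\<close>, up to finite index, either all \<open>\<phi>\<^sub>i\<close> act on this component as
  multiplications, which is forced by a Pruefer section if the \<open>p\<close>-component of \<open>Y / V\<close> is unbounded, or it is
  the sum of a bounded part and a divisible part of finite rank. The \<open>p\<close>-torsion of \<open>A\<close> splits off the divisible
  part. If its complement is not contained in \<open>V\<close>, then \<open>n\<^sub>i \<phi>\<^sub>i - m\<^sub>i\<close>, which maps it into torsion because it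
  kills \<open>V\<close>, must vanish on the whole divisible part modulo \<open>V\<close>, hence on the torsion.
\<close>

text \<open>Finiteness is handled as \<open>almost K H\<close>: finitely many cosets of
  \<open>H\<close> cover \<open>K\<close>. Inertiality enters mostly through a pigeonhole argument:
  for a subgroup \<open>X\<close> generated by a well-chosen sequence, two values of
  \<open>f\<close> are congruent modulo \<open>X\<close>, and comparing coefficients contradicts the
  choice. Multiplications are traded for the pointwise condition \<open>pw\<close>, which is tested
  on single elements; p-adic coefficients are recovered from it where they matter. The obstacle is
  that \<open>f\<close> may have different coefficients on two sections. Where both contain
  quasicyclic groups, or one is a chain of p-th parts of an element of infinite order, a diagonal
  subgroup between them detects the difference. This bounds the torsion at the primes of the
  denominators and forces multiplications on a component over an unbounded \<open>Y / V\<close>.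
  Direct sums exist only up to finite index. The bounded \<open>\<pi>1\<close>-torsion left in the
  summand complementary to \<open>B\<close> and \<open>D\<close> is removed by passing to
  \<open>N\<close> times this summand; the index stays finite because the summand is its own
  \<open>N\<close>-th multiple plus \<open>V\<close>, and \<open>V / N V\<close> is finite.\<close>

notation zmult (infixr "\<cdot>" 75)

section \<open>Abelian groups as modules over the integers\<close>

lemma zmult_succ: "zmult (n + 1) x = zmult n x + x"
proof (cases "0 \<le> n")
  case True
  then have "nat (n + 1) = Suc (nat n)" by simp
  then show ?thesis using True by (simp add: zmult_def)
next
  case False
  then have eq: "nat (- n) = Suc (nat (- n - 1))" by simp
  have *: "- (n + 1) = - n - 1" by simp
  show ?thesis
  proof (cases "n = -1")
    case True
    then show ?thesis by (simp add: zmult_def lessThan_Suc)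
  next
    case neq: False
    then have "\<not> 0 \<le> n + 1" using False by simp
    then show ?thesis using False by (simp only: zmult_def * eq if_False) (simp add: lessThan_Suc)
  qed
qed

lemma zmult_pred: "zmult (n - 1) x = zmult n x - x"
  using zmult_succ[of "n - 1" x] by simp

lemma zmult_0_left: "zmult 0 x = 0" by (simp add: zmult_def)

lemma zmult_add_left: "zmult (a + b) x = zmult a x + zmult b x"
proof (induction b rule: int_induct[where k = 0])
  case base
  then show ?case by (simp add: zmult_0_left)
next
  case (step1 i)
  then show ?case using zmult_succ[of "a + i" x] zmult_succ[of i x] by (simp add: algebra_simps)
next
  case (step2 i)
  then show ?case using zmult_pred[of "a + i" x] zmult_pred[of i x] by (simp add: add_diff_eq)
qed

lemma zmult_add_right: "zmult a (x + y) = zmult a x + zmult a y"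
  by (induction a rule: int_induct[where k = 0])
    (simp_all add: zmult_0_left zmult_succ zmult_pred algebra_simps)

lemma zmult_zmult: "zmult a (zmult b x) = zmult (a * b) x"
proof (induction a rule: int_induct[where k = 0])
  case base
  then show ?case by (simp add: zmult_0_left)
next
  case (step1 i)
  then show ?case using zmult_add_left[of "i * b" b x] by (simp add: zmult_succ distrib_right)
next
  case (step2 i)
  then show ?case using zmult_add_left[of "i * b - b" b x] by (simp add: zmult_pred left_diff_distrib)
qed

lemma zmult_1: "zmult 1 x = x"
  using zmult_succ[of 0 x] by (simp add: zmult_0_left)

text \<open>Supplies \<open>zm.span\<close> and the rules for finite sums; subgroups are exactly the
  submodules.\<close>

interpretation zm: module "zmult :: int \<Rightarrow> 'a::ab_group_add \<Rightarrow> 'a"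
  by standard (simp_all add: zmult_add_left zmult_add_right zmult_zmult zmult_1)

lemmas zm_simps = zmult_add_left zmult_add_right zmult_zmult zmult_1
  zm.scale_left_diff_distrib zm.scale_right_diff_distrib

section \<open>Subgroups and sums of subsets\<close>

lemma subgrp_0: "subgrp H \<Longrightarrow> 0 \<in> H" by (simp add: subgrp_def)
lemma subgrp_add: "subgrp H \<Longrightarrow> x \<in> H \<Longrightarrow> y \<in> H \<Longrightarrow> x + y \<in> H" by (simp add: subgrp_def)
lemma subgrp_uminus: "subgrp H \<Longrightarrow> x \<in> H \<Longrightarrow> - x \<in> H" by (simp add: subgrp_def)
lemma subgrp_diff: "subgrp H \<Longrightarrow> x \<in> H \<Longrightarrow> y \<in> H \<Longrightarrow> x - y \<in> H"
  using subgrp_add[of H x "- y"] by (simp add: subgrp_uminus)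

lemma subgrp_zmult: "subgrp H \<Longrightarrow> x \<in> H \<Longrightarrow> a \<cdot> x \<in> H"
  by (induction a rule: int_induct[where k = 0])
    (simp_all add: subgrp_0 zmult_succ zmult_pred subgrp_add subgrp_diff)

lemmas subgrp_intros = subgrp_0 subgrp_add subgrp_uminus subgrp_diff subgrp_zmult

lemma subgrp_sum: "subgrp H \<Longrightarrow> (\<And>i. i \<in> I \<Longrightarrow> g i \<in> H) \<Longrightarrow> sum g I \<in> H"
  by (induction I rule: infinite_finite_induct) (auto intro: subgrp_intros)

lemma subgrpI:
  assumes "0 \<in> H" "\<And>x y. x \<in> H \<Longrightarrow> y \<in> H \<Longrightarrow> x - y \<in> H"
  shows "subgrp H"
proof -
  have neg: "- x \<in> H" if "x \<in> H" for x using assms(2)[OF assms(1) that] by simp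
  have "x + y \<in> H" if "x \<in> H" "y \<in> H" for x y using assms(2)[OF that(1) neg[OF that(2)]] by simp
  then show ?thesis using assms neg by (auto simp: subgrp_def)
qed

lemma subgrp_iff_subspace: "subgrp H \<longleftrightarrow> zm.subspace H"
proof
  assume "subgrp H" then show "zm.subspace H" by (simp add: zm.subspace_def subgrp_intros)
next
  assume "zm.subspace H"
  then show "subgrp H" by (intro subgrpI zm.subspace_0 zm.subspace_diff)
qed

lemma subgrp_span: "subgrp (zm.span S)"
  by (simp add: subgrp_iff_subspace)

lemma span_le_subgrp: "S \<subseteq> H \<Longrightarrow> subgrp H \<Longrightarrow> zm.span S \<subseteq> H"
  by (simp add: subgrp_iff_subspace zm.span_minimal)

lemma subgrp_UNIV: "subgrp UNIV" by (simp add: subgrp_def)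
lemma subgrp_zero: "subgrp {0}" by (simp add: subgrp_def)
lemma subgrp_Int: "subgrp H \<Longrightarrow> subgrp K \<Longrightarrow> subgrp (H \<inter> K)" by (simp add: subgrp_def)
lemma subgrp_INT: "(\<And>i. i \<in> I \<Longrightarrow> subgrp (H i)) \<Longrightarrow> subgrp (\<Inter>i\<in>I. H i)" by (simp add: subgrp_def)

lemma subgrp_add_cancel: "subgrp H \<Longrightarrow> y \<in> H \<Longrightarrow> x + y \<in> H \<longleftrightarrow> x \<in> H"
  by (metis add_diff_cancel_right' subgrp_add subgrp_diff)

lemma subgrp_diff_cancel: "subgrp H \<Longrightarrow> y \<in> H \<Longrightarrow> x - y \<in> H \<longleftrightarrow> x \<in> H"
  by (metis diff_add_cancel subgrp_add subgrp_diff)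

lemma subgrp_diff_commute: "subgrp H \<Longrightarrow> x - y \<in> H \<longleftrightarrow> y - x \<in> H"
  by (metis minus_diff_eq subgrp_uminus)

text \<open>By Bezout \<open>x\<close> is an integer combination of the two multiples. This is the
  standard way to discard factors prime to the order under consideration.\<close>

lemma subgrp_coprime:
  assumes H: "subgrp H" and "a \<cdot> x \<in> H" "b \<cdot> x \<in> H" "coprime a b"
  shows "x \<in> H"
proof -
  obtain u v where uv: "u * a + v * b = 1"
    using assms(4) by (metis bezout_int coprime_iff_gcd_eq_1)
  have "u \<cdot> a \<cdot> x + v \<cdot> b \<cdot> x \<in> H" using subgrp_zmult[OF H] assms(2,3) by (intro subgrp_add[OF H])
  also have "u \<cdot> a \<cdot> x + v \<cdot> b \<cdot> x = x"
    unfolding zmult_zmult zmult_add_left[symmetric] uv zmult_1 ..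
  finally show ?thesis .
qed

lemma subgrp_zmult_dvd: "subgrp H \<Longrightarrow> a \<cdot> x \<in> H \<Longrightarrow> a dvd b \<Longrightarrow> b \<cdot> x \<in> H"
  by (metis dvd_def mult.commute subgrp_zmult zmult_zmult)

lemma sumsetI: "a \<in> S \<Longrightarrow> b \<in> T \<Longrightarrow> a + b \<in> sumset S T" by (auto simp: sumset_def)
lemma sumsetE: "x \<in> sumset S T \<Longrightarrow> (\<And>a b. a \<in> S \<Longrightarrow> b \<in> T \<Longrightarrow> x = a + b \<Longrightarrow> P) \<Longrightarrow> P"
  by (auto simp: sumset_def)
lemma sumset_mono: "S \<subseteq> S' \<Longrightarrow> T \<subseteq> T' \<Longrightarrow> sumset S T \<subseteq> sumset S' T'" by (auto simp: sumset_def)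
lemma sumset_assoc: "sumset (sumset S T) U = sumset S (sumset T U)"
proof (rule set_eqI)
  fix x
  have "x \<in> sumset (sumset S T) U \<longleftrightarrow> (\<exists>s\<in>S. \<exists>t\<in>T. \<exists>u\<in>U. x = s + t + u)" by (auto simp: sumset_def)
  also have "\<dots> \<longleftrightarrow> x \<in> sumset S (sumset T U)" by (fastforce simp: sumset_def add.assoc)
  finally show "x \<in> sumset (sumset S T) U \<longleftrightarrow> x \<in> sumset S (sumset T U)" .
qed
lemma sumset_commute: "sumset S T = sumset T S"
  unfolding sumset_def using add.commute by blast
lemma sumset_left: "0 \<in> T \<Longrightarrow> S \<subseteq> sumset S T" by (force simp: sumset_def)
lemma sumset_right: "0 \<in> S \<Longrightarrow> T \<subseteq> sumset S T" by (force simp: sumset_def)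
lemma finite_sumset: "finite S \<Longrightarrow> finite T \<Longrightarrow> finite (sumset S T)"
proof -
  assume "finite S" "finite T"
  moreover have "sumset S T = (\<lambda>(a, b). a + b) ` (S \<times> T)" by (auto simp: sumset_def)
  ultimately show ?thesis by simp
qed
lemma sumset_subset: "subgrp H \<Longrightarrow> S \<subseteq> H \<Longrightarrow> T \<subseteq> H \<Longrightarrow> sumset S T \<subseteq> H"
  by (auto simp: sumset_def intro: subgrp_add)

lemma subgrp_sumset:
  assumes "subgrp H" "subgrp K" shows "subgrp (sumset H K)"
proof (rule subgrpI)
  show "0 \<in> sumset H K" using assms sumsetI[of 0 H 0 K] by (simp add: subgrp_0)
next
  fix x y assume "x \<in> sumset H K" "y \<in> sumset H K"
  then obtain a b c d where *: "a \<in> H" "b \<in> K" "c \<in> H" "d \<in> K" "x = a + b" "y = c + d"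
    by (auto elim!: sumsetE)
  have "(a - c) + (b - d) \<in> sumset H K" using * assms by (intro sumsetI subgrp_diff)
  then show "x - y \<in> sumset H K" using * by (simp add: algebra_simps)
qed

subsection \<open>Endomorphisms\<close>

lemma endo_add: "endo f \<Longrightarrow> f (x + y) = f x + f y" by (simp add: endo_def)
lemma endo_0: "endo f \<Longrightarrow> f 0 = 0" by (metis add_cancel_right_right endo_add)
lemma endo_diff: "endo f \<Longrightarrow> f (x - y) = f x - f y"
  by (metis add_diff_cancel_right' diff_add_cancel endo_add)
lemma endo_zmult: "endo f \<Longrightarrow> f (a \<cdot> x) = a \<cdot> f x"
  by (induction a rule: int_induct[where k = 0])
    (simp_all add: endo_0 zmult_succ zmult_pred endo_add endo_diff)
lemmas endo_simps = endo_add endo_diff endo_zmult endo_0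

lemma subgrp_image: "endo f \<Longrightarrow> subgrp H \<Longrightarrow> subgrp (f ` H)"
  by (rule subgrpI) (metis endo_0 imageI subgrp_0, metis (no_types, lifting) endo_diff imageE imageI subgrp_diff)
lemma subgrp_vimage: "endo f \<Longrightarrow> subgrp H \<Longrightarrow> subgrp (f -` H)"
  by (rule subgrpI) (auto simp: endo_0 endo_diff subgrp_0 subgrp_diff)
lemma endo_zmult_const: "endo (\<lambda>x. a \<cdot> x)" by (simp add: endo_def zmult_add_right)

subsection \<open>Containment up to finitely many cosets\<close>

text \<open>For a subgroup \<open>H\<close> of \<open>K\<close> this is finite index. Without an
  inclusion between \<open>H\<close> and \<open>K\<close> the relation still composes and passes
  through sums, images and preimages.\<close>

definition almost :: "'a::ab_group_add set \<Rightarrow> 'a set \<Rightarrow> bool" where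
  "almost K H \<longleftrightarrow> (\<exists>F. finite F \<and> K \<subseteq> sumset F H)"

text \<open>Each value of \<open>g\<close> gets one representative in \<open>K\<close>; these
  finitely many elements are the translates.\<close>

lemma almost_by:
  assumes "finite (g ` K)" "\<And>x y. x \<in> K \<Longrightarrow> y \<in> K \<Longrightarrow> g x = g y \<Longrightarrow> x - y \<in> H"
  shows "almost K H"
  unfolding almost_def
proof (intro exI conjI)
  let ?r = "\<lambda>c. SOME y. y \<in> K \<and> g y = c"
  show "finite (?r ` g ` K)" using assms(1) by simp
  show "K \<subseteq> sumset (?r ` g ` K) H"
  proof
    fix x assume x: "x \<in> K"
    let ?y = "?r (g x)"
    have y: "?y \<in> K \<and> g ?y = g x" by (rule someI[of _ x]) (use x in simp)
    then have "x - ?y \<in> H" using assms(2)[of x ?y] x by simp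
    then have "?y + (x - ?y) \<in> sumset (?r ` g ` K) H" using x by (intro sumsetI) auto
    then show "x \<in> sumset (?r ` g ` K) H" by simp
  qed
qed

lemma almostE:
  assumes "almost K H"
  obtains c where "finite (c ` K)" "\<And>x. x \<in> K \<Longrightarrow> x - c x \<in> H"
proof -
  obtain F where F: "finite F" "K \<subseteq> sumset F H" using assms by (auto simp: almost_def)
  have "\<forall>x\<in>K. \<exists>c\<in>F. x - c \<in> H"
  proof
    fix x assume "x \<in> K"
    then have "x \<in> sumset F H" using F by auto
    then obtain a b where "a \<in> F" "b \<in> H" "x = a + b" by (rule sumsetE)
    then show "\<exists>c\<in>F. x - c \<in> H" by (intro bexI[of _ a]) auto
  qed
  then obtain c where "\<forall>x\<in>K. c x \<in> F \<and> x - c x \<in> H" by metis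
  then show thesis using that[of c] F(1) finite_subset[of "c ` K" F] by blast
qed

text \<open>Links the coset sets in the definitions of finite index and inertiality and in condition
  (iv) to \<open>almost\<close>.\<close>

lemma almost_iff_cosets:
  assumes H: "subgrp H"
  shows "finite {coset y H | y. y \<in> K} \<longleftrightarrow> almost K H"
proof
  assume "finite {coset y H | y. y \<in> K}"
  moreover have "{coset y H | y. y \<in> K} = (\<lambda>y. coset y H) ` K" by auto
  moreover have "x - y \<in> H" if "coset x H = coset y H" for x y
  proof -
    have "x \<in> coset x H" using subgrp_0[OF H] by (force simp: coset_def)
    then have "x \<in> coset y H" using that by simp
    then obtain h where "h \<in> H" "x = y + h" unfolding coset_def by blast
    then show ?thesis by simp
  qed
  ultimately show "almost K H" by (intro almost_by[where g = "\<lambda>y. coset y H"]) auto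
next
  assume "almost K H"
  then obtain c where c: "finite (c ` K)" "\<And>x. x \<in> K \<Longrightarrow> x - c x \<in> H" using almostE[of K H] by metis
  have "coset x H = coset (c x) H" if "x \<in> K" for x
  proof -
    have *: "coset u H \<subseteq> coset v H" if "u - v \<in> H" for u v
    proof
      fix w assume "w \<in> coset u H"
      then obtain h where "h \<in> H" "w = u + h" by (auto simp: coset_def)
      then have "w = v + ((u - v) + h)" "(u - v) + h \<in> H" using that H by (auto intro: subgrp_add)
      then show "w \<in> coset v H" unfolding coset_def by blast
    qed
    show ?thesis using *[of x "c x"] *[of "c x" x] c(2)[OF that] subgrp_diff_commute[OF H] by blast
  qed
  then have "{coset y H | y. y \<in> K} \<subseteq> (\<lambda>y. coset y H) ` c ` K" by auto
  then show "finite {coset y H | y. y \<in> K}" by (rule finite_subset) (use c in simp)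
qed

text \<open>Mostly used with \<open>K\<close> the image of a subgroup and \<open>H\<close> that
  subgroup: an inertial map sends two terms of any sequence in the subgroup to congruent elements.
  The bound \<open>m\<close> makes the indices as large as a later order argument wants.\<close>

lemma almost_pigeonhole:
  fixes g :: "nat \<Rightarrow> 'a::ab_group_add"
  assumes H: "subgrp H" and K: "almost K H" and g: "\<And>k. k \<ge> m \<Longrightarrow> g k \<in> K"
  shows "\<exists>l k. m \<le> l \<and> l < k \<and> g k - g l \<in> H"
proof -
  obtain c where c: "finite (c ` K)" "\<And>x. x \<in> K \<Longrightarrow> x - c x \<in> H" using almostE[OF K] by metis
  have "finite ((c \<circ> g) ` {m..})" by (rule finite_subset[OF _ c(1)]) (use g in auto)
  then have "\<not> inj_on (c \<circ> g) {m..}" using finite_imageD infinite_Ici by blast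
  then obtain i j where ij: "i \<ge> m" "j \<ge> m" "i \<noteq> j" "c (g i) = c (g j)" by (auto simp: inj_on_def)
  have "(g i - c (g i)) - (g j - c (g j)) \<in> H" using ij by (intro subgrp_diff[OF H] c g)
  then have d: "g i - g j \<in> H" using ij by simp
  show ?thesis
  proof (cases "i < j")
    case True
    then show ?thesis using d ij subgrp_diff_commute[OF H] by blast
  next
    case False
    then have "j < i" using ij by simp
    then show ?thesis using d ij by blast
  qed
qed

lemma almost_mono: "almost K H \<Longrightarrow> K' \<subseteq> K \<Longrightarrow> H \<subseteq> H' \<Longrightarrow> almost K' H'"
  unfolding almost_def using sumset_mono[OF order.refl, of H H'] by blast

lemma almost_subset: "K \<subseteq> H \<Longrightarrow> almost K H"
  unfolding almost_def by (intro exI[of _ "{0}"]) (force simp: sumset_def)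

lemma almost_finite: "finite K \<Longrightarrow> 0 \<in> H \<Longrightarrow> almost K H"
  unfolding almost_def by (intro exI[of _ K]) (force simp: sumset_def)

lemma almost_trans: "almost K H \<Longrightarrow> almost H L \<Longrightarrow> almost K L"
  unfolding almost_def
proof (elim exE conjE)
  fix F G assume "finite F" "K \<subseteq> sumset F H" "finite G" "H \<subseteq> sumset G L"
  moreover from this have "K \<subseteq> sumset (sumset F G) L"
    unfolding sumset_assoc using sumset_mono[OF order.refl, of H "sumset G L" F] by blast
  ultimately show "\<exists>F. finite F \<and> K \<subseteq> sumset F L"
    using finite_sumset by (intro exI[of _ "sumset F G"]) simp
qed

lemma almost_sumset: "almost K H \<Longrightarrow> almost K' H' \<Longrightarrow> almost (sumset K K') (sumset H H')"
  unfolding almost_def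
proof (elim exE conjE)
  fix F G assume *: "finite F" "K \<subseteq> sumset F H" "finite G" "K' \<subseteq> sumset G H'"
  have "sumset (sumset F H) (sumset G H') = sumset (sumset F G) (sumset H H')"
    using sumset_commute[of H "sumset G H'"] sumset_commute[of H H'] by (simp add: sumset_assoc)
  then have "sumset K K' \<subseteq> sumset (sumset F G) (sumset H H')" using sumset_mono[OF *(2,4)] by simp
  then show "\<exists>Fa. finite Fa \<and> sumset K K' \<subseteq> sumset Fa (sumset H H')"
    using * by (intro exI[of _ "sumset F G"] conjI finite_sumset)
qed

lemma almost_sumset_same:
  assumes "almost K H" "almost K' H" "subgrp H" shows "almost (sumset K K') H"
  using almost_sumset[OF assms(1,2)] sumset_subset[OF assms(3) order.refl order.refl] almost_mono by blast

lemma almost_image: "endo f \<Longrightarrow> almost K H \<Longrightarrow> almost (f ` K) (f ` H)"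
  unfolding almost_def
proof (elim exE conjE)
  fix F assume *: "endo f" "finite F" "K \<subseteq> sumset F H"
  then have "f ` K \<subseteq> sumset (f ` F) (f ` H)"
    by (fastforce simp: sumset_def endo_add)
  then show "\<exists>F. finite F \<and> f ` K \<subseteq> sumset F (f ` H)" using * by blast
qed

lemma almost_vimage:
  assumes "endo f" "subgrp H" "almost (f ` K) H" shows "almost K (f -` H)"
proof -
  obtain c where c: "finite (c ` f ` K)" "\<And>x. x \<in> f ` K \<Longrightarrow> x - c x \<in> H"
    using almostE[OF assms(3)] by metis
  show ?thesis
  proof (rule almost_by[where g = "\<lambda>x. c (f x)"])
    show "finite ((\<lambda>x. c (f x)) ` K)" using c(1) by (simp add: image_image)
    fix x y assume "x \<in> K" "y \<in> K" "c (f x) = c (f y)"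
    then show "x - y \<in> f -` H"
      using subgrp_diff[OF assms(2) c(2)[of "f x"] c(2)[of "f y"]] assms(1) by (simp add: endo_diff)
  qed
qed

lemma almost_INT:
  assumes "finite I" "\<And>i. i \<in> I \<Longrightarrow> subgrp (H i)" "\<And>i. i \<in> I \<Longrightarrow> almost K (H i)"
  shows "almost K (\<Inter>i\<in>I. H i)"
proof -
  have "\<forall>i\<in>I. \<exists>c. finite (c ` K) \<and> (\<forall>x\<in>K. x - c x \<in> H i)" using assms(3) almostE by metis
  then obtain c where c: "\<forall>i\<in>I. finite (c i ` K) \<and> (\<forall>x\<in>K. x - c i x \<in> H i)" by metis
  \<comment> \<open>\<open>restrict\<close> makes the tuple of representatives extensional, hence an
    element of a finite product.\<close>
  let ?g = "\<lambda>x. restrict (\<lambda>i. c i x) I"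
  show ?thesis
  proof (rule almost_by[where g = ?g])
    show "finite (?g ` K)"
      by (rule finite_subset[of _ "PiE I (\<lambda>i. c i ` K)"]) (use c assms(1) in \<open>auto intro: finite_PiE\<close>)
    fix x y assume *: "x \<in> K" "y \<in> K" "?g x = ?g y"
    show "x - y \<in> (\<Inter>i\<in>I. H i)"
    proof
      fix i assume i: "i \<in> I"
      then have eq: "c i x = c i y" using fun_cong[OF *(3), of i] by simp
      have "x - c i x \<in> H i" "y - c i y \<in> H i" using c i *(1,2) by auto
      from subgrp_diff[OF assms(2)[OF i] this] show "x - y \<in> H i" using eq by simp
    qed
  qed
qed

lemma almost_Int: "subgrp H \<Longrightarrow> subgrp L \<Longrightarrow> almost K H \<Longrightarrow> almost K L \<Longrightarrow> almost K (H \<inter> L)"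
  using almost_INT[of "{True, False}" "\<lambda>b. if b then H else L" K] by (auto simp: Int_commute)

lemma almost_Int_self: "subgrp H \<Longrightarrow> subgrp K \<Longrightarrow> almost K H \<Longrightarrow> almost K (K \<inter> H)"
  by (intro almost_Int) (auto intro: almost_subset)

section \<open>Inertiality in terms of \<open>almost\<close>\<close>

definition inertial_on :: "('a::ab_group_add \<Rightarrow> 'a) \<Rightarrow> 'a set \<Rightarrow> bool" where
  "inertial_on f E \<longleftrightarrow> (\<forall>X. subgrp X \<longrightarrow> X \<subseteq> E \<longrightarrow> almost (f ` X) X)"

text \<open>Adding the summand \<open>X\<close> to the image creates no new cosets of
  \<open>X\<close>.\<close>

lemma inertial_iff: "inertial f \<longleftrightarrow> (\<forall>X. subgrp X \<longrightarrow> almost (f ` X) X)"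
proof -
  have "almost (sumset (f ` X) X) X \<longleftrightarrow> almost (f ` X) X" if X: "subgrp X" for X
    using almost_sumset_same[OF _ almost_subset[OF order.refl] X] sumset_left[OF subgrp_0[OF X], of "f ` X"] almost_mono
    by blast
  then show ?thesis unfolding inertial_def by (auto simp: almost_iff_cosets)
qed

lemma finite_index_iff: "subgrp H \<Longrightarrow> finite_index H \<longleftrightarrow> almost UNIV H"
  using almost_iff_cosets[of H UNIV] by (simp add: finite_index_def)

text \<open>Finitely many cosets of \<open>X \<inter> A0\<close> cover \<open>X\<close>, and
  \<open>f\<close> maps cosets to cosets, so only the intersection has to be tested.\<close>

lemma inertial_from_finite_index:
  assumes f: "endo f" and A0: "subgrp A0" "almost UNIV A0" and on: "inertial_on f A0"
  shows "inertial f"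
  unfolding inertial_iff
proof (intro allI impI)
  fix X :: "'a set" assume X: "subgrp X"
  have "almost X (X \<inter> A0)" using almost_Int_self[OF A0(1) X] almost_mono[OF A0(2)] by blast
  then have "almost (f ` X) (f ` (X \<inter> A0))" by (rule almost_image[OF f])
  also have "almost (f ` (X \<inter> A0)) (X \<inter> A0)"
    using on subgrp_Int[OF X A0(1)] by (simp add: inertial_on_def)
  finally (almost_trans) show "almost (f ` X) X" by (rule almost_mono) auto
qed

subsection \<open>Pointwise multiplications\<close>

text \<open>For subgroups \<open>T \<subseteq> S\<close> this means that \<open>f\<close> maps every
  subgroup between \<open>T\<close> and \<open>S\<close> into itself. On periodic sections it agrees
  with \<open>acts_mult\<close>, but it involves no p-adic integers and can be verified element by
  element.\<close>

definition pw :: "('a::ab_group_add \<Rightarrow> 'a) \<Rightarrow> 'a set \<Rightarrow> 'a set \<Rightarrow> bool" where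
  "pw f S T \<longleftrightarrow> (\<forall>x\<in>S. \<exists>a. f x - a \<cdot> x \<in> T)"

lemma pwD: "pw f S T \<Longrightarrow> x \<in> S \<Longrightarrow> \<exists>a. f x - a \<cdot> x \<in> T" by (simp add: pw_def)

lemma pw_subset: "pw f S T \<Longrightarrow> S' \<subseteq> S \<Longrightarrow> T \<subseteq> T' \<Longrightarrow> pw f S' T'"
  unfolding pw_def by (meson subsetD)

lemma pw_invariant:
  assumes "pw f S T" "subgrp S" "T \<subseteq> S" "x \<in> S" shows "f x \<in> S"
proof -
  obtain a where "f x - a \<cdot> x \<in> S" using pwD[OF assms(1,4)] assms(3) by blast
  then show ?thesis using subgrp_diff_cancel[OF assms(2)] subgrp_zmult[OF assms(2,4)] by blast
qed

lemma pw_base: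
  assumes "pw f S T" "subgrp T" "T \<subseteq> S" "x \<in> T" shows "f x \<in> T"
proof -
  obtain a where "f x - a \<cdot> x \<in> T" using pwD[OF assms(1), of x] assms(3,4) by blast
  then show ?thesis using subgrp_diff_cancel[OF assms(2)] subgrp_zmult[OF assms(2,4)] by blast
qed

section \<open>Primary parts of an element modulo a subgroup\<close>

lemma prime_power_split:
  fixes n :: nat assumes "prime p" "n \<ge> 1"
  obtains k M where "n = p ^ k * M" "\<not> p dvd M"
proof -
  have "n \<noteq> 0" "\<not> is_unit p" using assms by (auto simp: prime_nat_iff)
  then show thesis using multiplicity_decompose'[of n p] that by metis
qed

lemma coprime_prime_power:
  "prime p \<Longrightarrow> \<not> p dvd (M::nat) \<Longrightarrow> coprime (int p ^ k) (int M)"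
  by (metis coprime_int_iff coprime_power_left_iff prime_imp_coprime)

lemma bezout_coprime:
  fixes a b :: int assumes "coprime a b" obtains u v where "u * a + v * b = 1"
  using bezout_int[of a b] assms by (auto simp: coprime_iff_gcd_eq_1)

lemma crt_int:
  fixes M L :: int assumes "coprime M L"
  obtains a where "M dvd a - a1" "L dvd a - a2"
proof -
  obtain u v where uv: "u * L + v * M = 1" using assms bezout_coprime[of L M] by (auto simp: coprime_commute)
  let ?a = "a1 * (u * L) + a2 * (v * M)"
  have "?a - a1 = v * M * (a2 - a1)" "?a - a2 = u * L * (a1 - a2)"
    using uv by (algebra, algebra)
  then have "M dvd ?a - a1" "L dvd ?a - a2" by (metis dvd_triv_left dvd_triv_right dvd_mult2 dvd_mult)+
  then show thesis by (rule that)
qed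

text \<open>With \<open>n = p ^ k * M\<close> and \<open>u * M + v * p ^ k = 1\<close>, the multiple
  \<open>c = u * M\<close> projects \<open>x\<close> to its \<open>p\<close>-part modulo
  \<open>V\<close>, and \<open>1 - c\<close> projects it to a part killed by \<open>M\<close>. Since
  \<open>M < n\<close>, this drives inductions on \<open>n\<close>.\<close>

lemma primary_split:
  assumes V: "subgrp V" and n: "(n::nat) > 1" "int n \<cdot> x \<in> V"
  obtains p k M c where "prime p" "M < n" "M \<ge> 1" "coprime (int M) (int p ^ k)"
    "int p ^ k \<cdot> c \<cdot> x \<in> V" "int M \<cdot> (1 - c) \<cdot> x \<in> V"
proof -
  obtain p where p: "prime p" "p dvd n" using n(1) prime_factor_nat[of n] by auto
  obtain k M where kM: "n = p ^ k * M" "\<not> p dvd M" using prime_power_split[OF p(1), of n] n(1) by auto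
  have "k \<noteq> 0" using kM p(2) by (metis mult_1 power_0)
  then have "p ^ k > 1" using prime_gt_1_nat[OF p(1)] by (intro one_less_power) auto
  moreover have "M \<ge> 1" using kM n(1) by (cases M) auto
  ultimately have M: "M < n" "M \<ge> 1" using kM(1) by auto
  have co: "coprime (int M) (int p ^ k)" using coprime_prime_power[OF p(1) kM(2)] by (simp add: coprime_commute)
  obtain u v where uv: "u * int M + v * int p ^ k = 1" using bezout_coprime[OF co] by blast
  have "int p ^ k \<cdot> (u * int M) \<cdot> x = u \<cdot> int n \<cdot> x" by (simp add: zmult_zmult kM(1) mult_ac)
  then have 1: "int p ^ k \<cdot> (u * int M) \<cdot> x \<in> V" using subgrp_zmult[OF V n(2)] by simp
  have "int M \<cdot> (1 - u * int M) \<cdot> x = v \<cdot> int n \<cdot> x"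
    unfolding uv[symmetric] by (simp add: zmult_zmult kM(1) mult_ac)
  then have 2: "int M \<cdot> (1 - u * int M) \<cdot> x \<in> V" using subgrp_zmult[OF V n(2)] by simp
  show thesis using that[OF p(1) M co 1 2] .
qed

text \<open>Adds up the primary parts of \<open>x\<close>. The hypothesis \<open>pr\<close> is about
  all multiples of \<open>x\<close> in a \<open>p\<close>-component, not about chosen projections,
  so that it passes to \<open>(1 - c) \<cdot> x\<close> in the induction.\<close>

lemma primary_generate:
  assumes V: "subgrp V" and K: "subgrp K" "V \<subseteq> K" and n: "(n::nat) \<ge> 1" "int n \<cdot> x \<in> V"
    and pr: "\<And>p c k. prime p \<Longrightarrow> int p ^ k \<cdot> c \<cdot> x \<in> V \<Longrightarrow> c \<cdot> x \<in> K"
  shows "x \<in> K"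
  using n pr
proof (induction n arbitrary: x rule: less_induct)
  case (less n)
  show ?case
  proof (cases "n = 1")
    case True
    then show ?thesis using less.prems K by (auto simp: zmult_1)
  next
    case False
    then have "n > 1" using less.prems by simp
    from primary_split[OF V this less.prems(2)] obtain p k M c where
      *: "prime p" "M < n" "M \<ge> 1" "int p ^ k \<cdot> c \<cdot> x \<in> V" "int M \<cdot> (1 - c) \<cdot> x \<in> V" .
    have "c \<cdot> x \<in> K" using less.prems(3)[OF *(1,4)] .
    moreover have "(1 - c) \<cdot> x \<in> K"
    proof (rule less.IH[OF *(2,3,5)])
      fix q d j assume "prime q" "int q ^ j \<cdot> d \<cdot> (1 - c) \<cdot> x \<in> V"
      then show "d \<cdot> (1 - c) \<cdot> x \<in> K" using less.prems(3)[of q j "d * (1 - c)"] by (simp add: zmult_zmult)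
    qed
    ultimately have "c \<cdot> x + (1 - c) \<cdot> x \<in> K" using K by (simp add: subgrp_add)
    then show ?thesis by (simp add: zmult_add_left[symmetric] zmult_1)
  qed
qed

text \<open>Coefficients matter only modulo the order of \<open>y\<close>; this is what lets the
  Chinese remainder theorem merge them.\<close>

lemma zmult_diff_dvd:
  assumes "subgrp V" "M \<cdot> y \<in> V" "M dvd a - b" "z - b \<cdot> y \<in> V" shows "z - a \<cdot> y \<in> V"
proof -
  have "(a - b) \<cdot> y \<in> V" using subgrp_zmult_dvd[OF assms(1,2,3)] .
  then have "(z - b \<cdot> y) - (a - b) \<cdot> y \<in> V" using assms by (simp add: subgrp_diff)
  then show ?thesis by (simp add: zm_simps)
qed

text \<open>The coefficients on the primary parts are merged by the Chinese remainder
  theorem.\<close>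

lemma pw_primary:
  assumes f: "endo f" and V: "subgrp V" and n: "(n::nat) \<ge> 1" "int n \<cdot> x \<in> V"
    and pr: "\<And>p c k. prime p \<Longrightarrow> int p ^ k \<cdot> c \<cdot> x \<in> V \<Longrightarrow> \<exists>a. f (c \<cdot> x) - a \<cdot> c \<cdot> x \<in> V"
    and fV: "\<And>v. v \<in> V \<Longrightarrow> f v \<in> V"
  shows "\<exists>a. f x - a \<cdot> x \<in> V"
  using n pr
proof (induction n arbitrary: x rule: less_induct)
  case (less n)
  show ?case
  proof (cases "n = 1")
    case True
    then have "x \<in> V" using less.prems by (simp add: zmult_1)
    then show ?thesis using fV[of x] by (intro exI[of _ 0]) (simp add: zmult_0_left)
  next
    case False
    then have "n > 1" using less.prems by simp
    from primary_split[OF V this less.prems(2)] obtain p k M c where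
      *: "prime p" "M < n" "M \<ge> 1" "int p ^ k \<cdot> c \<cdot> x \<in> V" "int M \<cdot> (1 - c) \<cdot> x \<in> V"
        "coprime (int M) (int p ^ k)" .
    obtain a2 where a2: "f (c \<cdot> x) - a2 \<cdot> c \<cdot> x \<in> V" using less.prems(3)[OF *(1,4)] by blast
    have "\<exists>a. f ((1 - c) \<cdot> x) - a \<cdot> (1 - c) \<cdot> x \<in> V"
    proof (rule less.IH[OF *(2,3,5)])
      fix q d j assume "prime q" "int q ^ j \<cdot> d \<cdot> (1 - c) \<cdot> x \<in> V"
      then show "\<exists>a. f (d \<cdot> (1 - c) \<cdot> x) - a \<cdot> d \<cdot> (1 - c) \<cdot> x \<in> V"
        using less.prems(3)[of q j "d * (1 - c)"] by (simp add: zmult_zmult)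
    qed
    then obtain a1 where a1: "f ((1 - c) \<cdot> x) - a1 \<cdot> (1 - c) \<cdot> x \<in> V" by blast
    obtain a where a: "int M dvd a - a1" "int p ^ k dvd a - a2" using crt_int[OF *(6)] by blast
    have "f (c \<cdot> x) - a \<cdot> c \<cdot> x + (f ((1 - c) \<cdot> x) - a \<cdot> (1 - c) \<cdot> x) \<in> V"
      by (intro subgrp_add[OF V] zmult_diff_dvd[OF V *(4) a(2) a2] zmult_diff_dvd[OF V *(5) a(1) a1])
    also have "f (c \<cdot> x) - a \<cdot> c \<cdot> x + (f ((1 - c) \<cdot> x) - a \<cdot> (1 - c) \<cdot> x) = f x - a \<cdot> x"
      using f by (simp add: endo_simps zm_simps algebra_simps)
    finally show ?thesis by blast
  qed
qed

text \<open>Any annihilating \<open>j\<close> may be replaced by its gcd with a power of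
  \<open>p\<close>, so the annihilator is generated by the smallest power in it.\<close>

lemma prime_power_order:
  assumes p: "prime p" and G: "subgrp G" and y: "int p ^ K \<cdot> y \<in> G"
  obtains i where "i \<le> K" "\<forall>j. j \<cdot> y \<in> G \<longleftrightarrow> int p ^ i dvd j"
proof -
  define i where "i = (LEAST i. int p ^ i \<cdot> y \<in> G)"
  have i: "int p ^ i \<cdot> y \<in> G" unfolding i_def by (rule LeastI) (rule y)
  have le: "i \<le> s" if "int p ^ s \<cdot> y \<in> G" for s unfolding i_def using that by (rule Least_le)
  have "j \<cdot> y \<in> G \<longleftrightarrow> int p ^ i dvd j" for j
  proof
    assume j: "j \<cdot> y \<in> G"
    let ?g = "gcd j (int p ^ i)"
    obtain u v where uv: "u * j + v * int p ^ i = ?g" using bezout_int by blast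
    have "?g \<cdot> y = u \<cdot> j \<cdot> y + v \<cdot> int p ^ i \<cdot> y"
      unfolding uv[symmetric] by (simp add: zmult_add_left zmult_zmult)
    moreover have "u \<cdot> j \<cdot> y + v \<cdot> int p ^ i \<cdot> y \<in> G"
      by (intro subgrp_add[OF G] subgrp_zmult[OF G] i j)
    ultimately have g: "?g \<cdot> y \<in> G" by simp
    have "?g dvd int p ^ i" by simp
    then obtain s where s: "s \<le> i" "?g = int p ^ s"
      using divides_primepow[of "int p" ?g i] p by auto
    then have "s = i" using le[of s] g by simp
    then show "int p ^ i dvd j" using s by (metis gcd_dvd1)
  next
    assume "int p ^ i dvd j" then show "j \<cdot> y \<in> G" by (rule subgrp_zmult_dvd[OF G i])
  qed
  then show thesis using that le[OF y] by blast
qed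

text \<open>The coefficient \<open>a\<close> of an element \<open>x\<close> of maximal order modulo
  \<open>T\<close> serves all of \<open>S\<close>. Any \<open>y\<close> differs by a multiple of
  \<open>x\<close> from some \<open>z\<close> independent of \<open>x\<close> modulo
  \<open>T\<close>; comparing the coefficients of \<open>z\<close>, \<open>x\<close> and
  \<open>z + x\<close> shows that \<open>a\<close> also fits \<open>z\<close>.\<close>

lemma pw_uniform_prime:
  assumes p: "prime p" and f: "endo f" and S: "subgrp S" and T: "subgrp T"
    and pwf: "pw f S T" and bd: "\<And>x. x \<in> S \<Longrightarrow> int p ^ k \<cdot> x \<in> T"
  shows "\<exists>a. \<forall>x\<in>S. f x - a \<cdot> x \<in> T"
proof -
  define h where "h = (LEAST h. \<forall>x\<in>S. int p ^ h \<cdot> x \<in> T)"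
  have h: "\<forall>x\<in>S. int p ^ h \<cdot> x \<in> T" unfolding h_def by (rule LeastI[of _ k]) (use bd in blast)
  have hmin: "h \<le> s" if "\<forall>x\<in>S. int p ^ s \<cdot> x \<in> T" for s unfolding h_def using that by (rule Least_le)
  have "\<exists>x\<in>S. \<forall>j. j \<cdot> x \<in> T \<longrightarrow> int p ^ h dvd j"
  proof (cases h)
    case 0
    then show ?thesis using subgrp_0[OF S] by auto
  next
    case (Suc h')
    then obtain x where x: "x \<in> S" "int p ^ h' \<cdot> x \<notin> T" using hmin[of h'] by auto
    obtain i where i: "i \<le> h" "\<forall>j. j \<cdot> x \<in> T \<longleftrightarrow> int p ^ i dvd j"
      using prime_power_order[OF p T, of h x] h x(1) by blast
    have "\<not> i \<le> h'" using x(2) i(2) le_imp_power_dvd by blast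
    then have "i = h" using i Suc by simp
    then show ?thesis using i x by blast
  qed
  then obtain x where x: "x \<in> S" "\<And>j. j \<cdot> x \<in> T \<Longrightarrow> int p ^ h dvd j" by blast
  obtain a where a: "f x - a \<cdot> x \<in> T" using pwD[OF pwf x(1)] by blast
  let ?G = "sumset (range (\<lambda>c. c \<cdot> x)) T"
  have "subgrp (range (\<lambda>c. c \<cdot> x))"
    by (rule subgrpI) (auto simp: zm.scale_left_diff_distrib[symmetric] intro: rev_image_eqI[of 0])
  then have G: "subgrp ?G" using T by (rule subgrp_sumset)
  have Gi: "w \<in> ?G \<longleftrightarrow> (\<exists>c. w - c \<cdot> x \<in> T)" for w
  proof
    assume "w \<in> ?G"
    then obtain c b where "b \<in> T" "w = c \<cdot> x + b" by (auto elim!: sumsetE)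
    then show "\<exists>c. w - c \<cdot> x \<in> T" by (intro exI[of _ c]) simp
  next
    assume "\<exists>c. w - c \<cdot> x \<in> T"
    then obtain c where "w - c \<cdot> x \<in> T" by blast
    then have "c \<cdot> x + (w - c \<cdot> x) \<in> ?G" by (intro sumsetI) auto
    then show "w \<in> ?G" by simp
  qed
  have "f y - a \<cdot> y \<in> T" if y: "y \<in> S" for y
  proof -
    have "int p ^ h \<cdot> y \<in> T" using h y by blast
    then have "int p ^ h \<cdot> y - 0 \<cdot> x \<in> T" by (simp add: zmult_0_left)
    then have "int p ^ h \<cdot> y \<in> ?G" using Gi[of "int p ^ h \<cdot> y"] by blast
    from prime_power_order[OF p G this]
    obtain i where i: "i \<le> h" "\<forall>j. j \<cdot> y \<in> ?G \<longleftrightarrow> int p ^ i dvd j" .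
    have "int p ^ i \<cdot> y \<in> ?G" using i(2) by simp
    then obtain u where u: "int p ^ i \<cdot> y - u \<cdot> x \<in> T" using Gi[of "int p ^ i \<cdot> y"] by blast
    have hi: "int p ^ h = int p ^ (h - i) * int p ^ i" using i(1) by (simp flip: power_add)
    have "int p ^ (h - i) \<cdot> (int p ^ i \<cdot> y - u \<cdot> x) \<in> T" by (rule subgrp_zmult[OF T u])
    moreover have "int p ^ (h - i) \<cdot> (int p ^ i \<cdot> y - u \<cdot> x) = int p ^ h \<cdot> y - (int p ^ (h - i) * u) \<cdot> x"
      unfolding hi by (simp add: zm_simps)
    ultimately have "(int p ^ (h - i) * u) \<cdot> x \<in> T"
      using subgrp_diff[OF T \<open>int p ^ h \<cdot> y \<in> T\<close>] by fastforce
    \<comment> \<open>Because \<open>x\<close> has the full order \<open>p ^ h\<close>,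
      \<open>u\<close> is divisible by \<open>p ^ i\<close>, and the corresponding multiple of
      \<open>x\<close> can be subtracted from \<open>y\<close>.\<close>
    then have "int p ^ (h - i) * int p ^ i dvd int p ^ (h - i) * u" using x(2) hi by metis
    then have "int p ^ i dvd u" using prime_gt_0_nat[OF p] by simp
    then obtain u' where u': "u = int p ^ i * u'" by blast
    define z where "z = y - u' \<cdot> x"
    have zS: "z \<in> S" unfolding z_def using x(1) y S by (simp add: subgrp_intros)
    have pz: "int p ^ i \<cdot> z \<in> T" using u unfolding z_def u' by (simp add: zm_simps mult_ac)
    have ind: "j \<cdot> z \<in> T \<and> l \<cdot> x \<in> T" if jl: "j \<cdot> z + l \<cdot> x \<in> T" for j l
    proof -
      have "j \<cdot> y - (j * u' - l) \<cdot> x \<in> T" using jl unfolding z_def by (simp add: zm_simps algebra_simps)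
      then have "int p ^ i dvd j" using i(2) Gi by blast
      then have "j \<cdot> z \<in> T" using subgrp_zmult_dvd[OF T pz] by blast
      then show ?thesis using jl subgrp_diff[OF T jl, of "j \<cdot> z"] by simp
    qed
    obtain b where b: "f (z + x) - b \<cdot> (z + x) \<in> T" using pwD[OF pwf] subgrp_add[OF S zS x(1)] by blast
    obtain c where c: "f z - c \<cdot> z \<in> T" using pwD[OF pwf zS] by blast
    have "(f (z + x) - b \<cdot> (z + x)) - (f z - c \<cdot> z) - (f x - a \<cdot> x) \<in> T" using a b c T by (simp add: subgrp_diff)
    also have "(f (z + x) - b \<cdot> (z + x)) - (f z - c \<cdot> z) - (f x - a \<cdot> x) = (c - b) \<cdot> z + (a - b) \<cdot> x"
      using f by (simp add: endo_simps zm_simps)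
    finally have cb: "(c - b) \<cdot> z \<in> T" "(a - b) \<cdot> x \<in> T" using ind by blast+
    \<comment> \<open>The order of \<open>z\<close> divides that of \<open>x\<close>, so a
      congruence valid on \<open>x\<close> holds on \<open>z\<close>.\<close>
    have "int p ^ i dvd a - b" using x(2)[OF cb(2)] i(1) le_imp_power_dvd dvd_trans by blast
    then have ab: "(a - b) \<cdot> z \<in> T" using subgrp_zmult_dvd[OF T pz] by blast
    have "(f z - c \<cdot> z) + (c - b) \<cdot> z - (a - b) \<cdot> z + u' \<cdot> (f x - a \<cdot> x) \<in> T"
      using a c cb ab T by (simp add: subgrp_intros)
    also have "(f z - c \<cdot> z) + (c - b) \<cdot> z - (a - b) \<cdot> z + u' \<cdot> (f x - a \<cdot> x) = f y - a \<cdot> y"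
      unfolding z_def using f by (simp add: endo_simps zm_simps algebra_simps)
    finally show ?thesis .
  qed
  then show ?thesis by blast
qed

lemma pw_uniform:
  assumes f: "endo f" and T: "subgrp T" and "(N::nat) \<ge> 1" and "subgrp S"
    and "pw f S T" and "\<And>x. x \<in> S \<Longrightarrow> int N \<cdot> x \<in> T"
  shows "\<exists>a. \<forall>x\<in>S. f x - a \<cdot> x \<in> T"
  using assms(3-)
proof (induction N arbitrary: S rule: less_induct)
  case (less N)
  show ?case
  proof (cases "N = 1")
    case True
    then have "S \<subseteq> T" using less.prems(4) by (auto simp: zmult_1)
    have "f x - 0 \<cdot> x \<in> T" if x: "x \<in> S" for x
    proof -
      obtain a where "f x - a \<cdot> x \<in> T" using pwD[OF less.prems(3) x] by blast
      then show ?thesis using \<open>S \<subseteq> T\<close> x subgrp_diff_cancel[OF T] subgrp_zmult[OF T] zmult_0_left by (metis diff_zero subsetD)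
    qed
    then show ?thesis by blast
  next
    case False
    then have "N > 1" using less.prems by simp
    obtain p where p: "prime p" "p dvd N" using prime_factor_nat[OF False] by auto
    obtain k M where kM: "N = p ^ k * M" "\<not> p dvd M" using prime_power_split[OF p(1), of N] less.prems(1) by auto
    have "k \<noteq> 0" using kM p(2) by (metis mult_1 power_0)
    then have "p ^ k > 1" using prime_gt_1_nat[OF p(1)] by (intro one_less_power) auto
    moreover have "M \<ge> 1" using kM \<open>N > 1\<close> by (cases M) auto
    ultimately have M: "M < N" "M \<ge> 1" using kM(1) by auto
    have co: "coprime (int M) (int p ^ k)" using coprime_prime_power[OF p(1) kM(2)] by (simp add: coprime_commute)
    have sub: "subgrp {x \<in> S. m \<cdot> x \<in> T}" for m
      by (rule subgrpI) (use less.prems(2) T in \<open>auto simp: zm_simps subgrp_intros\<close>)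
    have "\<exists>a. \<forall>x\<in>{x \<in> S. int M \<cdot> x \<in> T}. f x - a \<cdot> x \<in> T"
      by (rule less.IH[OF M sub]) (use pw_subset[OF less.prems(3) _ order.refl] in auto)
    then obtain a1 where a1: "\<And>x. x \<in> S \<Longrightarrow> int M \<cdot> x \<in> T \<Longrightarrow> f x - a1 \<cdot> x \<in> T" by blast
    have "\<exists>a. \<forall>x\<in>{x \<in> S. int p ^ k \<cdot> x \<in> T}. f x - a \<cdot> x \<in> T"
      by (rule pw_uniform_prime[OF p(1) f sub T]) (use pw_subset[OF less.prems(3) _ order.refl] in auto)
    then obtain a2 where a2: "\<And>x. x \<in> S \<Longrightarrow> int p ^ k \<cdot> x \<in> T \<Longrightarrow> f x - a2 \<cdot> x \<in> T" by blast
    obtain a where a: "int M dvd a - a1" "int p ^ k dvd a - a2" using crt_int[OF co] by blast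
    obtain u v where uv: "u * int M + v * int p ^ k = 1" using bezout_coprime[OF co] by blast
    have "f x - a \<cdot> x \<in> T" if x: "x \<in> S" for x
    proof -
      have Nx: "int N \<cdot> x \<in> T" using less.prems(4) x by blast
      let ?y = "(v * int p ^ k) \<cdot> x" and ?z = "(u * int M) \<cdot> x"
      have S: "?y \<in> S" "?z \<in> S" using x less.prems(2) by (simp_all add: subgrp_zmult)
      have "int M \<cdot> ?y = v \<cdot> int N \<cdot> x" "int p ^ k \<cdot> ?z = u \<cdot> int N \<cdot> x"
        by (simp_all add: zmult_zmult kM(1) mult_ac)
      then have *: "int M \<cdot> ?y \<in> T" "int p ^ k \<cdot> ?z \<in> T" using subgrp_zmult[OF T Nx] by simp_all
      have "(f ?y - a \<cdot> ?y) + (f ?z - a \<cdot> ?z) \<in> T"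
        by (intro subgrp_add[OF T] zmult_diff_dvd[OF T *(1) a(1) a1[OF S(1) *(1)]] zmult_diff_dvd[OF T *(2) a(2) a2[OF S(2) *(2)]])
      also have "(f ?y - a \<cdot> ?y) + (f ?z - a \<cdot> ?z) = f (?z + ?y) - a \<cdot> (?z + ?y)"
        using f by (simp add: endo_add zm_simps)
      also have "?z + ?y = x" unfolding zmult_add_left[symmetric] uv zmult_1 ..
      finally show ?thesis .
    qed
    then show ?thesis by blast
  qed
qed

text \<open>On each layer killed by \<open>p ^ k\<close> the coefficient is uniform. If the orders
  are bounded, a constant sequence does; otherwise every layer contains an element of exact order
  \<open>p ^ k\<close>, which makes consecutive coefficients congruent.\<close>

lemma pw_padic:
  assumes p: "prime p" and f: "endo f" and S: "subgrp S" and T: "subgrp T" and pwf: "pw f S T"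
  obtains \<alpha> :: "nat \<Rightarrow> int" where "\<forall>k. int p ^ k dvd \<alpha> (Suc k) - \<alpha> k"
    "\<forall>k. \<forall>x\<in>S. int p ^ k \<cdot> x \<in> T \<longrightarrow> f x - \<alpha> k \<cdot> x \<in> T"
proof (cases "\<exists>e. \<forall>k. \<forall>x\<in>S. int p ^ k \<cdot> x \<in> T \<longrightarrow> int p ^ e \<cdot> x \<in> T")
  case True
  then obtain e where e: "\<And>k x. x \<in> S \<Longrightarrow> int p ^ k \<cdot> x \<in> T \<Longrightarrow> int p ^ e \<cdot> x \<in> T" by blast
  have sub: "subgrp {x \<in> S. int p ^ e \<cdot> x \<in> T}"
    by (rule subgrpI) (use S T in \<open>auto simp: zm_simps subgrp_intros\<close>)
  have "\<exists>a. \<forall>x\<in>{x \<in> S. int p ^ e \<cdot> x \<in> T}. f x - a \<cdot> x \<in> T"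
    by (rule pw_uniform_prime[OF p f sub T]) (use pw_subset[OF pwf _ order.refl] in auto)
  then obtain a where "\<And>x. x \<in> S \<Longrightarrow> int p ^ e \<cdot> x \<in> T \<Longrightarrow> f x - a \<cdot> x \<in> T" by blast
  then show thesis using e by (intro that[of "\<lambda>_. a"]) auto
next
  case False
  have "\<exists>a. \<forall>x\<in>{x \<in> S. int p ^ k \<cdot> x \<in> T}. f x - a \<cdot> x \<in> T" for k
  proof (rule pw_uniform_prime[OF p f _ T])
    show "subgrp {x \<in> S. int p ^ k \<cdot> x \<in> T}"
      by (rule subgrpI) (use S T in \<open>auto simp: zm_simps subgrp_intros\<close>)
  qed (use pw_subset[OF pwf _ order.refl] in auto)
  then obtain \<alpha> where \<alpha>: "\<And>k x. x \<in> S \<Longrightarrow> int p ^ k \<cdot> x \<in> T \<Longrightarrow> f x - \<alpha> k \<cdot> x \<in> T" by (simp, metis)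
  have "int p ^ k dvd \<alpha> (Suc k) - \<alpha> k" for k
  proof -
    obtain K x where x: "x \<in> S" "int p ^ K \<cdot> x \<in> T" "int p ^ k \<cdot> x \<notin> T" using False by blast
    obtain i where i: "\<forall>j. j \<cdot> x \<in> T \<longleftrightarrow> int p ^ i dvd j" using prime_power_order[OF p T x(2)] by blast
    have "k < i" using i x(3) le_imp_power_dvd not_le by blast
    \<comment> \<open>\<open>y\<close> has order exactly \<open>p ^ k\<close> modulo
      \<open>T\<close>.\<close>
    define y where "y = int p ^ (i - k) \<cdot> x"
    have y: "j \<cdot> y \<in> T \<longleftrightarrow> int p ^ k dvd j" for j
    proof -
      have "int p ^ i = int p ^ k * int p ^ (i - k)" using \<open>k < i\<close> by (simp flip: power_add)
      then show ?thesis unfolding y_def zmult_zmult using i prime_gt_0_nat[OF p] by simp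
    qed
    have yS: "y \<in> S" unfolding y_def using x S by (simp add: subgrp_zmult)
    have "f y - \<alpha> k \<cdot> y \<in> T" "f y - \<alpha> (Suc k) \<cdot> y \<in> T" using y by (intro \<alpha> yS; simp)+
    then have "(f y - \<alpha> k \<cdot> y) - (f y - \<alpha> (Suc k) \<cdot> y) \<in> T" by (rule subgrp_diff[OF T])
    then have "(\<alpha> (Suc k) - \<alpha> k) \<cdot> y \<in> T" by (simp add: zm_simps)
    then show ?thesis using y by simp
  qed
  then show thesis using that \<alpha> by blast
qed

lemma padic_mono:
  fixes \<alpha> :: "nat \<Rightarrow> int"
  assumes "\<And>k. int p ^ k dvd \<alpha> (Suc k) - \<alpha> k" "k \<le> K"
  shows "int p ^ k dvd \<alpha> K - \<alpha> k"
  using assms(2)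
proof (induction K rule: dec_induct)
  case (step K)
  have "int p ^ k dvd \<alpha> (Suc K) - \<alpha> K" using assms(1) step(1) le_imp_power_dvd dvd_trans by blast
  then have "int p ^ k dvd (\<alpha> (Suc K) - \<alpha> K) + (\<alpha> K - \<alpha> k)" using step.IH by (rule dvd_add)
  then show ?case by simp
qed simp

lemma acts_mult_if_pw:
  assumes f: "endo f" and S: "subgrp S" and T: "subgrp T" "T \<subseteq> S" and pwf: "pw f S T"
    and per: "\<And>x. x \<in> S \<Longrightarrow> \<exists>n::nat. n \<ge> 1 \<and> int n \<cdot> x \<in> T"
  shows "acts_mult f S T"
proof -
  have "\<exists>\<alpha>. prime p \<longrightarrow> (\<forall>k. int p ^ k dvd \<alpha> (Suc k) - \<alpha> k) \<and>
    (\<forall>k. \<forall>x\<in>S. int p ^ k \<cdot> x \<in> T \<longrightarrow> f x - \<alpha> k \<cdot> x \<in> T)" for p :: nat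
  proof (cases "prime p")
    case True
    show ?thesis by (rule pw_padic[OF True f S T(1) pwf]) blast
  qed simp
  then have "\<exists>\<alpha>. \<forall>p. prime p \<longrightarrow> (\<forall>k. int p ^ k dvd \<alpha> p (Suc k) - \<alpha> p k) \<and>
    (\<forall>k. \<forall>x\<in>S. int p ^ k \<cdot> x \<in> T \<longrightarrow> f x - \<alpha> p k \<cdot> x \<in> T)" by (intro choice allI)
  then obtain \<alpha> where \<alpha>: "\<And>p k. prime p \<Longrightarrow> int p ^ k dvd \<alpha> p (Suc k) - \<alpha> p k"
    "\<And>p k x. prime p \<Longrightarrow> x \<in> S \<Longrightarrow> int p ^ k \<cdot> x \<in> T \<Longrightarrow> f x - \<alpha> p k \<cdot> x \<in> T" by blast
  have "padic_family \<alpha>" unfolding padic_family_def using \<alpha>(1) mod_eq_dvd_iff by metis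
  then show ?thesis unfolding acts_mult_def
    using pw_invariant[OF pwf S T(2)] pw_base[OF pwf T] per \<alpha>(2) by blast
qed

lemma pw_if_acts_mult:
  assumes f: "endo f" and S: "subgrp S" and T: "subgrp T" and am: "acts_mult f S T"
  shows "pw f S T"
  unfolding pw_def
proof
  fix x assume x: "x \<in> S"
  obtain n :: nat where n: "n \<ge> 1" "int n \<cdot> x \<in> T" using am x unfolding acts_mult_def by blast
  obtain \<alpha> where \<alpha>: "\<And>x p k. x \<in> S \<Longrightarrow> prime p \<Longrightarrow> int p ^ k \<cdot> x \<in> T \<Longrightarrow> f x - \<alpha> p k \<cdot> x \<in> T"
    using am unfolding acts_mult_def by metis
  show "\<exists>a. f x - a \<cdot> x \<in> T"
  proof (rule pw_primary[OF f T n])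
    show "f v \<in> T" if "v \<in> T" for v using am that by (auto simp: acts_mult_def)
    show "\<exists>a. f (c \<cdot> x) - a \<cdot> c \<cdot> x \<in> T" if "prime p" "int p ^ k \<cdot> c \<cdot> x \<in> T" for p c k
      using \<alpha>[OF subgrp_zmult[OF S x] that] by blast
  qed
qed

subsection \<open>Sections with finite socle\<close>

lemma almost_chain: "almost K L \<Longrightarrow> L \<subseteq> M \<Longrightarrow> almost M H \<Longrightarrow> almost K H"
  using almost_trans[OF _ almost_mono[OF _ _ order.refl]] by blast

lemma prime_factor_split:
  fixes n :: nat assumes "n \<ge> 1" "n \<noteq> 1"
  obtains p m where "prime p" "p dvd n" "n = p * m" "m < n" "m \<ge> 1"
proof -
  obtain p where p: "prime p" "p dvd n" using prime_factor_nat assms(2) by blast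
  then obtain m where m: "n = p * m" by (auto simp: dvd_def)
  then have m1: "m \<ge> 1" using assms(1) by (cases m) auto
  then have "m < p * m" using prime_gt_1_nat[OF p(1)] by simp
  then show thesis using that p m m1 by blast
qed

lemma coset_eq_iff:
  assumes "subgrp H" shows "coset x H = coset y H \<longleftrightarrow> x - y \<in> H"
proof -
  have mem: "w \<in> coset u H \<longleftrightarrow> w - u \<in> H" for w u
  proof
    assume "w - u \<in> H"
    then show "w \<in> coset u H" unfolding coset_def by (auto intro!: exI[of _ "w - u"])
  qed (auto simp: coset_def)
  show ?thesis
  proof
    assume "coset x H = coset y H"
    moreover have "x \<in> coset x H" using mem assms subgrp_0 by auto
    ultimately show "x - y \<in> H" using mem by blast
  next
    assume "x - y \<in> H"
    then have "w - x \<in> H \<longleftrightarrow> w - y \<in> H" for w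
      using subgrp_add[OF assms, of "w - x" "x - y"] subgrp_diff[OF assms, of "w - y" "x - y"] by auto
    then show "coset x H = coset y H" using mem by blast
  qed
qed

lemma subgrp_zmult_image: "subgrp H \<Longrightarrow> subgrp ((\<lambda>x. a \<cdot> x) ` H)"
  by (rule subgrp_image[OF endo_zmult_const])

text \<open>Multiplication by \<open>p ^ k\<close> sends level \<open>k + 1\<close> into the socle,
  and the elements it sends into \<open>Y\<close> form level \<open>k\<close>.\<close>

lemma almost_torsion_level:
  assumes W: "subgrp W" and Y: "subgrp Y" and soc: "almost {x \<in> W. p \<cdot> x \<in> Y} Y"
  shows "almost {x \<in> W. p ^ k \<cdot> x \<in> Y} Y"
proof (induction k)
  case 0
  then show ?case by (intro almost_subset) (auto simp: zmult_1)
next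
  case (Suc k)
  let ?f = "\<lambda>x. p ^ k \<cdot> x" and ?K = "{x \<in> W. p ^ Suc k \<cdot> x \<in> Y}"
  have "?f ` ?K \<subseteq> {x \<in> W. p \<cdot> x \<in> Y}" using W by (auto simp: zmult_zmult subgrp_zmult)
  then have "almost (?f ` ?K) Y" using almost_mono[OF soc] by blast
  then have "almost ?K (?f -` Y)" by (rule almost_vimage[OF endo_zmult_const Y])
  moreover have "almost ?K W" by (rule almost_subset) auto
  ultimately have "almost ?K (W \<inter> ?f -` Y)"
    by (intro almost_Int W subgrp_vimage[OF endo_zmult_const Y])
  moreover have "W \<inter> ?f -` Y = {x \<in> W. p ^ k \<cdot> x \<in> Y}" by auto
  ultimately show ?case using almost_trans Suc.IH by metis
qed

text \<open>The socles of the terms of the descending chain of the \<open>p\<^sup>k W\<close> stabilise, and from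
  then on the terms are divisible modulo \<open>Y\<close>.\<close>
lemma finite_socle_divisible:
  fixes p :: nat
  assumes W: "subgrp W" and Y: "subgrp Y" "Y \<subseteq> W"
    and per: "\<And>x. x \<in> W \<Longrightarrow> \<exists>k. int p ^ k \<cdot> x \<in> Y"
    and soc: "almost {x \<in> W. int p \<cdot> x \<in> Y} Y"
  obtains e where "\<forall>j. \<forall>x\<in>W. \<exists>y\<in>W. int p ^ e \<cdot> x - int p ^ (e + j) \<cdot> y \<in> Y"
    "almost W (sumset ((\<lambda>x. int p ^ e \<cdot> x) ` W) Y)"
proof -
  \<comment> \<open>The socle of \<open>p ^ k W\<close> modulo \<open>Y\<close>; \<open>N k\<close>
    is its order.\<close>
  define S where "S k = {x \<in> W. int p \<cdot> x \<in> Y \<and> (\<exists>y\<in>W. x - int p ^ k \<cdot> y \<in> Y)}" for k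
  define N where "N k = card ((\<lambda>x. coset x Y) ` S k)" for k
  have mono: "S k \<subseteq> S e" if "e \<le> k" for e k
  proof
    fix x assume "x \<in> S k"
    then obtain y where y: "x \<in> W" "int p \<cdot> x \<in> Y" "y \<in> W" "x - int p ^ k \<cdot> y \<in> Y" by (auto simp: S_def)
    have "int p ^ k \<cdot> y = int p ^ e \<cdot> int p ^ (k - e) \<cdot> y"
      using that by (simp add: zmult_zmult flip: power_add)
    then have "x - int p ^ e \<cdot> int p ^ (k - e) \<cdot> y \<in> Y" using y(4) by simp
    then show "x \<in> S e" using y(1,2) subgrp_zmult[OF W y(3)] unfolding S_def by blast
  qed
  have fin: "finite ((\<lambda>x. coset x Y) ` S k)" for k
  proof -
    have "{coset x Y |x. x \<in> {x \<in> W. int p \<cdot> x \<in> Y}} = (\<lambda>x. coset x Y) ` {x \<in> W. int p \<cdot> x \<in> Y}"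
      unfolding image_def by blast
    then have "finite ((\<lambda>x. coset x Y) ` {x \<in> W. int p \<cdot> x \<in> Y})"
      using iffD2[OF almost_iff_cosets[OF Y(1)] soc] by simp
    then show ?thesis by (rule finite_subset[rotated]) (auto simp: S_def)
  qed
  \<comment> \<open>The orders decrease, so from the index of a minimal one on the socles no longer
    change.\<close>
  define e where "e = (ARG_MIN N k. True)"
  have Nmin: "N e \<le> N k" for k unfolding e_def by (rule arg_min_nat_le) simp
  have stab: "S e \<subseteq> S k" if "e \<le> k" for k
  proof
    have "(\<lambda>x. coset x Y) ` S k = (\<lambda>x. coset x Y) ` S e"
      by (rule card_seteq[OF fin]) (use mono[OF that] Nmin[of k] in \<open>auto simp: N_def\<close>)
    moreover fix x assume x: "x \<in> S e"
    ultimately obtain z where z: "z \<in> S k" "coset x Y = coset z Y" by (metis (no_types, lifting) imageE imageI)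
    then have xz: "x - z \<in> Y" using coset_eq_iff[OF Y(1)] by blast
    obtain y where y: "y \<in> W" "z - int p ^ k \<cdot> y \<in> Y" using z by (auto simp: S_def)
    have "(x - z) + (z - int p ^ k \<cdot> y) \<in> Y" by (rule subgrp_add[OF Y(1) xz y(2)])
    then show "x \<in> S k" using x y by (auto simp: S_def)
  qed
  \<comment> \<open>Induction on the order of \<open>x\<close>: its multiple in the socle lies in
    \<open>p ^ (e + h) W\<close> modulo \<open>Y\<close>, hence in the next term; subtracting
    accordingly lowers the order by one factor \<open>p\<close>.\<close>
  have claim: "\<exists>y'\<in>W. x - int p ^ Suc e \<cdot> y' \<in> Y"
    if "x \<in> W" "y \<in> W" "x - int p ^ e \<cdot> y \<in> Y" "int p ^ h \<cdot> x \<in> Y" for h x y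
    using that
  proof (induction h arbitrary: x y)
    case 0
    then show ?case using subgrp_0[OF W] by (intro bexI[of _ 0]) (simp_all add: zmult_1)
  next
    case (Suc h)
    let ?z = "int p ^ h \<cdot> x"
    have "?z - int p ^ (e + h) \<cdot> y = int p ^ h \<cdot> (x - int p ^ e \<cdot> y)"
      by (simp add: zm_simps power_add mult_ac)
    then have "?z - int p ^ (e + h) \<cdot> y \<in> Y" using subgrp_zmult[OF Y(1) Suc.prems(3)] by simp
    then have "?z \<in> S (e + h)" using Suc.prems W by (auto simp: S_def zmult_zmult subgrp_zmult)
    then have "?z \<in> S (Suc (e + h))" using mono[of e "e + h"] stab[of "Suc (e + h)"] by auto
    then obtain w where w: "w \<in> W" "?z - int p ^ Suc (e + h) \<cdot> w \<in> Y" by (auto simp: S_def)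
    have 1: "x - int p ^ Suc e \<cdot> w \<in> W" using Suc.prems w W by (simp add: subgrp_diff subgrp_zmult)
    have 2: "y - int p \<cdot> w \<in> W" using Suc.prems w W by (simp add: subgrp_diff subgrp_zmult)
    have 3: "x - int p ^ Suc e \<cdot> w - int p ^ e \<cdot> (y - int p \<cdot> w) \<in> Y"
      using Suc.prems(3) by (simp add: zm_simps mult_ac)
    have 4: "int p ^ h \<cdot> (x - int p ^ Suc e \<cdot> w) \<in> Y"
      using w(2) by (simp add: zm_simps power_add mult_ac)
    obtain y' where y': "y' \<in> W" "x - int p ^ Suc e \<cdot> w - int p ^ Suc e \<cdot> y' \<in> Y"
      using Suc.IH[OF 1 2 3 4] by blast
    then have "x - int p ^ Suc e \<cdot> (w + y') \<in> Y" by (simp add: zm_simps diff_diff_eq)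
    then show ?case using subgrp_add[OF W w(1) y'(1)] by blast
  qed
  have step: "\<exists>y\<in>W. int p ^ e \<cdot> x - int p ^ Suc e \<cdot> y \<in> Y" if x: "x \<in> W" for x
  proof -
    have "int p ^ e \<cdot> x \<in> W" using subgrp_zmult[OF W x] .
    moreover from per[OF this] obtain h where "int p ^ h \<cdot> int p ^ e \<cdot> x \<in> Y" by blast
    ultimately show ?thesis using claim[of "int p ^ e \<cdot> x" x h] x subgrp_0[OF Y(1)] by simp
  qed
  have div: "\<exists>y\<in>W. int p ^ e \<cdot> x - int p ^ (e + j) \<cdot> y \<in> Y" if x: "x \<in> W" for j x
  proof (induction j)
    case 0
    show ?case using x subgrp_0[OF Y(1)] by (intro bexI[of _ x]) simp_all
  next
    case (Suc j)
    then obtain y where y: "y \<in> W" "int p ^ e \<cdot> x - int p ^ (e + j) \<cdot> y \<in> Y" by blast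
    obtain z where z: "z \<in> W" "int p ^ e \<cdot> y - int p ^ Suc e \<cdot> z \<in> Y" using step[OF y(1)] by blast
    have "int p ^ e \<cdot> x - int p ^ (e + j) \<cdot> y + int p ^ j \<cdot> (int p ^ e \<cdot> y - int p ^ Suc e \<cdot> z) \<in> Y"
      by (intro subgrp_add[OF Y(1)] y subgrp_zmult[OF Y(1)] z)
    then have "int p ^ e \<cdot> x - int p ^ (e + Suc j) \<cdot> z \<in> Y"
      by (simp add: zm_simps power_add mult_ac)
    then show ?case using z by blast
  qed
  \<comment> \<open>With \<open>j = e\<close> divisibility splits \<open>W\<close> into the level
    killed by \<open>p ^ e\<close>, which is finite modulo \<open>Y\<close>, and
    \<open>p ^ e W\<close>.\<close>
  have "W \<subseteq> sumset {x \<in> W. int p ^ e \<cdot> x \<in> Y} ((\<lambda>x. int p ^ e \<cdot> x) ` W)"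
  proof
    fix x assume x: "x \<in> W"
    obtain y where y: "y \<in> W" "int p ^ e \<cdot> x - int p ^ (e + e) \<cdot> y \<in> Y" using div[OF x] by blast
    then have "int p ^ e \<cdot> (x - int p ^ e \<cdot> y) \<in> Y" by (simp add: zm_simps power_add)
    then have "x - int p ^ e \<cdot> y \<in> {x \<in> W. int p ^ e \<cdot> x \<in> Y}"
      using x y(1) W by (simp add: subgrp_diff subgrp_zmult)
    from sumsetI[OF this imageI[OF y(1), of "\<lambda>x. int p ^ e \<cdot> x"]]
    show "x \<in> sumset {x \<in> W. int p ^ e \<cdot> x \<in> Y} ((\<lambda>x. int p ^ e \<cdot> x) ` W)" by simp
  qed
  moreover have "almost (sumset {x \<in> W. int p ^ e \<cdot> x \<in> Y} ((\<lambda>x. int p ^ e \<cdot> x) ` W))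
      (sumset Y ((\<lambda>x. int p ^ e \<cdot> x) ` W))"
    by (intro almost_sumset almost_torsion_level[OF W Y(1) soc] almost_subset order.refl)
  ultimately have "almost W (sumset ((\<lambda>x. int p ^ e \<cdot> x) ` W) Y)"
    unfolding sumset_commute[of _ Y] by (rule almost_mono[OF _ _ order.refl, rotated])
  then show thesis using that div by blast
qed

subsection \<open>Groups all of whose subgroups have finite \<open>p\<close>-quotients\<close>

text \<open>Lets a subgroup of \<open>E\<close> be replaced, up to finitely many cosets, by its
  multiple; this is how denominators are cleared in the proof of inertiality.\<close>

definition pfin :: "nat \<Rightarrow> 'a::ab_group_add set \<Rightarrow> bool" where
  "pfin p E \<longleftrightarrow> (\<forall>X. subgrp X \<longrightarrow> X \<subseteq> E \<longrightarrow> almost X ((\<lambda>x. int p \<cdot> x) ` X))"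

lemma pfinD: "pfin p E \<Longrightarrow> subgrp X \<Longrightarrow> X \<subseteq> E \<Longrightarrow> almost X ((\<lambda>x. int p \<cdot> x) ` X)"
  by (simp add: pfin_def)

lemma pfin_mult:
  assumes pf: "\<And>p. prime p \<Longrightarrow> p dvd n \<Longrightarrow> pfin p E" and n: "(n::nat) \<ge> 1"
    and X: "subgrp X" "X \<subseteq> E"
  shows "almost X ((\<lambda>x. int n \<cdot> x) ` X)"
  using n pf
proof (induction n rule: less_induct)
  case (less n)
  show ?case
  proof (cases "n = 1")
    case True
    then show ?thesis by (intro almost_subset) (simp add: zmult_1)
  next
    case False
    then obtain p m where p: "prime p" "p dvd n" and m: "n = p * m" and m1: "m < n" "m \<ge> 1"
      using prime_factor_split[OF less.prems(1)] by metis
    let ?Y = "(\<lambda>x. int m \<cdot> x) ` X"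
    have "almost X ?Y" using less.IH[OF m1] less.prems(2) m by auto
    moreover have "almost ?Y ((\<lambda>x. int p \<cdot> x) ` ?Y)"
      using X subgrp_zmult[OF X(1)] by (intro pfinD[OF less.prems(2)[OF p]] subgrp_zmult_image) auto
    moreover have "(\<lambda>x. int p \<cdot> x) ` ?Y = (\<lambda>x. int n \<cdot> x) ` X" by (simp add: image_image zmult_zmult m)
    ultimately show ?thesis using almost_trans[of X ?Y] by simp
  qed
qed

text \<open>Let \<open>Y = X \<inter> V\<close> and let \<open>W / Y\<close> be the
  \<open>p\<close>-component of \<open>X / Y\<close>; Bezout gives \<open>X = p X + W\<close>. The
  socle of \<open>W / Y\<close> is finite because \<open>Y / p Y\<close> and the
  \<open>p\<close>-torsion are. So up to finitely many cosets \<open>W\<close> is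
  \<open>p ^ e W + Y\<close>, which divisibility puts into \<open>p X + Y\<close>, and
  \<open>Y\<close> is almost contained in \<open>p Y\<close>.\<close>

lemma pfin_extend:
  fixes p :: nat
  assumes p: "prime p" and V: "subgrp V" "pfin p V" and E: "subgrp E"
    and per: "\<And>x. x \<in> E \<Longrightarrow> \<exists>n::nat. n \<ge> 1 \<and> int n \<cdot> x \<in> V"
    and fin: "finite {x \<in> E. int p \<cdot> x = 0}"
  shows "pfin p E"
  unfolding pfin_def
proof (intro allI impI)
  fix X assume X: "subgrp X" "X \<subseteq> E"
  let ?pX = "(\<lambda>x. int p \<cdot> x) ` X"
  have pX: "subgrp ?pX" by (rule subgrp_zmult_image[OF X(1)])
  let ?Y = "X \<inter> V"
  have Y: "subgrp ?Y" by (rule subgrp_Int[OF X(1) V(1)])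
  define W where "W = {x \<in> X. \<exists>k. int p ^ k \<cdot> x \<in> ?Y}"
  have YW: "?Y \<subseteq> W" unfolding W_def by (force simp: zmult_1 intro: exI[of _ 0])
  have W: "subgrp W"
  proof (rule subgrpI)
    show "0 \<in> W" using YW subgrp_0[OF Y] by blast
    fix x y assume "x \<in> W" "y \<in> W"
    then obtain k l where *: "x \<in> X" "y \<in> X" "int p ^ k \<cdot> x \<in> ?Y" "int p ^ l \<cdot> y \<in> ?Y" by (auto simp: W_def)
    have "int p ^ (k + l) \<cdot> (x - y) = int p ^ l \<cdot> int p ^ k \<cdot> x - int p ^ k \<cdot> int p ^ l \<cdot> y"
      by (simp add: zm_simps power_add mult_ac)
    moreover have "\<dots> \<in> ?Y" by (intro subgrp_diff[OF Y] subgrp_zmult[OF Y] *)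
    ultimately have "int p ^ (k + l) \<cdot> (x - y) \<in> ?Y" by simp
    then show "x - y \<in> W" using * X by (auto simp: W_def subgrp_diff)
  qed
  have soc: "almost {x \<in> W. int p \<cdot> x \<in> ?Y} ?Y"
  proof -
    let ?K = "{x \<in> W. int p \<cdot> x \<in> ?Y}" and ?pY = "(\<lambda>x. int p \<cdot> x) ` ?Y"
    have "almost ?Y ?pY" using pfinD[OF V(2) Y] by blast
    then have "almost ((\<lambda>x. int p \<cdot> x) ` ?K) ?pY" by (rule almost_mono) auto
    then have 1: "almost ?K ((\<lambda>x. int p \<cdot> x) -` ?pY)"
      by (intro almost_vimage endo_zmult_const subgrp_zmult_image[OF Y])
    have "almost ?K (E \<inter> (\<lambda>x. int p \<cdot> x) -` ?pY)"
      using X by (intro almost_Int E subgrp_vimage[OF endo_zmult_const] subgrp_zmult_image[OF Y] 1 almost_subset)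
        (auto simp: W_def)
    moreover have "E \<inter> (\<lambda>x. int p \<cdot> x) -` ?pY \<subseteq> sumset {x \<in> E. int p \<cdot> x = 0} ?Y"
    proof
      fix x assume "x \<in> E \<inter> (\<lambda>x. int p \<cdot> x) -` ?pY"
      then obtain y where y: "x \<in> E" "y \<in> ?Y" "int p \<cdot> x = int p \<cdot> y" by auto
      then have "x - y \<in> {x \<in> E. int p \<cdot> x = 0}" using X E by (auto simp: zm_simps intro!: subgrp_diff)
      from sumsetI[OF this y(2)] show "x \<in> sumset {x \<in> E. int p \<cdot> x = 0} ?Y" by simp
    qed
    moreover have "almost (sumset {x \<in> E. int p \<cdot> x = 0} ?Y) ?Y"
      unfolding almost_def using fin by (intro exI[of _ "{x \<in> E. int p \<cdot> x = 0}"]) simp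
    ultimately show ?thesis by (rule almost_chain)
  qed
  have perW: "\<exists>k. int p ^ k \<cdot> x \<in> ?Y" if "x \<in> W" for x using that by (simp add: W_def)
  obtain e where e: "\<forall>j. \<forall>x\<in>W. \<exists>y\<in>W. int p ^ e \<cdot> x - int p ^ (e + j) \<cdot> y \<in> ?Y"
    "almost W (sumset ((\<lambda>x. int p ^ e \<cdot> x) ` W) ?Y)"
    using finite_socle_divisible[OF W Y YW perW soc] by blast
  have YpX: "almost ?Y ?pX" using pfinD[OF V(2) Y] by (rule almost_mono) auto
  have "sumset ((\<lambda>x. int p ^ e \<cdot> x) ` W) ?Y \<subseteq> sumset ?pX ?Y"
  proof
    fix z assume "z \<in> sumset ((\<lambda>x. int p ^ e \<cdot> x) ` W) ?Y"
    then obtain x v where x: "x \<in> W" "v \<in> ?Y" "z = int p ^ e \<cdot> x + v" by (auto elim!: sumsetE)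
    obtain y where y: "y \<in> W" "int p ^ e \<cdot> x - int p ^ (e + 1) \<cdot> y \<in> ?Y" using e(1) x by blast
    have "int p ^ e \<cdot> y \<in> X" using y X by (auto simp: W_def subgrp_zmult)
    then have "int p \<cdot> int p ^ e \<cdot> y + (int p ^ e \<cdot> x - int p ^ (e + 1) \<cdot> y + v) \<in> sumset ?pX ?Y"
      by (intro sumsetI imageI subgrp_add[OF Y y(2) x(2)])
    then show "z \<in> sumset ?pX ?Y" using x(3) by (simp add: zmult_zmult)
  qed
  moreover have "almost (sumset ?pX ?Y) ?pX"
    by (intro almost_sumset_same almost_subset order.refl YpX pX)
  ultimately have WpX: "almost W ?pX" by (rule almost_chain[OF e(2)])
  have "X \<subseteq> sumset ?pX W"
  proof
    fix x assume x: "x \<in> X"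
    then obtain n :: nat where n: "n \<ge> 1" "int n \<cdot> x \<in> V" using per X by blast
    obtain k M where kM: "n = p ^ k * M" "\<not> p dvd M" using prime_power_split[OF p n(1)] by blast
    have co: "coprime (int M) (int p)" using coprime_prime_power[OF p kM(2), of 1] by (simp add: coprime_commute)
    obtain u v where uv: "u * int M + v * int p = 1" using bezout_coprime[OF co] by blast
    have Wm: "(u * int M) \<cdot> x \<in> W"
    proof -
      have "int p ^ k \<cdot> (u * int M) \<cdot> x = u \<cdot> int n \<cdot> x" by (simp add: zmult_zmult kM(1) mult_ac)
      moreover have "u \<cdot> int n \<cdot> x \<in> ?Y" 
        by (intro IntI subgrp_zmult[OF X(1)] subgrp_zmult[OF V(1)] x n(2))
      ultimately have "int p ^ k \<cdot> (u * int M) \<cdot> x \<in> ?Y" by simp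
      then show ?thesis using x X unfolding W_def by (auto simp: subgrp_zmult)
    qed
    have "v \<cdot> x \<in> X" using x X by (simp add: subgrp_zmult)
    from sumsetI[OF imageI[OF this] Wm] have "int p \<cdot> v \<cdot> x + (u * int M) \<cdot> x \<in> sumset ?pX W" .
    moreover have "int p \<cdot> v \<cdot> x + (u * int M) \<cdot> x = (u * int M + v * int p) \<cdot> x"
      by (simp add: zm_simps mult_ac add_ac)
    ultimately show "x \<in> sumset ?pX W" by (simp add: uv zmult_1)
  qed
  moreover have "almost (sumset ?pX W) ?pX" by (intro almost_sumset_same almost_subset order.refl WpX pX)
  ultimately show "almost X ?pX" by (rule almost_mono[OF _ _ order.refl, rotated])
qed

section \<open>Finite torsion-free rank expressed by rational coordinates\<close>

definition additive_on :: "'a::ab_group_add set \<Rightarrow> ('a \<Rightarrow> rat) \<Rightarrow> bool" where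
  "additive_on X c \<longleftrightarrow> (\<forall>x\<in>X. \<forall>y\<in>X. c (x + y) = c x + c y)"

lemma additive_on_subset: "additive_on X c \<Longrightarrow> Y \<subseteq> X \<Longrightarrow> additive_on Y c"
  by (auto simp: additive_on_def)

lemma additive_on_0: "additive_on X c \<Longrightarrow> subgrp X \<Longrightarrow> c 0 = 0"
  unfolding additive_on_def using subgrp_0[of X] by (metis add.right_neutral add_cancel_left_right)

lemma additive_on_diff: "additive_on X c \<Longrightarrow> subgrp X \<Longrightarrow> x \<in> X \<Longrightarrow> y \<in> X \<Longrightarrow> c (x - y) = c x - c y"
  unfolding additive_on_def using subgrp_diff[of X x y] by (metis add_diff_cancel_right' diff_add_cancel)

lemma additive_on_zmult:
  assumes "additive_on X c" "subgrp X" "x \<in> X" shows "c (a \<cdot> x) = of_int a * c x"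
proof (induction a rule: int_induct[where k = 0])
  case base
  then show ?case using additive_on_0 assms by (simp add: zmult_0_left)
next
  case (step1 i)
  then show ?case using assms subgrp_zmult[OF assms(2,3), of i]
    by (simp add: additive_on_def zmult_succ distrib_right)
next
  case (step2 i)
  then show ?case using additive_on_diff[OF assms(1,2) subgrp_zmult[OF assms(2,3), of i] assms(3)]
    by (simp add: zmult_pred left_diff_distrib)
qed

lemma subgrp_kernel:
  assumes "additive_on X c" "subgrp X" shows "subgrp {x \<in> X. c x = 0}"
  by (rule subgrpI) (use assms in \<open>auto simp: additive_on_0 additive_on_diff subgrp_0 subgrp_diff\<close>)

lemma almost_cyclic:
  assumes "p > 0" "x0 \<in> X" "subgrp X"
  shows "almost (range (\<lambda>c. c \<cdot> x0)) ((\<lambda>x. int p \<cdot> x) ` X)"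
  unfolding almost_def
proof (intro exI conjI)
  show "finite ((\<lambda>c. c \<cdot> x0) ` {0..<int p})" by simp
  show "range (\<lambda>c. c \<cdot> x0) \<subseteq> sumset ((\<lambda>c. c \<cdot> x0) ` {0..<int p}) ((\<lambda>x. int p \<cdot> x) ` X)"
  proof clarify
    fix c
    have "(c mod int p) \<cdot> x0 + int p \<cdot> (c div int p) \<cdot> x0
        \<in> sumset ((\<lambda>c. c \<cdot> x0) ` {0..<int p}) ((\<lambda>x. int p \<cdot> x) ` X)"
      using assms by (intro sumsetI imageI subgrp_zmult) auto
    moreover have "(c mod int p) \<cdot> x0 + int p \<cdot> (c div int p) \<cdot> x0 = c \<cdot> x0"
      by (simp add: zmult_zmult flip: zmult_add_left)
    ultimately show "c \<cdot> x0 \<in> sumset ((\<lambda>c. c \<cdot> x0) ` {0..<int p}) ((\<lambda>x. int p \<cdot> x) ` X)" by simp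
  qed
qed

text \<open>Induction on the number \<open>k\<close> of coordinates. The image of \<open>X\<close>
  under the last one is a subgroup of the rationals, and such a group is cyclic modulo its
  \<open>p\<close>-multiples: any value outside them generates it. The kernel has one coordinate
  less.\<close>

lemma almost_mult_coordinates:
  fixes k p :: nat
  assumes p: "prime p" and X: "subgrp X" and co: "\<And>j. j < k \<Longrightarrow> additive_on X (co j)"
    and inj: "\<And>x. x \<in> X \<Longrightarrow> \<forall>j<k. co j x = 0 \<Longrightarrow> x = 0"
  shows "almost X ((\<lambda>x. int p \<cdot> x) ` X)"
  using X co inj
proof (induction k arbitrary: X)
  case 0
  then have "X \<subseteq> {0}" by auto
  then show ?case using subgrp_0[OF 0(1)] by (intro almost_subset) (auto intro!: rev_image_eqI[of 0])
next
  case (Suc k)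
  let ?X0 = "{x \<in> X. co k x = 0}" and ?pX = "(\<lambda>x. int p \<cdot> x) ` X"
  note X = Suc.prems(1)
  have ck: "additive_on X (co k)" using Suc.prems(2) by simp
  have pX: "subgrp ?pX" by (rule subgrp_zmult_image[OF X])
  have "almost ?X0 ((\<lambda>x. int p \<cdot> x) ` ?X0)"
  proof (rule Suc.IH[OF subgrp_kernel[OF ck X]])
    show "additive_on ?X0 (co j)" if "j < k" for j
      by (rule additive_on_subset[of X]) (use that Suc.prems(2) in auto)
    show "x = 0" if "x \<in> ?X0" "\<forall>j<k. co j x = 0" for x
      using that Suc.prems(3)[of x] less_Suc_eq by auto
  qed
  then have X0: "almost ?X0 ?pX" by (rule almost_mono) auto
  obtain x0 where x0: "x0 \<in> X" "\<And>x. x \<in> X \<Longrightarrow> \<exists>i w. w \<in> X \<and> co k x = of_int i * co k x0 + of_nat p * co k w"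
  \<comment> \<open>If the image is \<open>p\<close>-divisible, \<open>x0 = 0\<close> will
    do.\<close>
  proof (cases "\<forall>x\<in>X. \<exists>w\<in>X. co k x = of_nat p * co k w")
    case True
    then show ?thesis by (intro that[OF subgrp_0[OF X]]) (metis add_0 mult_zero_left of_int_0)
  next
    case False
    then obtain x0 where x0: "x0 \<in> X" "\<And>w. w \<in> X \<Longrightarrow> co k x0 \<noteq> of_nat p * co k w" by blast
    have nz: "co k x0 \<noteq> 0" using x0(2)[OF subgrp_0[OF X]] additive_on_0[OF ck X] by simp
    have "\<exists>i w. w \<in> X \<and> co k x = of_int i * co k x0 + of_nat p * co k w" if x: "x \<in> X" for x
    proof -
      obtain b a where ba: "co k x / co k x0 = of_int b / of_int a" "a > 0" "coprime b a"
        using quotient_of_div[of "co k x / co k x0"] quotient_of_denom_pos[of "co k x / co k x0"]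
          quotient_of_coprime[of "co k x / co k x0"]
        by (cases "quotient_of (co k x / co k x0)") auto
      then have eq: "of_int a * co k x = of_int b * co k x0" using nz by (simp add: field_simps)
      have pint: "prime (int p)" using p by simp
      \<comment> \<open>If \<open>p\<close> divided the denominator \<open>a\<close>, it would not
        divide \<open>b\<close>, and the coordinate of \<open>x0\<close> would be a
        \<open>p\<close>-multiple after all.\<close>
      have "\<not> int p dvd a"
      proof
        assume pa: "int p dvd a"
        then have "\<not> int p dvd b" using ba(3) p by (metis coprime_common_divisor not_prime_unit pint)
        then have "coprime b (int p)" using pint by (metis coprime_commute prime_imp_coprime)
        then obtain u v where uv: "u * b + v * int p = 1" using bezout_coprime by blast
        obtain a' where a': "a = int p * a'" using pa by blast
        have "co k x0 = of_int (u * b + v * int p) * co k x0" using uv by simp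
        also have "\<dots> = of_int u * (of_int b * co k x0) + of_nat p * (of_int v * co k x0)"
          by (simp add: algebra_simps)
        also have "\<dots> = of_nat p * co k ((u * a') \<cdot> x + v \<cdot> x0)"
          using ck x x0(1) subgrp_zmult[OF X] unfolding additive_on_def eq[symmetric] a'
          by (simp add: additive_on_zmult[OF ck X] algebra_simps)
        finally show False using x0(2)[of "(u * a') \<cdot> x + v \<cdot> x0"] x x0(1) X by (simp add: subgrp_add subgrp_zmult)
      qed
      then have "coprime a (int p)" using pint by (metis coprime_commute prime_imp_coprime)
      then obtain u v where uv: "u * a + v * int p = 1" using bezout_coprime by blast
      have "co k x = of_int (u * a + v * int p) * co k x" using uv by simp
      also have "\<dots> = of_int u * (of_int a * co k x) + of_nat p * (of_int v * co k x)" by (simp add: algebra_simps)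
      also have "\<dots> = of_int (u * b) * co k x0 + of_nat p * co k (v \<cdot> x)"
        unfolding eq by (simp add: additive_on_zmult[OF ck X x])
      finally show ?thesis using subgrp_zmult[OF X x] by blast
    qed
    then show ?thesis using that x0(1) by blast
  qed
  let ?R = "range (\<lambda>c. c \<cdot> x0)"
  have "X \<subseteq> sumset (sumset ?R ?pX) ?X0"
  proof
    fix x assume x: "x \<in> X"
    obtain i w where iw: "w \<in> X" "co k x = of_int i * co k x0 + of_nat p * co k w" using x0(2)[OF x] by blast
    have "co k (x - (i \<cdot> x0 + int p \<cdot> w)) = 0"
      using iw x x0(1) ck subgrp_zmult[OF X] subgrp_add[OF X] unfolding additive_on_def
      by (simp add: additive_on_diff[OF ck X] additive_on_zmult[OF ck X])
    then have "x - (i \<cdot> x0 + int p \<cdot> w) \<in> ?X0" using X x x0(1) iw(1) by (simp add: subgrp_intros)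
    moreover have "i \<cdot> x0 + int p \<cdot> w \<in> sumset ?R ?pX" using iw(1) by (intro sumsetI) auto
    ultimately have "(i \<cdot> x0 + int p \<cdot> w) + (x - (i \<cdot> x0 + int p \<cdot> w)) \<in> sumset (sumset ?R ?pX) ?X0"
      by (rule sumsetI[rotated])
    then show "x \<in> sumset (sumset ?R ?pX) ?X0" by simp
  qed
  moreover have "almost (sumset (sumset ?R ?pX) ?X0) ?pX"
    using prime_gt_0_nat[OF p]
    by (intro almost_sumset_same X0 pX almost_cyclic x0(1) X almost_subset order.refl)
  ultimately show ?case by (rule almost_mono[OF _ _ order.refl, rotated])
qed

subsection \<open>Numbers composed of given primes\<close>

lemma pi_number_mult: "pi_number \<pi> (a * b) \<longleftrightarrow> pi_number \<pi> a \<and> pi_number \<pi> b"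
  unfolding pi_number_def by (auto simp: prime_dvd_mult_iff)

lemma pi_number_1: "pi_number \<pi> 1"
  unfolding pi_number_def by auto

lemma pi_number_split:
  assumes "(n::nat) \<ge> 1" obtains a b where "n = a * b" "pi_number \<pi> a" "pi_number (- \<pi>) b"
proof -
  have "\<exists>a b. n = a * b \<and> pi_number \<pi> a \<and> pi_number (- \<pi>) b" using assms
  proof (induction n rule: less_induct)
    case (less n)
    show ?case
    proof (cases "n = 1")
      case True
      then show ?thesis using pi_number_1 by (intro exI[of _ 1]) simp
    next
      case False
      then obtain p m where p: "prime p" "p dvd n" and m: "n = p * m" and m1: "m < n" "m \<ge> 1"
        using prime_factor_split[OF less.prems(1)] by metis
      obtain a b where ab: "m = a * b" "pi_number \<pi> a" "pi_number (- \<pi>) b" using less.IH[OF m1] by blast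
      have pp: "q = p" if "prime q" "q dvd p" for q using that p(1) by (metis primes_dvd_imp_eq)
      show ?thesis
      proof (cases "p \<in> \<pi>")
        case True
        then have "pi_number \<pi> p" unfolding pi_number_def using pp prime_gt_0_nat[OF p(1)] by blast
        then show ?thesis using ab m by (intro exI[of _ "p * a"] exI[of _ b]) (simp add: pi_number_mult)
      next
        case False
        then have "pi_number (- \<pi>) p" unfolding pi_number_def using pp prime_gt_0_nat[OF p(1)] by blast
        then show ?thesis using ab m by (intro exI[of _ a] exI[of _ "p * b"]) (simp add: pi_number_mult)
      qed
    qed
  qed
  then show thesis using that by blast
qed

lemma pi_number_coprime:
  assumes "pi_number \<pi> a" "pi_number (- \<pi>) b" shows "coprime (int a) (int b)"
proof -
  have "coprime a b"
  proof (rule ccontr)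
    assume "\<not> coprime a b"
    then have "gcd a b \<noteq> 1" by (simp add: coprime_iff_gcd_eq_1)
    then obtain p where "prime p" "p dvd gcd a b" using prime_factor_nat by blast
    then show False using assms by (auto simp: pi_number_def)
  qed
  then show ?thesis by simp
qed

text \<open>Induction on the coordinates. An element of \<open>Y\<close> with nonzero integral last
  coordinate \<open>a\<close> reduces \<open>v\<close> to the kernel of this coordinate once
  \<open>v\<close> is multiplied by the \<open>\<pi>'\<close>-part of \<open>a\<close>; the
  \<open>\<pi>\<close>-numbers that also occur cancel, being coprime to \<open>L\<close>. So the
  torsion of \<open>V / Y\<close> prime to \<open>\<pi>\<close> is bounded.\<close>

lemma isolator_exponent:
  fixes k :: nat
  assumes "subgrp V" "\<And>j. j < k \<Longrightarrow> additive_on V (co j)"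
    "\<And>x. x \<in> V \<Longrightarrow> \<forall>j<k. co j x = 0 \<Longrightarrow> x = 0"
    "\<And>j x. j < k \<Longrightarrow> x \<in> V \<Longrightarrow> \<exists>b. pi_number \<pi> b \<and> of_nat b * co j x \<in> \<int>"
    "subgrp Y" "Y \<subseteq> V"
  shows "\<exists>M. pi_number (- \<pi>) M \<and> (\<forall>v\<in>V. \<forall>L. pi_number (- \<pi>) L \<and> int L \<cdot> v \<in> Y \<longrightarrow> int M \<cdot> v \<in> Y)"
  using assms
proof (induction k arbitrary: V Y)
  case 0
  then have "V \<subseteq> {0}" by auto
  then show ?case using subgrp_0[OF 0(5)] using pi_number_1 by (intro exI[of _ 1]) auto
next
  case (Suc k)
  note V = Suc.prems(1) and Y = Suc.prems(5,6)
  have ck: "additive_on V (co k)" using Suc.prems(2) by simp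
  let ?V0 = "{x \<in> V. co k x = 0}"
  have V0: "subgrp ?V0" by (rule subgrp_kernel[OF ck V])
  have "\<exists>M. pi_number (- \<pi>) M \<and> (\<forall>v\<in>?V0. \<forall>L. pi_number (- \<pi>) L \<and> int L \<cdot> v \<in> Y \<inter> ?V0 \<longrightarrow> int M \<cdot> v \<in> Y \<inter> ?V0)"
  proof (rule Suc.IH[OF V0])
    show "additive_on ?V0 (co j)" if "j < k" for j
      by (rule additive_on_subset[of V]) (use that Suc.prems(2) in auto)
    show "x = 0" if "x \<in> ?V0" "\<forall>j<k. co j x = 0" for x
      using that Suc.prems(3)[of x] less_Suc_eq by auto
    show "\<exists>b. pi_number \<pi> b \<and> of_nat b * co j x \<in> \<int>" if "j < k" "x \<in> ?V0" for j x
      using that Suc.prems(4)[of j x] by auto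
  qed (use subgrp_Int[OF Y(1) V0] in auto)
  then obtain M0 where M0: "pi_number (- \<pi>) M0"
    "\<And>v L. v \<in> ?V0 \<Longrightarrow> pi_number (- \<pi>) L \<Longrightarrow> int L \<cdot> v \<in> Y \<Longrightarrow> int M0 \<cdot> v \<in> Y"
    using subgrp_zmult[OF V0] by blast
  show ?case
  proof (cases "\<forall>y\<in>Y. co k y = 0")
    case True
    have "int M0 \<cdot> v \<in> Y" if v: "v \<in> V" "pi_number (- \<pi>) L" "int L \<cdot> v \<in> Y" for v L
    proof -
      have "of_int (int L) * co k v = 0" using True v additive_on_zmult[OF ck V v(1)] by metis
      then have "v \<in> ?V0" using v by (auto simp: pi_number_def)
      then show ?thesis using M0(2) v by blast
    qed
    then show ?thesis using M0(1) by blast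
  next
    case False
    then obtain y where y: "y \<in> Y" "co k y \<noteq> 0" by blast
    obtain b where b: "pi_number \<pi> b" "of_nat b * co k y \<in> \<int>" using Suc.prems(4)[of k y] y Y by blast
    define y0 where "y0 = int b \<cdot> y"
    have y0: "y0 \<in> Y" using y Y unfolding y0_def by (simp add: subgrp_zmult)
    have co_y0: "co k y0 = of_nat b * co k y" using additive_on_zmult[OF ck V, of y] y Y unfolding y0_def by auto
    obtain a where a: "co k y0 = of_int a" using b(2) co_y0 by (auto elim: Ints_cases)
    have "a \<noteq> 0" using a co_y0 y b(1) by (auto simp: pi_number_def)
    then have "nat \<bar>a\<bar> \<ge> 1" by simp
    then obtain a1 a2 where a12: "nat \<bar>a\<bar> = a1 * a2" "pi_number \<pi> a1" "pi_number (- \<pi>) a2"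
      using pi_number_split by blast
    have sg: "int (a1 * a2) = sgn a * a" using a12(1) by (metis abs_ge_zero abs_sgn int_nat_eq mult.commute)
    have "int (M0 * a2) \<cdot> v \<in> Y" if v: "v \<in> V" "pi_number (- \<pi>) L" "int L \<cdot> v \<in> Y" for v L
    proof -
      obtain d where d: "pi_number \<pi> d" "of_nat d * co k v \<in> \<int>" using Suc.prems(4)[of k v] v by blast
      then obtain c where c: "of_nat d * co k v = of_int c" by (auto elim: Ints_cases)
      \<comment> \<open>\<open>a1 * a2\<close> is the absolute value of \<open>a\<close>, so the
        last coordinate of \<open>?w\<close> vanishes.\<close>
      let ?w = "int (a1 * d) \<cdot> int a2 \<cdot> v - (sgn a * c) \<cdot> y0"
      have y0V: "y0 \<in> V" using y0 Y by blast
      have "co k ?w = of_int (int (a1 * a2)) * (of_nat d * co k v) - of_int (sgn a * c) * co k y0"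
        using v(1) y0V subgrp_zmult[OF V]
        by (simp add: additive_on_diff[OF ck V] additive_on_zmult[OF ck V] mult_ac)
      also have "\<dots> = 0" unfolding sg c a by (simp add: mult_ac)
      finally have "?w \<in> ?V0" using V v(1) y0V by (simp add: subgrp_diff subgrp_zmult)
      moreover have "(sgn a * c) \<cdot> y0 \<in> Y" using Y y0 by (simp add: subgrp_zmult)
      ultimately have "(sgn a * c) \<cdot> y0 + ?w \<in> sumset Y ?V0" by (intro sumsetI)
      then have 1: "int (a1 * d) \<cdot> int a2 \<cdot> v \<in> sumset Y ?V0" by simp
      have "int L \<cdot> int a2 \<cdot> v = int a2 \<cdot> int L \<cdot> v" by (simp add: zmult_zmult mult_ac)
      then have La2: "int L \<cdot> int a2 \<cdot> v \<in> Y" using subgrp_zmult[OF Y(1) v(3)] by simp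
      then have 2: "int L \<cdot> int a2 \<cdot> v \<in> sumset Y ?V0" using sumset_left[OF subgrp_0[OF V0]] by blast
      have "coprime (int (a1 * d)) (int L)"
        using a12(2) d(1) v(2) by (intro pi_number_coprime) (simp_all add: pi_number_mult)
      then have "int a2 \<cdot> v \<in> sumset Y ?V0"
        by (rule subgrp_coprime[OF subgrp_sumset[OF Y(1) V0] 1 2])
      then obtain y1 w where yw: "y1 \<in> Y" "w \<in> ?V0" "int a2 \<cdot> v = y1 + w" by (rule sumsetE)
      have "int L \<cdot> w = int L \<cdot> int a2 \<cdot> v - int L \<cdot> y1" unfolding yw(3) by (simp add: zmult_add_right)
      then have "int L \<cdot> w \<in> Y" using subgrp_diff[OF Y(1) La2 subgrp_zmult[OF Y(1) yw(1)]] by simp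
      then have "int M0 \<cdot> w \<in> Y" using M0(2) yw(2) v(2) by blast
      then have "int M0 \<cdot> y1 + int M0 \<cdot> w \<in> Y" using Y yw(1) by (simp add: subgrp_add subgrp_zmult)
      then show ?thesis using yw(3) by (simp add: zmult_add_right[symmetric] zmult_zmult[symmetric])
    qed
    then show ?thesis using M0(1) a12(3) by (intro exI[of _ "M0 * a2"]) (auto simp: pi_number_mult)
  qed
qed

subsection \<open>The structure implies inertiality\<close>

lemma Qpi_add: "r \<in> Qpi \<pi> \<Longrightarrow> s \<in> Qpi \<pi> \<Longrightarrow> r + s \<in> Qpi \<pi>"
proof -
  assume "r \<in> Qpi \<pi>" "s \<in> Qpi \<pi>"
  then obtain a b c d where *: "pi_number \<pi> b" "pi_number \<pi> d" "r = of_int a / of_nat b" "s = of_int c / of_nat d"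
    by (auto simp: Qpi_def)
  then have "r + s = of_int (a * int d + c * int b) / of_nat (b * d)"
    by (auto simp: pi_number_def field_simps)
  then show ?thesis using * pi_number_mult unfolding Qpi_def by blast
qed

lemma coordinates_if_iso:
  assumes "iso_Qpi_sum \<pi> V" "subgrp V"
  obtains k :: nat and co where "\<forall>j<k. additive_on V (co j)"
    "\<forall>x\<in>V. (\<forall>j<k. co j x = 0) \<longrightarrow> x = 0"
    "\<forall>j<k. \<forall>x\<in>V. \<exists>b. pi_number \<pi> b \<and> of_nat b * co j x \<in> \<int>"
proof -
  obtain k f where f: "bij_betw f (Qpi_vec \<pi> k) V"
    "\<And>g h. g \<in> Qpi_vec \<pi> k \<Longrightarrow> h \<in> Qpi_vec \<pi> k \<Longrightarrow> f (\<lambda>j. g j + h j) = f g + f h"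
    using assms(1) unfolding iso_Qpi_sum_def by blast
  let ?i = "inv_into (Qpi_vec \<pi> k) f"
  have im: "f ` Qpi_vec \<pi> k = V" and inj: "inj_on f (Qpi_vec \<pi> k)" using f(1) by (auto simp: bij_betw_def)
  have i: "?i x \<in> Qpi_vec \<pi> k" "f (?i x) = x" if "x \<in> V" for x
    using that im inv_into_into[of x f] f_inv_into_f[of x f] by auto
  have closed: "(\<lambda>j. g j + h j) \<in> Qpi_vec \<pi> k" if "g \<in> Qpi_vec \<pi> k" "h \<in> Qpi_vec \<pi> k" for g h
    using that by (auto simp: Qpi_vec_def Qpi_add)
  have add: "?i (x + y) = (\<lambda>j. ?i x j + ?i y j)" if "x \<in> V" "y \<in> V" for x y
  proof -
    have "f (\<lambda>j. ?i x j + ?i y j) = x + y" using f(2)[OF i(1) i(1)] i that by simp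
    then have "?i (x + y) = ?i (f (\<lambda>j. ?i x j + ?i y j))" by simp
    also have "\<dots> = (\<lambda>j. ?i x j + ?i y j)" by (rule inv_into_f_f[OF inj closed[OF i(1)[OF that(1)] i(1)[OF that(2)]]])
    finally show ?thesis .
  qed
  have zero: "(\<lambda>_. 0) \<in> Qpi_vec \<pi> k"
    using pi_number_1 by (fastforce simp: Qpi_vec_def Qpi_def intro: exI[of _ 0])
  have f0: "f (\<lambda>_. 0) = 0" using f(2)[OF zero zero] by simp
  have "additive_on V (\<lambda>x. ?i x j)" for j
    unfolding additive_on_def using add by (intro ballI) metis
  moreover have "x = 0" if "x \<in> V" "\<forall>j<k. ?i x j = 0" for x
  proof -
    have "?i x j = 0" for j
    proof (cases "j < k")
      case False
      then show ?thesis using i(1)[OF that(1)] unfolding Qpi_vec_def by simp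
    qed (use that(2) in simp)
    then have "?i x = (\<lambda>_. 0)" by (rule ext)
    then show ?thesis using i(2)[OF that(1)] f0 by simp
  qed
  moreover have "\<exists>b. pi_number \<pi> b \<and> of_nat b * ?i x j \<in> \<int>" if "j < k" "x \<in> V" for j x
  proof -
    have "?i x j \<in> Qpi \<pi>" using i(1)[OF that(2)] that(1) by (auto simp: Qpi_vec_def)
    then obtain a b where ab: "?i x j = of_int a / of_nat b" "pi_number \<pi> b" unfolding Qpi_def by blast
    then have "of_nat b * ?i x j = of_int a" by (auto simp: pi_number_def)
    then show ?thesis using ab(2) by (metis Ints_of_int)
  qed
  ultimately show thesis using that[of k "\<lambda>j x. ?i x j"] by blast
qed

lemma zspan_eq_span: "finite F \<Longrightarrow> zspan F = zm.span F"
  unfolding zspan_def zm.span_finite by auto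

text \<open>A finite set of elements killed by \<open>p\<close> generates a group with at most
  \<open>r\<close> generators, again killed by \<open>p\<close>, hence with at most
  \<open>p ^ r\<close> elements.\<close>

lemma finite_torsion_if_finite_rank:
  assumes D: "subgrp D" and fr: "finite_rank D" and p: "(p::nat) > 0"
  shows "finite {x \<in> D. int p \<cdot> x = 0}"
proof -
  obtain r where r: "\<forall>F. finite F \<and> F \<subseteq> D \<longrightarrow> (\<exists>G. finite G \<and> card G \<le> r \<and> zspan G = zspan F)"
    using fr[unfolded finite_rank_def] ..
  have bound: "card F \<le> p ^ r" if F: "finite F" "F \<subseteq> {x \<in> D. int p \<cdot> x = 0}" for F
  proof -
    obtain G where G: "finite G" "card G \<le> r" "zspan G = zspan F" using r F by blast
    have sub: "subgrp {x. int p \<cdot> x = 0}" by (rule subgrpI) (auto simp: zm_simps)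
    have "G \<subseteq> zm.span F" using G zspan_eq_span F(1) zm.span_superset by metis
    moreover have "zm.span F \<subseteq> {x. int p \<cdot> x = 0}" using F(2) by (intro span_le_subgrp[OF _ sub]) auto
    ultimately have Gp: "\<And>s. s \<in> G \<Longrightarrow> int p \<cdot> s = 0" by blast
    let ?S = "(\<lambda>c. \<Sum>s\<in>G. c s \<cdot> s) ` (PiE G (\<lambda>_. {0..<int p}))"
    have "F \<subseteq> ?S"
    proof
      fix x assume "x \<in> F"
      then have "x \<in> zspan G" using zspan_eq_span[OF F(1)] zm.span_superset G(3) by blast
      then obtain c where c: "x = (\<Sum>s\<in>G. c s \<cdot> s)" unfolding zspan_def by blast
      have "c s \<cdot> s = (c s mod int p) \<cdot> s" if "s \<in> G" for s
      proof -
        have "c s \<cdot> s = (c s div int p * int p + c s mod int p) \<cdot> s" by simp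
        also have "\<dots> = (c s div int p) \<cdot> int p \<cdot> s + (c s mod int p) \<cdot> s"
          by (simp only: zmult_add_left zmult_zmult)
        finally show ?thesis using Gp[OF that] by simp
      qed
      then have "x = (\<Sum>s\<in>G. restrict (\<lambda>s. c s mod int p) G s \<cdot> s)" unfolding c by (intro sum.cong) auto
      moreover have "restrict (\<lambda>s. c s mod int p) G \<in> PiE G (\<lambda>_. {0..<int p})" using p by auto
      ultimately show "x \<in> ?S" by (rule image_eqI)
    qed
    moreover have fin: "finite (PiE G (\<lambda>_. {0..<int p}))" using G(1) by (intro finite_PiE) auto
    ultimately have "card F \<le> card ?S" by (intro card_mono) auto
    also have "\<dots> \<le> card (PiE G (\<lambda>_. {0..<int p}))" by (rule card_image_le[OF fin])
    also have "\<dots> = p ^ card G" using G(1) by (simp add: card_PiE)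
    also have "\<dots> \<le> p ^ r" using G(2) p by (intro power_increasing) auto
    finally show ?thesis .
  qed
  show ?thesis
  proof (rule ccontr)
    assume "infinite {x \<in> D. int p \<cdot> x = 0}"
    then obtain F where "F \<subseteq> {x \<in> D. int p \<cdot> x = 0}" "finite F" "card F = Suc (p ^ r)"
      using infinite_arbitrarily_large by blast
    then show False using bound by fastforce
  qed
qed

section \<open>Chains of successive p-th parts\<close>

lemma divisible_sequence:
  assumes V: "subgrp V" and div: "\<And>x. x \<in> D \<Longrightarrow> \<exists>y\<in>D. int p \<cdot> y - x \<in> V" and x: "x \<in> D"
  obtains z where "z 0 = x" "\<forall>k::nat. z k \<in> D" "\<forall>j k. int p ^ j \<cdot> z (k + j) - z k \<in> V"
proof -
  obtain s where s: "\<And>x. x \<in> D \<Longrightarrow> s x \<in> D \<and> int p \<cdot> s x - x \<in> V" using div by metis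
  define z where "z k = (s ^^ k) x" for k
  have z: "z k \<in> D" for k by (induction k) (auto simp: z_def x s)
  have step: "int p \<cdot> z (Suc k) - z k \<in> V" for k using s[OF z[of k]] by (simp add: z_def)
  have "int p ^ j \<cdot> z (k + j) - z k \<in> V" for j k
  proof (induction j)
    case 0
    then show ?case using subgrp_0[OF V] by (simp add: zmult_1)
  next
    case (Suc j)
    have "int p ^ j \<cdot> (int p \<cdot> z (Suc (k + j)) - z (k + j)) + (int p ^ j \<cdot> z (k + j) - z k) \<in> V"
      by (intro subgrp_add[OF V] subgrp_zmult[OF V] step Suc.IH)
    then show ?case by (simp add: zm_simps mult_ac)
  qed
  then show thesis using that[of z] z by (simp add: z_def)
qed

text \<open>A difference of two terms of a sequence of successive \<open>p\<close>-th parts is a unit multiple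
  of the later one.\<close>
lemma unit_cancel:
  assumes p: "prime p" and P: "subgrp P" and "int p ^ K \<cdot> x \<in> P" "m > 0" "x - int p ^ m \<cdot> x \<in> P"
  shows "x \<in> P"
proof -
  have "coprime (1 - int p ^ m) (int p ^ m)" by (metis coprime_add_one_right coprime_minus_left_iff
    coprime_commute diff_add_cancel minus_diff_eq)
  then have "coprime (1 - int p ^ m) (int p ^ K)" using assms(4) by simp
  moreover have "(1 - int p ^ m) \<cdot> x \<in> P" using assms(5) by (simp add: zm_simps)
  ultimately show ?thesis using subgrp_coprime[OF P] assms(3) by blast
qed

text \<open>In a chain of \<open>p\<close>-th parts of \<open>x\<close> two terms are congruent
  modulo \<open>V\<close>; \<open>unit_cancel\<close> puts the later one into \<open>V\<close>, and
  \<open>x\<close> is a multiple of it modulo \<open>V\<close>.\<close>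

lemma divisible_finite_trivial:
  assumes p: "prime p" and V: "subgrp V"
    and div: "\<And>x. x \<in> W \<Longrightarrow> \<exists>y\<in>W. int p \<cdot> y - x \<in> V"
    and tors: "\<And>x. x \<in> W \<Longrightarrow> \<exists>k. int p ^ k \<cdot> x \<in> V" and fin: "almost W V" and x: "x \<in> W"
  shows "x \<in> V"
proof -
  obtain z where z: "z 0 = x" "\<forall>k::nat. z k \<in> W" "\<forall>j k. int p ^ j \<cdot> z (k + j) - z k \<in> V"
    using divisible_sequence[OF V div x] by blast
  obtain l k where lk: "l < k" "z k - z l \<in> V" using almost_pigeonhole[OF V fin, of 0 z] z(2) by blast
  obtain K where "int p ^ K \<cdot> z k \<in> V" using tors z(2) by blast
  moreover have "(z k - z l) - (int p ^ (k - l) \<cdot> z k - z l) \<in> V"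
    using z(3)[rule_format, of "k - l" l] lk by (intro subgrp_diff[OF V lk(2)]) simp
  ultimately have "z k \<in> V" using unit_cancel[OF p V, of K "z k" "k - l"] lk(1) by simp
  then have "int p ^ k \<cdot> z k \<in> V" by (rule subgrp_zmult[OF V])
  then show ?thesis using z(3)[rule_format, of k 0] z(1) V subgrp_diff_commute[OF V] subgrp_diff_cancel[OF V, of "int p ^ k \<cdot> z k" x]
    by simp
qed

text \<open>Case (b) for a single endomorphism. The set \<open>\<pi>\<close> may exceed the primes
  of \<open>n\<close>, since all the endomorphisms contribute to it.\<close>

locale multiplication_structure =
  fixes f :: "'a::ab_group_add \<Rightarrow> 'a" and B D C V \<pi> \<pi>1 and m :: int and n :: nat
  assumes f: "endo f" and B: "subgrp B" and D: "subgrp D" and C: "subgrp C"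
    and direct: "direct3 B D C" and \<pi>: "\<pi> \<subseteq> \<pi>1" "\<forall>p\<in>\<pi>1. prime p"
    and cmp: "sumset B D = comp \<pi>1 (sumset (sumset B D) C)"
    and Bb: "bounded_grp B" and Dp: "pi_group (- \<pi>) D" and Dr: "finite_rank D"
    and V: "subgrp V" "V \<subseteq> C" and iso: "iso_Qpi_sum \<pi> V"
    and CV: "\<forall>x\<in>C. \<exists>n. pi_number (- \<pi>) n \<and> int n \<cdot> x \<in> V"
    and Cdiv: "\<forall>p\<in>\<pi>1. \<forall>x\<in>C. \<exists>y\<in>C. int p \<cdot> y - x \<in> V"
    and am: "acts_mult f B {0}" "acts_mult f D {0}" "acts_mult f C V"
    and rat: "acts_ratmult f m n V"
    and ratD: "\<And>p. prime p \<Longrightarrow> infinite {coset x V | x. x \<in> sec_pcomp p C V} \<Longrightarrow>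
       acts_ratmult f m n (comp {p} D)"
    and n: "prime_divs n \<subseteq> \<pi>"
begin

abbreviation "E \<equiv> sumset D C"

lemma E: "subgrp E" by (rule subgrp_sumset[OF D C])
lemma VE: "V \<subseteq> E" using V(2) sumset_right[OF subgrp_0[OF D]] by blast
lemma n1: "n \<ge> 1" using rat by (simp add: acts_ratmult_def)

lemma D_tors: "x \<in> D \<Longrightarrow> \<exists>k. pi_number \<pi>1 k \<and> int k \<cdot> x = 0"
proof -
  assume "x \<in> D"
  then have "x \<in> sumset B D" using sumset_right[OF subgrp_0[OF B]] by blast
  then have "x \<in> comp \<pi>1 (sumset (sumset B D) C)" using cmp by simp
  then show ?thesis unfolding comp_def by blast
qed

lemma B_tors: "x \<in> B \<Longrightarrow> \<exists>k. pi_number \<pi>1 k \<and> int k \<cdot> x = 0"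
proof -
  assume "x \<in> B"
  then have "x \<in> sumset B D" using sumset_left[OF subgrp_0[OF D]] by blast
  then have "x \<in> comp \<pi>1 (sumset (sumset B D) C)" using cmp by simp
  then show ?thesis unfolding comp_def by blast
qed

text \<open>\<open>B + D\<close> is all of the \<open>\<pi>1\<close>-component and meets
  \<open>C\<close> trivially.\<close>

lemma C_torsion_free:
  assumes c: "c \<in> C" and k: "pi_number \<pi>1 k" "int k \<cdot> c = 0" shows "c = 0"
proof -
  have "c \<in> sumset (sumset B D) C"
    using c sumset_right[OF subgrp_0[OF subgrp_sumset[OF B D]]] by blast
  then have "c \<in> comp \<pi>1 (sumset (sumset B D) C)" unfolding comp_def using k by blast
  then have "c \<in> sumset B D" using cmp by simp
  then obtain b d where bd: "b \<in> B" "d \<in> D" "c = b + d" by (rule sumsetE)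
  have "b + d + (- c) = 0" using bd by simp
  then have "- c = 0" using direct bd subgrp_uminus[OF C c] unfolding direct3_def by blast
  then show ?thesis by simp
qed

lemma D_C_independent:
  assumes "d \<in> D" "c \<in> C" "d + c = 0" shows "d = 0" "c = 0"
  using direct assms subgrp_0[OF B] unfolding direct3_def by (metis add_0)+

lemma pfin_V: assumes "prime p" shows "pfin p V"
proof -
  obtain k :: nat and co where co: "\<forall>j<k. additive_on V (co j)"
    "\<forall>x\<in>V. (\<forall>j<k. co j x = 0) \<longrightarrow> x = 0"
    "\<forall>j<k. \<forall>x\<in>V. \<exists>b. pi_number \<pi> b \<and> of_nat b * co j x \<in> \<int>"
    by (rule coordinates_if_iso[OF iso V(1)])
  show ?thesis unfolding pfin_def
  proof (intro allI impI)
    fix X assume X: "subgrp X" "X \<subseteq> V"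
    show "almost X ((\<lambda>x. int p \<cdot> x) ` X)"
      by (rule almost_mult_coordinates[OF assms X(1), of k co])
        (use additive_on_subset[OF _ X(2)] co X in auto)
  qed
qed

lemma E_periodic: "x \<in> E \<Longrightarrow> \<exists>L. pi_number (- \<pi>) L \<and> int L \<cdot> x \<in> V"
proof -
  assume "x \<in> E"
  then obtain d c where dc: "d \<in> D" "c \<in> C" "x = d + c" by (rule sumsetE)
  obtain k where k: "pi_number (- \<pi>) k" "int k \<cdot> d = 0" using Dp dc unfolding pi_group_def by blast
  obtain l where l: "pi_number (- \<pi>) l" "int l \<cdot> c \<in> V" using CV dc by blast
  have "int (k * l) \<cdot> x = int l \<cdot> int k \<cdot> d + int k \<cdot> int l \<cdot> c" unfolding dc by (simp add: zm_simps mult_ac)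
  also have "\<dots> \<in> V" using k l subgrp_zmult[OF V(1) l(2)] by simp
  finally show ?thesis using k l by (intro exI[of _ "k * l"]) (simp add: pi_number_mult)
qed

text \<open>The \<open>p\<close>-torsion of \<open>D \<oplus> C\<close> is that of \<open>D\<close>,
  finite because \<open>D\<close> has finite rank.\<close>

lemma pfin_E: assumes p: "p \<in> \<pi>1" shows "pfin p E"
proof (rule pfin_extend[OF _ V(1) pfin_V E])
  show pp: "prime p" using p \<pi> by auto
  show "prime p" by (rule pp)
  have pn: "pi_number \<pi>1 p" unfolding pi_number_def using p pp prime_gt_0_nat primes_dvd_imp_eq by blast
  show "\<exists>n\<ge>1. int n \<cdot> x \<in> V" if "x \<in> E" for x
    using E_periodic[OF that] unfolding pi_number_def by (metis One_nat_def Suc_leI)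
  have "{x \<in> E. int p \<cdot> x = 0} \<subseteq> {x \<in> D. int p \<cdot> x = 0}"
  proof
    fix x assume "x \<in> {x \<in> E. int p \<cdot> x = 0}"
    then have "x \<in> E" and x: "int p \<cdot> x = 0" by auto
    from \<open>x \<in> E\<close> obtain d c where dc: "d \<in> D" "c \<in> C" "x = d + c" by (rule sumsetE)
    have "int p \<cdot> d + int p \<cdot> c = 0" using x dc by (simp add: zmult_add_right)
    then have "int p \<cdot> c = 0" using D_C_independent subgrp_zmult[OF D dc(1)] subgrp_zmult[OF C dc(2)] by blast
    then have "c = 0" using C_torsion_free[OF dc(2) pn] by blast
    then show "x \<in> {x \<in> D. int p \<cdot> x = 0}" using dc x by simp
  qed
  then show "finite {x \<in> E. int p \<cdot> x = 0}"
    using finite_torsion_if_finite_rank[OF D Dr prime_gt_0_nat[OF pp]] finite_subset by blast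
qed

lemma ratV: "v \<in> V \<Longrightarrow> int n \<cdot> f v = m \<cdot> v"
  using rat endo_zmult[OF f] unfolding acts_ratmult_def by metis

lemma fV: "v \<in> V \<Longrightarrow> f v \<in> V" using rat unfolding acts_ratmult_def by blast

text \<open>On \<open>y = d + c\<close> the coefficients for \<open>d\<close> and for
  \<open>c\<close> modulo \<open>V\<close> could disagree. Either one summand disappears
  (\<open>d = 0\<close> for \<open>p\<close> outside \<open>\<pi>1\<close>, \<open>c \<in> V\<close>
  for \<open>p \<in> \<pi>\<close> or a finite component), or condition (iv) makes \<open>f\<close>
  the same fraction \<open>m / n\<close> on both.\<close>

lemma pw_E_primary:
  assumes p: "prime p" and y: "y \<in> E" "int p ^ k \<cdot> y \<in> V"
  shows "\<exists>a. f y - a \<cdot> y \<in> V"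
proof -
  obtain d c where dc: "d \<in> D" "c \<in> C" "y = d + c" using y(1) by (rule sumsetE)
  have "int p ^ k \<cdot> d + (int p ^ k \<cdot> c - int p ^ k \<cdot> y) = 0" using dc by (simp add: zmult_add_right)
  moreover have "int p ^ k \<cdot> c - int p ^ k \<cdot> y \<in> C" using y V dc C by (auto intro: subgrp_diff subgrp_zmult)
  ultimately have pd: "int p ^ k \<cdot> d = 0" and "int p ^ k \<cdot> c - int p ^ k \<cdot> y = 0"
    using D_C_independent subgrp_zmult[OF D dc(1)] by blast+
  then have pc: "int p ^ k \<cdot> c \<in> V" using y(2) by simp
  have qp: "pi_number S (p ^ k)" if "p \<in> S" for S
    unfolding pi_number_def using that p prime_gt_0_nat[OF p] prime_dvd_power primes_dvd_imp_eq
    by (metis zero_less_power)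
  obtain aC where aC: "f c - aC \<cdot> c \<in> V" using pwD[OF pw_if_acts_mult[OF f C V(1) am(3)] dc(2)] by blast
  obtain aD where aD: "f d - aD \<cdot> d = 0" using pwD[OF pw_if_acts_mult[OF f D subgrp_zero am(2)] dc(1)] by blast
  have inV: "\<exists>a. f y - a \<cdot> y \<in> V" if "c \<in> V"
  proof
    have "f y - aD \<cdot> y = (f d - aD \<cdot> d) + (f c - aD \<cdot> c)" unfolding dc using f by (simp add: endo_add zm_simps)
    also have "\<dots> \<in> V" unfolding aD using that fV V(1) by (simp add: subgrp_diff subgrp_zmult)
    finally show "f y - aD \<cdot> y \<in> V" .
  qed
  show ?thesis
  proof (cases "p \<in> \<pi>1")
    case False
    obtain j where j: "pi_number \<pi>1 j" "int j \<cdot> d = 0" using D_tors[OF dc(1)] by blast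
    have "d = 0" using subgrp_coprime[OF subgrp_zero, of "int j" d "int (p ^ k)"] j pd
        pi_number_coprime[OF j(1) qp[of "- \<pi>1"]] False by simp
    then show ?thesis using aC dc(3) by auto
  next
    case True
    show ?thesis
    proof (cases "infinite {coset x V | x. x \<in> sec_pcomp p C V}")
      case inf: True
      show ?thesis
      proof (cases "p \<in> \<pi>")
        case True
        obtain l where l: "pi_number (- \<pi>) l" "int l \<cdot> c \<in> V" using CV dc by blast
        have "c \<in> V" using subgrp_coprime[OF V(1), of "int (p ^ k)" c "int l"] l pc
            pi_number_coprime[OF qp[OF True] l(1)] by simp
        then show ?thesis by (rule inV)
      next
        case False
        have "d \<in> comp {p} D" unfolding comp_def using dc(1) pd qp[of "{p}"] by (auto intro!: exI[of _ "p ^ k"])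
        then have nd: "int n \<cdot> f d = m \<cdot> d"
          using ratD[OF p inf] endo_zmult[OF f] unfolding acts_ratmult_def by metis
        have "f c \<in> C" using dc(2) am(3) unfolding acts_mult_def by blast
        then have inC: "int n \<cdot> f c - m \<cdot> c \<in> C" by (intro subgrp_diff[OF C] subgrp_zmult[OF C] dc(2))
        \<comment> \<open>The defect of \<open>c\<close> is \<open>p\<close>-torsion in
          \<open>C\<close>, hence zero; so \<open>f\<close> is \<open>m / n\<close> on
          \<open>c\<close> itself and not only modulo \<open>V\<close>.\<close>
        have "int (p ^ k) \<cdot> (int n \<cdot> f c - m \<cdot> c) = int n \<cdot> f (int p ^ k \<cdot> c) - m \<cdot> int p ^ k \<cdot> c"
          using f by (simp add: endo_zmult zm_simps mult_ac)
        also have "\<dots> = 0" unfolding ratV[OF pc] by simp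
        finally have nc: "int n \<cdot> f c - m \<cdot> c = 0" by (rule C_torsion_free[OF inC qp[OF \<open>p \<in> \<pi>1\<close>]])
        have ny: "int n \<cdot> f y = m \<cdot> y" unfolding dc using f nd nc by (simp add: endo_add zm_simps)
        \<comment> \<open>\<open>n\<close> is invertible modulo the order of \<open>y\<close>, so
          the fraction becomes an integer coefficient.\<close>
        have "\<not> p dvd n" using n False p unfolding prime_divs_def by blast
        then have "coprime (int n) (int p ^ k)" using coprime_prime_power[OF p] by (simp add: coprime_commute)
        then obtain u w where uw: "u * int n + w * int p ^ k = 1" using bezout_coprime by blast
        have "f y - (u * m) \<cdot> y = (u * int n + w * int p ^ k) \<cdot> f y - u \<cdot> int n \<cdot> f y"
          unfolding uw ny by (simp add: zm_simps)
        also have "\<dots> = w \<cdot> f (int p ^ k \<cdot> y)" using f by (simp add: endo_zmult zm_simps)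
        also have "\<dots> \<in> V" by (intro subgrp_zmult[OF V(1)] fV y(2))
        finally show ?thesis by blast
      qed
    next
      case False
      \<comment> \<open>A finite \<open>p\<close>-component of \<open>C / V\<close> is trivial,
        since it is \<open>p\<close>-divisible.\<close>
      then have "almost (sec_pcomp p C V) V" using almost_iff_cosets[OF V(1), of "sec_pcomp p C V"] by simp
      moreover have "\<exists>y\<in>sec_pcomp p C V. int p \<cdot> y - x \<in> V" if "x \<in> sec_pcomp p C V" for x
      proof -
        obtain l where x: "x \<in> C" "int p ^ l \<cdot> x \<in> V" using \<open>x \<in> sec_pcomp p C V\<close> by (auto simp: sec_pcomp_def)
        obtain w where w: "w \<in> C" "int p \<cdot> w - x \<in> V" using Cdiv True x by blast
        have "int p ^ l \<cdot> (int p \<cdot> w - x) + int p ^ l \<cdot> x \<in> V"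
          by (intro subgrp_add[OF V(1)] subgrp_zmult[OF V(1)] w x)
        then have "int p ^ Suc l \<cdot> w \<in> V" by (simp add: zm_simps mult_ac)
        then show ?thesis using w unfolding sec_pcomp_def by blast
      qed
      moreover have "c \<in> sec_pcomp p C V" using dc pc by (auto simp: sec_pcomp_def)
      ultimately have "c \<in> V" by (intro divisible_finite_trivial[OF p V(1)]) (auto simp: sec_pcomp_def)
      then show ?thesis by (rule inV)
    qed
  qed
qed

lemma pw_E: "pw f E V"
  unfolding pw_def
proof
  fix x assume x: "x \<in> E"
  obtain L where L: "pi_number (- \<pi>) L" "int L \<cdot> x \<in> V" using E_periodic[OF x] by blast
  show "\<exists>a. f x - a \<cdot> x \<in> V"
  proof (rule pw_primary[OF f V(1) _ L(2)])
    show "L \<ge> 1" using L(1) by (simp add: pi_number_def)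
    show "\<exists>a. f (c \<cdot> x) - a \<cdot> c \<cdot> x \<in> V" if "prime p" "int p ^ k \<cdot> c \<cdot> x \<in> V" for p c k
      using pw_E_primary[OF that(1) subgrp_zmult[OF E x] that(2)] .
  qed (rule fV)
qed

text \<open>\<open>n f - m\<close> maps \<open>X\<close> into \<open>X\<close> plus elements of
  \<open>V\<close> that have a \<open>\<pi>'\<close>-multiple in \<open>X\<close>. These lie in
  \<open>?Y\<close>, and \<open>M ?Y\<close> is contained in \<open>X\<close> while
  \<open>?Y / M ?Y\<close> is finite. So \<open>n (f X + X)\<close> is almost contained in
  \<open>X\<close>, and undoing the factor \<open>n\<close> costs finitely many cosets because its
  primes lie in \<open>\<pi>1\<close>.\<close>

lemma inertial_on_E: "inertial_on f E"
  unfolding inertial_on_def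
proof (intro allI impI)
  fix X assume X: "subgrp X" "X \<subseteq> E"
  define g where "g x = int n \<cdot> f x - m \<cdot> x" for x
  obtain k :: nat and co where co: "\<forall>j<k. additive_on V (co j)"
    "\<forall>x\<in>V. (\<forall>j<k. co j x = 0) \<longrightarrow> x = 0"
    "\<forall>j<k. \<forall>x\<in>V. \<exists>b. pi_number \<pi> b \<and> of_nat b * co j x \<in> \<int>"
    by (rule coordinates_if_iso[OF iso V(1)])
  have "\<exists>M. pi_number (- \<pi>) M \<and>
      (\<forall>v\<in>V. \<forall>L. pi_number (- \<pi>) L \<and> int L \<cdot> v \<in> X \<inter> V \<longrightarrow> int M \<cdot> v \<in> X \<inter> V)"
    by (rule isolator_exponent[OF V(1), of k co]) (use co subgrp_Int[OF X(1) V(1)] in auto)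
  then obtain M where M: "pi_number (- \<pi>) M"
    "\<And>v L. v \<in> V \<Longrightarrow> pi_number (- \<pi>) L \<Longrightarrow> int L \<cdot> v \<in> X \<inter> V \<Longrightarrow> int M \<cdot> v \<in> X \<inter> V"
    by blast
  let ?Y = "{v \<in> V. int M \<cdot> v \<in> X}"
  have Y: "subgrp ?Y" by (rule subgrpI) (use V X in \<open>auto simp: zm_simps subgrp_intros\<close>)
  have "almost ?Y ((\<lambda>v. int M \<cdot> v) ` ?Y)"
    using M(1) by (intro pfin_mult[of M V] pfin_V Y) (auto simp: pi_number_def)
  then have YX: "almost ?Y X" by (rule almost_mono) auto
  have gX: "g x \<in> sumset ?Y X" if x: "x \<in> X" for x
  proof -
    obtain a where a: "f x - a \<cdot> x \<in> V" using pwD[OF pw_E] x X by blast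
    let ?w = "int n \<cdot> (f x - a \<cdot> x)"
    have w: "?w \<in> V" by (rule subgrp_zmult[OF V(1) a])
    obtain L where L: "pi_number (- \<pi>) L" "int L \<cdot> x \<in> V" using E_periodic x X by blast
    \<comment> \<open>\<open>L\<close> carries \<open>x\<close> into \<open>V\<close>, where
      \<open>n f = m\<close>; hence it carries \<open>?w\<close> into \<open>X\<close>.\<close>
    have "int L \<cdot> ?w = int n \<cdot> f (int L \<cdot> x) - (int n * a) \<cdot> int L \<cdot> x"
      using f by (simp add: endo_zmult zm_simps mult_ac)
    also have "\<dots> = (m - int n * a) \<cdot> int L \<cdot> x" unfolding ratV[OF L(2)]
      by (simp only: zm.scale_left_diff_distrib)
    also have "\<dots> \<in> X" by (intro subgrp_zmult[OF X(1)] x)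
    finally have "int M \<cdot> ?w \<in> X" using M(2)[OF w L(1)] subgrp_zmult[OF V(1) w] by blast
    then have "?w \<in> ?Y" using w by blast
    then have "?w + (int n * a - m) \<cdot> x \<in> sumset ?Y X" by (intro sumsetI[OF _ subgrp_zmult[OF X(1) x]])
    then show ?thesis unfolding g_def by (simp add: zm_simps)
  qed
  let ?Z = "sumset (f ` X) X"
  have Z: "subgrp ?Z" by (intro subgrp_sumset subgrp_image f X)
  have ZE: "?Z \<subseteq> E" using pw_invariant[OF pw_E E VE] X by (intro sumset_subset[OF E]) auto
  have "almost ?Z ((\<lambda>x. int n \<cdot> x) ` ?Z)"
    using n \<pi> by (intro pfin_mult[of n E] pfin_E n1 Z ZE) (auto simp: prime_divs_def)
  moreover have "(\<lambda>x. int n \<cdot> x) ` ?Z \<subseteq> sumset ?Y X"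
  proof clarify
    fix z assume "z \<in> ?Z"
    then obtain x x' where x: "x \<in> X" "x' \<in> X" "z = f x + x'" by (auto elim!: sumsetE)
    obtain u v where uv: "u \<in> ?Y" "v \<in> X" "g x = u + v" using gX[OF x(1)] by (rule sumsetE)
    have "int n \<cdot> z = g x + (m \<cdot> x + int n \<cdot> x')" unfolding x(3) g_def by (simp add: zm_simps)
    also have "\<dots> = u + (v + (m \<cdot> x + int n \<cdot> x'))" unfolding uv by simp
    also have "\<dots> \<in> sumset ?Y X" using uv x X by (intro sumsetI subgrp_add subgrp_zmult)
    finally show "int n \<cdot> z \<in> sumset ?Y X" .
  qed
  moreover have "almost (sumset ?Y X) X" by (intro almost_sumset_same YX almost_subset order.refl X)
  ultimately have "almost ?Z X" by (rule almost_chain)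
  then show "almost (f ` X) X" by (rule almost_mono[OF _ sumset_left[OF subgrp_0[OF X(1)]] order.refl])
qed

text \<open>\<open>f\<close> is one integer \<open>b\<close> on \<open>B\<close>. With
  \<open>?X'\<close> the projection of \<open>X\<close> to \<open>D \<oplus> C\<close> and
  \<open>N1\<close> a \<open>\<pi>1\<close>-number killing \<open>B\<close>, \<open>N1 ?X'\<close>
  lies in \<open>X\<close>; so \<open>?X'\<close> is almost contained in \<open>X\<close>, and
  \<open>inertial_on_E\<close> applies to it.\<close>

lemma inertial_on_structure: "inertial_on f (sumset (sumset B D) C)"
  unfolding inertial_on_def
proof (intro allI impI)
  fix X assume X: "subgrp X" "X \<subseteq> sumset (sumset B D) C"
  obtain N :: nat where N: "N \<ge> 1" "\<And>x. x \<in> B \<Longrightarrow> int N \<cdot> x = 0" using Bb unfolding bounded_grp_def by blast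
  obtain b where b: "\<And>x. x \<in> B \<Longrightarrow> f x - b \<cdot> x = 0"
    using pw_uniform[OF f subgrp_zero N(1) B pw_if_acts_mult[OF f B subgrp_zero am(1)]] N(2) by blast
  obtain N1 N2 where N12: "N = N1 * N2" "pi_number \<pi>1 N1" "pi_number (- \<pi>1) N2" using pi_number_split[OF N(1)] .
  have N1B: "int N1 \<cdot> x = 0" if x: "x \<in> B" for x
  proof -
    obtain l where l: "pi_number \<pi>1 l" "int l \<cdot> x = 0" using B_tors[OF x] by blast
    have "int l \<cdot> int N1 \<cdot> x = int N1 \<cdot> int l \<cdot> x" "int N2 \<cdot> int N1 \<cdot> x = int N \<cdot> x"
      by (simp_all add: zmult_zmult N12 mult_ac)
    then show ?thesis
      using subgrp_coprime[OF subgrp_zero _ _ pi_number_coprime[OF l(1) N12(3)], of "int N1 \<cdot> x"] l N(2)[OF x] by simp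
  qed
  let ?X' = "{e \<in> E. \<exists>b\<in>B. b + e \<in> X}"
  have X': "subgrp ?X'"
  proof (rule subgrpI)
    show "0 \<in> ?X'" using subgrp_0[OF E] subgrp_0[OF B] subgrp_0[OF X(1)] by force
    fix x y assume "x \<in> ?X'" "y \<in> ?X'"
    then obtain b1 b2 where *: "x \<in> E" "y \<in> E" "b1 \<in> B" "b2 \<in> B" "b1 + x \<in> X" "b2 + y \<in> X" by blast
    have "(b1 - b2) + (x - y) \<in> X" using subgrp_diff[OF X(1) *(5,6)] by (simp add: algebra_simps)
    then show "x - y \<in> ?X'" using subgrp_diff[OF B *(3,4)] subgrp_diff[OF E *(1,2)] by blast
  qed
  have "almost ?X' ((\<lambda>x. int N1 \<cdot> x) ` ?X')"
    using N12(2) by (intro pfin_mult[of N1 E] pfin_E X') (auto simp: pi_number_def)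
  moreover have "(\<lambda>x. int N1 \<cdot> x) ` ?X' \<subseteq> X"
  proof clarify
    fix e b assume e: "b \<in> B" "b + e \<in> X"
    have "int N1 \<cdot> (b + e) = int N1 \<cdot> e" using N1B[OF e(1)] by (simp add: zmult_add_right)
    then show "int N1 \<cdot> e \<in> X" using subgrp_zmult[OF X(1) e(2)] by metis
  qed
  ultimately have X'X: "almost ?X' X" by (rule almost_mono[OF _ order.refl])
  have "almost (f ` ?X') ?X'" using inertial_on_E X' unfolding inertial_on_def by blast
  then have fX: "almost (f ` ?X') X" using X'X by (rule almost_trans)
  have "almost (sumset (f ` ?X') (sumset ?X' X)) X"
    by (intro almost_sumset_same X'X fX almost_subset[of X X] order.refl X)
  moreover have "f ` X \<subseteq> sumset (f ` ?X') (sumset ?X' X)"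
  proof clarify
    fix x assume x: "x \<in> X"
    then obtain b0 e where be: "b0 \<in> B" "e \<in> E" "x = b0 + e" using X(2) unfolding sumset_assoc by (blast elim: sumsetE)
    have e: "e \<in> ?X'" using be x by blast
    have "f x = f e + ((- b) \<cdot> e + b \<cdot> x)" using f b[OF be(1)] unfolding be by (simp add: endo_add zm_simps)
    also have "\<dots> \<in> sumset (f ` ?X') (sumset ?X' X)"
      by (intro sumsetI imageI e subgrp_zmult[OF X'] subgrp_zmult[OF X(1)] x)
    finally show "f x \<in> sumset (f ` ?X') (sumset ?X' X)" .
  qed
  ultimately show "almost (f ` X) X" by (meson almost_mono order.refl)
qed

end

subsection \<open>Maximal subgroups avoiding a set\<close>

lemma subgrp_adjoin: "subgrp H \<Longrightarrow> subgrp {h + a \<cdot> x | h a. h \<in> H}"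
proof (rule subgrpI)
  assume H: "subgrp H"
  show "0 \<in> {h + a \<cdot> x | h a. h \<in> H}"
    using subgrp_0[OF H] by (auto intro!: exI[of _ 0] simp: zmult_0_left)
  fix y z assume "y \<in> {h + a \<cdot> x | h a. h \<in> H}" "z \<in> {h + a \<cdot> x | h a. h \<in> H}"
  then obtain h a h' a' where *: "y = h + a \<cdot> x" "z = h' + a' \<cdot> x" "h \<in> H" "h' \<in> H" by blast
  then have "y - z = (h - h') + (a - a') \<cdot> x" by (simp add: zm_simps)
  then show "y - z \<in> {h + a \<cdot> x | h a. h \<in> H}" using subgrp_diff[OF H *(3,4)] by blast
qed

text \<open>Zorn's lemma. Maximality is put in the form in which it is used: adjoining any new
  \<open>x\<close> to \<open>H\<close> produces an element of \<open>E\<close> outside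
  \<open>V\<close>.\<close>

lemma maximal_avoiding:
  assumes V: "subgrp V" and W: "subgrp W" "V \<subseteq> W"
  obtains H where "subgrp H" "V \<subseteq> H" "H \<subseteq> W" "H \<inter> E \<subseteq> V"
    "\<forall>x\<in>W. x \<notin> H \<longrightarrow> (\<exists>h\<in>H. \<exists>a. h + a \<cdot> x \<in> E \<and> h + a \<cdot> x \<notin> V)"
proof -
  let ?A = "{H. subgrp H \<and> V \<subseteq> H \<and> H \<subseteq> W \<and> H \<inter> E \<subseteq> V}"
  have "\<exists>M\<in>?A. \<forall>X\<in>?A. M \<subseteq> X \<longrightarrow> X = M"
  proof (rule subset_Zorn_nonempty)
    show "?A \<noteq> {}" using V W by auto
    fix \<C> assume ne: "\<C> \<noteq> {}" and ch: "subset.chain ?A \<C>"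
    have sub: "\<C> \<subseteq> ?A" and tot: "\<And>X Y. X \<in> \<C> \<Longrightarrow> Y \<in> \<C> \<Longrightarrow> X \<subseteq> Y \<or> Y \<subseteq> X"
      using ch by (auto simp: subset_chain_def)
    have "subgrp (\<Union>\<C>)"
    proof (rule subgrpI)
      obtain X where "X \<in> \<C>" using ne by auto
      then show "0 \<in> \<Union>\<C>" using sub subgrp_0 by blast
      fix x y assume "x \<in> \<Union>\<C>" "y \<in> \<Union>\<C>"
      then obtain X Y where XY: "X \<in> \<C>" "Y \<in> \<C>" "x \<in> X" "y \<in> Y" by auto
      then obtain Z where Z: "Z \<in> \<C>" "x \<in> Z" "y \<in> Z" using tot[OF XY(1,2)] by blast
      then have "subgrp Z" using sub by blast
      then show "x - y \<in> \<Union>\<C>" using subgrp_diff[OF _ Z(2,3)] Z(1) by blast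
    qed
    moreover obtain X where "X \<in> \<C>" using ne by auto
    ultimately show "\<Union>\<C> \<in> ?A" using sub by blast
  qed
  then obtain H where H: "subgrp H" "V \<subseteq> H" "H \<subseteq> W" "H \<inter> E \<subseteq> V"
    and max: "\<forall>X\<in>?A. H \<subseteq> X \<longrightarrow> X = H" by auto
  have "\<exists>h\<in>H. \<exists>a. h + a \<cdot> x \<in> E \<and> h + a \<cdot> x \<notin> V" if x: "x \<in> W" "x \<notin> H" for x
  proof (rule ccontr)
    assume neg: "\<not> (\<exists>h\<in>H. \<exists>a. h + a \<cdot> x \<in> E \<and> h + a \<cdot> x \<notin> V)"
    let ?X = "{h + a \<cdot> x | h a. h \<in> H}"
    have HX: "H \<subseteq> ?X"
    proof
      fix h assume "h \<in> H"
      then have "h = h + 0 \<cdot> x \<and> h \<in> H" by (simp add: zmult_0_left)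
      then show "h \<in> ?X" by blast
    qed
    have "x \<in> ?X" using subgrp_0[OF H(1)] by (auto intro!: exI[of _ 0] exI[of _ 1] simp: zmult_1)
    moreover have "?X \<subseteq> W" using H x W by (auto intro: subgrp_add subgrp_zmult)
    ultimately have "?X \<in> ?A" using neg HX H subgrp_adjoin[OF H(1)] by blast
    then show False using max HX \<open>x \<in> ?X\<close> x(2) by blast
  qed
  then show thesis using that H by blast
qed

text \<open>The usual splitting of divisible subgroups, relative to \<open>V\<close>. An
  \<open>x\<close> with \<open>p x\<close> in the sum is first corrected by an element of
  \<open>D\<close> so that its \<open>p\<close>-multiple lies in \<open>X\<close>; then maximality
  applies.\<close>

lemma divisible_complement:
  assumes p: "prime p" and V: "subgrp V" and D: "subgrp D" "V \<subseteq> D" and Z: "subgrp Z" "D \<subseteq> Z"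
    and div: "\<forall>x\<in>D. \<exists>y\<in>D. int p \<cdot> y - x \<in> V" and tors: "\<forall>x\<in>Z. \<exists>k. int p ^ k \<cdot> x \<in> V"
  obtains X where "subgrp X" "V \<subseteq> X" "X \<subseteq> Z" "X \<inter> D \<subseteq> V" "Z \<subseteq> sumset D X"
proof -
  obtain X where X: "subgrp X" "V \<subseteq> X" "X \<subseteq> Z" "X \<inter> D \<subseteq> V"
    and max: "\<forall>x\<in>Z. x \<notin> X \<longrightarrow> (\<exists>h\<in>X. \<exists>a. h + a \<cdot> x \<in> D \<and> h + a \<cdot> x \<notin> V)"
    using maximal_avoiding[OF V Z(1), of D] D(2) Z(2) by blast
  let ?S = "sumset D X"
  have S: "subgrp ?S" by (rule subgrp_sumset[OF D(1) X(1)])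
  have DS: "D \<subseteq> ?S" and XS: "X \<subseteq> ?S" using sumset_left[OF subgrp_0[OF X(1)]] sumset_right[OF subgrp_0[OF D(1)]] by blast+
  have step: "x \<in> ?S" if x: "x \<in> Z" "int p \<cdot> x \<in> ?S" for x
  proof -
    obtain d c where dc: "d \<in> D" "c \<in> X" "int p \<cdot> x = d + c" using x(2) by (rule sumsetE)
    obtain d' where d': "d' \<in> D" "int p \<cdot> d' - d \<in> V" using div dc by blast
    let ?x = "x - d'"
    have xZ: "?x \<in> Z" using x d' Z by (auto intro: subgrp_diff)
    have "int p \<cdot> ?x = c - (int p \<cdot> d' - d)" using dc by (simp add: zm_simps)
    then have px: "int p \<cdot> ?x \<in> X" using dc d' X by (metis subgrp_diff subsetD)
    have "?x \<in> ?S"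
    proof (cases "?x \<in> X")
      case False
      then obtain h a where ha: "h \<in> X" "h + a \<cdot> ?x \<in> D" "h + a \<cdot> ?x \<notin> V" using max xZ by blast
      \<comment> \<open>Otherwise \<open>h + a \<cdot> ?x\<close> would lie in
        \<open>X \<inter> D\<close>, hence in \<open>V\<close>.\<close>
      have "\<not> int p dvd a"
      proof
        assume "int p dvd a"
        then have "a \<cdot> ?x \<in> X" using subgrp_zmult_dvd[OF X(1) px] by blast
        then show False using ha X(4) subgrp_add[OF X(1) ha(1)] by blast
      qed
      then have "coprime a (int p)" using p by (metis coprime_commute prime_imp_coprime prime_nat_int_transfer)
      moreover have "a \<cdot> ?x \<in> ?S" using subgrp_diff[OF S, of "h + a \<cdot> ?x" h] ha DS XS by auto
      ultimately show ?thesis using subgrp_coprime[OF S, of a ?x "int p"] px XS by blast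
    qed (use XS in blast)
    then show ?thesis using subgrp_add[OF S, of ?x d'] d' DS by auto
  qed
  have "x \<in> ?S" if "x \<in> Z" "int p ^ k \<cdot> x \<in> ?S" for x k
    using that
  proof (induction k arbitrary: x)
    case 0 then show ?case by (simp add: zmult_1)
  next
    case (Suc k)
    have "int p ^ k \<cdot> int p \<cdot> x \<in> ?S" using Suc.prems(2) by (simp add: zmult_zmult mult_ac)
    then have "int p \<cdot> x \<in> ?S" using Suc.IH[OF subgrp_zmult[OF Z(1) Suc.prems(1)]] by blast
    then show ?case using step Suc.prems(1) by blast
  qed
  then have "Z \<subseteq> ?S" using tors D(2) DS by blast
  then show thesis using that X by blast
qed

subsection \<open>Inertial endomorphisms\<close>

lemma inertialD: "inertial f \<Longrightarrow> subgrp X \<Longrightarrow> almost (f ` X) X"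
  by (simp add: inertial_iff)

text \<open>Allows the passage to \<open>f - m\<close> and to maps that invert a prime in the
  denominator of \<open>f\<close>.\<close>

lemma inertial_combination:
  fixes f :: "'a::ab_group_add \<Rightarrow> 'a"
  assumes "inertial f" "endo f" shows "inertial (\<lambda>x. a \<cdot> f x + b \<cdot> x)"
  unfolding inertial_iff
proof (intro allI impI)
  fix X :: "'a set" assume X: "subgrp X"
  have "almost ((\<lambda>x. a \<cdot> x) ` f ` X) ((\<lambda>x. a \<cdot> x) ` X)"
    by (intro almost_image endo_zmult_const inertialD assms X)
  then have "almost ((\<lambda>x. a \<cdot> x) ` f ` X) X"
    by (rule almost_mono) (use subgrp_zmult[OF X] in auto)
  then have "almost (sumset ((\<lambda>x. a \<cdot> x) ` f ` X) X) X"
    by (intro almost_sumset_same almost_subset[of X X] order.refl X)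
  moreover have "(\<lambda>x. a \<cdot> f x + b \<cdot> x) ` X \<subseteq> sumset ((\<lambda>x. a \<cdot> x) ` f ` X) X"
    using subgrp_zmult[OF X] by (auto intro!: sumsetI)
  ultimately show "almost ((\<lambda>x. a \<cdot> f x + b \<cdot> x) ` X) X" by (meson almost_mono order.refl)
qed

lemma endo_combination: "endo f \<Longrightarrow> endo (\<lambda>x. a \<cdot> f x + b \<cdot> x)"
  by (simp add: endo_def zm_simps algebra_simps)

section \<open>Subgroups with finite socle above them on which an inertial map is a
  multiplication\<close>

lemma almost_cyclic_torsion:
  assumes V: "subgrp V" and n: "(n::nat) \<ge> 1" "int n \<cdot> e \<in> V"
  shows "almost (range (\<lambda>c. c \<cdot> e)) V"
  unfolding almost_def
proof (intro exI conjI)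
  show "finite ((\<lambda>c. c \<cdot> e) ` {0..<int n})" by simp
  show "range (\<lambda>c. c \<cdot> e) \<subseteq> sumset ((\<lambda>c. c \<cdot> e) ` {0..<int n}) V"
  proof clarify
    fix c
    have "(c mod int n) \<cdot> e + (c div int n) \<cdot> int n \<cdot> e \<in> sumset ((\<lambda>c. c \<cdot> e) ` {0..<int n}) V"
      using n by (intro sumsetI[OF imageI subgrp_zmult[OF V n(2)]]) auto
    moreover have "(c mod int n) \<cdot> e + (c div int n) \<cdot> int n \<cdot> e = c \<cdot> e"
      by (simp add: zmult_zmult flip: zmult_add_left)
    ultimately show "c \<cdot> e \<in> sumset ((\<lambda>c. c \<cdot> e) ` {0..<int n}) V" by simp
  qed
qed

lemma almost_span_torsion:
  assumes V: "subgrp V" and "finite E" "\<And>e. e \<in> E \<Longrightarrow> \<exists>n::nat. n \<ge> 1 \<and> int n \<cdot> e \<in> V"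
  shows "almost (zm.span E) V"
  using assms(2,3)
proof (induction E rule: finite_induct)
  case empty
  then show ?case using subgrp_0[OF V] by (intro almost_subset) simp
next
  case (insert e E)
  obtain n :: nat where n: "n \<ge> 1" "int n \<cdot> e \<in> V" using insert.prems by blast
  have "zm.span (insert e E) \<subseteq> sumset (range (\<lambda>c. c \<cdot> e)) (zm.span E)"
  proof
    fix x assume "x \<in> zm.span (insert e E)"
    then obtain c where "x - c \<cdot> e \<in> zm.span E" unfolding zm.span_insert by blast
    then have "c \<cdot> e + (x - c \<cdot> e) \<in> sumset (range (\<lambda>c. c \<cdot> e)) (zm.span E)" by (intro sumsetI) auto
    then show "x \<in> sumset (range (\<lambda>c. c \<cdot> e)) (zm.span E)" by simp
  qed
  moreover have "almost (sumset (range (\<lambda>c. c \<cdot> e)) (zm.span E)) V"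
    using insert by (intro almost_sumset_same almost_cyclic_torsion[OF V n] V) auto
  ultimately show ?case by (meson almost_mono order.refl)
qed

text \<open>Stated for all large \<open>K\<close>, so that two expressions can be brought to the
  same length.\<close>

lemma span_range_sum:
  fixes x :: "nat \<Rightarrow> 'a::ab_group_add"
  assumes "w \<in> zm.span (range x)"
  shows "\<exists>K0. \<forall>K\<ge>K0. \<exists>c. w = (\<Sum>j<K. c j \<cdot> x j)"
proof -
  let ?S = "{w. \<exists>K0. \<forall>K\<ge>K0. \<exists>c. w = (\<Sum>j<K. c j \<cdot> x j)}"
  have "subgrp ?S"
  proof (rule subgrpI)
    show "0 \<in> ?S" by (auto intro!: exI[of _ "\<lambda>_. 0"] simp: zmult_0_left)
    fix v w assume "v \<in> ?S" "w \<in> ?S"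
    then obtain K0 K1 where K: "\<forall>K\<ge>K0. \<exists>c. v = (\<Sum>j<K. c j \<cdot> x j)" "\<forall>K\<ge>K1. \<exists>c. w = (\<Sum>j<K. c j \<cdot> x j)"
      by auto
    have "\<exists>c. v - w = (\<Sum>j<K. c j \<cdot> x j)" if "K \<ge> max K0 K1" for K
    proof -
      have "K \<ge> K0" "K \<ge> K1" using that by simp_all
      then obtain c d where "v = (\<Sum>j<K. c j \<cdot> x j)" "w = (\<Sum>j<K. d j \<cdot> x j)"
        using K by blast
      then have "v - w = (\<Sum>j<K. (c j - d j) \<cdot> x j)" by (simp add: zm_simps sum_subtractf)
      then show ?thesis by (rule exI[of _ "\<lambda>j. c j - d j"])
    qed
    then show "v - w \<in> ?S" by blast
  qed
  moreover have "range x \<subseteq> ?S"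
  proof clarify
    fix i
    have "x i = (\<Sum>j<K. (if j = i then 1 else 0) \<cdot> x j)" if "K \<ge> Suc i" for K
    proof -
      have "(\<Sum>j<K. (if j = i then 1 else 0) \<cdot> x j) = (\<Sum>j<K. if j = i then x j else 0)"
        by (intro sum.cong) (auto simp: zmult_1 zmult_0_left)
      then show ?thesis using that by simp
    qed
    then have "\<exists>c. x i = (\<Sum>j<K. c j \<cdot> x j)" if "K \<ge> Suc i" for K
      using that by (intro exI[of _ "\<lambda>j. if j = i then 1 else 0"]) auto
    then show "\<exists>K0. \<forall>K\<ge>K0. \<exists>c. x i = (\<Sum>j<K. c j \<cdot> x j)" by (intro exI[of _ "Suc i"]) simp
  qed
  ultimately have "zm.span (range x) \<subseteq> ?S" by (intro span_le_subgrp)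
  then show ?thesis using assms by blast
qed

text \<open>Otherwise one could choose \<open>x\<^sub>0, x\<^sub>1, \<dots>\<close> such that the groups generated by \<open>x\<^sub>k\<close> and \<open>f x\<^sub>k\<close>
  are independent modulo \<open>V\<close> and \<open>f x\<^sub>k\<close> is not a multiple of \<open>x\<^sub>k\<close>.\<close>
lemma inertial_avoiding_finite:
  assumes f: "endo f" "inertial f" and V: "subgrp V" and W: "subgrp W" and fW: "\<And>x. x \<in> W \<Longrightarrow> f x \<in> W"
  shows "\<exists>E. finite E \<and> E \<subseteq> W \<and> (\<forall>x\<in>W.
    (\<forall>a b. a \<cdot> x + b \<cdot> f x \<in> sumset (zm.span E) V \<longrightarrow> a \<cdot> x + b \<cdot> f x \<in> V) \<longrightarrow> (\<exists>a. f x - a \<cdot> x \<in> V))"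
proof (rule ccontr)
  assume neg: "\<not> ?thesis"
  define good where "good = (\<lambda>E x. (\<forall>a b. a \<cdot> x + b \<cdot> f x \<in> sumset (zm.span E) V \<longrightarrow> a \<cdot> x + b \<cdot> f x \<in> V)
    \<longrightarrow> (\<exists>a. f x - a \<cdot> x \<in> V))"
  have neg': "\<not> (\<exists>E. finite E \<and> E \<subseteq> W \<and> (\<forall>x\<in>W. good E x))" unfolding good_def by (rule neg)
  define bad where "bad E x \<longleftrightarrow> x \<in> W \<and>
    (\<forall>a b. a \<cdot> x + b \<cdot> f x \<in> sumset (zm.span E) V \<longrightarrow> a \<cdot> x + b \<cdot> f x \<in> V) \<and> (\<forall>a. f x - a \<cdot> x \<notin> V)" for E x
  define s where "s E = (SOME x. bad E x)" for E
  have s: "bad E (s E)" if "finite E" "E \<subseteq> W" for E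
  proof -
    obtain x where x: "x \<in> W" "\<not> good E x" using neg' \<open>finite E\<close> \<open>E \<subseteq> W\<close> by blast
    then have "bad E x" unfolding good_def bad_def by simp
    then show ?thesis unfolding s_def by (rule someI)
  qed
  \<comment> \<open>Each chosen element is added together with its image, so that later pairs avoid
    both.\<close>
  define E where "E k = ((\<lambda>E. insert (s E) (insert (f (s E)) E)) ^^ k) {}" for k
  define x where "x k = s (E k)" for k
  have E_Suc: "E (Suc k) = insert (x k) (insert (f (x k)) (E k))" for k by (simp add: E_def x_def)
  have E: "finite (E k) \<and> E k \<subseteq> W" for k
  proof (induction k)
    case 0 then show ?case by (simp add: E_def)
  next
    case (Suc k)
    then have "x k \<in> W" using s[of "E k"] by (simp add: x_def bad_def)
    then show ?case using Suc fW by (simp add: E_Suc)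
  qed
  have bad: "bad (E k) (x k)" for k using s E by (simp add: x_def)
  have xE: "x j \<in> E k" "f (x j) \<in> E k" if "j < k" for j k
    using that by (induction k) (auto simp: E_Suc less_Suc_eq)
  have indep: "a k \<cdot> x k + b k \<cdot> f (x k) \<in> V"
    if "(\<Sum>j<K. a j \<cdot> x j + b j \<cdot> f (x j)) \<in> V" "k < K" for a b k K
    using that
  proof (induction K)
    case (Suc K)
    let ?t = "a K \<cdot> x K + b K \<cdot> f (x K)" and ?S = "\<Sum>j<K. a j \<cdot> x j + b j \<cdot> f (x j)"
    have "- ?S \<in> zm.span (E K)"
      by (intro subgrp_uminus[OF subgrp_span] subgrp_sum[OF subgrp_span] subgrp_add[OF subgrp_span]
          subgrp_zmult[OF subgrp_span] zm.span_base xE) auto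
    moreover have "?S + ?t \<in> V" using Suc.prems(1) by simp
    ultimately have "- ?S + (?S + ?t) \<in> sumset (zm.span (E K)) V" by (rule sumsetI)
    then have t: "?t \<in> V" using bad[of K] unfolding bad_def by simp
    then have "?S \<in> V" using subgrp_diff[OF V \<open>?S + ?t \<in> V\<close> t] by simp
    then show ?case using Suc t by (auto simp: less_Suc_eq)
  qed simp
  let ?X = "sumset V (zm.span (range x))"
  have X: "subgrp ?X" by (rule subgrp_sumset[OF V subgrp_span])
  have xX: "x k \<in> ?X" for k using sumset_right[OF subgrp_0[OF V]] zm.span_base[of "x k" "range x"] by blast
  obtain l k where lk: "l < k" "f (x k) - f (x l) \<in> ?X"
    using almost_pigeonhole[OF X inertialD[OF f(2) X], of 0 "\<lambda>k. f (x k)"] xX by blast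
  obtain v w where vw: "v \<in> V" "w \<in> zm.span (range x)" "f (x k) - f (x l) = v + w" using lk(2) by (rule sumsetE)
  obtain K0 where "\<forall>K\<ge>K0. \<exists>c. w = (\<Sum>j<K. c j \<cdot> x j)" using span_range_sum[OF vw(2)] by blast
  then obtain c where c: "w = (\<Sum>j<max K0 (Suc k). c j \<cdot> x j)" by (meson max.cobounded1)
  let ?K = "max K0 (Suc k)"
  \<comment> \<open>The congruence of \<open>f (x k)\<close> and \<open>f (x l)\<close> modulo
    \<open>?X\<close> is read as a relation among all \<open>x j\<close> and \<open>f (x j)\<close>;
    by independence its \<open>k\<close>-th part makes \<open>f (x k)\<close> a multiple of
    \<open>x k\<close> modulo \<open>V\<close>.\<close>
  let ?b = "\<lambda>j. if j = k then 1 else if j = l then - 1 else 0"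
  have "(\<Sum>j<?K. ?b j \<cdot> f (x j)) = (\<Sum>j<?K. (if j = k then f (x j) else 0) + (if j = l then - f (x j) else 0))"
    using lk(1) by (intro sum.cong) (auto simp: zmult_1 zmult_0_left)
  also have "\<dots> = f (x k) - f (x l)" using lk(1) by (simp add: sum.distrib)
  finally have "(\<Sum>j<?K. (- c j) \<cdot> x j + ?b j \<cdot> f (x j)) = v"
    using vw(3) c by (simp add: sum.distrib sum_negf sum_subtractf)
  then have "(\<Sum>j<?K. (- c j) \<cdot> x j + ?b j \<cdot> f (x j)) \<in> V" using vw(1) by simp
  then have "(- c k) \<cdot> x k + ?b k \<cdot> f (x k) \<in> V" by (rule indep) simp
  then have "f (x k) - c k \<cdot> x k \<in> V" by (simp add: zmult_1)
  then show False using bad[of k] unfolding bad_def by blast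
qed

text \<open>\<open>H\<close> is maximal avoiding the finite obstruction, and the elements
  \<open>x\<close> with both \<open>x\<close> and \<open>f x\<close> in \<open>H\<close> satisfy the
  hypothesis of \<open>inertial_avoiding_finite\<close>. By maximality the socle over
  \<open>H\<close> lies in the span of \<open>E\<close> plus \<open>H\<close>, finite modulo
  \<open>H\<close> because \<open>W / V\<close> is periodic; both conditions defining
  \<open>?Y\<close> inherit this.\<close>

lemma inertial_pw_finite_socle:
  assumes f: "endo f" "inertial f" and V: "subgrp V" and W: "subgrp W" "V \<subseteq> W"
    and fV: "\<And>x. x \<in> V \<Longrightarrow> f x \<in> V" and fW: "\<And>x. x \<in> W \<Longrightarrow> f x \<in> W"
    and per: "\<And>x. x \<in> W \<Longrightarrow> \<exists>n::nat. n \<ge> 1 \<and> int n \<cdot> x \<in> V"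
  obtains Y where "subgrp Y" "V \<subseteq> Y" "Y \<subseteq> W" "pw f Y V"
    "almost {x \<in> W. \<exists>p::nat. prime p \<and> int p \<cdot> x \<in> Y} Y"
proof -
  from inertial_avoiding_finite[OF f V W(1) fW]
  obtain E where E0: "finite E \<and> E \<subseteq> W \<and> (\<forall>x\<in>W. (\<forall>a b. a \<cdot> x + b \<cdot> f x \<in> sumset (zm.span E) V
    \<longrightarrow> a \<cdot> x + b \<cdot> f x \<in> V) \<longrightarrow> (\<exists>a. f x - a \<cdot> x \<in> V))" ..
  then have E: "finite E" "E \<subseteq> W" by (rule conjunct1, rule conjunct1[OF conjunct2])
  note good = bspec[OF conjunct2[OF conjunct2[OF E0]], THEN mp]
  let ?G = "sumset (zm.span E) V"
  have G: "subgrp ?G" by (rule subgrp_sumset[OF subgrp_span V])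
  obtain H where H: "subgrp H" "V \<subseteq> H" "H \<subseteq> W" "H \<inter> ?G \<subseteq> V"
    and max: "\<forall>x\<in>W. x \<notin> H \<longrightarrow> (\<exists>h\<in>H. \<exists>a. h + a \<cdot> x \<in> ?G \<and> h + a \<cdot> x \<notin> V)"
    using maximal_avoiding[OF V W, of ?G] by blast
  let ?Y = "H \<inter> f -` H"
  have Y: "subgrp ?Y" by (intro subgrp_Int H subgrp_vimage f)
  have "pw f ?Y V" unfolding pw_def
  proof
    fix x assume x: "x \<in> ?Y"
    then have "a \<cdot> x + b \<cdot> f x \<in> H" for a b using H by (simp add: subgrp_add subgrp_zmult)
    then have "\<forall>a b. a \<cdot> x + b \<cdot> f x \<in> ?G \<longrightarrow> a \<cdot> x + b \<cdot> f x \<in> V" using H(4) by blast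
    then show "\<exists>a. f x - a \<cdot> x \<in> V" by (rule good[rotated]) (use x H in blast)
  qed
  let ?S = "{x \<in> W. \<exists>p::nat. prime p \<and> int p \<cdot> x \<in> H}"
  have "?S \<subseteq> sumset ?G H"
  proof clarify
    fix x and p :: nat assume x: "x \<in> W" and p: "prime p" "int p \<cdot> x \<in> H"
    have GH: "subgrp (sumset ?G H)" by (rule subgrp_sumset[OF G H(1)])
    have sub: "?G \<subseteq> sumset ?G H" "H \<subseteq> sumset ?G H"
      using sumset_left[OF subgrp_0[OF H(1)]] sumset_right[OF subgrp_0[OF G]] by blast+
    show "x \<in> sumset ?G H"
    proof (cases "x \<in> H")
      case False
      then obtain h a where ha: "h \<in> H" "h + a \<cdot> x \<in> ?G" "h + a \<cdot> x \<notin> V" using max x by blast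
      have "\<not> int p dvd a"
      proof
        assume "int p dvd a"
        then have "a \<cdot> x \<in> H" using subgrp_zmult_dvd[OF H(1) p(2)] by blast
        then show False using ha H(4) subgrp_add[OF H(1) ha(1)] by blast
      qed
      then have "coprime a (int p)" using p(1) by (metis coprime_commute prime_imp_coprime prime_nat_int_transfer)
      moreover have "a \<cdot> x \<in> sumset ?G H" using subgrp_diff[OF GH, of "h + a \<cdot> x" h] ha sub by auto
      ultimately show ?thesis using subgrp_coprime[OF GH, of a x "int p"] p(2) sub by blast
    qed (use sub in blast)
  qed
  moreover have "almost (sumset ?G H) H"
  proof -
    have "almost (zm.span E) H" using almost_span_torsion[OF V E(1)] per E(2) H(2) by (meson almost_mono order.refl subsetD)
    then show ?thesis using H by (intro almost_sumset_same almost_subset[of V H] almost_subset[of H H]) auto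
  qed
  ultimately have soc: "almost ?S H" by (meson almost_mono order.refl)
  let ?K = "{x \<in> W. \<exists>p::nat. prime p \<and> int p \<cdot> x \<in> ?Y}"
  have "almost ?K H" by (rule almost_mono[OF soc]) auto
  moreover have "f ` ?K \<subseteq> ?S" using fW f(1) by (auto simp: endo_zmult)
  then have "almost (f ` ?K) H" by (rule almost_mono[OF soc]) simp
  then have "almost ?K (f -` H)" by (rule almost_vimage[OF f(1) H(1)])
  ultimately have "almost ?K ?Y" by (intro almost_Int H subgrp_vimage f)
  then show thesis using that[of ?Y] Y \<open>pw f ?Y V\<close> H fV by blast
qed

subsection \<open>Quasicyclic sections\<close>

text \<open>If each \<open>z k\<close> is congruent modulo \<open>V\<close> to \<open>p\<close>
  times the next term, this is the subgroup generated by \<open>V\<close> and all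
  \<open>z k\<close>, modulo \<open>V\<close> a homomorphic image of a quasicyclic group. One index
  suffices because the cyclic groups form a chain.\<close>

definition prufer :: "'a::ab_group_add set \<Rightarrow> (nat \<Rightarrow> 'a) \<Rightarrow> 'a set" where
  "prufer V z = {w. \<exists>k a. w - a \<cdot> z k \<in> V}"

lemma subgrp_prufer:
  assumes V: "subgrp V" and z: "\<forall>j k. int p ^ j \<cdot> z (k + j) - z k \<in> V"
  shows "subgrp (prufer V z)"
proof (rule subgrpI)
  show "0 \<in> prufer V z" using subgrp_0[OF V] unfolding prufer_def
    by (auto intro!: exI[of _ 0] simp: zmult_0_left)
  fix x y assume "x \<in> prufer V z" "y \<in> prufer V z"
  then obtain k a l b where *: "x - a \<cdot> z k \<in> V" "y - b \<cdot> z l \<in> V" unfolding prufer_def by blast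
  have "(x - a \<cdot> z k) - (y - b \<cdot> z l) - a \<cdot> (int p ^ l \<cdot> z (k + l) - z k) + b \<cdot> (int p ^ k \<cdot> z (l + k) - z l) \<in> V"
    by (intro subgrp_add[OF V] subgrp_diff[OF V *] subgrp_diff[OF V _ subgrp_zmult[OF V]]
        subgrp_zmult[OF V] z[rule_format])
  then have "(x - y) - (a * int p ^ l - b * int p ^ k) \<cdot> z (k + l) \<in> V"
    by (simp add: zm_simps algebra_simps)
  then show "x - y \<in> prufer V z" unfolding prufer_def by blast
qed

lemma prufer_base: "subgrp V \<Longrightarrow> V \<subseteq> prufer V z"
  unfolding prufer_def by (auto intro!: exI[of _ 0] simp: zmult_0_left)

lemma prufer_mem: "subgrp V \<Longrightarrow> z k \<in> prufer V z"
  unfolding prufer_def mem_Collect_eq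
  by (rule exI[of _ k], rule exI[of _ "1::int"]) (simp add: zmult_1 subgrp_0)

text \<open>Let \<open>?P\<close> be the quasicyclic group through \<open>x\<close>. Pigeonhole and
  \<open>unit_cancel\<close> put some \<open>f (z k)\<close>, hence \<open>f x\<close>, into
  \<open>?P\<close>. So \<open>f x\<close> is a multiple of some \<open>z i\<close> modulo
  \<open>V\<close>, and since its order divides that of \<open>x\<close> it is already a multiple of
  \<open>x\<close>.\<close>

lemma inertial_pw_divisible:
  assumes f: "endo f" "inertial f" and p: "prime p" and V: "subgrp V" and D: "subgrp D" "V \<subseteq> D"
    and fV: "\<And>x. x \<in> V \<Longrightarrow> f x \<in> V"
    and div: "\<forall>x\<in>D. \<exists>y\<in>D. int p \<cdot> y - x \<in> V" and tors: "\<forall>x\<in>D. \<exists>k. int p ^ k \<cdot> x \<in> V"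
  shows "pw f D V"
  unfolding pw_def
proof
  fix x assume x: "x \<in> D"
  obtain z where z: "z 0 = x" "\<forall>k::nat. z k \<in> D" "\<forall>j k. int p ^ j \<cdot> z (k + j) - z k \<in> V"
    using divisible_sequence[OF V _ x, of p] div by blast
  let ?P = "prufer V z"
  have P: "subgrp ?P" by (rule subgrp_prufer[OF V z(3)])
  obtain l k where lk: "l < k" "f (z k) - f (z l) \<in> ?P"
    using almost_pigeonhole[OF P inertialD[OF f(2) P], of 0 "\<lambda>k. f (z k)"] prufer_mem[OF V] by blast
  have fVP: "f v \<in> ?P" if "v \<in> V" for v using fV[OF that] prufer_base[OF V] by blast
  obtain K where "int p ^ K \<cdot> z k \<in> V" using tors z(2) by blast
  then have tor: "int p ^ K \<cdot> f (z k) \<in> ?P" using fVP f(1) by (metis endo_zmult)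
  have "f (z k) - int p ^ (k - l) \<cdot> f (z k) \<in> ?P"
  proof -
    have "f (int p ^ (k - l) \<cdot> z (l + (k - l)) - z l) \<in> ?P" using fVP z(3) by blast
    then have "int p ^ (k - l) \<cdot> f (z k) - f (z l) \<in> ?P" using lk(1) f(1) by (simp add: endo_simps)
    from subgrp_diff[OF P lk(2) this] show ?thesis by simp
  qed
  then have fzk: "f (z k) \<in> ?P" by (rule unit_cancel[OF p P tor, rotated]) (use lk(1) in simp)
  have "f (int p ^ k \<cdot> z (0 + k) - z 0) \<in> ?P" using fVP z(3) by blast
  then have "int p ^ k \<cdot> f (z k) - f x \<in> ?P" using z(1) f(1) by (simp add: endo_simps)
  from subgrp_diff[OF P subgrp_zmult[OF P fzk, of "int p ^ k"] this] have "f x \<in> ?P" by simp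
  then obtain i a where ia: "f x - a \<cdot> z i \<in> V" unfolding prufer_def by blast
  obtain h0 where h0: "int p ^ h0 \<cdot> x \<in> V" using tors x by blast
  obtain h where h: "\<forall>j. j \<cdot> x \<in> V \<longleftrightarrow> int p ^ h dvd j" using prime_power_order[OF p V h0] by blast
  show "\<exists>a. f x - a \<cdot> x \<in> V"
  proof (cases h)
    case 0
    then have "1 \<cdot> x \<in> V" using h[rule_format, of 1] by simp
    then have "f x - 0 \<cdot> x \<in> V" using fV by (simp add: zmult_1 zmult_0_left)
    then show ?thesis by blast
  next
    case (Suc h')
    have zi: "int p ^ i \<cdot> z i - x \<in> V" using z(3)[rule_format, of i 0] z(1) by simp
    have zi_iff: "(j * int p ^ i) \<cdot> z i \<in> V \<longleftrightarrow> int p ^ h dvd j" for j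
    proof -
      have "(j * int p ^ i) \<cdot> z i - j \<cdot> x = j \<cdot> (int p ^ i \<cdot> z i - x)" by (simp add: zm_simps)
      then have "(j * int p ^ i) \<cdot> z i - j \<cdot> x \<in> V" using subgrp_zmult[OF V zi] by simp
      then have "(j * int p ^ i) \<cdot> z i \<in> V \<longleftrightarrow> j \<cdot> x \<in> V"
        using subgrp_add_cancel[OF V, of "(j * int p ^ i) \<cdot> z i - j \<cdot> x" "j \<cdot> x"] by auto
      then show ?thesis using h by simp
    qed
    obtain K where "int p ^ K \<cdot> z i \<in> V" using tors z(2) by blast
    then obtain q where q: "\<forall>j. j \<cdot> z i \<in> V \<longleftrightarrow> int p ^ q dvd j" using prime_power_order[OF p V] by blast
    have "\<not> p ^ h dvd p ^ h'" using power_dvd_imp_le[of p h h'] Suc prime_gt_1_nat[OF p] by auto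
    then have "\<not> int p ^ h dvd int p ^ h'" by (metis of_nat_dvd_iff of_nat_power)
    then have "\<not> int p ^ q dvd int p ^ h' * int p ^ i" using zi_iff[of "int p ^ h'"] q by blast
    then have "\<not> q \<le> h' + i" using le_imp_power_dvd by (metis power_add)
    \<comment> \<open>\<open>p ^ q\<close> is the order of \<open>z i\<close>. The bound needs
      \<open>h > 0\<close>, and it forces \<open>p ^ i\<close> to divide \<open>a\<close>.\<close>
    then have "h + i \<le> q" using Suc by simp
    moreover have "int p ^ h \<cdot> f x \<in> V"
      using fV[of "int p ^ h \<cdot> x"] h f(1) by (simp add: endo_zmult)
    from subgrp_diff[OF V this subgrp_zmult[OF V ia, of "int p ^ h"]]
    have "int p ^ h \<cdot> f x - int p ^ h \<cdot> (f x - a \<cdot> z i) \<in> V" .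
    then have "(int p ^ h * a) \<cdot> z i \<in> V" by (simp add: zm_simps)
    then have "int p ^ q dvd int p ^ h * a" using q by blast
    ultimately have "int p ^ h * int p ^ i dvd int p ^ h * a" by (metis dvd_trans le_imp_power_dvd power_add)
    then have "int p ^ i dvd a" using prime_gt_0_nat[OF p] by simp
    then obtain a' where a': "a = int p ^ i * a'" by blast
    have "(f x - a \<cdot> z i) + a' \<cdot> (int p ^ i \<cdot> z i - x) \<in> V" by (intro subgrp_add[OF V] subgrp_zmult[OF V] ia zi)
    then have "f x - a' \<cdot> x \<in> V" unfolding a' by (simp add: zm_simps mult_ac)
    then show ?thesis by blast
  qed
qed

text \<open>Extending \<open>N\<close> by \<open>p \<cdot> w - z\<close> makes \<open>w\<close> a \<open>p\<close>-th part of \<open>z\<close>; the multiple \<open>w\<close> of an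
  element \<open>y\<close> of large order is chosen so that \<open>N\<close> still meets the powers of \<open>z\<close> trivially.\<close>
lemma prufer_section_step:
  assumes p: "prime p" and S: "subgrp S" and V: "subgrp V"
    and unb: "\<forall>k. \<exists>x\<in>S. int p ^ k \<cdot> x \<notin> V" and tors: "\<forall>x\<in>S. \<exists>k. int p ^ k \<cdot> x \<in> V"
    and N: "subgrp N" "V \<subseteq> N" "N \<subseteq> S" and e: "\<forall>x\<in>N. int p ^ e \<cdot> x \<in> V"
    and z: "z \<in> S" "\<forall>a. a \<cdot> z \<in> N \<longleftrightarrow> int p ^ k dvd a"
  shows "\<exists>N' w. subgrp N' \<and> V \<subseteq> N' \<and> N' \<subseteq> S \<and> (\<exists>e. \<forall>x\<in>N'. int p ^ e \<cdot> x \<in> V) \<and> w \<in> S \<and>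
    (\<forall>a. a \<cdot> w \<in> N' \<longleftrightarrow> int p ^ Suc k dvd a) \<and> N \<subseteq> N' \<and> int p \<cdot> w - z \<in> N'"
proof -
  have pp: "prime (int p)" using p by simp
  have p0: "int p \<noteq> 0" using prime_gt_0_nat[OF p] by simp
  let ?E = "{h + a \<cdot> z | h a. h \<in> N}"
  have E: "subgrp ?E" by (rule subgrp_adjoin[OF N(1)])
  have NE: "N \<subseteq> ?E"
  proof
    fix h assume "h \<in> N"
    then have "h = h + 0 \<cdot> z \<and> h \<in> N" by (simp add: zmult_0_left)
    then show "h \<in> ?E" by blast
  qed
  have zE: "a \<cdot> z \<in> ?E" for a
  proof -
    have "a \<cdot> z = 0 + a \<cdot> z \<and> 0 \<in> N" using subgrp_0[OF N(1)] by simp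
    then show ?thesis by blast
  qed
  have Eb: "int p ^ (e + k) \<cdot> x \<in> V" if xE: "x \<in> ?E" for x
  proof -
    obtain h a where ha: "x = h + a \<cdot> z" "h \<in> N" using xE by blast
    have "int p ^ k \<cdot> z \<in> N" using z by simp
    then have "int p ^ e \<cdot> int p ^ k \<cdot> z \<in> V" by (rule e[rule_format])
    then have "int p ^ k \<cdot> int p ^ e \<cdot> h + a \<cdot> int p ^ e \<cdot> int p ^ k \<cdot> z \<in> V"
      using e[rule_format, OF ha(2)] by (intro subgrp_add[OF V subgrp_zmult[OF V] subgrp_zmult[OF V]])
    then show ?thesis unfolding ha by (simp add: zm_simps power_add mult_ac)
  qed
  \<comment> \<open>\<open>p ^ (e + k)\<close> kills \<open>N\<close> together with \<open>z\<close>
    modulo \<open>V\<close>; the extra factor \<open>p ^ k\<close> forces \<open>s > k\<close> for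
    the order \<open>p ^ s\<close> of \<open>y\<close> over this group.\<close>
  obtain y where y: "y \<in> S" "int p ^ (e + k + k) \<cdot> y \<notin> V" using unb by blast
  obtain K where "int p ^ K \<cdot> y \<in> V" using tors y by blast
  then have "int p ^ K \<cdot> y \<in> ?E" using N NE by blast
  from prime_power_order[OF p E this]
  obtain s where s: "\<forall>j. j \<cdot> y \<in> ?E \<longleftrightarrow> int p ^ s dvd j" by blast
  have "k < s"
  proof (rule ccontr)
    assume "\<not> k < s"
    then have "int p ^ s dvd int p ^ k" by (simp add: le_imp_power_dvd)
    then have "int p ^ k \<cdot> y \<in> ?E" by (rule s[rule_format, THEN iffD2])
    from Eb[OF this] have "int p ^ (e + k + k) \<cdot> y \<in> V" by (simp add: zm_simps power_add mult_ac)
    then show False using y by simp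
  qed
  have "int p ^ s \<cdot> y \<in> ?E" using s by simp
  then obtain \<nu> r where r: "int p ^ s \<cdot> y = \<nu> + r \<cdot> z" "\<nu> \<in> N" by blast
  \<comment> \<open>The unit \<open>u\<close> turns the coefficient \<open>r\<close> of
    \<open>z\<close> into a power \<open>p ^ a\<close> modulo \<open>p ^ k\<close>;
    \<open>a = k\<close> covers an \<open>r\<close> divisible by \<open>p ^ k\<close>.\<close>
  obtain a u where au: "a \<le> k" "coprime u (int p)" "int p ^ k dvd u * r - int p ^ a"
  proof -
    have "gcd r (int p ^ k) dvd int p ^ k" by simp
    then obtain a where a: "a \<le> k" "gcd r (int p ^ k) = int p ^ a"
      using divides_primepow[of "int p" "gcd r (int p ^ k)" k] pp by auto
    show thesis
    proof (cases "a = k")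
      case True
      then have "int p ^ k dvd r" using a by (metis gcd_dvd1)
      then show thesis using that[of k 1] by simp
    next
      case False
      obtain u v where uv: "u * r + v * int p ^ k = int p ^ a" using bezout_int[of r "int p ^ k"] a by metis
      have "int p ^ a dvd r" using a by (metis gcd_dvd1)
      then obtain r' where r': "r = int p ^ a * r'" by blast
      have "int p ^ k = int p ^ a * int p ^ (k - a)" using a(1) by (simp flip: power_add)
      then have "int p ^ a * (u * r' + v * int p ^ (k - a)) = int p ^ a * 1"
        using uv by (simp add: r' algebra_simps)
      then have 1: "u * r' + v * int p ^ (k - a) = 1" using p0 by simp
      have "coprime u (int p)"
      proof (rule ccontr)
        assume "\<not> coprime u (int p)"
        then have "int p dvd u" using pp by (metis coprime_commute prime_imp_coprime)
        moreover have "int p dvd int p ^ (k - a)" using False a(1) by (intro dvd_power) auto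
        ultimately have "int p dvd 1" unfolding 1[symmetric] by (simp add: dvd_add)
        then show False using pp by (metis not_prime_unit)
      qed
      moreover have "u * r - int p ^ a = int p ^ k * (- v)" using uv by (simp add: algebra_simps)
      ultimately show thesis using that[OF a(1), of u] by (metis dvd_triv_left)
    qed
  qed
  \<comment> \<open>The exponent is chosen so that \<open>p ^ (a + 1) \<cdot> w\<close> is congruent
    to \<open>p ^ a \<cdot> z\<close> modulo \<open>N\<close>; then \<open>p \<cdot> w - z\<close>
    has bounded order over \<open>N\<close>.\<close>
  define w where "w = (int p ^ (s - 1 - a) * u) \<cdot> y"
  have wS: "w \<in> S" unfolding w_def by (rule subgrp_zmult[OF S y(1)])
  have ps: "int p ^ s = int p ^ a * (int p * int p ^ (s - 1 - a))"
    using \<open>k < s\<close> au(1) by (simp flip: power_add power_Suc)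
  have paw: "int p ^ a \<cdot> (int p \<cdot> w - z) \<in> N"
  proof -
    have "(int p ^ a * int p) \<cdot> w = u \<cdot> int p ^ s \<cdot> y" unfolding w_def ps by (simp add: zmult_zmult mult_ac)
    also have "\<dots> = u \<cdot> \<nu> + (u * r) \<cdot> z" unfolding r(1) by (simp add: zm_simps)
    finally have "int p ^ a \<cdot> (int p \<cdot> w - z) = u \<cdot> \<nu> + (u * r - int p ^ a) \<cdot> z"
      by (simp add: zm_simps)
    also have "\<dots> \<in> N" using z(2) au(3) by (intro subgrp_add[OF N(1) subgrp_zmult[OF N(1) r(2)]]) auto
    finally show ?thesis .
  qed
  have wE: "int p ^ Suc a dvd b" if "b \<cdot> w \<in> ?E" for b
  proof -
    have "(b * (int p ^ (s - 1 - a) * u)) \<cdot> y \<in> ?E" using that unfolding w_def by (simp add: zmult_zmult)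
    then have "int p ^ s dvd (b * int p ^ (s - 1 - a)) * u" using s by (simp add: mult_ac)
    moreover have "coprime (int p ^ s) u" using au(2) by (simp add: coprime_commute)
    ultimately have "int p ^ s dvd b * int p ^ (s - 1 - a)" using coprime_dvd_mult_left_iff by blast
    then have "int p ^ Suc a * int p ^ (s - 1 - a) dvd b * int p ^ (s - 1 - a)" unfolding ps by (simp add: mult_ac)
    then show ?thesis using p0 by simp
  qed
  let ?d = "int p \<cdot> w - z"
  let ?N' = "{h + j \<cdot> ?d | h j. h \<in> N}"
  have N': "subgrp ?N'" by (rule subgrp_adjoin[OF N(1)])
  have NN': "N \<subseteq> ?N'"
  proof
    fix h assume "h \<in> N"
    then have "h = h + 0 \<cdot> ?d \<and> h \<in> N" by (simp add: zmult_0_left)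
    then show "h \<in> ?N'" by blast
  qed
  have dN': "?d \<in> ?N'"
  proof -
    have "?d = 0 + 1 \<cdot> ?d \<and> 0 \<in> N" using subgrp_0[OF N(1)] by (simp add: zmult_1)
    then show ?thesis by blast
  qed
  have "?d \<in> S" using wS z(1) S by (simp add: subgrp_diff subgrp_zmult)
  then have N'S: "?N' \<subseteq> S" using N(3) S by (auto intro!: subgrp_add[OF S] subgrp_zmult[OF S])
  have N'b: "int p ^ (e + a) \<cdot> x \<in> V" if xN: "x \<in> ?N'" for x
  proof -
    obtain h j where hj: "x = h + j \<cdot> ?d" "h \<in> N" using xN by blast
    have "int p ^ a \<cdot> int p ^ e \<cdot> h + j \<cdot> int p ^ e \<cdot> int p ^ a \<cdot> ?d \<in> V"
      by (intro subgrp_add[OF V subgrp_zmult[OF V] subgrp_zmult[OF V]] e[rule_format] hj(2) paw)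
    moreover have "int p ^ a \<cdot> int p ^ e \<cdot> h + j \<cdot> int p ^ e \<cdot> int p ^ a \<cdot> ?d = int p ^ (e + a) \<cdot> x"
      unfolding hj(1) by (simp only: zmult_add_right zmult_zmult power_add mult_ac)
    ultimately show ?thesis by simp
  qed
  have ord: "b \<cdot> w \<in> ?N' \<longleftrightarrow> int p ^ Suc k dvd b" for b
  proof
    assume "int p ^ Suc k dvd b"
    moreover have "int p ^ k \<cdot> z \<in> N" using z(2) by simp
    then have "int p ^ k \<cdot> ?d + int p ^ k \<cdot> z \<in> ?N'"
      by (intro subgrp_add[OF N' subgrp_zmult[OF N' dN'] subsetD[OF NN']])
    then have "int p ^ Suc k \<cdot> w \<in> ?N'" by (simp add: zm_simps mult_ac)
    ultimately show "b \<cdot> w \<in> ?N'" using subgrp_zmult_dvd[OF N'] by blast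
  next
    assume "b \<cdot> w \<in> ?N'"
    then obtain h j where hj: "b \<cdot> w = h + j \<cdot> ?d" "h \<in> N" by blast
    have "(b - j * int p) \<cdot> w = h + (- j) \<cdot> z" using hj(1) by (simp add: zm_simps algebra_simps)
    moreover have "h + (- j) \<cdot> z \<in> ?E" using hj(2) by blast
    ultimately have pa: "int p ^ Suc a dvd b - j * int p" using wE by simp
    then have "int p dvd b - j * int p" using dvd_trans[of "int p" "int p ^ Suc a"] by simp
    then have "int p dvd b" using dvd_add[of "int p" "b - j * int p" "j * int p"] by simp
    then obtain b' where b': "b = int p * b'" by blast
    have "int p * int p ^ a dvd int p * (b' - j)" using pa unfolding b' by (simp add: algebra_simps)
    then have "int p ^ a dvd b' - j" using p0 by simp
    then have "(b' - j) \<cdot> ?d \<in> N" using subgrp_zmult_dvd[OF N(1) paw] by blast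
    moreover have "b' \<cdot> z = h - (b' - j) \<cdot> ?d" using hj(1) unfolding b' by (simp add: zm_simps algebra_simps)
    ultimately have "b' \<cdot> z \<in> N" using subgrp_diff[OF N(1) hj(2)] by simp
    then have "int p ^ k dvd b'" using z(2) by blast
    then show "int p ^ Suc k dvd b" unfolding b' by simp
  qed
  show ?thesis
    by (rule exI[of _ ?N'], rule exI[of _ w], intro conjI N' N'S wS NN' dN' allI ord exI[of _ "e + a"] ballI N'b order.trans[OF N(2) NN'])
qed

text \<open>Dependent choice along \<open>prufer_section_step\<close>, then the union of the groups.
  Boundedness of each partial group modulo \<open>V\<close> keeps elements of sufficiently large
  order available at the next step.\<close>

lemma prufer_section:
  assumes p: "prime p" and S: "subgrp S" and V: "subgrp V" "V \<subseteq> S"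
    and unb: "\<forall>k. \<exists>x\<in>S. int p ^ k \<cdot> x \<notin> V" and tors: "\<forall>x\<in>S. \<exists>k. int p ^ k \<cdot> x \<in> V"
  obtains N and z :: "nat \<Rightarrow> 'a::ab_group_add" where "subgrp N" "V \<subseteq> N" "N \<subseteq> S" "\<forall>k. z k \<in> S"
    "\<forall>j k. int p ^ j \<cdot> z (k + j) - z k \<in> N" "\<forall>k a. a \<cdot> z k \<in> N \<longleftrightarrow> int p ^ k dvd a"
proof -
  define P where "P k q \<longleftrightarrow> subgrp (fst q) \<and> V \<subseteq> fst q \<and> fst q \<subseteq> S \<and> (\<exists>e. \<forall>x\<in>fst q. int p ^ e \<cdot> x \<in> V) \<and>
    snd q \<in> S \<and> (\<forall>a. a \<cdot> snd q \<in> fst q \<longleftrightarrow> int p ^ k dvd a)" for k and q :: "'a set \<times> 'a"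
  define Q where "Q (k::nat) q q' \<longleftrightarrow> fst q \<subseteq> fst q' \<and> int p \<cdot> snd q' - snd q \<in> fst q'" for k and q q' :: "'a set \<times> 'a"
  have "\<exists>g. \<forall>k. P k (g k) \<and> Q k (g k) (g (Suc k))"
  proof (rule dependent_nat_choice)
    have "\<exists>e. \<forall>x\<in>V. int p ^ e \<cdot> x \<in> V" using subgrp_zmult[OF V(1)] by blast
    then have "P 0 (V, 0)" unfolding P_def using V subgrp_0[OF S] subgrp_0[OF V(1)] by simp
    then show "\<exists>q. P 0 q" ..
  next
    fix q :: "'a set \<times> 'a" and k assume "P k q"
    then have q: "subgrp (fst q)" "V \<subseteq> fst q" "fst q \<subseteq> S" "snd q \<in> S"
      "\<forall>a. a \<cdot> snd q \<in> fst q \<longleftrightarrow> int p ^ k dvd a" and "\<exists>e. \<forall>x\<in>fst q. int p ^ e \<cdot> x \<in> V"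
      unfolding P_def by blast+
    then obtain e where e: "\<forall>x\<in>fst q. int p ^ e \<cdot> x \<in> V" by blast
    from prufer_section_step[OF p S V(1) unb tors q(1-3) e q(4,5)]
    obtain N' w where *: "subgrp N' \<and> V \<subseteq> N' \<and> N' \<subseteq> S \<and> (\<exists>e. \<forall>x\<in>N'. int p ^ e \<cdot> x \<in> V) \<and> w \<in> S \<and>
      (\<forall>a. a \<cdot> w \<in> N' \<longleftrightarrow> int p ^ Suc k dvd a) \<and> fst q \<subseteq> N' \<and> int p \<cdot> w - snd q \<in> N'"
      by (elim exE)
    have "P (Suc k) (N', w) \<and> Q k q (N', w)" unfolding P_def Q_def using * by simp
    then show "\<exists>q'. P (Suc k) q' \<and> Q k q q'" ..
  qed
  then obtain g where "\<forall>k. P k (g k) \<and> Q k (g k) (g (Suc k))" ..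
  then have g: "\<And>k. P k (g k)" "\<And>k. Q k (g k) (g (Suc k))" by auto
  define M where "M k = fst (g k)" for k
  define z where "z k = snd (g k)" for k
  have M: "subgrp (M k)" "V \<subseteq> M k" "M k \<subseteq> S" "z k \<in> S" "a \<cdot> z k \<in> M k \<longleftrightarrow> int p ^ k dvd a" for k a
    using g(1)[of k] unfolding P_def M_def z_def by simp_all
  have mono: "M k \<subseteq> M l" if "k \<le> l" for k l
  proof (rule lift_Suc_mono_le[of M, OF _ that])
    show "M n \<subseteq> M (Suc n)" for n using g(2)[of n] unfolding Q_def M_def by blast
  qed
  have step: "int p ^ j \<cdot> z (k + j) - z k \<in> M (k + j)" for j k
  proof (induction j)
    case 0 then show ?case using subgrp_0[OF M(1)] by (simp add: zmult_1)
  next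
    case (Suc j)
    have "int p \<cdot> z (Suc (k + j)) - z (k + j) \<in> M (Suc (k + j))" using g(2) by (simp add: Q_def M_def z_def)
    moreover have "int p ^ j \<cdot> z (k + j) - z k \<in> M (Suc (k + j))" using Suc mono[of "k + j" "Suc (k + j)"] by auto
    ultimately have "int p ^ j \<cdot> (int p \<cdot> z (Suc (k + j)) - z (k + j)) + (int p ^ j \<cdot> z (k + j) - z k) \<in> M (Suc (k + j))"
      by (intro subgrp_add[OF M(1)] subgrp_zmult[OF M(1)])
    then show ?case by (simp add: zm_simps mult_ac)
  qed
  let ?N = "\<Union>k. M k"
  have N: "subgrp ?N"
  proof (rule subgrpI)
    show "0 \<in> ?N" using subgrp_0[OF M(1)] by blast
    fix x y assume "x \<in> ?N" "y \<in> ?N"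
    then obtain k l where "x \<in> M k" "y \<in> M l" by blast
    then have "x - y \<in> M (max k l)" using mono[of k "max k l"] mono[of l "max k l"] by (intro subgrp_diff[OF M(1)]) auto
    then show "x - y \<in> ?N" by blast
  qed
  \<comment> \<open>Membership at a later stage \<open>M (k + i)\<close> is tested on
    \<open>z (k + i)\<close>, whose order there is known exactly.\<close>
  have ord: "a \<cdot> z k \<in> ?N \<longleftrightarrow> int p ^ k dvd a" for k a
  proof
    assume "a \<cdot> z k \<in> ?N"
    then obtain i where "a \<cdot> z k \<in> M i" by blast
    then have "a \<cdot> z k \<in> M (k + i)" using mono[of i "k + i"] by auto
    moreover have "a \<cdot> (int p ^ i \<cdot> z (k + i) - z k) \<in> M (k + i)" using step by (intro subgrp_zmult[OF M(1)])
    ultimately have "a \<cdot> (int p ^ i \<cdot> z (k + i) - z k) + a \<cdot> z k \<in> M (k + i)" by (intro subgrp_add[OF M(1)])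
    then have "(a * int p ^ i) \<cdot> z (k + i) \<in> M (k + i)" by (simp add: zm_simps)
    then have "int p ^ k * int p ^ i dvd a * int p ^ i" using M(5) by (simp add: power_add)
    then show "int p ^ k dvd a" using prime_gt_0_nat[OF p] by simp
  next
    assume "int p ^ k dvd a" then show "a \<cdot> z k \<in> ?N" using M(5) by blast
  qed
  have "V \<subseteq> ?N" using M(2)[of 0] by blast
  moreover have "?N \<subseteq> S" using M(3) by blast
  moreover have "\<forall>k. z k \<in> S" using M(4) by simp
  moreover have "\<forall>j k. int p ^ j \<cdot> z (k + j) - z k \<in> ?N"
  proof (intro allI)
    fix j k
    show "int p ^ j \<cdot> z (k + j) - z k \<in> ?N" using step[of j k] by (rule UN_I[OF UNIV_I])
  qed
  moreover have "\<forall>k a. a \<cdot> z k \<in> ?N \<longleftrightarrow> int p ^ k dvd a" using ord by simp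
  ultimately show thesis by (rule that[OF N])
qed

text \<open>The gcd of \<open>b\<close> and \<open>p ^ (i + c)\<close> is \<open>p ^ s\<close> with
  \<open>s < c\<close>, so some multiple of \<open>b\<close> equals \<open>p ^ c\<close> modulo
  \<open>p ^ i\<close>, which kills \<open>y\<close>.\<close>

lemma unit_multiple:
  assumes p: "prime p" and V: "subgrp V" and "\<not> int p ^ c dvd b" and y: "int p ^ i \<cdot> y \<in> V"
  shows "\<exists>u. u \<cdot> b \<cdot> y - int p ^ c \<cdot> y \<in> V"
proof -
  let ?g = "gcd b (int p ^ (i + c))"
  obtain s where s: "?g = int p ^ s" using divides_primepow[of "int p" ?g "i + c"] p by auto
  have "s < c"
  proof (rule ccontr)
    assume "\<not> s < c"
    then have "int p ^ c dvd ?g" unfolding s by (simp add: le_imp_power_dvd)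
    then show False using assms(3) by simp
  qed
  obtain u w where uw: "u * b + w * int p ^ (i + c) = int p ^ s" using bezout_int[of b "int p ^ (i + c)"] s by metis
  let ?q = "int p ^ (c - s)"
  have "int p ^ c = ?q * int p ^ s" using \<open>s < c\<close> by (simp flip: power_add)
  also have "\<dots> = ?q * (u * b + w * int p ^ (i + c))" unfolding uw ..
  finally have "(?q * u) * b - int p ^ c = (- ?q * w * int p ^ c) * int p ^ i" by (simp add: algebra_simps power_add)
  then have "(?q * u) \<cdot> b \<cdot> y - int p ^ c \<cdot> y = (- ?q * w * int p ^ c) \<cdot> int p ^ i \<cdot> y"
    by (simp only: zmult_zmult zm.scale_left_diff_distrib[symmetric])
  also have "\<dots> \<in> V" by (rule subgrp_zmult[OF V y])
  finally show ?thesis by blast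
qed

text \<open>The subgroup \<open>X\<close> generated by \<open>N\<close> and the elements \<open>v\<^sub>k + z\<^sub>k\<close> meets \<open>S\<close> in little more
  than \<open>N\<close>, whereas \<open>X + f X\<close> contains almost all \<open>p\<^sup>c z\<^sub>k\<close>.\<close>
lemma inertial_no_twisted_diagonal:
  fixes v :: "nat \<Rightarrow> 'a::ab_group_add"
  assumes f: "endo f" "inertial f" and p: "prime p" and V: "subgrp V" "V \<subseteq> S" and S: "subgrp S"
    and unb: "\<forall>k. \<exists>x\<in>S. int p ^ k \<cdot> x \<notin> V" and tors: "\<forall>x\<in>S. \<exists>k. int p ^ k \<cdot> x \<in> V"
    and v: "\<forall>j k. int p ^ j \<cdot> v (k + j) - v k \<in> V"
    and indep: "\<And>k a. a \<cdot> v k \<in> S \<Longrightarrow> (int p ^ c * a) \<cdot> v k \<in> V \<and> int p ^ k dvd int p ^ c * a"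
    and twist: "\<And>k s. s \<in> S \<Longrightarrow> \<exists>a b. a \<cdot> (v k + s) + b \<cdot> f (v k + s) - int p ^ c \<cdot> s \<in> V"
  shows False
proof -
  obtain N and z :: "nat \<Rightarrow> 'a" where N: "subgrp N" "V \<subseteq> N" "N \<subseteq> S" and zS: "\<forall>k. z k \<in> S"
    and z: "\<forall>j k. int p ^ j \<cdot> z (k + j) - z k \<in> N" and ord: "\<forall>k a. a \<cdot> z k \<in> N \<longleftrightarrow> int p ^ k dvd a"
    by (rule prufer_section[OF p S V unb tors])
  define y where "y k = v k + z k" for k
  have y: "\<forall>j k. int p ^ j \<cdot> y (k + j) - y k \<in> N"
  proof (intro allI)
    fix j k
    have "(int p ^ j \<cdot> v (k + j) - v k) + (int p ^ j \<cdot> z (k + j) - z k) \<in> N"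
      using v z N(2) by (intro subgrp_add[OF N(1)]) auto
    then show "int p ^ j \<cdot> y (k + j) - y k \<in> N" by (simp add: y_def zm_simps algebra_simps)
  qed
  let ?X = "prufer N y"
  have X: "subgrp ?X" by (rule subgrp_prufer[OF N(1) y])
  let ?Z = "sumset (f ` ?X) ?X"
  have Z: "subgrp ?Z" by (intro subgrp_sumset subgrp_image f X)
  have XZ: "?X \<subseteq> ?Z" "f ` ?X \<subseteq> ?Z"
    using sumset_right[OF subgrp_0[OF subgrp_image[OF f(1) X]]] sumset_left[OF subgrp_0[OF X]] by blast+
  have ZX: "almost ?Z ?X" by (intro almost_sumset_same inertialD f X almost_subset[of ?X ?X] order.refl)
  have pz: "int p ^ c \<cdot> z k \<in> ?Z" for k
  proof -
    have "\<exists>a b. a \<cdot> y k + b \<cdot> f (y k) - int p ^ c \<cdot> z k \<in> V" unfolding y_def by (rule twist) (use zS in simp)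
    then obtain a b where ab: "a \<cdot> y k + b \<cdot> f (y k) - int p ^ c \<cdot> z k \<in> V" by blast
    have "y k \<in> ?X" by (rule prufer_mem[OF N(1)])
    then have "a \<cdot> y k + b \<cdot> f (y k) \<in> ?Z" using XZ by (intro subgrp_add[OF Z] subgrp_zmult[OF Z]) auto
    moreover have "a \<cdot> y k + b \<cdot> f (y k) - int p ^ c \<cdot> z k \<in> ?Z" using ab N(2) prufer_base[OF N(1)] XZ(1) by blast
    ultimately have "(a \<cdot> y k + b \<cdot> f (y k)) - (a \<cdot> y k + b \<cdot> f (y k) - int p ^ c \<cdot> z k) \<in> ?Z" by (rule subgrp_diff[OF Z])
    then show ?thesis by simp
  qed
  \<comment> \<open>Beyond the index \<open>2 * c\<close>, \<open>z k\<close> cannot be killed by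
    \<open>p ^ (2 * c)\<close> modulo \<open>N\<close>, which is what the congruence will
    imply.\<close>
  obtain l k where lk: "2 * c + 1 \<le> l" "l < k" "int p ^ c \<cdot> z k - int p ^ c \<cdot> z l \<in> ?X"
    using almost_pigeonhole[OF X ZX, of "2 * c + 1" "\<lambda>k. int p ^ c \<cdot> z k"] pz by blast
  let ?d = "int p ^ c \<cdot> z k - int p ^ c \<cdot> z l"
  have dS: "?d \<in> S" using zS by (intro subgrp_diff[OF S] subgrp_zmult[OF S]) auto
  obtain i a where ia: "?d - a \<cdot> y i \<in> N" using lk(3) unfolding prufer_def by blast
  have "?d - (?d - a \<cdot> y i) - a \<cdot> z i \<in> S" using ia N(3) zS
    by (intro subgrp_diff[OF S subgrp_diff[OF S dS] subgrp_zmult[OF S]]) auto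
  \<comment> \<open>Since \<open>?d\<close> lies in \<open>S\<close>, so does the
    \<open>v\<close>-component of \<open>a \<cdot> y i\<close>; by \<open>indep\<close> and
    \<open>ord\<close> the factor \<open>p ^ c\<close> then carries both components into
    \<open>N\<close>.\<close>
  then have "a \<cdot> v i \<in> S" by (simp add: y_def zm_simps)
  from indep[OF this] have 1: "(int p ^ c * a) \<cdot> v i \<in> N" "int p ^ i dvd int p ^ c * a" using N(2) by auto
  then have "(int p ^ c * a) \<cdot> v i + (int p ^ c * a) \<cdot> z i \<in> N" using ord by (intro subgrp_add[OF N(1)]) auto
  from subgrp_add[OF N(1) subgrp_zmult[OF N(1) ia, of "int p ^ c"] this]
  have "int p ^ c \<cdot> (?d - a \<cdot> y i) + ((int p ^ c * a) \<cdot> v i + (int p ^ c * a) \<cdot> z i) \<in> N" .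
  then have "int p ^ c \<cdot> ?d \<in> N" by (simp add: y_def zm_simps algebra_simps)
  moreover have "(int p ^ c * int p ^ c) \<cdot> (int p ^ (k - l) \<cdot> z k - z l) \<in> N"
    using z[rule_format, of "k - l" l] lk(2) by (intro subgrp_zmult[OF N(1)]) simp
  ultimately have "int p ^ c \<cdot> ?d - (int p ^ c * int p ^ c) \<cdot> (int p ^ (k - l) \<cdot> z k - z l) \<in> N"
    by (rule subgrp_diff[OF N(1)])
  moreover have "int p ^ c \<cdot> ?d - (int p ^ c * int p ^ c) \<cdot> (int p ^ (k - l) \<cdot> z k - z l)
      = (int p ^ c * int p ^ c) \<cdot> z k - int p ^ (k - l) \<cdot> (int p ^ c * int p ^ c) \<cdot> z k"
    by (simp add: zm_simps mult_ac)
  ultimately have "(int p ^ c * int p ^ c) \<cdot> z k - int p ^ (k - l) \<cdot> (int p ^ c * int p ^ c) \<cdot> z k \<in> N" by simp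
  moreover have "int p ^ k \<cdot> (int p ^ c * int p ^ c) \<cdot> z k \<in> N" using ord by (simp add: zmult_zmult)
  ultimately have "(int p ^ c * int p ^ c) \<cdot> z k \<in> N" using unit_cancel[OF p N(1)] lk(2) by (metis zero_less_diff)
  then have "int p ^ k dvd int p ^ (2 * c)" using ord by (simp add: mult_2 power_add)
  then have "p ^ k dvd p ^ (2 * c)" by (metis of_nat_dvd_iff of_nat_power)
  then have "k \<le> 2 * c" using power_dvd_imp_le[of p k "2 * c"] prime_gt_1_nat[OF p] by simp
  then show False using lk by simp
qed

subsection \<open>Primary components modulo a subgroup\<close>

definition ppart :: "nat \<Rightarrow> 'a::ab_group_add set \<Rightarrow> 'a set" where
  "ppart p V = {x. \<exists>k. int p ^ k \<cdot> x \<in> V}"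

lemma ppart_base: "V \<subseteq> ppart p V"
  unfolding ppart_def by (auto intro!: exI[of _ 0] simp: zmult_1)

lemma subgrp_power_mono: "subgrp V \<Longrightarrow> int p ^ k \<cdot> x \<in> V \<Longrightarrow> k \<le> l \<Longrightarrow> int p ^ l \<cdot> x \<in> V"
  by (rule subgrp_zmult_dvd[OF _ _ le_imp_power_dvd])

lemma subgrp_ppart: assumes V: "subgrp V" shows "subgrp (ppart p V)"
proof (rule subgrpI)
  show "0 \<in> ppart p V" using ppart_base subgrp_0[OF V] by blast
  fix x y assume "x \<in> ppart p V" "y \<in> ppart p V"
  then obtain k l where "int p ^ k \<cdot> x \<in> V" "int p ^ l \<cdot> y \<in> V" by (auto simp: ppart_def)
  then have "int p ^ (k + l) \<cdot> x \<in> V" "int p ^ (k + l) \<cdot> y \<in> V" using subgrp_power_mono[OF V] by auto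
  then have "int p ^ (k + l) \<cdot> (x - y) \<in> V" using subgrp_diff[OF V] by (simp add: zm.scale_right_diff_distrib)
  then show "x - y \<in> ppart p V" unfolding ppart_def by blast
qed

lemma ppart_invariant: "endo f \<Longrightarrow> (\<And>v. v \<in> V \<Longrightarrow> f v \<in> V) \<Longrightarrow> x \<in> ppart p V \<Longrightarrow> f x \<in> ppart p V"
  unfolding ppart_def by (auto simp flip: endo_zmult)

lemma ppart_mono: "V \<subseteq> V' \<Longrightarrow> ppart p V \<subseteq> ppart p V'" unfolding ppart_def by blast

lemma prime_coprime_int: "prime p \<Longrightarrow> \<not> int p dvd a \<Longrightarrow> coprime a (int p ^ k)" for p :: nat
  using prime_imp_coprime[of "int p" a] by (simp add: coprime_commute)

text \<open>If \<open>f\<close> divides \<open>x\<close> by \<open>p\<close>, then \<open>p \<cdot> f - 1\<close> kills all \<open>f\<^sup>k x\<close> and is invertible on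
  \<open>p\<close>-torsion.\<close>
lemma torsion_bounded_if_fractional:
  fixes f :: "'a::ab_group_add \<Rightarrow> 'a"
  assumes f: "endo f" "inertial f" and p: "prime p" and x: "int p \<cdot> f x = x" "\<forall>a. a \<cdot> x = 0 \<longrightarrow> a = 0"
  obtains e where "\<forall>y\<in>ppart p {0::'a}. int p ^ e \<cdot> y = 0"
proof -
  \<comment> \<open>\<open>v k\<close> is a \<open>p ^ k\<close>-th part of \<open>x\<close>; as
    \<open>x\<close> has infinite order, no nonzero multiple of \<open>v k\<close> is
    torsion.\<close>
  define v where "v k = (f ^^ k) x" for k
  have fv: "int p \<cdot> f (v k) = v k" for k
  proof (induction k)
    case (Suc k)
    have "int p \<cdot> f (v (Suc k)) = f (int p \<cdot> f (v k))" by (simp add: v_def endo_zmult[OF f(1)])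
    then show ?case using Suc by (simp add: v_def)
  qed (simp add: v_def x(1))
  have v: "int p ^ j \<cdot> v (k + j) = v k" for j k
  proof (induction j)
    case (Suc j)
    have "int p ^ Suc j \<cdot> v (k + Suc j) = int p ^ j \<cdot> int p \<cdot> f (v (k + j))"
      by (simp add: v_def zmult_zmult mult_ac)
    then show ?case using fv Suc by simp
  qed (simp add: zmult_1)
  have v_free: "a = 0" if av: "a \<cdot> v k \<in> ppart p {0::'a}" for a k
  proof -
    obtain l where "int p ^ l \<cdot> a \<cdot> v k = 0" using av unfolding ppart_def by blast
    then have "(int p ^ l * a) \<cdot> int p ^ k \<cdot> v k = 0"
      by (metis zmult_zmult mult.commute zm.scale_zero_right)
    moreover have "int p ^ k \<cdot> v k = x" using v[of k 0] by (simp add: v_def)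
    ultimately have "(int p ^ l * a) \<cdot> x = 0" by metis
    then have "int p ^ l * a = 0" using x(2) by blast
    then show ?thesis using prime_gt_0_nat[OF p] by simp
  qed
  \<comment> \<open>The diagonal argument with constant \<open>0\<close>: \<open>p f - 1\<close>
    kills \<open>v k\<close> and multiplies \<open>s\<close> by a number prime to
    \<open>p\<close>.\<close>
  have bounded: "\<exists>k. \<forall>y\<in>S. int p ^ k \<cdot> y = 0"
    if S: "subgrp S" "S \<subseteq> ppart p {0::'a}" and pwf: "pw f S {0}" for S
  proof (rule ccontr)
    assume "\<not> ?thesis"
    then have unb: "\<forall>k. \<exists>x\<in>S. int p ^ k \<cdot> x \<notin> {0}" by blast
    show False
    proof (rule inertial_no_twisted_diagonal[OF f p subgrp_zero _ S(1) unb, of v 0])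
      show "{0} \<subseteq> S" using subgrp_0[OF S(1)] by simp
      show "\<forall>x\<in>S. \<exists>k. int p ^ k \<cdot> x \<in> {0}" using S(2) by (auto simp: ppart_def)
      show "\<forall>j k. int p ^ j \<cdot> v (k + j) - v k \<in> {0}" using v by simp
      show "(int p ^ 0 * a) \<cdot> v k \<in> {0} \<and> int p ^ k dvd int p ^ 0 * a" if "a \<cdot> v k \<in> S" for k a
        using v_free[of a k] that S(2) by (auto simp: zmult_0_left)
      show "\<exists>a b. a \<cdot> (v k + s) + b \<cdot> f (v k + s) - int p ^ 0 \<cdot> s \<in> {0}" if s: "s \<in> S" for k s
      proof -
        obtain \<alpha> where \<alpha>: "f s = \<alpha> \<cdot> s" using pwD[OF pwf s] by auto
        obtain i where i: "int p ^ i \<cdot> s \<in> {0}" using s S(2) by (auto simp: ppart_def)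
        have "\<not> int p dvd int p * \<alpha> - 1"
        proof
          assume "int p dvd int p * \<alpha> - 1"
          from dvd_diff[OF dvd_triv_left[of "int p" \<alpha>] this] have "int p dvd 1" by simp
          then show False using prime_gt_1_nat[OF p] by simp
        qed
        then have "coprime (int p * \<alpha> - 1) (int p ^ i)" by (rule prime_coprime_int[OF p])
        then obtain u w where uw: "u * (int p * \<alpha> - 1) + w * int p ^ i = 1" using bezout_coprime by blast
        have "(u * (int p * \<alpha> - 1)) \<cdot> s + (w * int p ^ i) \<cdot> s = s"
          unfolding zmult_add_left[symmetric] uw zmult_1 ..
        moreover have "(w * int p ^ i) \<cdot> s = 0" using i by (metis singletonD zm.scale_zero_right zmult_zmult)
        ultimately have us: "(u * (int p * \<alpha> - 1)) \<cdot> s = s" by simp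
        have "(- u) \<cdot> (v k + s) + (u * int p) \<cdot> f (v k + s) = u \<cdot> (int p \<cdot> f (v k) - v k) + (u * (int p * \<alpha> - 1)) \<cdot> s"
          using f(1) by (simp add: endo_add \<alpha> zm_simps algebra_simps)
        also have "\<dots> = s" unfolding us fv by simp
        finally show ?thesis by (intro exI[of _ "- u"] exI[of _ "u * int p"]) (simp add: zmult_1)
      qed
    qed
  qed
  let ?T = "ppart p {0::'a}"
  have T: "subgrp ?T" by (rule subgrp_ppart[OF subgrp_zero])
  have fT: "f y \<in> ?T" if "y \<in> ?T" for y using ppart_invariant[OF f(1) _ that] endo_0[OF f(1)] by simp
  obtain Y where Y: "subgrp Y" "{0} \<subseteq> Y" "Y \<subseteq> ?T" "pw f Y {0}"
    and soc: "almost {x \<in> ?T. \<exists>q::nat. prime q \<and> int q \<cdot> x \<in> Y} Y"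
  proof (rule inertial_pw_finite_socle[OF f subgrp_zero T ppart_base _ fT])
    show "f x \<in> {0}" if "x \<in> {0}" for x using that endo_0[OF f(1)] by simp
    show "\<exists>n::nat. n \<ge> 1 \<and> int n \<cdot> x \<in> {0}" if xT: "x \<in> ?T" for x
    proof -
      obtain k where "int p ^ k \<cdot> x \<in> {0}" using xT by (auto simp: ppart_def)
      then show ?thesis using prime_gt_0_nat[OF p] by (intro exI[of _ "p ^ k"]) (simp add: Suc_le_eq)
    qed
  qed
  obtain h where h: "\<forall>y\<in>Y. int p ^ h \<cdot> y = 0" using bounded[OF Y(1,3,4)] by blast
  have tors: "\<exists>k. int p ^ k \<cdot> x \<in> Y" if "x \<in> ?T" for x using that Y(2) unfolding ppart_def by blast
  have "almost {x \<in> ?T. int p \<cdot> x \<in> Y} Y" by (rule almost_mono[OF soc]) (use p in auto)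
  from finite_socle_divisible[OF T Y(1,3) tors this]
  obtain e where e: "\<forall>j. \<forall>x\<in>?T. \<exists>y\<in>?T. int p ^ e \<cdot> x - int p ^ (e + j) \<cdot> y \<in> Y" .
  \<comment> \<open>\<open>p ^ e\<close> makes the torsion divisible modulo \<open>Y\<close>, and
    \<open>p ^ h\<close> then kills \<open>Y\<close>. The resulting divisible group falls under
    \<open>bounded\<close> as well, so it is zero.\<close>
  let ?D = "(\<lambda>x. int p ^ (e + h) \<cdot> x) ` ?T"
  have D: "subgrp ?D" by (rule subgrp_zmult_image[OF T])
  have DT: "?D \<subseteq> ?T" using subgrp_zmult[OF T] by auto
  have div: "\<exists>y\<in>?D. int p \<cdot> y - x \<in> {0}" if x: "x \<in> ?D" for x
  proof -
    obtain w where w: "w \<in> ?T" "x = int p ^ (e + h) \<cdot> w" using x by blast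
    obtain w' where w': "w' \<in> ?T" "int p ^ e \<cdot> w - int p ^ (e + 1) \<cdot> w' \<in> Y" using e w(1) by blast
    have "int p ^ h \<cdot> (int p ^ e \<cdot> w - int p ^ (e + 1) \<cdot> w') = 0" using h w' by blast
    then have "int p \<cdot> int p ^ (e + h) \<cdot> w' - x = 0" unfolding w(2) by (simp add: zm_simps power_add mult_ac)
    then show ?thesis using w'(1) by blast
  qed
  have pwD: "pw f ?D {0}"
  proof (rule inertial_pw_divisible[OF f p subgrp_zero D])
    show "{0} \<subseteq> ?D" using subgrp_0[OF D] by simp
    show "f x \<in> {0}" if "x \<in> {0}" for x using that endo_0[OF f(1)] by simp
    show "\<forall>x\<in>?D. \<exists>k. int p ^ k \<cdot> x \<in> {0}"
    proof
      fix x assume "x \<in> ?D"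
      from subsetD[OF DT this] show "\<exists>k. int p ^ k \<cdot> x \<in> {0}" unfolding ppart_def by blast
    qed
  qed (use div in blast)
  obtain m where m: "\<forall>y\<in>?D. int p ^ m \<cdot> y = 0" using bounded[OF D DT pwD] by blast
  have "int p ^ (e + h) \<cdot> y = 0" if y: "y \<in> ?T" for y
  proof -
    have yD: "int p ^ (e + h) \<cdot> y \<in> ?D" using y by blast
    obtain z where z: "z 0 = int p ^ (e + h) \<cdot> y" "\<forall>k::nat. z k \<in> ?D" "\<forall>j k. int p ^ j \<cdot> z (k + j) - z k \<in> {0}"
      by (rule divisible_sequence[OF subgrp_zero div yD])
    have "int p ^ m \<cdot> z m = 0" using m z(2) by blast
    then show ?thesis using z(3)[rule_format, of m 0] z(1) by simp
  qed
  then show thesis using that by blast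
qed

text \<open>If \<open>p x\<close> lies in \<open>Y0\<close> but \<open>x\<close> does not,
  maximality yields an element of \<open>E\<close> involving \<open>x\<close> with a coefficient
  prime to \<open>p\<close>; so the socle lies in \<open>E + Y0\<close>.\<close>

lemma almost_socle_sumset:
  assumes p: "prime p" and Y0: "subgrp Y0" "V \<subseteq> Y0" and E: "almost E V" and Y: "subgrp Y" "Y0 \<subseteq> Y"
    and EV: "Y0 \<inter> E \<subseteq> V" and Eg: "subgrp E"
    and max: "\<forall>x\<in>Y. x \<notin> Y0 \<longrightarrow> (\<exists>h\<in>Y0. \<exists>a. h + a \<cdot> x \<in> E \<and> h + a \<cdot> x \<notin> V)"
  shows "almost {x \<in> Y. int p \<cdot> x \<in> Y0} Y0"
proof -
  let ?S = "sumset E Y0"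
  have S: "subgrp ?S" by (rule subgrp_sumset[OF Eg Y0(1)])
  have sub: "E \<subseteq> ?S" "Y0 \<subseteq> ?S" using sumset_left[OF subgrp_0[OF Y0(1)]] sumset_right[OF subgrp_0[OF Eg]] by blast+
  have "{x \<in> Y. int p \<cdot> x \<in> Y0} \<subseteq> ?S"
  proof clarify
    fix x assume x: "x \<in> Y" "int p \<cdot> x \<in> Y0"
    show "x \<in> ?S"
    proof (cases "x \<in> Y0")
      case False
      then obtain h a where ha: "h \<in> Y0" "h + a \<cdot> x \<in> E" "h + a \<cdot> x \<notin> V" using max x by blast
      have "\<not> int p dvd a"
      proof
        assume "int p dvd a"
        then have "a \<cdot> x \<in> Y0" using subgrp_zmult_dvd[OF Y0(1) x(2)] by blast
        then show False using ha EV subgrp_add[OF Y0(1) ha(1)] by blast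
      qed
      then have "coprime a (int p)" using prime_coprime_int[OF p, of a 1] by simp
      moreover have "a \<cdot> x \<in> ?S" using subgrp_diff[OF S, of "h + a \<cdot> x" h] ha sub by auto
      ultimately show ?thesis using subgrp_coprime[OF S, of a x "int p"] x(2) sub by blast
    qed (use sub in blast)
  qed
  moreover have "almost ?S Y0"
    using almost_mono[OF E order.refl Y0(2)] by (intro almost_sumset_same Y0 almost_subset[of Y0 Y0] order.refl)
  ultimately show ?thesis by (meson almost_mono order.refl)
qed

text \<open>\<open>p ^ e\<close> makes the component divisible modulo \<open>Y\<close> and
  \<open>p ^ h\<close> moves \<open>Y\<close> into \<open>V\<close>; so multiplication by
  \<open>p ^ (e + h)\<close> yields a divisible \<open>D\<close>, on which inertial maps act by
  multiplications. \<open>Y0\<close> is maximal in \<open>Y\<close> avoiding the socle of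
  \<open>D\<close>; as \<open>Y / Y0\<close> is bounded with finite socle, it is finite.\<close>

lemma primary_structure_bounded:
  fixes f :: "'i \<Rightarrow> 'a::ab_group_add \<Rightarrow> 'a"
  assumes f: "\<And>i. i \<in> I \<Longrightarrow> endo (f i)" "\<And>i. i \<in> I \<Longrightarrow> inertial (f i)" and p: "prime p"
    and V: "subgrp V" and fV: "\<And>i v. i \<in> I \<Longrightarrow> v \<in> V \<Longrightarrow> f i v \<in> V"
    and Y: "subgrp Y" "V \<subseteq> Y" "Y \<subseteq> ppart p V"
    and soc: "almost {x \<in> ppart p V. int p \<cdot> x \<in> Y} Y" and bd: "\<forall>y\<in>Y. int p ^ h \<cdot> y \<in> V"
  obtains D Y0 where "subgrp D" "V \<subseteq> D" "D \<subseteq> ppart p V" "subgrp Y0" "V \<subseteq> Y0" "Y0 \<subseteq> Y"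
    "Y0 \<inter> D \<subseteq> V" "almost (ppart p V) (sumset D Y0)" "\<forall>x\<in>D. \<exists>y\<in>D. int p \<cdot> y - x \<in> V"
    "almost {x \<in> D. int p \<cdot> x \<in> V} V" "\<forall>i\<in>I. pw (f i) D V"
proof -
  let ?W = "ppart p V"
  have W: "subgrp ?W" by (rule subgrp_ppart[OF V])
  have tors: "\<exists>k. int p ^ k \<cdot> x \<in> Y" if "x \<in> ?W" for x using that Y(2) by (auto simp: ppart_def)
  obtain e where e: "\<forall>j. \<forall>x\<in>?W. \<exists>y\<in>?W. int p ^ e \<cdot> x - int p ^ (e + j) \<cdot> y \<in> Y"
    "almost ?W (sumset ((\<lambda>x. int p ^ e \<cdot> x) ` ?W) Y)"
    by (rule finite_socle_divisible[OF W Y(1,3) tors soc])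
  let ?M = "(\<lambda>x. int p ^ (e + h) \<cdot> x) ` ?W"
  let ?D = "sumset ?M V"
  have M: "subgrp ?M" by (rule subgrp_zmult_image[OF W])
  have D: "subgrp ?D" by (rule subgrp_sumset[OF M V])
  have VD: "V \<subseteq> ?D" by (rule sumset_right[OF subgrp_0[OF M]])
  have MD: "?M \<subseteq> ?D" by (rule sumset_left[OF subgrp_0[OF V]])
  have DW: "?D \<subseteq> ?W" using ppart_base[of V p] subgrp_zmult[OF W] by (intro sumset_subset[OF W]) auto
  have div: "\<forall>x\<in>?D. \<exists>y\<in>?D. int p \<cdot> y - x \<in> V"
  proof
    fix x assume "x \<in> ?D"
    then obtain w v where w: "w \<in> ?W" "v \<in> V" "x = int p ^ (e + h) \<cdot> w + v" by (auto elim!: sumsetE)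
    obtain w' where w': "w' \<in> ?W" "int p ^ e \<cdot> w - int p ^ (e + 1) \<cdot> w' \<in> Y" using e(1) w(1) by blast
    have "int p ^ h \<cdot> (int p ^ e \<cdot> w - int p ^ (e + 1) \<cdot> w') \<in> V" using bd w' by blast
    then have "- (int p ^ h \<cdot> (int p ^ e \<cdot> w - int p ^ (e + 1) \<cdot> w')) - v \<in> V"
      using w(2) by (intro subgrp_diff[OF V] subgrp_uminus[OF V])
    then have "int p \<cdot> int p ^ (e + h) \<cdot> w' - x \<in> V" unfolding w(3) by (simp add: zm_simps power_add mult_ac diff_diff_eq)
    then show "\<exists>y\<in>?D. int p \<cdot> y - x \<in> V" using w'(1) MD by blast
  qed
  have pwD: "\<forall>i\<in>I. pw (f i) ?D V"
    using DW by (intro ballI inertial_pw_divisible[OF f p V D VD] fV div) (auto simp: ppart_def)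
  have Dtors: "\<exists>k. int p ^ k \<cdot> x \<in> V" if "x \<in> ?D" for x using that DW by (auto simp: ppart_def)
  define E where "E = {x \<in> ?D. int p \<cdot> x \<in> V}"
  have E: "subgrp E" unfolding E_def
    by (rule subgrpI) (use D V in \<open>auto simp: zm.scale_right_diff_distrib subgrp_0 subgrp_diff\<close>)
  have EV: "almost E V"
  proof -
    \<comment> \<open>A socle element of \<open>?D\<close> is, up to \<open>V\<close>,
      \<open>p ^ h\<close> times an element of level \<open>h + 1\<close> over \<open>Y\<close>;
      this level is finite modulo \<open>Y\<close>, and \<open>p ^ h Y\<close> lies in
      \<open>V\<close>.\<close>
    let ?L = "{x \<in> ?W. int p ^ (Suc h) \<cdot> x \<in> Y}" and ?g = "\<lambda>x. int p ^ h \<cdot> x"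
    have "almost (?g ` ?L) (?g ` Y)"
      by (intro almost_image endo_zmult_const almost_torsion_level[OF W Y(1) soc])
    then have "almost (?g ` ?L) V" by (rule almost_mono) (use bd in auto)
    then have "almost (sumset (?g ` ?L) V) V" by (intro almost_sumset_same V almost_subset[of V V] order.refl)
    moreover have "E \<subseteq> sumset (?g ` ?L) V"
    proof
      fix x assume x: "x \<in> E"
      then have xD: "x \<in> ?D" by (simp add: E_def)
      obtain z where z: "z 0 = x" "\<forall>k::nat. z k \<in> ?D" "\<forall>j k. int p ^ j \<cdot> z (k + j) - z k \<in> V"
        by (rule divisible_sequence[OF V bspec[OF div] xD])
      have d: "int p ^ h \<cdot> z h - x \<in> V" using z(3)[rule_format, of h 0] z(1) by simp
      have "int p \<cdot> (int p ^ h \<cdot> z h - x) + int p \<cdot> x \<in> V"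
        using x by (intro subgrp_add[OF V subgrp_zmult[OF V d]]) (simp add: E_def)
      then have "int p ^ Suc h \<cdot> z h \<in> Y" using Y(2) by (auto simp: zm_simps mult_ac)
      then have "int p ^ h \<cdot> z h \<in> ?g ` ?L" using z(2) DW by blast
      moreover have "- (int p ^ h \<cdot> z h - x) \<in> V" by (rule subgrp_uminus[OF V d])
      ultimately have "int p ^ h \<cdot> z h + - (int p ^ h \<cdot> z h - x) \<in> sumset (?g ` ?L) V" by (rule sumsetI)
      then show "x \<in> sumset (?g ` ?L) V" by simp
    qed
    ultimately show ?thesis by (meson almost_mono order.refl)
  qed
  obtain Y0 where Y0: "subgrp Y0" "V \<subseteq> Y0" "Y0 \<subseteq> Y" "Y0 \<inter> E \<subseteq> V"
    and max: "\<forall>x\<in>Y. x \<notin> Y0 \<longrightarrow> (\<exists>h\<in>Y0. \<exists>a. h + a \<cdot> x \<in> E \<and> h + a \<cdot> x \<notin> V)"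
    by (rule maximal_avoiding[OF V Y(1,2)])
  have soc0: "almost {x \<in> Y. int p \<cdot> x \<in> Y0} Y0"
    by (rule almost_socle_sumset[OF p Y0(1,2) EV Y(1) Y0(3,4) E max])
  have tors0: "\<exists>k. int p ^ k \<cdot> x \<in> Y0" if "x \<in> Y" for x using that bd Y0(2) by blast
  obtain e' where e': "\<forall>j. \<forall>x\<in>Y. \<exists>y\<in>Y. int p ^ e' \<cdot> x - int p ^ (e' + j) \<cdot> y \<in> Y0"
    "almost Y (sumset ((\<lambda>x. int p ^ e' \<cdot> x) ` Y) Y0)"
    by (rule finite_socle_divisible[OF Y(1) Y0(1,3) tors0 soc0])
  \<comment> \<open>This multiple is divisible modulo \<open>Y0\<close> and \<open>p ^ h\<close>
    maps \<open>Y\<close> into \<open>Y0\<close>, so nothing survives.\<close>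
  have "(\<lambda>x. int p ^ e' \<cdot> x) ` Y \<subseteq> Y0"
  proof clarify
    fix x assume "x \<in> Y"
    then obtain y where y: "y \<in> Y" "int p ^ e' \<cdot> x - int p ^ (e' + h) \<cdot> y \<in> Y0" using e'(1) by blast
    have "int p ^ (e' + h) \<cdot> y \<in> Y0"
      using subgrp_power_mono[OF V, of p h y "e' + h"] bd y(1) Y0(2) by auto
    then show "int p ^ e' \<cdot> x \<in> Y0" using y(2) subgrp_diff_cancel[OF Y0(1)] by blast
  qed
  then have YY0: "almost Y Y0"
    using almost_mono[OF e'(2) order.refl sumset_subset[OF Y0(1)]] by blast
  have "sumset ((\<lambda>x. int p ^ e \<cdot> x) ` ?W) Y \<subseteq> sumset ?D Y"
  proof
    fix x assume "x \<in> sumset ((\<lambda>x. int p ^ e \<cdot> x) ` ?W) Y"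
    then obtain w y where w: "w \<in> ?W" "y \<in> Y" "x = int p ^ e \<cdot> w + y" by (auto elim!: sumsetE)
    obtain w' where w': "w' \<in> ?W" "int p ^ e \<cdot> w - int p ^ (e + h) \<cdot> w' \<in> Y" using e(1) w(1) by blast
    have "int p ^ (e + h) \<cdot> w' + ((int p ^ e \<cdot> w - int p ^ (e + h) \<cdot> w') + y) \<in> sumset ?D Y"
      using w'(1) MD by (intro sumsetI subgrp_add[OF Y(1) w'(2) w(2)]) blast
    then show "x \<in> sumset ?D Y" unfolding w(3) by simp
  qed
  then have "almost ?W (sumset ?D Y)" by (rule almost_mono[OF e(2) order.refl])
  moreover have "almost (sumset ?D Y) (sumset ?D Y0)"
    by (intro almost_sumset YY0 almost_subset[of ?D ?D] order.refl)
  ultimately have WD: "almost ?W (sumset ?D Y0)" by (rule almost_trans)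
  \<comment> \<open>An element of \<open>Y0 \<inter> ?D\<close> outside \<open>V\<close> would have
    a multiple outside \<open>V\<close> in the socle of \<open>?D\<close>.\<close>
  have "x \<in> V" if "x \<in> Y0" "x \<in> ?D" "int p ^ k \<cdot> x \<in> V" for x k
    using that
  proof (induction k arbitrary: x)
    case 0 then show ?case by (simp add: zmult_1)
  next
    case (Suc k)
    have "int p ^ k \<cdot> int p \<cdot> x \<in> V" using Suc.prems(3) by (simp add: zmult_zmult mult_ac)
    then have "int p \<cdot> x \<in> V"
      by (rule Suc.IH[OF subgrp_zmult[OF Y0(1) Suc.prems(1)] subgrp_zmult[OF D Suc.prems(2)]])
    then have "x \<in> E" using Suc.prems by (simp add: E_def)
    then show ?case using Suc.prems Y0(4) by blast
  qed
  then have "Y0 \<inter> ?D \<subseteq> V" using Dtors by blast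
  then show thesis using that[OF D VD DW Y0(1-3) _ WD div _ pwD] EV unfolding E_def by blast
qed

text \<open>Here \<open>f x - \<alpha>\<^sub>k x\<close>, for \<open>p\<^sup>k x \<in> V\<close>, is the value at \<open>x\<close> of \<open>f - \<alpha>\<close> modulo \<open>V\<close>, where the
  \<open>p\<close>-adic integer \<open>\<alpha>\<close> describes the action of \<open>f\<close> on \<open>Y\<close>. Its image \<open>J\<close> is divisible.\<close>
lemma primary_pw_unbounded:
  assumes f: "endo f" "inertial f" and p: "prime p" and V: "subgrp V" and fV: "\<And>v. v \<in> V \<Longrightarrow> f v \<in> V"
    and Y: "subgrp Y" "V \<subseteq> Y" "pw f Y V" and unb: "\<forall>k. \<exists>y\<in>Y. int p ^ k \<cdot> y \<notin> V"
    and Z: "subgrp Z" "Y \<subseteq> Z" "Z \<subseteq> ppart p V" and Zdiv: "\<forall>x\<in>Z. \<exists>y\<in>Z. x - int p \<cdot> y \<in> Y"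
    and We: "\<forall>x\<in>ppart p V. int p ^ e \<cdot> x \<in> Z"
  shows "pw f Z V"
proof -
  obtain \<alpha> where "\<forall>k. int p ^ k dvd \<alpha> (Suc k) - \<alpha> k"
    "\<forall>k. \<forall>x\<in>Y. int p ^ k \<cdot> x \<in> V \<longrightarrow> f x - \<alpha> k \<cdot> x \<in> V"
    by (rule pw_padic[OF p f(1) Y(1) V Y(3)])
  then have \<alpha>: "\<And>k. int p ^ k dvd \<alpha> (Suc k) - \<alpha> k"
    "\<And>k x. x \<in> Y \<Longrightarrow> int p ^ k \<cdot> x \<in> V \<Longrightarrow> f x - \<alpha> k \<cdot> x \<in> V"
    by simp_all
  define c where "c k x = f x - \<alpha> k \<cdot> x" for k x
  have c_add: "c k (x + y) = c k x + c k y" and c_diff: "c k (x - y) = c k x - c k y"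
    and c_zmult: "c k (a \<cdot> x) = a \<cdot> c k x" for k x y a
    using f(1) by (simp_all add: c_def endo_simps zm_simps mult_ac)
  \<comment> \<open>Modulo \<open>V\<close> the value \<open>c k x\<close> is the same for all
    \<open>k\<close> with \<open>p ^ k \<cdot> x \<in> V\<close>; so \<open>J\<close> below is the
    image of a well-defined additive map.\<close>
  have cc: "c k x - c l x \<in> V" if "int p ^ k \<cdot> x \<in> V" "k \<le> l" for k l x
  proof -
    have "(\<alpha> l - \<alpha> k) \<cdot> x \<in> V" using subgrp_zmult_dvd[OF V that(1)] padic_mono[of p \<alpha>, OF \<alpha>(1) that(2)] by blast
    then show ?thesis by (simp add: c_def zm_simps)
  qed
  have cV: "c k v \<in> V" if "v \<in> V" for k v unfolding c_def using that by (intro subgrp_diff[OF V] subgrp_zmult[OF V] fV)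
  have cY: "c k y \<in> V" if "y \<in> Y" "int p ^ k \<cdot> y \<in> V" for k y using \<alpha>(2)[OF that] by (simp add: c_def)
  have tors: "\<exists>k. int p ^ k \<cdot> x \<in> V" if "x \<in> Z" for x using that Z(3) by (auto simp: ppart_def)
  define J where "J = {w. \<exists>x\<in>Z. \<exists>k. int p ^ k \<cdot> x \<in> V \<and> w - c k x \<in> V}"
  have JI: "w \<in> J" if "x \<in> Z" "int p ^ k \<cdot> x \<in> V" "w - c k x \<in> V" for w x k using that unfolding J_def by blast
  have J: "subgrp J"
  proof (rule subgrpI)
    show "0 \<in> J" by (rule JI[of 0 0]) (use subgrp_0[OF Z(1)] subgrp_0[OF V] cV in \<open>auto intro: subgrp_uminus[OF V]\<close>)
    fix w w' assume "w \<in> J" "w' \<in> J"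
    then obtain x k x' k' where *: "x \<in> Z" "int p ^ k \<cdot> x \<in> V" "w - c k x \<in> V"
      "x' \<in> Z" "int p ^ k' \<cdot> x' \<in> V" "w' - c k' x' \<in> V" unfolding J_def by blast
    let ?K = "k + k'"
    have "int p ^ ?K \<cdot> x \<in> V" "int p ^ ?K \<cdot> x' \<in> V" using subgrp_power_mono[OF V] * by auto
    from subgrp_diff[OF V this] have "int p ^ ?K \<cdot> (x - x') \<in> V" by (simp add: zm.scale_right_diff_distrib)
    moreover have "(w - c k x) + (c k x - c ?K x) - ((w' - c k' x') + (c k' x' - c ?K x')) \<in> V"
      by (intro subgrp_diff[OF V subgrp_add[OF V] subgrp_add[OF V]] * cc) auto
    then have "(w - w') - c ?K (x - x') \<in> V" by (simp add: c_diff algebra_simps)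
    ultimately show "w - w' \<in> J" by (rule JI[OF subgrp_diff[OF Z(1) *(1,4)]])
  qed
  have VJ: "V \<subseteq> J"
  proof
    fix v assume "v \<in> V"
    then have "v - c 0 0 \<in> V" using cV[of 0 0] subgrp_0[OF V] by (intro subgrp_diff[OF V])
    then show "v \<in> J" by (intro JI[of 0 0]) (use subgrp_0[OF Z(1)] subgrp_0[OF V] in auto)
  qed
  have JW: "J \<subseteq> ppart p V"
  proof
    fix w assume "w \<in> J"
    then obtain x k where *: "x \<in> Z" "int p ^ k \<cdot> x \<in> V" "w - c k x \<in> V" unfolding J_def by blast
    have "int p ^ k \<cdot> (w - c k x) + c k (int p ^ k \<cdot> x) \<in> V" by (intro subgrp_add[OF V subgrp_zmult[OF V]] cV *)
    then have "int p ^ k \<cdot> w \<in> V" by (simp add: c_zmult zm.scale_right_diff_distrib)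
    then show "w \<in> ppart p V" unfolding ppart_def by blast
  qed
  have Jtors: "\<exists>k. int p ^ k \<cdot> x \<in> V" if "x \<in> J" for x using that JW by (auto simp: ppart_def)
  \<comment> \<open>\<open>Z\<close> is contained in \<open>Y + p Z\<close>, and \<open>c\<close>
    vanishes on \<open>Y\<close> modulo \<open>V\<close>.\<close>
  have Jdiv: "\<forall>w\<in>J. \<exists>y\<in>J. int p \<cdot> y - w \<in> V"
  proof
    fix w assume "w \<in> J"
    then obtain x k where *: "x \<in> Z" "int p ^ k \<cdot> x \<in> V" "w - c k x \<in> V" unfolding J_def by blast
    obtain x' where x': "x' \<in> Z" "x - int p \<cdot> x' \<in> Y" using Zdiv *(1) by blast
    obtain l where l: "int p ^ l \<cdot> x' \<in> V" using tors x' by blast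
    let ?K = "k + l"
    have K: "int p ^ ?K \<cdot> x \<in> V" "int p ^ ?K \<cdot> x' \<in> V" using subgrp_power_mono[OF V] * l by auto
    have "int p ^ ?K \<cdot> x - int p \<cdot> int p ^ ?K \<cdot> x' \<in> V" by (intro subgrp_diff[OF V] subgrp_zmult[OF V K(2)] K(1))
    then have "int p ^ ?K \<cdot> (x - int p \<cdot> x') \<in> V" by (simp add: zm_simps mult_ac)
    then have 1: "c ?K (x - int p \<cdot> x') \<in> V" by (rule cY[OF x'(2)])
    have "c ?K x' \<in> J" using x'(1) K(2) subgrp_0[OF V] by (intro JI) auto
    moreover have "- c ?K (x - int p \<cdot> x') - (c k x - c ?K x) - (w - c k x) \<in> V"
      by (intro subgrp_diff[OF V subgrp_diff[OF V subgrp_uminus[OF V 1] cc[OF *(2)]] *(3)]) simp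
    then have "- c ?K (x - int p \<cdot> x') - (c k x - c ?K x) - (w - c k x) \<in> V" .
    then have "int p \<cdot> c ?K x' - w \<in> V" by (simp add: c_diff c_zmult)
    ultimately show "\<exists>y\<in>J. int p \<cdot> y - w \<in> V" by blast
  qed
  \<comment> \<open>By divisibility \<open>w\<close> is \<open>p ^ e\<close> times an element of the
    component, up to \<open>V\<close>, and \<open>p ^ e\<close> maps the component into
    \<open>Z\<close>.\<close>
  have JZ: "J \<subseteq> Z"
  proof
    fix w assume w: "w \<in> J"
    obtain z where z: "z 0 = w" "\<forall>k::nat. z k \<in> J" "\<forall>j k. int p ^ j \<cdot> z (k + j) - z k \<in> V"
      by (rule divisible_sequence[OF V bspec[OF Jdiv] w])
    have "int p ^ e \<cdot> z e \<in> Z" using We z(2) JW by blast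
    moreover have "int p ^ e \<cdot> z e - w \<in> Z" using z(3)[rule_format, of e 0] z(1) Y(2) Z(2) by auto
    ultimately have "int p ^ e \<cdot> z e - (int p ^ e \<cdot> z e - w) \<in> Z" by (rule subgrp_diff[OF Z(1)])
    then show "w \<in> Z" by simp
  qed
  have pwJ: "pw f J V" by (rule inertial_pw_divisible[OF f p V J VJ fV Jdiv]) (use Jtors in simp_all)
  obtain \<delta> where "\<forall>k. int p ^ k dvd \<delta> (Suc k) - \<delta> k"
    "\<forall>k. \<forall>x\<in>J. int p ^ k \<cdot> x \<in> V \<longrightarrow> f x - \<delta> k \<cdot> x \<in> V"
    by (rule pw_padic[OF p f(1) J V pwJ])
  then have \<delta>: "\<And>k. int p ^ k dvd \<delta> (Suc k) - \<delta> k"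
    "\<And>k x. x \<in> J \<Longrightarrow> int p ^ k \<cdot> x \<in> V \<Longrightarrow> f x - \<delta> k \<cdot> x \<in> V"
    by simp_all
  \<comment> \<open>\<open>f\<close> acts on \<open>J\<close> with coefficients
    \<open>\<delta>\<close>. If these disagree with \<open>\<alpha>\<close> on some
    \<open>d\<close>, the chain of \<open>p\<close>-th parts of \<open>d\<close> and the unbounded
    section \<open>Y / V\<close> contradict \<open>inertial_no_twisted_diagonal\<close>; so
    \<open>f - \<alpha>\<close> kills \<open>J\<close> modulo \<open>V\<close>.\<close>
  have triv: "\<forall>d\<in>J. \<forall>k. int p ^ k \<cdot> d \<in> V \<longrightarrow> c k d \<in> V"
  proof (intro ballI allI impI, rule ccontr)
    fix d k0 assume d: "d \<in> J" "int p ^ k0 \<cdot> d \<in> V" and nc: "c k0 d \<notin> V"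
    have nd: "\<not> int p ^ k0 dvd \<alpha> K - \<delta> K" if "K \<ge> k0" for K
    proof
      assume dv: "int p ^ k0 dvd \<alpha> K - \<delta> K"
      have "int p ^ k0 dvd (\<alpha> K - \<alpha> k0) - (\<delta> K - \<delta> k0)"
        by (intro dvd_diff padic_mono[of p \<alpha>, OF \<alpha>(1) that] padic_mono[of p \<delta>, OF \<delta>(1) that])
      from dvd_diff[OF dv this] have "int p ^ k0 dvd \<alpha> k0 - \<delta> k0" by simp
      then have "(\<alpha> k0 - \<delta> k0) \<cdot> d \<in> V" using subgrp_zmult_dvd[OF V d(2)] by blast
      from subgrp_diff[OF V \<delta>(2)[OF d] this] have "c k0 d \<in> V" by (simp add: c_def zm_simps)
      then show False using nc by simp
    qed
    \<comment> \<open>On \<open>p\<close>-power torsion modulo \<open>V\<close>,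
      \<open>p ^ k0\<close> is a multiple of the difference of the two coefficients; this is where
      the constant \<open>k0\<close> of the diagonal argument comes from.\<close>
    have um: "\<exists>u. u \<cdot> (\<alpha> K - \<delta> K) \<cdot> y - int p ^ k0 \<cdot> y \<in> V" if "K \<ge> k0" "int p ^ i \<cdot> y \<in> V" for K i y
      by (rule unit_multiple[OF p V nd[OF that(1)] that(2)])
    have "d \<notin> V" using nc cV by blast
    obtain v where v: "v 0 = d" "\<forall>k::nat. v k \<in> J" "\<forall>j k. int p ^ j \<cdot> v (k + j) - v k \<in> V"
      by (rule divisible_sequence[OF V bspec[OF Jdiv] d(1)])
    have Ytors: "\<forall>x\<in>Y. \<exists>k. int p ^ k \<cdot> x \<in> V" using tors Z(2) by blast
    show False
    proof (rule inertial_no_twisted_diagonal[OF f p V Y(2) Y(1) unb Ytors v(3), of k0])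
      fix k a assume aY: "a \<cdot> v k \<in> Y"
      have aJ: "a \<cdot> v k \<in> J" using v(2) subgrp_zmult[OF J] by blast
      obtain i where i: "int p ^ i \<cdot> a \<cdot> v k \<in> V" using Jtors[OF aJ] by blast
      let ?K = "i + k0"
      have K: "int p ^ ?K \<cdot> a \<cdot> v k \<in> V" using subgrp_power_mono[OF V i] by simp
      from subgrp_diff[OF V \<delta>(2)[OF aJ K] \<alpha>(2)[OF aY K]]
      have "(\<alpha> ?K - \<delta> ?K) \<cdot> a \<cdot> v k \<in> V" by (simp add: zm.scale_left_diff_distrib left_diff_distrib)
      moreover obtain u where "u \<cdot> (\<alpha> ?K - \<delta> ?K) \<cdot> a \<cdot> v k - int p ^ k0 \<cdot> a \<cdot> v k \<in> V"
        using um[OF _ i, of ?K] by auto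
      ultimately have "u \<cdot> (\<alpha> ?K - \<delta> ?K) \<cdot> a \<cdot> v k - (u \<cdot> (\<alpha> ?K - \<delta> ?K) \<cdot> a \<cdot> v k - int p ^ k0 \<cdot> a \<cdot> v k) \<in> V"
        using subgrp_diff[OF V subgrp_zmult[OF V]] by blast
      then have pk: "(int p ^ k0 * a) \<cdot> v k \<in> V" by (simp add: zmult_zmult)
      obtain l where "int p ^ l \<cdot> v k \<in> V" using Jtors v(2) by blast
      then obtain q where q: "\<forall>j. j \<cdot> v k \<in> V \<longleftrightarrow> int p ^ q dvd j" using prime_power_order[OF p V] by blast
      have "int p ^ k \<cdot> v k \<notin> V"
      proof
        assume "int p ^ k \<cdot> v k \<in> V"
        moreover have "int p ^ k \<cdot> v k - d \<in> V" using v(3)[rule_format, of k 0] v(1) by simp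
        ultimately have "int p ^ k \<cdot> v k - (int p ^ k \<cdot> v k - d) \<in> V" by (rule subgrp_diff[OF V])
        then show False using \<open>d \<notin> V\<close> by simp
      qed
      then have "\<not> q \<le> k" using q le_imp_power_dvd by blast
      then have "int p ^ k dvd int p ^ q" by (simp add: le_imp_power_dvd)
      then show "(int p ^ k0 * a) \<cdot> v k \<in> V \<and> int p ^ k dvd int p ^ k0 * a" using pk q dvd_trans by blast
    next
      fix k s assume s: "s \<in> Y"
      obtain i where i: "int p ^ i \<cdot> s \<in> V" using Ytors s by blast
      obtain l where l: "int p ^ l \<cdot> v k \<in> V" using Jtors v(2) by blast
      let ?K = "i + l + k0"
      have K: "int p ^ ?K \<cdot> s \<in> V" "int p ^ ?K \<cdot> v k \<in> V"
        using subgrp_power_mono[OF V i] subgrp_power_mono[OF V l] by auto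
      obtain u where u: "u \<cdot> (\<alpha> ?K - \<delta> ?K) \<cdot> s - int p ^ k0 \<cdot> s \<in> V" using um[OF _ i, of ?K] by auto
      have "(f (v k) - \<delta> ?K \<cdot> v k) + (f s - \<alpha> ?K \<cdot> s) \<in> V"
        using v(2) by (intro subgrp_add[OF V \<delta>(2)[OF _ K(2)] \<alpha>(2)[OF s K(1)]]) simp
      from subgrp_add[OF V subgrp_zmult[OF V this, of u] u]
      have "(- (u * \<delta> ?K)) \<cdot> (v k + s) + u \<cdot> f (v k + s) - int p ^ k0 \<cdot> s \<in> V"
        using f(1) by (simp add: endo_add zm_simps algebra_simps)
      then show "\<exists>a b. a \<cdot> (v k + s) + b \<cdot> f (v k + s) - int p ^ k0 \<cdot> s \<in> V" by blast
    qed
  qed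
  have Ztors: "\<forall>x\<in>Z. \<exists>k. int p ^ k \<cdot> x \<in> V" using tors by blast
  obtain X where X: "subgrp X" "V \<subseteq> X" "X \<subseteq> Z" "X \<inter> J \<subseteq> V" "Z \<subseteq> sumset J X"
    by (rule divisible_complement[OF p V J VJ Z(1) JZ Jdiv Ztors])
  \<comment> \<open>As \<open>f - \<alpha>\<close> kills \<open>J\<close>, it takes all its values
    on the complement \<open>X\<close>, so \<open>J\<close> lies in \<open>f X + X\<close>.
    Inertiality then makes \<open>J\<close> finite modulo \<open>V\<close>, and divisibility makes
    it trivial.\<close>
  have "J \<subseteq> sumset (f ` X) X"
  proof
    fix w assume "w \<in> J"
    then obtain x k where *: "x \<in> Z" "int p ^ k \<cdot> x \<in> V" "w - c k x \<in> V" unfolding J_def by blast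
    obtain d x' where dx: "d \<in> J" "x' \<in> X" "x = d + x'" using X(5) *(1) by (blast elim: sumsetE)
    obtain l where l: "int p ^ l \<cdot> d \<in> V" using Jtors dx(1) by blast
    let ?K = "k + l"
    have "int p ^ ?K \<cdot> d \<in> V" using subgrp_power_mono[OF V l] by simp
    then have "c ?K d \<in> V" using triv dx(1) by blast
    then have "(w - c k x) + (c k x - c ?K x) + c ?K d \<in> V" by (intro subgrp_add[OF V] * cc) simp
    then have "w - c ?K x' \<in> V" unfolding dx(3) by (simp add: c_add algebra_simps)
    from subgrp_diff[OF X(1) subsetD[OF X(2) this] subgrp_zmult[OF X(1) dx(2)]]
    have "w - c ?K x' - \<alpha> ?K \<cdot> x' \<in> X" .
    then have "f x' + (w - c ?K x' - \<alpha> ?K \<cdot> x') \<in> sumset (f ` X) X" using dx(2) by (intro sumsetI imageI)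
    then show "w \<in> sumset (f ` X) X" by (simp add: c_def)
  qed
  moreover have "almost (sumset (f ` X) X) X"
    by (intro almost_sumset_same inertialD f X almost_subset[of X X] order.refl)
  ultimately have "almost J X" by (meson almost_mono order.refl)
  then have "almost J (J \<inter> X)" by (rule almost_Int_self[OF X(1) J])
  then have "almost J V" by (rule almost_mono) (use X(4) in auto)
  then have JV: "J \<subseteq> V" using divisible_finite_trivial[OF p V bspec[OF Jdiv] Jtors] by blast
  show ?thesis unfolding pw_def
  proof
    fix x assume x: "x \<in> Z"
    obtain k where k: "int p ^ k \<cdot> x \<in> V" using tors x by blast
    have "c k x \<in> J" using x k subgrp_0[OF V] by (intro JI) auto
    then show "\<exists>a. f x - a \<cdot> x \<in> V" using JV by (auto simp: c_def)
  qed
qed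

lemma ppart_coprime:
  assumes V: "subgrp V" and q: "prime q" and n: "\<not> q dvd n" "int n \<cdot> x \<in> V" and x: "x \<in> ppart q V"
  shows "x \<in> V"
proof -
  obtain k where k: "int q ^ k \<cdot> x \<in> V" using x by (auto simp: ppart_def)
  show ?thesis by (rule subgrp_coprime[OF V k n(2) coprime_prime_power[OF q n(1)]])
qed

lemma prime_not_dvd_power: "prime p \<Longrightarrow> prime q \<Longrightarrow> p \<noteq> q \<Longrightarrow> \<not> p dvd q ^ k" for p q :: nat
  using prime_dvd_power primes_dvd_imp_eq by blast

lemma ppart_Int:
  assumes "subgrp V" "prime p" "prime q" "p \<noteq> q" "x \<in> ppart p V" "x \<in> ppart q V" shows "x \<in> V"
proof -
  obtain k where "int p ^ k \<cdot> x \<in> V" using assms(5) by (auto simp: ppart_def)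
  then have "int (p ^ k) \<cdot> x \<in> V" by simp
  then show ?thesis using ppart_coprime[OF assms(1,3) prime_not_dvd_power[of q p k]] assms by blast
qed

lemma almost_power_mult:
  assumes "almost V ((\<lambda>x. int p \<cdot> x) ` V)" shows "almost V ((\<lambda>x. int p ^ k \<cdot> x) ` V)"
proof (induction k)
  case 0 show ?case by (intro almost_subset) (simp add: zmult_1)
next
  case (Suc k)
  have "almost ((\<lambda>x. int p ^ k \<cdot> x) ` V) ((\<lambda>x. int p ^ k \<cdot> x) ` (\<lambda>x. int p \<cdot> x) ` V)"
    by (intro almost_image endo_zmult_const assms)
  moreover have "(\<lambda>x. int p ^ k \<cdot> x) ` (\<lambda>x. int p \<cdot> x) ` V = (\<lambda>x. int p ^ Suc k \<cdot> x) ` V"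
    by (simp add: image_image zmult_zmult mult_ac)
  ultimately show ?case using almost_trans[OF Suc.IH] by simp
qed

text \<open>The section is lifted to torsion subgroups of the whole group as far as possible:
  \<open>B\<close> is the \<open>p ^ h\<close>-torsion of \<open>Y0\<close>, \<open>D\<close> is
  \<open>p ^ e\<close> times the torsion of \<open>D'\<close>, and \<open>P\<close> complements
  \<open>D + V\<close> in \<open>D'\<close> modulo \<open>V\<close>. The alternative at the end is
  the source of condition (iv).\<close>

lemma primary_data:
  fixes f :: "'i \<Rightarrow> 'a::ab_group_add \<Rightarrow> 'a" and n m :: "'i \<Rightarrow> int"
  assumes f: "\<And>i. i \<in> I \<Longrightarrow> endo (f i)" and p: "prime p"
    and V: "subgrp V" and tf: "\<forall>v\<in>V. \<forall>a. a \<cdot> v = 0 \<longrightarrow> a = 0 \<or> v = 0"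
    and Vfin: "almost V ((\<lambda>x. int p \<cdot> x) ` V)"
    and nm: "\<And>i v. i \<in> I \<Longrightarrow> v \<in> V \<Longrightarrow> n i \<cdot> f i v = m i \<cdot> v"
    and D': "subgrp D'" "V \<subseteq> D'" "D' \<subseteq> ppart p V" and Y0: "subgrp Y0" "V \<subseteq> Y0" "Y0 \<subseteq> ppart p V"
    and YD: "Y0 \<inter> D' \<subseteq> V" and alm: "almost (ppart p V) (sumset D' Y0)"
    and div: "\<forall>x\<in>D'. \<exists>y\<in>D'. int p \<cdot> y - x \<in> V" and soc: "almost {x \<in> D'. int p \<cdot> x \<in> V} V"
    and pwF: "\<forall>i\<in>I. pw (f i) D' V" and pwY: "\<forall>i\<in>I. pw (f i) Y0 V" and bd: "\<forall>y\<in>Y0. int p ^ h \<cdot> y \<in> V"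
  shows "\<exists>B D P g. subgrp B \<and> subgrp D \<and> subgrp P \<and> V \<subseteq> P \<and> P \<subseteq> ppart p V \<and>
    B \<subseteq> ppart p {0} \<and> D \<subseteq> ppart p {0} \<and> B \<inter> D \<subseteq> {0} \<and>
    almost (ppart p V) (sumset (sumset B D) P) \<and> (\<forall>x\<in>B. int p ^ g \<cdot> x = 0) \<and>
    (\<forall>x\<in>D. \<exists>y\<in>D. int p \<cdot> y = x) \<and> finite {x \<in> D. int p \<cdot> x = 0} \<and>
    (\<forall>i\<in>I. pw (f i) B {0} \<and> pw (f i) D {0} \<and> pw (f i) P V) \<and>
    (\<forall>x\<in>P \<inter> ppart p {0}. int p ^ g \<cdot> x = 0) \<and> (\<forall>x\<in>P. \<exists>y\<in>P. int p \<cdot> y - x \<in> V) \<and>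
    ((\<forall>i\<in>I. \<forall>x\<in>D. n i \<cdot> f i x = m i \<cdot> x) \<or> P \<subseteq> V)"
proof -
  let ?Tor = "ppart p {0::'a}"
  have T0: "subgrp ?Tor" by (rule subgrp_ppart[OF subgrp_zero])
  have p0: "int p \<noteq> 0" using prime_gt_0_nat[OF p] by simp
  have VT: "v = 0" if v: "v \<in> V" "v \<in> ?Tor" for v
  proof -
    obtain k where "int p ^ k \<cdot> v = 0" using v(2) unfolding ppart_def by blast
    moreover have "int p ^ k \<noteq> 0" using p0 by simp
    ultimately show ?thesis using tf v(1) by blast
  qed
  have fT: "f i x \<in> ?Tor" if "i \<in> I" "x \<in> ?Tor" for i x
    using ppart_invariant[OF f[OF that(1)] _ that(2)] endo_0[OF f[OF that(1)]] by simp
  have pw0: "pw (f i) S {0}" if S: "S \<subseteq> ?Tor" and pwS: "pw (f i) S V" and i: "i \<in> I" for i S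
    unfolding pw_def
  proof
    fix x assume x: "x \<in> S"
    obtain a where a: "f i x - a \<cdot> x \<in> V" using pwD[OF pwS x] by blast
    have "f i x - a \<cdot> x \<in> ?Tor" using S x fT[OF i] by (intro subgrp_diff[OF T0] subgrp_zmult[OF T0]) auto
    then show "\<exists>a. f i x - a \<cdot> x \<in> {0}" using VT[OF a] by auto
  qed
  define B where "B = {y \<in> Y0. int p ^ h \<cdot> y = 0}"
  have B: "subgrp B" unfolding B_def by (rule subgrpI) (use Y0(1) in \<open>auto simp: subgrp_0 subgrp_diff zm.scale_right_diff_distrib\<close>)
  have BT: "B \<subseteq> ?Tor" unfolding B_def ppart_def by blast
  have BD': "x = 0" if "x \<in> B" "x \<in> D'" for x using that YD BT VT unfolding B_def by blast
  have pwB: "pw (f i) B {0}" if "i \<in> I" for i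
    by (rule pw0[OF BT pw_subset[OF bspec[OF pwY that]] that]) (auto simp: B_def)
  let ?T = "D' \<inter> ?Tor"
  have T: "subgrp ?T" by (rule subgrp_Int[OF D'(1) T0])
  have Ttors: "\<exists>k. int p ^ k \<cdot> x \<in> {0}" if "x \<in> ?T" for x using that unfolding ppart_def by blast
  let ?K = "{x \<in> ?T. int p \<cdot> x \<in> {0}}"
  have K: "subgrp ?K" by (rule subgrpI) (use D'(1) T0 in \<open>auto simp: subgrp_0 subgrp_diff zm.scale_right_diff_distrib\<close>)
  have "almost ?K V" by (rule almost_mono[OF soc]) (use subgrp_0[OF V] in auto)
  then have "almost ?K (?K \<inter> V)" by (rule almost_Int_self[OF V K])
  then have socT: "almost ?K {0}" by (rule almost_mono) (use VT in auto)
  obtain e where e: "\<forall>j. \<forall>x\<in>?T. \<exists>y\<in>?T. int p ^ e \<cdot> x - int p ^ (e + j) \<cdot> y \<in> {0}"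
    by (rule finite_socle_divisible[OF T subgrp_zero _ Ttors socT]) (use subgrp_0[OF T] in simp_all)
  define D where "D = (\<lambda>x. int p ^ e \<cdot> x) ` ?T"
  have D: "subgrp D" unfolding D_def by (rule subgrp_zmult_image[OF T])
  have DT: "D \<subseteq> ?T" unfolding D_def using subgrp_zmult[OF T] by blast
  have Ddiv: "\<forall>x\<in>D. \<exists>y\<in>D. int p \<cdot> y = x"
  proof
    fix x assume "x \<in> D"
    then obtain w where w: "w \<in> ?T" "x = int p ^ e \<cdot> w" unfolding D_def by blast
    obtain y where y: "y \<in> ?T" "int p ^ e \<cdot> w - int p ^ (e + 1) \<cdot> y \<in> {0}" using e w(1) by blast
    have "int p \<cdot> int p ^ e \<cdot> y = x" using y(2) w(2) by (simp add: zmult_zmult mult_ac)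
    then show "\<exists>y\<in>D. int p \<cdot> y = x" using y(1) unfolding D_def by blast
  qed
  have Dfin: "finite {x \<in> D. int p \<cdot> x = 0}"
  proof -
    obtain F where F: "finite F" "?K \<subseteq> sumset F {0}" using socT by (auto simp: almost_def)
    have "{x \<in> D. int p \<cdot> x = 0} \<subseteq> F" using F(2) DT by (auto simp: sumset_def)
    then show ?thesis using F(1) finite_subset by blast
  qed
  have pwD0: "pw (f i) D {0}" if "i \<in> I" for i
    by (rule pw0[OF _ pw_subset[OF bspec[OF pwF that]] that]) (use DT in auto)
  let ?E = "sumset D V"
  have E: "subgrp ?E" by (rule subgrp_sumset[OF D V])
  have VE: "V \<subseteq> ?E" and DE: "D \<subseteq> ?E" using sumset_left[OF subgrp_0[OF V]] sumset_right[OF subgrp_0[OF D]] by blast+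
  have ED: "?E \<subseteq> D'" by (rule sumset_subset[OF D'(1)]) (use DT D'(2) in auto)
  have Ediv: "\<forall>x\<in>?E. \<exists>y\<in>?E. int p \<cdot> y - x \<in> V"
  proof
    fix x assume "x \<in> ?E"
    then obtain d v where dv: "d \<in> D" "v \<in> V" "x = d + v" by (rule sumsetE)
    obtain y where y: "y \<in> D" "int p \<cdot> y = d" using Ddiv dv(1) by blast
    have "int p \<cdot> y - x \<in> V" using dv y subgrp_uminus[OF V] by simp
    then show "\<exists>y\<in>?E. int p \<cdot> y - x \<in> V" using y(1) DE by blast
  qed
  have D'tors: "\<forall>x\<in>D'. \<exists>k. int p ^ k \<cdot> x \<in> V" using D'(3) unfolding ppart_def by blast
  obtain P where P: "subgrp P" "V \<subseteq> P" "P \<subseteq> D'" "P \<inter> ?E \<subseteq> V" "D' \<subseteq> sumset ?E P"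
    by (rule divisible_complement[OF p V E VE D'(1) ED Ediv D'tors])
  have pwP: "pw (f i) P V" if "i \<in> I" for i by (rule pw_subset[OF bspec[OF pwF that] P(3) order.refl])
  have Pdiv: "\<forall>x\<in>P. \<exists>y\<in>P. int p \<cdot> y - x \<in> V"
  proof
    fix x assume x: "x \<in> P"
    then obtain w where w: "w \<in> D'" "int p \<cdot> w - x \<in> V" using div P(3) by blast
    obtain d y where dy: "d \<in> ?E" "y \<in> P" "w = d + y" using P(5) w(1) by (blast elim: sumsetE)
    have "int p \<cdot> y - x \<in> P" by (intro subgrp_diff[OF P(1)] subgrp_zmult[OF P(1)] dy x)
    moreover have "(int p \<cdot> w - x) - int p \<cdot> d \<in> ?E"
      by (rule subgrp_diff[OF E subsetD[OF VE w(2)] subgrp_zmult[OF E dy(1)]])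
    then have "int p \<cdot> y - x \<in> ?E" unfolding dy(3) by (simp add: zmult_add_right)
    ultimately show "\<exists>y\<in>P. int p \<cdot> y - x \<in> V" using P(4) dy(2) by blast
  qed
  \<comment> \<open>\<open>p ^ e\<close> maps the torsion of \<open>P\<close> into \<open>D\<close>,
    which meets \<open>P\<close> only in the torsion-free \<open>V\<close>.\<close>
  have PT: "int p ^ e \<cdot> x = 0" if "x \<in> P" "x \<in> ?Tor" for x
  proof -
    have "int p ^ e \<cdot> x \<in> D" using that P(3) unfolding D_def by blast
    then have "int p ^ e \<cdot> x \<in> V" using P(4) DE subgrp_zmult[OF P(1) that(1)] by blast
    then show ?thesis using VT subgrp_zmult[OF T0 that(2)] by blast
  qed
  \<comment> \<open>\<open>p ^ h Y0\<close> lies in \<open>V\<close>, and \<open>V / p ^ h V\<close>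
    is finite; so up to finitely many cosets an element of \<open>Y0\<close> differs from one of
    \<open>V\<close> by \<open>p ^ h\<close>-torsion.\<close>
  have YB: "almost Y0 (sumset B V)"
  proof -
    let ?g = "\<lambda>x. int p ^ h \<cdot> x"
    have "almost (?g ` Y0) (?g ` V)" by (rule almost_mono[OF almost_power_mult[OF Vfin]]) (use bd in auto)
    then have "almost Y0 (?g -` ?g ` V)" by (intro almost_vimage endo_zmult_const subgrp_zmult_image[OF V])
    then have "almost Y0 (Y0 \<inter> ?g -` ?g ` V)"
      by (rule almost_Int_self[OF subgrp_vimage[OF endo_zmult_const subgrp_zmult_image[OF V]] Y0(1)])
    moreover have "Y0 \<inter> ?g -` ?g ` V \<subseteq> sumset B V"
    proof
      fix y assume "y \<in> Y0 \<inter> ?g -` ?g ` V"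
      then obtain v where v: "y \<in> Y0" "v \<in> V" "?g y = ?g v" by auto
      have "y - v \<in> B" unfolding B_def using v Y0 by (auto simp: zm.scale_right_diff_distrib intro: subgrp_diff)
      from sumsetI[OF this v(2)] show "y \<in> sumset B V" by simp
    qed
    ultimately show ?thesis by (rule almost_mono[OF _ order.refl])
  qed
  have W: "almost (ppart p V) (sumset (sumset B D) P)"
  proof -
    have "almost (sumset D' Y0) (sumset (sumset ?E P) (sumset B V))"
      by (intro almost_sumset almost_subset P(5) YB)
    moreover have "sumset (sumset ?E P) (sumset B V) \<subseteq> sumset (sumset B D) P"
    proof
      fix x assume "x \<in> sumset (sumset ?E P) (sumset B V)"
      then obtain d v y b v' where *: "d \<in> D" "v \<in> V" "y \<in> P" "b \<in> B" "v' \<in> V" "x = d + v + y + (b + v')"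
        by (elim sumsetE) blast
      have "(b + d) + (v + y + v') \<in> sumset (sumset B D) P"
        using * P(2) by (intro sumsetI subgrp_add[OF P(1)]) auto
      then show "x \<in> sumset (sumset B D) P" using *(6) by (simp add: algebra_simps)
    qed
    ultimately have "almost (sumset D' Y0) (sumset (sumset B D) P)" by (rule almost_mono[OF _ order.refl])
    then show ?thesis by (rule almost_trans[OF alm])
  qed
  have iv: "(\<forall>i\<in>I. \<forall>x\<in>D. n i \<cdot> f i x = m i \<cdot> x) \<or> P \<subseteq> V"
  proof (cases "\<forall>i\<in>I. \<forall>x\<in>D. n i \<cdot> f i x = m i \<cdot> x")
    case False
    then obtain i x0 where i: "i \<in> I" and x0: "x0 \<in> D" "n i \<cdot> f i x0 \<noteq> m i \<cdot> x0" by blast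
    \<comment> \<open>\<open>\<psi>\<close> kills \<open>V\<close>, so it maps \<open>D'\<close>
      into torsion. Since \<open>\<psi>\<close> is nonzero at \<open>x0\<close>, which
      \<open>p ^ k\<close> kills, its coefficients on \<open>D'\<close> are not divisible by
      \<open>p ^ k\<close>. By \<open>unit_multiple\<close> and divisibility every element of
      \<open>D'\<close> is then a multiple of a value of \<open>\<psi>\<close> modulo
      \<open>V\<close>.\<close>
    define \<psi> where "\<psi> x = n i \<cdot> f i x - m i \<cdot> x" for x
    have \<psi>V: "\<psi> v = 0" if "v \<in> V" for v using nm[OF i that] by (simp add: \<psi>_def)
    have \<psi>: "\<psi> (a \<cdot> x) = a \<cdot> \<psi> x" "\<psi> (x + y) = \<psi> x + \<psi> y" "\<psi> (x - y) = \<psi> x - \<psi> y" for a x y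
      using f[OF i] by (simp_all add: \<psi>_def endo_simps zm_simps mult_ac)
    have \<psi>D': "\<psi> x \<in> ?T" if x: "x \<in> D'" for x
    proof
      show "\<psi> x \<in> D'" unfolding \<psi>_def using pw_invariant[OF bspec[OF pwF i] D'(1,2) x]
        by (intro subgrp_diff[OF D'(1)] subgrp_zmult[OF D'(1)] x)
      obtain k where "int p ^ k \<cdot> x \<in> V" using D'tors x by blast
      then have "int p ^ k \<cdot> \<psi> x = 0" using \<psi>V by (simp flip: \<psi>(1))
      then show "\<psi> x \<in> ?Tor" unfolding ppart_def by blast
    qed
    obtain \<alpha> where \<alpha>: "\<forall>k. \<forall>x\<in>D'. int p ^ k \<cdot> x \<in> V \<longrightarrow> f i x - \<alpha> k \<cdot> x \<in> V"
      by (rule pw_padic[OF p f[OF i] D'(1) V bspec[OF pwF i]])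
    have \<psi>\<alpha>: "\<psi> x - (n i * \<alpha> k - m i) \<cdot> x \<in> V" if "x \<in> D'" "int p ^ k \<cdot> x \<in> V" for k x
    proof -
      have "n i \<cdot> (f i x - \<alpha> k \<cdot> x) \<in> V" using \<alpha> that by (intro subgrp_zmult[OF V]) blast
      then show ?thesis by (simp add: \<psi>_def zm_simps)
    qed
    obtain k where k: "int p ^ k \<cdot> x0 \<in> {0}" using Ttors x0(1) DT by blast
    have "D' \<subseteq> ?E"
    proof
      fix x assume x: "x \<in> D'"
      obtain z where z: "z 0 = x" "\<forall>k::nat. z k \<in> D'" "\<forall>j k. int p ^ j \<cdot> z (k + j) - z k \<in> V"
        by (rule divisible_sequence[OF V bspec[OF div] x])
      have zk: "int p ^ k \<cdot> z k - x \<in> V" using z(3)[rule_format, of k 0] z(1) by simp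
      obtain l where l: "int p ^ l \<cdot> z k \<in> V" using D'tors z(2) by blast
      let ?b = "n i * \<alpha> (l + k) - m i"
      have nd: "\<not> int p ^ k dvd ?b"
      proof
        assume "int p ^ k dvd ?b"
        then have b0: "?b \<cdot> x0 = 0" using subgrp_zmult_dvd[OF subgrp_zero k] by simp
        have "int p ^ (l + k) \<cdot> x0 \<in> V" using subgrp_power_mono[OF subgrp_zero k, of "l + k"] subgrp_0[OF V] by simp
        then have "\<psi> x0 \<in> V" using \<psi>\<alpha>[of x0 "l + k"] x0(1) DT b0 by auto
        then have "\<psi> x0 = 0" using VT \<psi>D' x0(1) DT by blast
        then show False using x0(2) by (simp add: \<psi>_def)
      qed
      obtain u where u: "u \<cdot> ?b \<cdot> z k - int p ^ k \<cdot> z k \<in> V" using unit_multiple[OF p V nd l] by blast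
      have "int p ^ (l + k) \<cdot> z k \<in> V" using subgrp_power_mono[OF V l] by simp
      then have "\<psi> (z k) - ?b \<cdot> z k \<in> V" using \<psi>\<alpha> z(2) by blast
      from subgrp_add[OF V subgrp_add[OF V subgrp_zmult[OF V this, of u] u] zk]
      have d: "u \<cdot> \<psi> (z k) - x \<in> V" by (simp add: zm.scale_right_diff_distrib)
      \<comment> \<open>A second chain writes \<open>z k\<close> as \<open>p ^ e\<close> times an
        element of \<open>D'\<close> up to \<open>V\<close>; hence \<open>\<psi> (z k)\<close> is
        \<open>p ^ e\<close> times torsion and lies in \<open>D\<close>.\<close>
      obtain z' where z': "z' 0 = z k" "\<forall>k::nat. z' k \<in> D'" "\<forall>j k. int p ^ j \<cdot> z' (k + j) - z' k \<in> V"
        by (rule divisible_sequence[OF V bspec[OF div] z(2)[rule_format, of k]])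
      have "int p ^ e \<cdot> z' e - z k \<in> V" using z'(3)[rule_format, of e 0] z'(1) by simp
      then have "\<psi> (int p ^ e \<cdot> z' e - z k) = 0" by (rule \<psi>V)
      then have "\<psi> (z k) = int p ^ e \<cdot> \<psi> (z' e)" by (simp add: \<psi>)
      then have "\<psi> (z k) \<in> D" unfolding D_def using \<psi>D' z'(2) by blast
      then have "u \<cdot> \<psi> (z k) + - (u \<cdot> \<psi> (z k) - x) \<in> ?E"
        by (intro sumsetI subgrp_zmult[OF D] subgrp_uminus[OF V] d)
      then show "x \<in> ?E" by simp
    qed
    then show ?thesis using P(3,4) by blast
  qed blast
  let ?g = "max e h"
  have B0: "int p ^ ?g \<cdot> x = 0" if "x \<in> B" for x
    using subgrp_power_mono[OF subgrp_zero, of p h x ?g] that unfolding B_def by simp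
  have P0: "int p ^ ?g \<cdot> x = 0" if "x \<in> P \<inter> ?Tor" for x
    using subgrp_power_mono[OF subgrp_zero, of p e x ?g] PT that by simp
  have Pp: "P \<subseteq> ppart p V" using P(3) D'(3) by blast
  have DT0: "D \<subseteq> ?Tor" using DT by blast
  have BD: "B \<inter> D \<subseteq> {0}" using BD' DT by blast
  show ?thesis
    by (rule exI[of _ B], rule exI[of _ D], rule exI[of _ P], rule exI[of _ ?g])
      (intro conjI B D P(1,2) Pp BT DT0 BD W Ddiv Dfin Pdiv iv ballI B0 P0 pwB pwD0 pwP)
qed

subsection \<open>Groups with prescribed primary components\<close>

text \<open>The group over \<open>V\<close> whose \<open>p\<close>-component modulo \<open>V\<close>
  is \<open>H p\<close>, for all primes at once. The condition speaks of every multiple of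
  \<open>x\<close> in a \<open>p\<close>-component and so involves no choice of primary
  projections.\<close>

definition glue :: "'a::ab_group_add set \<Rightarrow> (nat \<Rightarrow> 'a set) \<Rightarrow> 'a set" where
  "glue V H = {x. (\<exists>n::nat. n \<ge> 1 \<and> int n \<cdot> x \<in> V) \<and>
     (\<forall>p c. prime p \<longrightarrow> c \<cdot> x \<in> ppart p V \<longrightarrow> c \<cdot> x \<in> H p)}"

locale primary_family =
  fixes V :: "'a::ab_group_add set" and H :: "nat \<Rightarrow> 'a set"
  assumes V: "subgrp V"
    and H: "prime p \<Longrightarrow> subgrp (H p)" "prime p \<Longrightarrow> V \<subseteq> H p" "prime p \<Longrightarrow> H p \<subseteq> ppart p V"
begin

lemma glue_periodic: "x \<in> glue V H \<Longrightarrow> \<exists>n::nat. n \<ge> 1 \<and> int n \<cdot> x \<in> V"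
  by (simp add: glue_def)

text \<open>\<open>c \<cdot> (x - y)\<close> may lie in a \<open>p\<close>-component although
  \<open>c \<cdot> x\<close> does not. The projection \<open>v * M\<close> moves \<open>x\<close>
  and \<open>y\<close> separately into the component, and the remaining part of
  \<open>c \<cdot> (x - y)\<close> lies in \<open>V\<close>.\<close>

lemma subgrp_glue: "subgrp (glue V H)"
proof (rule subgrpI)
  show "0 \<in> glue V H"
    using subgrp_0[OF V] H subgrp_0 by (auto simp: glue_def)
  fix x y assume xy: "x \<in> glue V H" "y \<in> glue V H"
  then obtain n1 n2 :: nat where n12: "n1 \<ge> 1" "int n1 \<cdot> x \<in> V" "n2 \<ge> 1" "int n2 \<cdot> y \<in> V"
    unfolding glue_def by blast
  let ?n = "n1 * n2"
  have n1: "?n \<ge> 1" using n12 by simp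
  have nx: "int ?n \<cdot> x \<in> V" by (rule subgrp_zmult_dvd[OF V n12(2)]) simp
  have ny: "int ?n \<cdot> y \<in> V" by (rule subgrp_zmult_dvd[OF V n12(4)]) simp
  have nxy: "int ?n \<cdot> (x - y) \<in> V" using subgrp_diff[OF V nx ny] by (simp add: zm.scale_right_diff_distrib)
  have "c \<cdot> (x - y) \<in> H p" if p: "prime p" and cp: "c \<cdot> (x - y) \<in> ppart p V" for p c
  proof -
    obtain k M where kM: "?n = p ^ k * M" "\<not> p dvd M" by (rule prime_power_split[OF p n1])
    obtain u v where uv: "u * int p ^ k + v * int M = 1" by (rule bezout_coprime[OF coprime_prime_power[OF p kM(2)]])
    have part: "(v * int M) \<cdot> w \<in> H p" if "w \<in> glue V H" "int ?n \<cdot> w \<in> V" for w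
    proof -
      have "int p ^ k \<cdot> (v * int M) \<cdot> w = v \<cdot> int ?n \<cdot> w" by (simp only: kM(1) zmult_zmult) (simp add: mult_ac)
      then have "(v * int M) \<cdot> w \<in> ppart p V" using subgrp_zmult[OF V that(2)] unfolding ppart_def by (metis mem_Collect_eq)
      then show ?thesis using that(1) p unfolding glue_def by blast
    qed
    let ?w = "c \<cdot> (x - y)"
    have "c \<cdot> ((v * int M) \<cdot> x - (v * int M) \<cdot> y) \<in> H p"
      by (intro subgrp_zmult[OF H(1)[OF p]] subgrp_diff[OF H(1)[OF p]] part xy nx ny)
    then have 1: "(v * int M) \<cdot> ?w \<in> H p" by (simp add: zm_simps mult_ac)
    have "int M \<cdot> (u * int p ^ k) \<cdot> ?w = (u * c) \<cdot> int ?n \<cdot> (x - y)" by (simp only: kM(1) zmult_zmult) (simp add: mult_ac)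
    then have "int M \<cdot> (u * int p ^ k) \<cdot> ?w \<in> V" using subgrp_zmult[OF V nxy] by simp
    then have "(u * int p ^ k) \<cdot> ?w \<in> V"
      by (rule ppart_coprime[OF V p kM(2)]) (rule subgrp_zmult[OF subgrp_ppart[OF V] cp])
    then have "(u * int p ^ k) \<cdot> ?w + (v * int M) \<cdot> ?w \<in> H p" using 1 H[OF p] by (intro subgrp_add) auto
    then show ?thesis by (simp only: zmult_add_left[symmetric] uv zmult_1)
  qed
  then show "x - y \<in> glue V H" unfolding glue_def using n1 nxy by blast
qed

lemma H_le_glue: assumes p: "prime p" shows "H p \<subseteq> glue V H"
proof
  fix x assume x: "x \<in> H p"
  then have xp: "x \<in> ppart p V" using H[OF p] by blast
  then obtain k where k: "int p ^ k \<cdot> x \<in> V" by (auto simp: ppart_def)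
  have 1: "\<exists>n::nat. n \<ge> 1 \<and> int n \<cdot> x \<in> V"
    using k prime_gt_0_nat[OF p] by (intro exI[of _ "p ^ k"]) (simp add: Suc_le_eq)
  have "c \<cdot> x \<in> H q" if q: "prime q" "c \<cdot> x \<in> ppart q V" for q c
  proof (cases "q = p")
    case True then show ?thesis using x subgrp_zmult[OF H(1)[OF p]] by simp
  next
    case False
    then have "c \<cdot> x \<in> V" using ppart_Int[OF V p q(1) _ subgrp_zmult[OF subgrp_ppart[OF V] xp] q(2)] by blast
    then show ?thesis using H[OF q(1)] by blast
  qed
  then show "x \<in> glue V H" unfolding glue_def using 1 by blast
qed

lemma glue_ppart: "prime p \<Longrightarrow> x \<in> glue V H \<Longrightarrow> x \<in> ppart p V \<Longrightarrow> x \<in> H p"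
  unfolding glue_def by (metis (mono_tags, lifting) mem_Collect_eq zmult_1)

lemma V_le_glue: "V \<subseteq> glue V H"
  using H_le_glue[OF two_is_prime_nat] H(2)[OF two_is_prime_nat] by blast

lemma glue_le: assumes "subgrp K" "\<And>p. prime p \<Longrightarrow> H p \<subseteq> K" shows "glue V H \<subseteq> K"
proof
  fix x assume x: "x \<in> glue V H"
  obtain n :: nat where n: "n \<ge> 1" "int n \<cdot> x \<in> V" using glue_periodic[OF x] by blast
  have VK: "V \<subseteq> K" using assms(2)[OF two_is_prime_nat] H(2)[OF two_is_prime_nat] by blast
  show "x \<in> K"
  proof (rule primary_generate[OF V assms(1) VK n])
    fix p c k assume p: "prime p" and "int p ^ k \<cdot> c \<cdot> x \<in> V"
    then have "c \<cdot> x \<in> ppart p V" unfolding ppart_def by blast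
    then show "c \<cdot> x \<in> K" using glue_ppart[OF p subgrp_zmult[OF subgrp_glue x]] assms(2)[OF p] by blast
  qed
qed

lemma pw_glue:
  assumes f: "endo f" and fV: "\<And>v. v \<in> V \<Longrightarrow> f v \<in> V" and pwH: "\<And>p. prime p \<Longrightarrow> pw f (H p) V"
  shows "pw f (glue V H) V"
  unfolding pw_def
proof
  fix x assume x: "x \<in> glue V H"
  obtain n :: nat where n: "n \<ge> 1" "int n \<cdot> x \<in> V" using glue_periodic[OF x] by blast
  show "\<exists>a. f x - a \<cdot> x \<in> V"
  proof (rule pw_primary[OF f V n _ fV])
    fix p c k assume p: "prime p" and "int p ^ k \<cdot> c \<cdot> x \<in> V"
    then have "c \<cdot> x \<in> ppart p V" unfolding ppart_def by blast
    then show "\<exists>a. f (c \<cdot> x) - a \<cdot> c \<cdot> x \<in> V"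
      using pwD[OF pwH[OF p]] glue_ppart[OF p subgrp_zmult[OF subgrp_glue x]] by blast
  qed
qed

end

text \<open>Induction on the exceptional set \<open>L\<close>: adjoining a whole component to
  \<open>K\<close> removes its prime from \<open>L\<close> and costs finitely many cosets.\<close>

lemma almost_UNIV_primary:
  assumes V: "subgrp V" and per: "\<And>x. \<exists>n::nat. n \<ge> 1 \<and> int n \<cdot> x \<in> V" and "finite L"
    and K: "subgrp K" "V \<subseteq> K" and "\<And>p. prime p \<Longrightarrow> p \<notin> L \<Longrightarrow> ppart p V \<subseteq> K"
    and "\<And>p. p \<in> L \<Longrightarrow> almost (ppart p V) K"
  shows "almost UNIV K"
  using assms(3-)
proof (induction L arbitrary: K rule: finite_induct)
  case empty
  have "x \<in> K" for x
  proof -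
    obtain n :: nat where n: "n \<ge> 1" "int n \<cdot> x \<in> V" using per by blast
    show ?thesis
    proof (rule primary_generate[OF V empty(1,2) n])
      fix p c k assume p: "prime p" and "int p ^ k \<cdot> c \<cdot> x \<in> V"
      then have "c \<cdot> x \<in> ppart p V" unfolding ppart_def by blast
      then show "c \<cdot> x \<in> K" using empty(3)[OF p] by blast
    qed
  qed
  then show ?case by (intro almost_subset) blast
next
  case (insert p L)
  let ?K = "sumset (ppart p V) K"
  have sub: "K \<subseteq> ?K" "ppart p V \<subseteq> ?K"
    using sumset_right[OF subgrp_0[OF subgrp_ppart[OF V]]] sumset_left[OF subgrp_0[OF insert.prems(1)]] by blast+
  have "almost UNIV ?K"
  proof (rule insert.IH)
    show "subgrp ?K" by (rule subgrp_sumset[OF subgrp_ppart[OF V] insert.prems(1)])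
    show "V \<subseteq> ?K" using sub insert.prems(2) by blast
    show "ppart q V \<subseteq> ?K" if "prime q" "q \<notin> L" for q
      using that sub insert.prems(3)[of q] by (cases "q = p") auto
    show "almost (ppart q V) ?K" if "q \<in> L" for q
      using almost_mono[OF insert.prems(4)[of q] order.refl sub(1)] that by blast
  qed
  moreover have "almost ?K K"
    by (intro almost_sumset_same insert.prems almost_subset[of K K] order.refl) simp
  ultimately show ?case by (rule almost_trans)
qed

subsection \<open>Finite rank\<close>

text \<open>For finite \<open>H\<close> the quotient by \<open>p H\<close> is no larger than the
  \<open>p\<close>-torsion, as both are compared with the order of \<open>H\<close>;
  \<open>G\<close> consists of coset representatives.\<close>

lemma generators_modulo_prime:
  fixes p :: nat
  assumes H: "subgrp H" "finite H"
  obtains G where "G \<subseteq> H" "card G \<le> card {x \<in> H. int p \<cdot> x = 0}" "H \<subseteq> sumset G ((\<lambda>x. int p \<cdot> x) ` H)"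
proof -
  let ?f = "\<lambda>x. int p \<cdot> x"
  let ?pH = "?f ` H" and ?S = "{x \<in> H. ?f x = 0}"
  have pH: "subgrp ?pH" by (rule subgrp_zmult_image[OF H(1)])
  define c where "c x = (SOME y. y \<in> H \<and> coset y ?pH = coset x ?pH)" for x
  have c: "c x \<in> H \<and> coset (c x) ?pH = coset x ?pH" if "x \<in> H" for x
    unfolding c_def by (rule someI[of _ x]) (use that in simp)
  let ?G = "c ` H"
  have GH: "?G \<subseteq> H" using c by blast
  have inj: "inj_on (\<lambda>(a, b). a + b) (?G \<times> ?pH)"
  proof (rule inj_onI, clarify)
    fix x x' u u' assume *: "x \<in> H" "x' \<in> H" "u \<in> H" "u' \<in> H" "c x + ?f u = c x' + ?f u'"
    have "c x - c x' = ?f u' - ?f u" using *(5) by (simp add: algebra_simps)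
    also have "\<dots> \<in> ?pH" by (intro subgrp_diff[OF pH] imageI *)
    finally have "coset (c x) ?pH = coset (c x') ?pH" using coset_eq_iff[OF pH] by blast
    then have "coset x ?pH = coset x' ?pH" using c *(1,2) by simp
    then have "c x = c x'" unfolding c_def by simp
    then show "c x = c x' \<and> ?f u = ?f u'" using *(5) by simp
  qed
  have fin: "finite ?pH" "finite ?S" "finite ?G" using H(2) by auto
  have "card ?G * card ?pH = card (?G \<times> ?pH)" by (rule card_cartesian_product[symmetric])
  also have "\<dots> \<le> card H"
    by (rule card_inj_on_le[OF inj _ H(2)]) (use GH subgrp_zmult[OF H(1)] in \<open>auto intro!: subgrp_add[OF H(1)]\<close>)
  also have "\<dots> \<le> card (?pH \<times> ?S)"
  proof -
    define r where "r y = (SOME x. x \<in> H \<and> ?f x = y)" for y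
    have r: "r (?f x) \<in> H \<and> ?f (r (?f x)) = ?f x" if "x \<in> H" for x
      unfolding r_def by (rule someI[of _ x]) (use that in simp)
    have "inj_on (\<lambda>x. (?f x, x - r (?f x))) H" 
    proof (rule inj_onI)
      fix x y assume "(?f x, x - r (?f x)) = (?f y, y - r (?f y))"
      then have "?f x = ?f y" "x - r (?f x) = y - r (?f y)" by (metis prod.inject)+
      then have "x - r (?f x) = y - r (?f x)" by (simp only:)
      then show "x = y" by simp
    qed
    moreover have "(\<lambda>x. (?f x, x - r (?f x))) ` H \<subseteq> ?pH \<times> ?S"
    proof (rule image_subsetI)
      fix x assume x: "x \<in> H"
      then have "x - r (?f x) \<in> H" using r by (intro subgrp_diff[OF H(1)]) auto
      moreover have "?f (x - r (?f x)) = 0" using r[OF x] by (simp add: zm.scale_right_diff_distrib)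
      ultimately show "(?f x, x - r (?f x)) \<in> ?pH \<times> ?S" using x by blast
    qed
    ultimately show ?thesis using fin by (intro card_inj_on_le) auto
  qed
  also have "\<dots> = card ?S * card ?pH" by (simp add: card_cartesian_product)
  finally have "card ?G * card ?pH \<le> card ?S * card ?pH" .
  moreover have "card ?pH > 0" using fin(1) subgrp_0[OF pH] by (auto simp: card_gt_0_iff)
  ultimately have card: "card ?G \<le> card ?S" by simp
  have "H \<subseteq> sumset ?G ?pH"
  proof
    fix x assume x: "x \<in> H"
    then have "x - c x \<in> ?pH" using c coset_eq_iff[OF pH] by metis
    then have "c x + (x - c x) \<in> sumset ?G ?pH" using x by (intro sumsetI) auto
    then show "x \<in> sumset ?G ?pH" by simp
  qed
  then show thesis using that GH card by blast
qed

text \<open>Iterates \<open>H = K + p H\<close> along the prime factors of \<open>k\<close>.\<close>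

lemma multiplication_generates:
  assumes K: "subgrp K" "K \<subseteq> H" and H: "subgrp H"
    and gen: "\<And>p. p \<in> S \<Longrightarrow> H \<subseteq> sumset K ((\<lambda>x. int p \<cdot> x) ` H)"
    and k: "pi_number S k"
  shows "H \<subseteq> sumset K ((\<lambda>x. int k \<cdot> x) ` H)"
proof -
  have "k \<ge> 1" using k by (simp add: pi_number_def)
  then show ?thesis using k
  proof (induction k rule: less_induct)
    case (less k)
    show ?case
    proof (cases "k = 1")
      case True
      then show ?thesis using sumset_right[OF subgrp_0[OF K(1)], of H] by (simp add: zmult_1)
    next
      case False
      obtain p j where pj: "prime p" "p dvd k" "k = p * j" "j < k" "j \<ge> 1"
        by (rule prime_factor_split[OF less.prems(1) False])
      have pS: "p \<in> S" using pj less.prems(2) by (auto simp: pi_number_def)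
      have j: "pi_number S j" using less.prems(2) pj(3) by (simp add: pi_number_mult)
      show ?thesis
      proof
        fix x assume "x \<in> H"
        then have "x \<in> sumset K ((\<lambda>x. int j \<cdot> x) ` H)" using less.IH[OF pj(4,5) j] by blast
        then obtain a y where a: "a \<in> K" "y \<in> H" "x = a + int j \<cdot> y" by (auto elim!: sumsetE)
        have "y \<in> sumset K ((\<lambda>x. int p \<cdot> x) ` H)" using gen[OF pS] a(2) by blast
        then obtain b z where b: "b \<in> K" "z \<in> H" "y = b + int p \<cdot> z" by (auto elim!: sumsetE)
        have "(a + int j \<cdot> b) + int k \<cdot> z \<in> sumset K ((\<lambda>x. int k \<cdot> x) ` H)"
          by (intro sumsetI imageI subgrp_add[OF K(1)] subgrp_zmult[OF K(1)] a b)
        then show "x \<in> sumset K ((\<lambda>x. int k \<cdot> x) ` H)"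
          unfolding a(3) b(3) pj(3) by (simp add: zm_simps mult_ac add_ac)
      qed
    qed
  qed
qed

text \<open>A finitely generated subgroup is finite and killed by some \<open>S\<close>-number
  \<open>k\<close>. Representatives modulo \<open>p\<close>, taken for all \<open>p \<in> S\<close>,
  generate it modulo every such \<open>p\<close>, hence modulo \<open>k\<close>, hence outright;
  their number is at most the sum of the socle orders.\<close>

lemma finite_rank_if_finite_socles:
  assumes D: "subgrp D" and S: "finite S"
    and tors: "\<forall>x\<in>D. \<exists>k. pi_number S k \<and> int k \<cdot> x = 0"
    and soc: "\<And>p. p \<in> S \<Longrightarrow> finite {x \<in> D. int p \<cdot> x = 0}"
  shows "finite_rank D"
  unfolding finite_rank_def
proof (rule exI[of _ "\<Sum>p\<in>S. card {x \<in> D. int p \<cdot> x = 0}"], intro allI impI)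
  let ?r = "\<Sum>p\<in>S. card {x \<in> D. int p \<cdot> x = 0}"
  fix F assume F: "finite F \<and> F \<subseteq> D"
  let ?H = "zm.span F"
  have H: "subgrp ?H" by (rule subgrp_span)
  have HD: "?H \<subseteq> D" using F D by (intro span_le_subgrp) auto
  have "\<forall>e\<in>F. \<exists>k. pi_number S k \<and> int k \<cdot> e = 0" using tors F by blast
  then obtain k where "\<forall>e\<in>F. pi_number S (k e) \<and> int (k e) \<cdot> e = 0" by (rule bchoice[THEN exE])
  then have k: "\<And>e. e \<in> F \<Longrightarrow> pi_number S (k e) \<and> int (k e) \<cdot> e = 0" by blast
  have "almost ?H {0}"
    using F k by (intro almost_span_torsion subgrp_zero) (auto simp: pi_number_def Suc_le_eq)
  then obtain F' where "finite F'" "?H \<subseteq> sumset F' {0}" by (auto simp: almost_def)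
  then have fin: "finite ?H" using finite_subset[of ?H "sumset F' {0}"] finite_sumset[of F' "{0}"] by simp
  have "\<exists>G. G \<subseteq> ?H \<and> card G \<le> card {x \<in> ?H. int p \<cdot> x = 0} \<and> ?H \<subseteq> sumset G ((\<lambda>x. int p \<cdot> x) ` ?H)" for p :: nat
    by (rule generators_modulo_prime[OF H fin]) blast
  then have "\<forall>p. \<exists>G. G \<subseteq> ?H \<and> card G \<le> card {x \<in> ?H. int p \<cdot> x = 0} \<and> ?H \<subseteq> sumset G ((\<lambda>x. int p \<cdot> x) ` ?H)" ..
  then obtain G where "\<forall>p. G p \<subseteq> ?H \<and> card (G p) \<le> card {x \<in> ?H. int p \<cdot> x = 0} \<and>
    ?H \<subseteq> sumset (G p) ((\<lambda>x. int p \<cdot> x) ` ?H)" by (rule choice[THEN exE])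
  then have G: "\<And>p. G p \<subseteq> ?H" "\<And>p. card (G p) \<le> card {x \<in> ?H. int p \<cdot> x = 0}"
    "\<And>p. ?H \<subseteq> sumset (G p) ((\<lambda>x. int p \<cdot> x) ` ?H)" by simp_all
  let ?G = "\<Union>p\<in>S. G p"
  have GH: "?G \<subseteq> ?H" using G(1) by blast
  have Gfin: "finite ?G" using GH fin finite_subset by blast
  have "card ?G \<le> (\<Sum>p\<in>S. card (G p))" by (rule card_UN_le[OF S])
  also have "\<dots> \<le> ?r"
  proof (rule sum_mono)
    fix p assume p: "p \<in> S"
    have "card (G p) \<le> card {x \<in> ?H. int p \<cdot> x = 0}" by (rule G(2))
    also have "\<dots> \<le> card {x \<in> D. int p \<cdot> x = 0}" using HD by (intro card_mono soc[OF p]) auto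
    finally show "card (G p) \<le> card {x \<in> D. int p \<cdot> x = 0}" .
  qed
  finally have card: "card ?G \<le> ?r" .
  let ?K = "zm.span ?G"
  have KH: "?K \<subseteq> ?H" by (rule span_le_subgrp[OF GH H])
  let ?k = "\<Prod>e\<in>F. k e"
  have kS: "pi_number S ?k"
    using F k by (auto simp: pi_number_def prime_dvd_prod_iff intro: Suc_leI)
  have "?H \<subseteq> sumset ?K ((\<lambda>x. int ?k \<cdot> x) ` ?H)"
  proof (rule multiplication_generates[OF subgrp_span KH H _ kS])
    fix p assume "p \<in> S"
    then have "G p \<subseteq> ?K" using zm.span_superset by blast
    then show "?H \<subseteq> sumset ?K ((\<lambda>x. int p \<cdot> x) ` ?H)" using G(3)[of p] sumset_mono[OF _ order.refl] by blast
  qed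
  moreover have "int ?k \<cdot> x = 0" if "x \<in> ?H" for x
  proof -
    have sub: "subgrp {x. int ?k \<cdot> x = 0}" by (rule subgrpI) (auto simp: zm.scale_right_diff_distrib)
    have "F \<subseteq> {x. int ?k \<cdot> x = 0}"
    proof clarify
      fix e assume e: "e \<in> F"
      then have "k e dvd ?k" using F by (intro dvd_prodI) auto
      then have d: "int (k e) dvd int ?k" by (simp only: of_nat_dvd_iff)
      have "int ?k \<cdot> e \<in> {0}" by (rule subgrp_zmult_dvd[OF subgrp_zero _ d]) (use k[OF e] in simp)
      then show "int ?k \<cdot> e = 0" by (simp only: singleton_iff)
    qed
    then show ?thesis using span_le_subgrp[OF _ sub] that by blast
  qed
  then have "(\<lambda>x. int ?k \<cdot> x) ` ?H \<subseteq> {0}" by blast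
  ultimately have "?H \<subseteq> sumset ?K {0}" using sumset_mono[OF order.refl] by (metis (no_types, lifting) order.trans)
  then have "?H \<subseteq> ?K" by (auto simp: sumset_def)
  then have "zspan ?G = zspan F" using KH zspan_eq_span[OF Gfin] zspan_eq_span[OF conjunct1[OF F]] by simp
  then show "\<exists>G. finite G \<and> card G \<le> ?r \<and> zspan G = zspan F" using Gfin card by blast
qed

lemma pi_number_prime_power: "prime p \<Longrightarrow> p \<in> S \<Longrightarrow> pi_number S (p ^ k)"
  unfolding pi_number_def using prime_gt_0_nat prime_dvd_power primes_dvd_imp_eq by (metis zero_less_power)

lemma divisible_grp_if_primes:
  assumes "\<And>p x. prime p \<Longrightarrow> x \<in> D \<Longrightarrow> \<exists>y\<in>D. int p \<cdot> y = x" shows "divisible_grp D"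
  unfolding divisible_grp_def
proof (intro allI impI ballI)
  fix n :: nat and x assume "n \<ge> 1" "x \<in> D"
  then show "\<exists>y\<in>D. int n \<cdot> y = x"
  proof (induction n arbitrary: x rule: less_induct)
    case (less n)
    show ?case
    proof (cases "n = 1")
      case True then show ?thesis using less.prems by (auto simp: zmult_1)
    next
      case False
      obtain p j where pj: "prime p" "p dvd n" "n = p * j" "j < n" "j \<ge> 1"
        by (rule prime_factor_split[OF less.prems(1) False])
      obtain y where y: "y \<in> D" "int p \<cdot> y = x" using assms[OF pj(1) less.prems(2)] by blast
      obtain z where z: "z \<in> D" "int j \<cdot> z = y" using less.IH[OF pj(4,5) y(1)] by blast
      have "int n \<cdot> z = x" unfolding pj(3) y(2)[symmetric] z(2)[symmetric] by (simp add: zmult_zmult)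
      then show ?thesis using z(1) by blast
    qed
  qed
qed

subsection \<open>Assembling the primary data\<close>

text \<open>\<open>L\<close> is a finite set of exceptional primes. For
  \<open>p \<in> \<pi>1\<close> the component is split as in \<open>primary_data\<close>; for the
  other \<open>p \<in> L\<close> it is almost contained in \<open>P p\<close> alone, and outside
  \<open>L\<close> it equals \<open>P p\<close>.\<close>

locale primary_decomposition =
  fixes f :: "nat \<Rightarrow> 'a::ab_group_add \<Rightarrow> 'a" and t :: nat and m :: "nat \<Rightarrow> int" and n :: "nat \<Rightarrow> nat"
    and V :: "'a set" and \<pi> \<pi>1 L :: "nat set" and B D P :: "nat \<Rightarrow> 'a set" and g :: "nat \<Rightarrow> nat"
  assumes f: "i < t \<Longrightarrow> endo (f i)"
    and V: "subgrp V" and tf: "v \<in> V \<Longrightarrow> a \<cdot> v = 0 \<Longrightarrow> a = 0 \<or> v = 0"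
    and per: "\<exists>k::nat. k \<ge> 1 \<and> int k \<cdot> x \<in> V"
    and fV: "i < t \<Longrightarrow> v \<in> V \<Longrightarrow> f i v \<in> V" and rat: "i < t \<Longrightarrow> v \<in> V \<Longrightarrow> int (n i) \<cdot> f i v = m i \<cdot> v"
    and n: "i < t \<Longrightarrow> n i \<ge> 1" "i < t \<Longrightarrow> coprime (m i) (int (n i))"
    and \<pi>_eq: "\<pi> = prime_divs (\<Prod>i<t. n i)" and Vdiv: "p \<in> \<pi> \<Longrightarrow> v \<in> V \<Longrightarrow> \<exists>w\<in>V. int p \<cdot> w = v"
    and Vfin: "prime p \<Longrightarrow> almost V ((\<lambda>x. int p \<cdot> x) ` V)" and iso: "iso_Qpi_sum \<pi> V"
    and L: "finite L" "p \<in> L \<Longrightarrow> prime p" and \<pi>1: "\<pi>1 \<subseteq> L" "\<pi> \<subseteq> \<pi>1"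
    and \<pi>_bounded: "p \<in> \<pi> \<Longrightarrow> \<exists>h. \<forall>x\<in>ppart p V. int p ^ h \<cdot> x \<in> V"
    and B: "prime p \<Longrightarrow> subgrp (B p)" "prime p \<Longrightarrow> B p \<subseteq> ppart p {0}"
    and D: "prime p \<Longrightarrow> subgrp (D p)" "prime p \<Longrightarrow> D p \<subseteq> ppart p {0}"
    and P: "prime p \<Longrightarrow> subgrp (P p)" "prime p \<Longrightarrow> V \<subseteq> P p" "prime p \<Longrightarrow> P p \<subseteq> ppart p V"
    and BD: "prime p \<Longrightarrow> B p \<inter> D p \<subseteq> {0}"
    and triv: "prime p \<Longrightarrow> p \<notin> \<pi>1 \<Longrightarrow> B p = {0}" "prime p \<Longrightarrow> p \<notin> \<pi>1 \<Longrightarrow> D p = {0}"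
      "prime p \<Longrightarrow> p \<notin> L \<Longrightarrow> P p = ppart p V"
    and alm: "p \<in> L \<Longrightarrow> almost (ppart p V) (sumset (sumset (B p) (D p)) (P p))"
    and Bb: "p \<in> \<pi>1 \<Longrightarrow> x \<in> B p \<Longrightarrow> int p ^ g p \<cdot> x = 0"
    and Dd: "p \<in> \<pi>1 \<Longrightarrow> x \<in> D p \<Longrightarrow> \<exists>y\<in>D p. int p \<cdot> y = x"
    and Ds: "p \<in> \<pi>1 \<Longrightarrow> finite {x \<in> D p. int p \<cdot> x = 0}"
    and Pb: "p \<in> \<pi>1 \<Longrightarrow> x \<in> P p \<Longrightarrow> x \<in> ppart p {0} \<Longrightarrow> int p ^ g p \<cdot> x = 0"
    and Pd: "p \<in> \<pi>1 \<Longrightarrow> x \<in> P p \<Longrightarrow> \<exists>y\<in>P p. int p \<cdot> y - x \<in> V"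
    and pwB: "i < t \<Longrightarrow> prime p \<Longrightarrow> pw (f i) (B p) {0}" and pwD: "i < t \<Longrightarrow> prime p \<Longrightarrow> pw (f i) (D p) {0}"
    and pwP: "i < t \<Longrightarrow> prime p \<Longrightarrow> pw (f i) (P p) V"
    and iv: "p \<in> \<pi>1 \<Longrightarrow> (\<forall>i<t. \<forall>x\<in>D p. int (n i) \<cdot> f i x = m i \<cdot> x) \<or> P p \<subseteq> V"
begin

lemma pr: "p \<in> \<pi>1 \<Longrightarrow> prime p" using \<pi>1 L by blast
lemma pr': "p \<in> \<pi> \<Longrightarrow> prime p" using \<pi>1 pr by blast

sublocale BF: primary_family "{0}" B
  by standard (use subgrp_zero B subgrp_0[OF B(1)] in simp_all)
sublocale DF: primary_family "{0}" D
  by standard (use subgrp_zero D subgrp_0[OF D(1)] in simp_all)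
sublocale PF: primary_family V P
  by standard (use V P in auto)

definition "BB = glue {0} B"
definition "DD = glue {0} D"
definition "CC = glue V P"
text \<open>\<open>N\<close> kills \<open>B p\<close> and the \<open>p\<close>-torsion of
  \<open>P p\<close> for every \<open>p \<in> \<pi>1\<close>. Hence the multiple \<open>NC\<close>
  of \<open>CC\<close> has no \<open>\<pi>1\<close>-torsion left and serves as \<open>C\<close>,
  with \<open>NV\<close> in the role of \<open>V\<close>.\<close>

definition "N = (\<Prod>p\<in>\<pi>1. p ^ g p)"
definition "NC = (\<lambda>x. int N \<cdot> x) ` CC"
definition "NV = (\<lambda>x. int N \<cdot> x) ` V"
definition "A0 = sumset (sumset BB DD) NC"

lemma BB: "subgrp BB" and DD: "subgrp DD" and CC: "subgrp CC"
  unfolding BB_def DD_def CC_def by (rule BF.subgrp_glue DF.subgrp_glue PF.subgrp_glue)+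

lemma NC: "subgrp NC" unfolding NC_def by (rule subgrp_zmult_image[OF CC])
lemma NV: "subgrp NV" unfolding NV_def by (rule subgrp_zmult_image[OF V])
lemma VC: "V \<subseteq> CC" unfolding CC_def by (rule PF.V_le_glue)
lemma NVC: "NV \<subseteq> NC" unfolding NV_def NC_def using VC by blast

lemma N: "pi_number \<pi>1 N"
proof -
  have "finite \<pi>1" using finite_subset \<pi>1 L by blast
  moreover have "pi_number \<pi>1 (\<Prod>p\<in>S. p ^ g p)" if "finite S" "S \<subseteq> \<pi>1" for S
    using that
  proof (induction S rule: finite_induct)
    case empty then show ?case using pi_number_1 by simp
  next
    case (insert p S)
    then show ?case using pi_number_prime_power[OF pr, of p \<pi>1 "g p"] by (simp add: pi_number_mult)
  qed
  ultimately show ?thesis unfolding N_def by blast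
qed

lemma N1: "N \<ge> 1" using N by (simp add: pi_number_def)

lemma N_kills: "p \<in> \<pi>1 \<Longrightarrow> int p ^ g p \<cdot> x = 0 \<Longrightarrow> int N \<cdot> x = 0"
proof -
  assume p: "p \<in> \<pi>1" and x: "int p ^ g p \<cdot> x = 0"
  have "finite \<pi>1" using finite_subset \<pi>1 L by blast
  then have "p ^ g p dvd N" unfolding N_def using p by (intro dvd_prodI) auto
  then have "int p ^ g p dvd int N" by (metis of_nat_dvd_iff of_nat_power)
  then show ?thesis using subgrp_zmult_dvd[OF subgrp_zero, of "int p ^ g p" x] x by simp
qed

lemma V_torsion_free: "v \<in> V \<Longrightarrow> v \<in> ppart p {0} \<Longrightarrow> prime p \<Longrightarrow> v = 0"
proof -
  assume v: "v \<in> V" "v \<in> ppart p {0}" and p: "prime p"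
  then obtain k where "int p ^ k \<cdot> v = 0" unfolding ppart_def by blast
  then show ?thesis using tf[OF v(1), of "int p ^ k"] prime_gt_0_nat[OF p] by simp
qed

lemma subgrp_kernel_mult: "subgrp {x::'a. a \<cdot> x = 0}"
  by (rule subgrpI) (auto simp: zm.scale_right_diff_distrib)

lemma CC_torsion:
  assumes c: "c \<in> CC" and k: "pi_number \<pi>1 k" "int k \<cdot> c = 0" shows "int N \<cdot> c = 0"
proof -
  have "c \<in> {x. int N \<cdot> x = 0}"
  proof (rule primary_generate[OF subgrp_zero subgrp_kernel_mult])
    show "k \<ge> 1" using k by (simp add: pi_number_def)
    show "int k \<cdot> c \<in> {0}" using k by simp
    fix p a j assume p: "prime p" and "int p ^ j \<cdot> a \<cdot> c \<in> {0}"
    then have ac: "a \<cdot> c \<in> ppart p {0}" unfolding ppart_def by blast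
    have acC: "a \<cdot> c \<in> CC" by (rule subgrp_zmult[OF CC c])
    show "a \<cdot> c \<in> {x. int N \<cdot> x = 0}"
    proof (cases "p \<in> \<pi>1")
      case True
      have "a \<cdot> c \<in> ppart p V" using ac ppart_mono[of "{0}" V p] subgrp_0[OF V] by blast
      then have "a \<cdot> c \<in> P p" using PF.glue_ppart[OF p] acC unfolding CC_def by blast
      then show ?thesis using N_kills[OF True] Pb[OF True _ ac] by blast
    next
      case False
      have "\<not> p dvd k" using False p k(1) by (auto simp: pi_number_def)
      moreover have "int k \<cdot> a \<cdot> c \<in> {0}" using k(2) by (metis insertI1 mult.commute zm.scale_zero_right zmult_zmult)
      ultimately have "a \<cdot> c \<in> {0}" using ppart_coprime[OF subgrp_zero p _ _ ac] by blast
      then show ?thesis by simp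
    qed
  qed simp
  then show ?thesis by simp
qed

lemma NC_torsion_free:
  assumes c: "c \<in> NC" and k: "pi_number \<pi>1 k" "int k \<cdot> c = 0" shows "c = 0"
proof -
  obtain x where x: "x \<in> CC" "c = int N \<cdot> x" using c unfolding NC_def by blast
  have "int (k * N) \<cdot> x = 0" using k(2) x(2) by (simp add: zmult_zmult)
  then show ?thesis using CC_torsion[OF x(1), of "k * N"] k(1) N x(2) by (simp add: pi_number_mult)
qed

lemma BB_bounded: "x \<in> BB \<Longrightarrow> int N \<cdot> x = 0"
proof -
  have "BB \<subseteq> {x. int N \<cdot> x = 0}" unfolding BB_def
  proof (rule BF.glue_le[OF subgrp_kernel_mult])
    show "B p \<subseteq> {x. int N \<cdot> x = 0}" if "prime p" for p
      using Bb N_kills triv(1)[OF that] by (cases "p \<in> \<pi>1") auto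
  qed
  then show "x \<in> BB \<Longrightarrow> int N \<cdot> x = 0" by blast
qed

lemma subgrp_pi_torsion:
  assumes "subgrp W" shows "subgrp {x. \<exists>k. pi_number S k \<and> int k \<cdot> x \<in> W}"
proof (rule subgrpI)
  show "0 \<in> {x. \<exists>k. pi_number S k \<and> int k \<cdot> x \<in> W}" using pi_number_1 subgrp_0[OF assms] by (auto intro!: exI[of _ 1])
  fix x y assume "x \<in> {x. \<exists>k. pi_number S k \<and> int k \<cdot> x \<in> W}" "y \<in> {x. \<exists>k. pi_number S k \<and> int k \<cdot> x \<in> W}"
  then obtain k l where kl: "pi_number S k" "int k \<cdot> x \<in> W" "pi_number S l" "int l \<cdot> y \<in> W" by blast
  have "int (k * l) \<cdot> x \<in> W" by (rule subgrp_zmult_dvd[OF assms kl(2)]) simp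
  moreover have "int (k * l) \<cdot> y \<in> W" by (rule subgrp_zmult_dvd[OF assms kl(4)]) simp
  ultimately have "int (k * l) \<cdot> (x - y) \<in> W" using subgrp_diff[OF assms] by (simp add: zm.scale_right_diff_distrib)
  moreover have "pi_number S (k * l)" using kl by (simp add: pi_number_mult)
  ultimately show "x - y \<in> {x. \<exists>k. pi_number S k \<and> int k \<cdot> x \<in> W}" by blast
qed

lemma pi_torsionI: "x \<in> ppart p W \<Longrightarrow> prime p \<Longrightarrow> p \<in> S \<Longrightarrow> \<exists>k. pi_number S k \<and> int k \<cdot> x \<in> W"
proof -
  assume x: "x \<in> ppart p W" and p: "prime p" "p \<in> S"
  obtain k where "int p ^ k \<cdot> x \<in> W" using x unfolding ppart_def by blast
  then show "\<exists>k. pi_number S k \<and> int k \<cdot> x \<in> W"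
    using pi_number_prime_power[OF p] by (intro exI[of _ "p ^ k"]) simp
qed

text \<open>The component is bounded modulo \<open>V\<close>, so the divisible torsion group
  \<open>D p\<close> lies in the torsion-free \<open>V\<close>.\<close>

lemma D_\<pi>: assumes p: "p \<in> \<pi>" shows "D p = {0}"
proof -
  obtain h where h: "\<forall>x\<in>ppart p V. int p ^ h \<cdot> x \<in> V" using \<pi>_bounded[OF p] by blast
  have pp: "prime p" "p \<in> \<pi>1" using p \<pi>1 pr' by auto
  have "x = 0" if x: "x \<in> D p" for x
  proof -
    have "\<exists>y\<in>D p. int p \<cdot> y - x \<in> {0}" if "x \<in> D p" for x using Dd[OF pp(2) that] by auto
    then obtain z where z: "z 0 = x" "\<forall>k::nat. z k \<in> D p" "\<forall>j k. int p ^ j \<cdot> z (k + j) - z k \<in> {0}"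
      using divisible_sequence[OF subgrp_zero _ x] by blast
    have zh: "z h \<in> ppart p {0}" using z(2) D(2)[OF pp(1)] by blast
    then have "z h \<in> ppart p V" using ppart_mono[of "{0}" V p] subgrp_0[OF V] by blast
    then have "int p ^ h \<cdot> z h \<in> V" using h by blast
    then have "int p ^ h \<cdot> z h = 0"
      using V_torsion_free[OF _ subgrp_zmult[OF subgrp_ppart[OF subgrp_zero] zh] pp(1)] by blast
    then show ?thesis using z(3)[rule_format, of h 0] z(1) by simp
  qed
  then show ?thesis using subgrp_0[OF D(1)[OF pp(1)]] by blast
qed

lemma DD_torsion: "x \<in> DD \<Longrightarrow> \<exists>k. pi_number (\<pi>1 - \<pi>) k \<and> int k \<cdot> x = 0"
proof -
  have "DD \<subseteq> {x. \<exists>k. pi_number (\<pi>1 - \<pi>) k \<and> int k \<cdot> x \<in> {0}}" unfolding DD_def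
  proof (rule DF.glue_le[OF subgrp_pi_torsion[OF subgrp_zero]])
    fix p :: nat assume p: "prime p"
    show "D p \<subseteq> {x. \<exists>k. pi_number (\<pi>1 - \<pi>) k \<and> int k \<cdot> x \<in> {0}}"
    proof (cases "p \<in> \<pi>1 - \<pi>")
      case True
      then show ?thesis using D(2)[OF p] pi_torsionI[OF _ p True] by blast
    next
      case False
      then have "D p = {0}" using triv(2)[OF p] D_\<pi> by blast
      then show ?thesis using subgrp_0[OF subgrp_pi_torsion[OF subgrp_zero]] by (simp only: insert_subset empty_subsetI simp_thms)
    qed
  qed
  then show "x \<in> DD \<Longrightarrow> \<exists>k. pi_number (\<pi>1 - \<pi>) k \<and> int k \<cdot> x = 0" by blast
qed

lemma pi_number_mono: "pi_number S k \<Longrightarrow> S \<subseteq> S' \<Longrightarrow> pi_number S' k"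
  unfolding pi_number_def by blast

lemma BB_DD: "x \<in> BB \<Longrightarrow> x \<in> DD \<Longrightarrow> x = 0"
proof -
  assume x: "x \<in> BB" "x \<in> DD"
  have "x \<in> {0}"
  proof (rule primary_generate[OF subgrp_zero subgrp_zero _ N1])
    show "int N \<cdot> x \<in> {0}" using BB_bounded[OF x(1)] by simp
    fix p c k assume p: "prime p" and "int p ^ k \<cdot> c \<cdot> x \<in> {0}"
    then have cx: "c \<cdot> x \<in> ppart p {0}" unfolding ppart_def by blast
    have "c \<cdot> x \<in> B p" using BF.glue_ppart[OF p _ cx] subgrp_zmult[OF BB x(1)] unfolding BB_def by blast
    moreover have "c \<cdot> x \<in> D p" using DF.glue_ppart[OF p _ cx] subgrp_zmult[OF DD x(2)] unfolding DD_def by blast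
    ultimately show "c \<cdot> x \<in> {0}" using BD[OF p] by blast
  qed simp
  then show ?thesis by simp
qed

lemma direct: "direct3 BB DD NC"
  unfolding direct3_def
proof (intro ballI impI)
  fix b d c assume *: "b \<in> BB" "d \<in> DD" "c \<in> NC" "b + d + c = 0"
  obtain k where k: "pi_number (\<pi>1 - \<pi>) k" "int k \<cdot> d = 0" using DD_torsion[OF *(2)] by blast
  have k1: "pi_number \<pi>1 k" by (rule pi_number_mono[OF k(1)]) blast
  have c: "c = - (b + d)" using *(4) by (metis add.commute eq_neg_iff_add_eq_0)
  have "int (N * k) \<cdot> c = - (int k \<cdot> int N \<cdot> b + int N \<cdot> int k \<cdot> d)" unfolding c by (simp add: zm_simps mult_ac)
  also have "\<dots> = 0" unfolding BB_bounded[OF *(1)] k(2) by simp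
  finally have c0: "c = 0" using NC_torsion_free[OF *(3), of "N * k"] N k1 by (simp add: pi_number_mult)
  then have "b = - d" using *(4) by (simp add: eq_neg_iff_add_eq_0)
  then have "b = 0" using BB_DD[OF *(1)] subgrp_uminus[OF DD *(2)] by simp
  then show "b = 0 \<and> d = 0 \<and> c = 0" using c0 *(4) by simp
qed

lemma comp_A0: "sumset BB DD = comp \<pi>1 A0"
proof
  show "sumset BB DD \<subseteq> comp \<pi>1 A0"
  proof
    fix x assume x: "x \<in> sumset BB DD"
    then obtain b d where bd: "b \<in> BB" "d \<in> DD" "x = b + d" by (rule sumsetE)
    obtain k where k: "pi_number (\<pi>1 - \<pi>) k" "int k \<cdot> d = 0" using DD_torsion[OF bd(2)] by blast
    have "pi_number \<pi>1 (N * k)" using N pi_number_mono[OF k(1), of \<pi>1] by (auto simp: pi_number_mult)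
    moreover have "int (N * k) \<cdot> x = int k \<cdot> int N \<cdot> b + int N \<cdot> int k \<cdot> d" unfolding bd by (simp add: zm_simps mult_ac)
    then have "int (N * k) \<cdot> x = 0" unfolding BB_bounded[OF bd(1)] k(2) by simp
    moreover have "x \<in> A0" unfolding A0_def using x sumset_left[OF subgrp_0[OF NC]] by blast
    ultimately show "x \<in> comp \<pi>1 A0" unfolding comp_def by blast
  qed
  show "comp \<pi>1 A0 \<subseteq> sumset BB DD"
  proof
    fix x assume "x \<in> comp \<pi>1 A0"
    then obtain l where l: "pi_number \<pi>1 l" "int l \<cdot> x = 0" and "x \<in> A0" unfolding comp_def by blast
    then obtain y c where yc: "y \<in> sumset BB DD" "c \<in> NC" "x = y + c" unfolding A0_def by (blast elim: sumsetE)
    obtain b d where bd: "b \<in> BB" "d \<in> DD" "y = b + d" using yc(1) by (rule sumsetE)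
    obtain k where k: "pi_number (\<pi>1 - \<pi>) k" "int k \<cdot> d = 0" using DD_torsion[OF bd(2)] by blast
    have kk: "pi_number \<pi>1 (l * (N * k))" using l N pi_number_mono[OF k(1), of \<pi>1] by (auto simp: pi_number_mult)
    have "int (l * (N * k)) \<cdot> c = int (N * k) \<cdot> int l \<cdot> x - int (l * k) \<cdot> int N \<cdot> b - int (l * N) \<cdot> int k \<cdot> d"
      unfolding yc bd by (simp add: zm_simps mult_ac)
    also have "\<dots> = 0" unfolding BB_bounded[OF bd(1)] k(2) l(2) by simp
    finally have "c = 0" by (rule NC_torsion_free[OF yc(2) kk])
    then show "x \<in> sumset BB DD" using yc by simp
  qed
qed

lemma prime_part_multiple:
  assumes "prime p" "prime q" "p \<noteq> q" "subgrp W" "x \<in> ppart q W"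
  obtains u where "x - int p \<cdot> u \<cdot> x \<in> W"
proof -
  obtain k where k: "int q ^ k \<cdot> x \<in> W" using assms(5) by (auto simp: ppart_def)
  have "coprime (int p) (int q ^ k)"
    using assms(1-3) by (metis coprime_power_right_iff coprime_int_iff primes_coprime)
  then obtain u w where uw: "u * int p + w * int q ^ k = 1" using bezout_coprime by blast
  have "x - int p \<cdot> u \<cdot> x = (u * int p + w * int q ^ k) \<cdot> x - (u * int p) \<cdot> x"
    unfolding uw by (simp add: zmult_zmult zmult_1 mult.commute)
  also have "\<dots> = w \<cdot> int q ^ k \<cdot> x" by (simp add: zm_simps)
  also have "\<dots> \<in> W" by (rule subgrp_zmult[OF assms(4) k])
  finally show thesis by (rule that)
qed

lemma subgrp_divisible_part: assumes "subgrp W" "subgrp S" "W \<subseteq> S"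
  shows "subgrp {x. \<exists>y\<in>S. int p \<cdot> y - x \<in> W}"
proof (rule subgrpI)
  show "0 \<in> {x. \<exists>y\<in>S. int p \<cdot> y - x \<in> W}" using subgrp_0[OF assms(1)] subgrp_0[OF assms(2)] by force
  fix x x' assume "x \<in> {x. \<exists>y\<in>S. int p \<cdot> y - x \<in> W}" "x' \<in> {x. \<exists>y\<in>S. int p \<cdot> y - x \<in> W}"
  then obtain y y' where y: "y \<in> S" "y' \<in> S" "int p \<cdot> y - x \<in> W" "int p \<cdot> y' - x' \<in> W" by blast
  have "int p \<cdot> (y - y') - (x - x') \<in> W" using subgrp_diff[OF assms(1) y(3,4)] by (simp add: zm_simps algebra_simps)
  then show "x - x' \<in> {x. \<exists>y\<in>S. int p \<cdot> y - x \<in> W}" using subgrp_diff[OF assms(2) y(1,2)] by blast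
qed

lemma DD_divisible: assumes p: "prime p" and x: "x \<in> DD" shows "\<exists>y\<in>DD. int p \<cdot> y = x"
proof -
  have "DD \<subseteq> {x. \<exists>y\<in>DD. int p \<cdot> y - x \<in> {0}}" unfolding DD_def
  proof (rule DF.glue_le[OF subgrp_divisible_part])
    fix q :: nat assume q: "prime q"
    show "D q \<subseteq> {x. \<exists>y\<in>glue {0} D. int p \<cdot> y - x \<in> {0}}"
    proof clarify
      fix x assume x: "x \<in> D q"
      show "\<exists>y\<in>glue {0} D. int p \<cdot> y - x \<in> {0}"
      proof (cases "q = p")
        case True
        then show ?thesis
        proof (cases "p \<in> \<pi>1")
          case True
          then obtain y where "y \<in> D p" "int p \<cdot> y = x" using Dd[OF True] x \<open>q = p\<close> by blast
          then show ?thesis using DF.H_le_glue[OF p] by auto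
        next
          case False
          then have "x = 0" using triv(2)[OF p] x \<open>q = p\<close> by auto
          then show ?thesis using subgrp_0[OF DF.subgrp_glue] by (intro bexI[of _ 0]) auto
        qed
      next
        case False
        have "x \<in> ppart q {0}" using D(2)[OF q] x by blast
        then obtain u where "x - int p \<cdot> u \<cdot> x \<in> {0}" using prime_part_multiple[OF p q _ subgrp_zero] False by metis
        moreover have "u \<cdot> x \<in> glue {0} D" using DF.H_le_glue[OF q] subgrp_zmult[OF D(1)[OF q] x] by blast
        ultimately show ?thesis by (intro bexI[of _ "u \<cdot> x"]) auto
      qed
    qed
  qed (use DF.subgrp_glue subgrp_zero DF.V_le_glue in auto)
  then show ?thesis using x by auto
qed

lemma CC_divisible: assumes p: "p \<in> \<pi>1" and x: "x \<in> CC" shows "\<exists>y\<in>CC. int p \<cdot> y - x \<in> V"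
proof -
  have pp: "prime p" by (rule pr[OF p])
  have "CC \<subseteq> {x. \<exists>y\<in>CC. int p \<cdot> y - x \<in> V}" unfolding CC_def
  proof (rule PF.glue_le[OF subgrp_divisible_part])
    fix q :: nat assume q: "prime q"
    show "P q \<subseteq> {x. \<exists>y\<in>glue V P. int p \<cdot> y - x \<in> V}"
    proof clarify
      fix x assume x: "x \<in> P q"
      show "\<exists>y\<in>glue V P. int p \<cdot> y - x \<in> V"
      proof (cases "q = p")
        case True
        then obtain y where "y \<in> P p" "int p \<cdot> y - x \<in> V" using Pd[OF p] x by blast
        then show ?thesis using PF.H_le_glue[OF pp] by auto
      next
        case False
        have "x \<in> ppart q V" using P(3)[OF q] x by blast
        then obtain u where "x - int p \<cdot> u \<cdot> x \<in> V" using prime_part_multiple[OF pp q _ V] False by metis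
        then have "int p \<cdot> u \<cdot> x - x \<in> V" using subgrp_diff_commute[OF V] by blast
        moreover have "u \<cdot> x \<in> glue V P" using PF.H_le_glue[OF q] subgrp_zmult[OF P(1)[OF q] x] by blast
        ultimately show ?thesis by blast
      qed
    qed
  qed (use PF.subgrp_glue V PF.V_le_glue in auto)
  then show ?thesis using x by auto
qed

lemma CC_divisible_number:
  assumes "pi_number \<pi>1 k" "x \<in> CC" shows "\<exists>y\<in>CC. \<exists>v\<in>V. x = int k \<cdot> y + v"
proof -
  have "CC \<subseteq> sumset V ((\<lambda>x. int k \<cdot> x) ` CC)"
  proof (rule multiplication_generates[OF V VC CC _ assms(1)])
    fix p assume p: "p \<in> \<pi>1"
    show "CC \<subseteq> sumset V ((\<lambda>x. int p \<cdot> x) ` CC)"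
    proof
      fix x assume "x \<in> CC"
      then obtain y where y: "y \<in> CC" "int p \<cdot> y - x \<in> V" using CC_divisible[OF p] by blast
      have "- (int p \<cdot> y - x) + int p \<cdot> y \<in> sumset V ((\<lambda>x. int p \<cdot> x) ` CC)"
        by (intro sumsetI imageI subgrp_uminus[OF V] y)
      then show "x \<in> sumset V ((\<lambda>x. int p \<cdot> x) ` CC)" by simp
    qed
  qed
  then have "x \<in> sumset V ((\<lambda>x. int k \<cdot> x) ` CC)" using assms(2) by blast
  then obtain v w where vw: "v \<in> V" "w \<in> (\<lambda>x. int k \<cdot> x) ` CC" "x = v + w" by (rule sumsetE)
  then obtain y where "y \<in> CC" "w = int k \<cdot> y" by blast
  then have "x = int k \<cdot> y + v" using vw(3) by (simp add: add.commute)
  then show ?thesis using vw(1) \<open>y \<in> CC\<close> by blast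
qed

lemma Qpi_module_NC: "Qpi_module \<pi> NC"
  unfolding Qpi_module_def
proof (intro conjI ballI NC)
  fix p x assume p: "p \<in> \<pi>" and x: "x \<in> NC"
  have p1: "p \<in> \<pi>1" using p \<pi>1 by blast
  obtain c where c: "c \<in> CC" "x = int N \<cdot> c" using x unfolding NC_def by blast
  obtain y where y: "y \<in> CC" "int p \<cdot> y - c \<in> V" using CC_divisible[OF p1 c(1)] by blast
  \<comment> \<open>The error of divisibility lies in \<open>V\<close>, which is itself
    \<open>p\<close>-divisible; correcting by \<open>w\<close> makes the division by
    \<open>p\<close> exact.\<close>
  obtain w where w: "w \<in> V" "int p \<cdot> w = int p \<cdot> y - c" using Vdiv[OF p y(2)] by blast
  have "int p \<cdot> int N \<cdot> (y - w) = int N \<cdot> (int p \<cdot> y - int p \<cdot> w)" by (simp add: zm_simps mult.commute)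
  also have "\<dots> = x" unfolding w(2) c(2) by simp
  finally have "int p \<cdot> int N \<cdot> (y - w) = x" .
  moreover have "y - w \<in> CC" using y(1) w(1) VC by (intro subgrp_diff[OF CC]) auto
  then have "int N \<cdot> (y - w) \<in> NC" unfolding NC_def by (rule imageI)
  moreover have "z = z'" if "z \<in> NC" "z' \<in> NC" "int p \<cdot> z = x" "int p \<cdot> z' = x" for z z'
  proof -
    have "int p \<cdot> (z - z') = 0" using that by (simp add: zm.scale_right_diff_distrib)
    then have "z - z' = 0"
      using NC_torsion_free[OF subgrp_diff[OF NC that(1,2)], of p] pi_number_prime_power[OF pr[OF p1] p1, of 1] by simp
    then show ?thesis by simp
  qed
  ultimately show "\<exists>!y. y \<in> NC \<and> int p \<cdot> y = x" by blast
qed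

lemma pw_BB: "i < t \<Longrightarrow> pw (f i) BB {0}"
  unfolding BB_def by (rule BF.pw_glue[OF f _ pwB]) (auto simp: endo_0[OF f])

lemma pw_DD: "i < t \<Longrightarrow> pw (f i) DD {0}"
  unfolding DD_def by (rule DF.pw_glue[OF f _ pwD]) (auto simp: endo_0[OF f])

lemma pw_CC: "i < t \<Longrightarrow> pw (f i) CC V"
  unfolding CC_def by (rule PF.pw_glue[OF f fV pwP])

lemma pw_NC: assumes i: "i < t" shows "pw (f i) NC NV"
  unfolding pw_def
proof
  fix x assume "x \<in> NC"
  then obtain c where c: "c \<in> CC" "x = int N \<cdot> c" unfolding NC_def by blast
  obtain a where a: "f i c - a \<cdot> c \<in> V" using pw_CC[OF i] c(1) unfolding pw_def by blast
  have "f i x - a \<cdot> x = int N \<cdot> (f i c - a \<cdot> c)" unfolding c using f[OF i] by (simp add: endo_zmult zm_simps mult.commute)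
  then show "\<exists>a. f i x - a \<cdot> x \<in> NV" using a unfolding NV_def by blast
qed

lemma NC_periodic: "x \<in> NC \<Longrightarrow> \<exists>k. pi_number (- \<pi>) k \<and> int k \<cdot> x \<in> NV"
proof -
  assume "x \<in> NC"
  then obtain c where c: "c \<in> CC" "x = int N \<cdot> c" unfolding NC_def by blast
  have "CC \<subseteq> {x. \<exists>k. pi_number (- \<pi>) k \<and> int k \<cdot> x \<in> V}" unfolding CC_def
  proof (rule PF.glue_le[OF subgrp_pi_torsion[OF V]])
    fix p :: nat assume p: "prime p"
    show "P p \<subseteq> {x. \<exists>k. pi_number (- \<pi>) k \<and> int k \<cdot> x \<in> V}"
    proof (cases "p \<in> \<pi>")
      case False
      then show ?thesis using P(3)[OF p] pi_torsionI[OF _ p, of _ V "- \<pi>"] by blast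
    next
      case True
      then have p1: "p \<in> \<pi>1" using \<pi>1 by blast
      obtain h where h: "\<forall>x\<in>ppart p V. int p ^ h \<cdot> x \<in> V" using \<pi>_bounded[OF True] by blast
      \<comment> \<open>For \<open>p \<in> \<pi>\<close> the section \<open>P p / V\<close> is
        divisible and bounded, hence trivial.\<close>
      have "x \<in> V" if x: "x \<in> P p" for x
      proof -
        obtain z where z: "z 0 = x" "\<forall>k::nat. z k \<in> P p" "\<forall>j k. int p ^ j \<cdot> z (k + j) - z k \<in> V"
          by (rule divisible_sequence[OF V Pd[OF p1] x])
        have "int p ^ h \<cdot> z h \<in> V" using h z(2) P(3)[OF p] by blast
        moreover have "int p ^ h \<cdot> z h - x \<in> V" using z(3)[rule_format, of h 0] z(1) by simp
        ultimately have "int p ^ h \<cdot> z h - (int p ^ h \<cdot> z h - x) \<in> V" by (rule subgrp_diff[OF V])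
        then show ?thesis by simp
      qed
      then show ?thesis using pi_number_1 by (force simp: zmult_1 intro!: exI[of _ 1])
    qed
  qed
  then obtain k where k: "pi_number (- \<pi>) k" "int k \<cdot> c \<in> V" using c(1) by blast
  have "int k \<cdot> x = int N \<cdot> int k \<cdot> c" unfolding c by (simp add: zmult_zmult mult.commute)
  then show ?thesis using k unfolding NV_def by blast
qed

lemma NC_divisible: assumes "p \<in> \<pi>1" "x \<in> NC" shows "\<exists>y\<in>NC. int p \<cdot> y - x \<in> NV"
proof -
  obtain c where c: "c \<in> CC" "x = int N \<cdot> c" using assms(2) unfolding NC_def by blast
  obtain y where y: "y \<in> CC" "int p \<cdot> y - c \<in> V" using CC_divisible[OF assms(1) c(1)] by blast
  have "int p \<cdot> int N \<cdot> y - x = int N \<cdot> (int p \<cdot> y - c)" unfolding c by (simp add: zm_simps mult.commute)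
  then show ?thesis using y unfolding NC_def NV_def by blast
qed

lemma inj_N: "inj_on (\<lambda>x. int N \<cdot> x) V"
proof (rule inj_onI)
  fix x y assume xy: "x \<in> V" "y \<in> V" "int N \<cdot> x = int N \<cdot> y"
  then have "int N \<cdot> (x - y) = 0" by (simp add: zm.scale_right_diff_distrib)
  then have "x - y = 0" using tf[OF subgrp_diff[OF V xy(1,2)], of "int N"] N1 by auto
  then show "x = y" by simp
qed

lemma iso_NV: "iso_Qpi_sum \<pi> NV"
proof -
  obtain k h where h: "bij_betw h (Qpi_vec \<pi> k) V"
    "\<forall>a\<in>Qpi_vec \<pi> k. \<forall>b\<in>Qpi_vec \<pi> k. h (\<lambda>j. a j + b j) = h a + h b"
    using iso unfolding iso_Qpi_sum_def by blast
  have "bij_betw (\<lambda>x. int N \<cdot> x) V NV" unfolding NV_def bij_betw_def using inj_N by simp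
  then have "bij_betw ((\<lambda>x. int N \<cdot> x) \<circ> h) (Qpi_vec \<pi> k) NV" by (rule bij_betw_trans[OF h(1)])
  moreover have "\<forall>a\<in>Qpi_vec \<pi> k. \<forall>b\<in>Qpi_vec \<pi> k.
    ((\<lambda>x. int N \<cdot> x) \<circ> h) (\<lambda>j. a j + b j) = ((\<lambda>x. int N \<cdot> x) \<circ> h) a + ((\<lambda>x. int N \<cdot> x) \<circ> h) b"
    using h(2) by (simp add: zmult_add_right)
  ultimately show ?thesis unfolding iso_Qpi_sum_def by blast
qed

lemma prime_divs_n: "i < t \<Longrightarrow> prime_divs (n i) \<subseteq> \<pi>"
  unfolding \<pi>_eq prime_divs_def by (auto intro: dvd_trans dvd_prodI)

lemma NV_divisible: "p \<in> \<pi> \<Longrightarrow> x \<in> NV \<Longrightarrow> \<exists>y\<in>NV. int p \<cdot> y = x"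
proof -
  assume p: "p \<in> \<pi>" and "x \<in> NV"
  then obtain v where v: "v \<in> V" "x = int N \<cdot> v" unfolding NV_def by blast
  obtain w where w: "w \<in> V" "int p \<cdot> w = v" using Vdiv[OF p v(1)] by blast
  have "int p \<cdot> int N \<cdot> w = x" unfolding v w(2)[symmetric] by (simp add: zmult_zmult mult.commute)
  then show ?thesis using w(1) unfolding NV_def by blast
qed

lemma NV_V: "NV \<subseteq> V" unfolding NV_def using subgrp_zmult[OF V] by blast

lemma acts_ratmult_NV: assumes i: "i < t" shows "acts_ratmult (f i) (m i) (n i) NV"
  unfolding acts_ratmult_def
proof (intro conjI ballI)
  show "f i ` NV \<subseteq> NV" using fV[OF i] endo_zmult[OF f[OF i]] unfolding NV_def by (auto intro!: imageI)
  show "n i \<ge> 1" "coprime (m i) (int (n i))" using n[OF i] by auto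
  show "pi_divisible (prime_divs (n i)) NV" unfolding pi_divisible_def using NV_divisible prime_divs_n[OF i] by blast
  show "comp (prime_divs (n i)) NV \<subseteq> {0}"
  proof
    fix x assume "x \<in> comp (prime_divs (n i)) NV"
    then obtain k where "x \<in> NV" "k > 0" "int k \<cdot> x = 0" unfolding comp_def pi_number_def by blast
    then show "x \<in> {0}" using tf[of x "int k"] NV_V by auto
  qed
  show "f i (int (n i) \<cdot> x) = m i \<cdot> x" if "x \<in> NV" for x
    using rat[OF i, of x] that NV_V endo_zmult[OF f[OF i]] by auto
qed

lemma comp_DD: assumes p: "prime p" and x: "x \<in> comp {p} DD" shows "x \<in> D p"
proof -
  obtain k where k: "x \<in> DD" "pi_number {p} k" "int k \<cdot> x = 0" using x unfolding comp_def by blast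
  have "k \<ge> 1" using k(2) by (simp add: pi_number_def)
  then obtain j M where jM: "k = p ^ j * M" "\<not> p dvd M" by (rule prime_power_split[OF p])
  have "M = 1"
  proof (rule ccontr)
    assume "M \<noteq> 1"
    then obtain q where q: "prime q" "q dvd M" using prime_factor_nat by blast
    then have "q = p" using k(2) jM(1) by (auto simp: pi_number_def)
    then show False using q jM(2) by simp
  qed
  then have "int p ^ j \<cdot> x \<in> {0}" using jM(1) k(3) by simp
  then have "x \<in> ppart p {0}" unfolding ppart_def by blast
  then show ?thesis using DF.glue_ppart[OF p] k(1) unfolding DD_def by blast
qed

text \<open>Each element of \<open>CC\<close> has a multiple prime to \<open>p\<close> in
  \<open>V\<close>, so the \<open>p\<close>-component of \<open>NC / NV\<close> is even trivial.
  Read backwards, an infinite component forces the fractional alternative in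
  \<open>iv\<close>.\<close>

lemma sec_pcomp_finite:
  assumes p: "p \<in> \<pi>1" "P p \<subseteq> V" shows "finite {coset x NV | x. x \<in> sec_pcomp p NC NV}"
proof -
  have pp: "prime p" by (rule pr[OF p(1)])
  let ?K = "{x. \<exists>k. pi_number (- {p}) k \<and> int k \<cdot> x \<in> V}"
  have "CC \<subseteq> ?K" unfolding CC_def
  proof (rule PF.glue_le[OF subgrp_pi_torsion[OF V]])
    fix q :: nat assume q: "prime q"
    show "P q \<subseteq> ?K"
    proof (cases "q = p")
      case True
      then show ?thesis using p(2) pi_number_1 by (force simp: zmult_1 intro!: exI[of _ 1])
    next
      case False
      then show ?thesis using P(3)[OF q] pi_torsionI[OF _ q, of _ V "- {p}"] by blast
    qed
  qed
  have "sec_pcomp p NC NV \<subseteq> NV"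
  proof
    fix x assume "x \<in> sec_pcomp p NC NV"
    then obtain j c where jc: "c \<in> CC" "x = int N \<cdot> c" "int p ^ j \<cdot> x \<in> NV" unfolding sec_pcomp_def NC_def by blast
    obtain k where k: "pi_number (- {p}) k" "int k \<cdot> c \<in> V" using \<open>CC \<subseteq> ?K\<close> jc(1) by blast
    have "\<not> p dvd k" using k(1) pp by (auto simp: pi_number_def)
    moreover have "int k \<cdot> x = int N \<cdot> int k \<cdot> c" unfolding jc by (simp add: zmult_zmult mult.commute)
    then have "int k \<cdot> x \<in> NV" using k(2) unfolding NV_def by blast
    moreover have "x \<in> ppart p NV" using jc(3) unfolding ppart_def by blast
    ultimately show "x \<in> NV" by (rule ppart_coprime[OF NV pp])
  qed
  then show ?thesis using almost_iff_cosets[OF NV] almost_subset by blast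
qed

lemma acts_ratmult_DD:
  assumes i: "i < t" and p: "prime p" and inf: "infinite {coset x NV | x. x \<in> sec_pcomp p NC NV}"
  shows "acts_ratmult (f i) (m i) (n i) (comp {p} DD)"
proof -
  have DDinv: "f i x \<in> DD" if "x \<in> DD" for x
    by (rule pw_invariant[OF pw_DD[OF i] DD _ that]) (use subgrp_0[OF DD] in simp)
  have eq: "int (n i) \<cdot> f i x = m i \<cdot> x" if x: "x \<in> D p" for x
  proof (cases "p \<in> \<pi>1")
    case True
    then have "\<not> P p \<subseteq> V" using sec_pcomp_finite inf by blast
    then show ?thesis using iv[OF True] i x by blast
  next
    case False
    then have "x = 0" using triv(2)[OF p] x by blast
    then show ?thesis using endo_0[OF f[OF i]] by simp
  qed
  show ?thesis unfolding acts_ratmult_def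
  proof (intro conjI ballI)
    show "f i ` comp {p} DD \<subseteq> comp {p} DD"
    proof clarify
      fix x assume "x \<in> comp {p} DD"
      then obtain k where k: "x \<in> DD" "pi_number {p} k" "int k \<cdot> x = 0" unfolding comp_def by blast
      have "int k \<cdot> f i x = 0" using k(3) endo_zmult[OF f[OF i], of "int k" x] endo_0[OF f[OF i]] by simp
      then show "f i x \<in> comp {p} DD" unfolding comp_def using k DDinv by blast
    qed
    show "n i \<ge> 1" "coprime (m i) (int (n i))" using n[OF i] by auto
    show "pi_divisible (prime_divs (n i)) (comp {p} DD)" unfolding pi_divisible_def
    proof (intro ballI)
      fix q x assume q: "q \<in> prime_divs (n i)" and x: "x \<in> comp {p} DD"
      have q\<pi>: "q \<in> \<pi>" using q prime_divs_n[OF i] by blast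
      have xD: "x \<in> D p" by (rule comp_DD[OF p x])
      show "\<exists>y\<in>comp {p} DD. int q \<cdot> y = x"
      proof (cases "q = p")
        case True
        then have "x = 0" using D_\<pi>[OF q\<pi>] xD by auto
        then show ?thesis using x by (intro bexI[of _ x]) simp_all
      next
        case False
        have "x \<in> ppart p {0}" using D(2)[OF p] xD by blast
        then obtain u where u: "x - int q \<cdot> u \<cdot> x \<in> {0}"
          using prime_part_multiple[OF pr'[OF q\<pi>] p False subgrp_zero] by metis
        obtain k where k: "x \<in> DD" "pi_number {p} k" "int k \<cdot> x = 0" using x unfolding comp_def by blast
        have "int k \<cdot> u \<cdot> x = 0" using k(3) by (metis mult.commute zm.scale_zero_right zmult_zmult)
        then have "u \<cdot> x \<in> comp {p} DD" unfolding comp_def using k subgrp_zmult[OF DD k(1)] by blast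
        moreover have "int q \<cdot> u \<cdot> x = x" using u by simp
        ultimately show ?thesis by blast
      qed
    qed
    show "comp (prime_divs (n i)) (comp {p} DD) \<subseteq> {0}"
    proof
      fix x assume "x \<in> comp (prime_divs (n i)) (comp {p} DD)"
      then obtain r where r: "x \<in> comp {p} DD" "pi_number (prime_divs (n i)) r" "int r \<cdot> x = 0" unfolding comp_def by blast
      have xD: "x \<in> D p" by (rule comp_DD[OF p r(1)])
      show "x \<in> {0}"
      proof (cases "p \<in> \<pi>")
        case True then show ?thesis using D_\<pi> xD by blast
      next
        case False
        have "\<not> p dvd r" using False p r(2) prime_divs_n[OF i] by (auto simp: pi_number_def)
        then show ?thesis using ppart_coprime[OF subgrp_zero p, of r x] r(3) xD D(2)[OF p] by blast
      qed
    qed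
    show "f i (int (n i) \<cdot> x) = m i \<cdot> x" if "x \<in> comp {p} DD" for x
      using eq[OF comp_DD[OF p that]] endo_zmult[OF f[OF i]] by simp
  qed
qed

lemma finite_rank_DD: "finite_rank DD"
proof (rule finite_rank_if_finite_socles[OF DD])
  show "finite \<pi>1" using finite_subset \<pi>1 L by blast
  show "\<forall>x\<in>DD. \<exists>k. pi_number \<pi>1 k \<and> int k \<cdot> x = 0" using DD_torsion pi_number_mono[of "\<pi>1 - \<pi>" _ \<pi>1] by blast
  fix p assume p: "p \<in> \<pi>1"
  have "{x \<in> DD. int p \<cdot> x = 0} \<subseteq> {x \<in> D p. int p \<cdot> x = 0}"
  proof clarify
    fix x assume x: "x \<in> DD" "int p \<cdot> x = 0"
    have "x \<in> comp {p} DD" unfolding comp_def using x pi_number_prime_power[OF pr[OF p], of "{p}" 1] by auto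
    then show "x \<in> D p" by (rule comp_DD[OF pr[OF p]])
  qed
  then show "finite {x \<in> DD. int p \<cdot> x = 0}" using Ds[OF p] finite_subset by blast
qed

text \<open>By the choice of \<open>L\<close> the sum of \<open>BB\<close>, \<open>DD\<close> and
  \<open>CC\<close> has finite index. Replacing \<open>CC\<close> by \<open>NC\<close> costs
  finitely many cosets because \<open>CC = V + NC\<close> and \<open>V / NV\<close> is
  finite.\<close>

lemma A0_index: "almost UNIV A0"
proof -
  let ?R = "sumset BB DD"
  let ?K = "sumset ?R CC"
  have R: "subgrp ?R" by (rule subgrp_sumset[OF BB DD])
  have K: "subgrp ?K" by (rule subgrp_sumset[OF R CC])
  have CK: "CC \<subseteq> ?K" by (rule sumset_right[OF subgrp_0[OF R]])
  have "almost UNIV ?K"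
  proof (rule almost_UNIV_primary[OF V per L(1) K])
    show "V \<subseteq> ?K" using VC CK by blast
    show "ppart p V \<subseteq> ?K" if "prime p" "p \<notin> L" for p
      using PF.H_le_glue[OF that(1)] triv(3)[OF that] CK unfolding CC_def by blast
    show "almost (ppart p V) ?K" if "p \<in> L" for p
      using BF.H_le_glue[OF L(2)[OF that]] DF.H_le_glue[OF L(2)[OF that]] PF.H_le_glue[OF L(2)[OF that]]
      unfolding BB_def DD_def CC_def by (intro almost_mono[OF alm[OF that] order.refl] sumset_mono)
  qed
  moreover have "almost CC NC"
  proof -
    have NVN: "almost V ((\<lambda>x. int N \<cdot> x) ` V)"
    proof -
      have "almost V ((\<lambda>x. int k \<cdot> x) ` V)" if "k \<ge> 1" for k :: nat
        using that
      proof (induction k rule: less_induct)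
        case (less k)
        show ?case
        proof (cases "k = 1")
          case True then show ?thesis by (intro almost_subset) (simp add: zmult_1)
        next
          case False
          obtain p j where pj: "prime p" "p dvd k" "k = p * j" "j < k" "j \<ge> 1"
            by (rule prime_factor_split[OF less.prems False])
          have "almost ((\<lambda>x. int j \<cdot> x) ` V) ((\<lambda>x. int j \<cdot> x) ` (\<lambda>x. int p \<cdot> x) ` V)"
            by (intro almost_image endo_zmult_const Vfin pj)
          moreover have "(\<lambda>x. int j \<cdot> x) ` (\<lambda>x. int p \<cdot> x) ` V = (\<lambda>x. int k \<cdot> x) ` V"
            by (simp add: image_image zmult_zmult pj(3) mult.commute)
          ultimately show ?thesis using almost_trans[OF less.IH[OF pj(4,5)]] by simp
        qed
      qed
      then show ?thesis using N1 by blast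
    qed
    have "CC \<subseteq> sumset V NC"
    proof
      fix x assume "x \<in> CC"
      then obtain y v where "y \<in> CC" "v \<in> V" "x = int N \<cdot> y + v" using CC_divisible_number[OF N] by blast
      then have "v + int N \<cdot> y \<in> sumset V NC" unfolding NC_def by (intro sumsetI imageI)
      then show "x \<in> sumset V NC" using \<open>x = int N \<cdot> y + v\<close> by (simp add: add.commute)
    qed
    moreover have "almost V NC" using NVN NVC unfolding NV_def by (rule almost_mono[OF _ order.refl])
    then have "almost (sumset V NC) NC" by (intro almost_sumset_same NC almost_subset[of NC NC] order.refl)
    ultimately show ?thesis by (meson almost_mono order.refl)
  qed
  then have "almost ?K A0" unfolding A0_def by (intro almost_sumset almost_subset[of ?R ?R] order.refl)
  ultimately show ?thesis by (rule almost_trans)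
qed

theorem mixed_structure:
  "subgrp A0 \<and> finite_index A0 \<and>
   subgrp BB \<and> subgrp DD \<and> subgrp NC \<and> A0 = sumset (sumset BB DD) NC \<and> direct3 BB DD NC \<and>
   finite \<pi>1 \<and> \<pi> \<subseteq> \<pi>1 \<and> (\<forall>p\<in>\<pi>1. prime p) \<and>
   sumset BB DD = comp \<pi>1 A0 \<and> bounded_grp BB \<and>
   divisible_grp DD \<and> pi_group (- \<pi>) DD \<and> finite_rank DD \<and>
   Qpi_module \<pi> NC \<and> (\<forall>i<t. f i ` NC \<subseteq> NC) \<and>
   subgrp NV \<and> NV \<subseteq> NC \<and> pi_divisible \<pi> NV \<and> iso_Qpi_sum \<pi> NV \<and>
   (\<forall>x\<in>NC. \<exists>n. pi_number (- \<pi>) n \<and> zmult (int n) x \<in> NV) \<and>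
   (\<forall>p\<in>\<pi>1. \<forall>x\<in>NC. \<exists>y\<in>NC. zmult (int p) y - x \<in> NV) \<and>
   (\<forall>i<t. acts_mult (f i) BB {0} \<and> acts_mult (f i) DD {0} \<and>
      (\<exists>m n. acts_ratmult (f i) m n NV) \<and> acts_mult (f i) NC NV) \<and>
   (\<forall>i<t. acts_ratmult (f i) (m i) (n i) NV \<and>
      (\<forall>p. prime p \<and> infinite {coset x NV | x. x \<in> sec_pcomp p NC NV} \<longrightarrow>
         acts_ratmult (f i) (m i) (n i) (comp {p} DD)))"
proof (intro conjI)
  show A0: "subgrp A0" unfolding A0_def by (intro subgrp_sumset BB DD NC)
  show "finite_index A0" using finite_index_iff[OF A0] A0_index by blast
  show "finite \<pi>1" using finite_subset \<pi>1 L by blast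
  show "\<forall>p\<in>\<pi>1. prime p" using pr by blast
  show "bounded_grp BB" unfolding bounded_grp_def using N1 BB_bounded by blast
  show "divisible_grp DD" by (rule divisible_grp_if_primes[OF DD_divisible])
  show "pi_group (- \<pi>) DD" unfolding pi_group_def using DD_torsion pi_number_mono[of "\<pi>1 - \<pi>" _ "- \<pi>"] by blast
  show "\<forall>i<t. f i ` NC \<subseteq> NC" using pw_invariant[OF pw_NC NC NVC] by blast
  show "pi_divisible \<pi> NV" unfolding pi_divisible_def using NV_divisible by blast
  show "\<forall>x\<in>NC. \<exists>n. pi_number (- \<pi>) n \<and> int n \<cdot> x \<in> NV" using NC_periodic by blast
  show "\<forall>p\<in>\<pi>1. \<forall>x\<in>NC. \<exists>y\<in>NC. int p \<cdot> y - x \<in> NV" using NC_divisible by blast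
  show "\<forall>i<t. acts_mult (f i) BB {0} \<and> acts_mult (f i) DD {0} \<and>
      (\<exists>m n. acts_ratmult (f i) m n NV) \<and> acts_mult (f i) NC NV"
  proof (intro allI impI conjI)
    fix i assume i: "i < t"
    have per0: "\<exists>k::nat. k \<ge> 1 \<and> int k \<cdot> x \<in> {0}" if "x \<in> glue {0} H" for x :: 'a and H
      using that unfolding glue_def by blast
    show "acts_mult (f i) BB {0}"
      by (rule acts_mult_if_pw[OF f[OF i] BB subgrp_zero _ pw_BB[OF i]])
        (use subgrp_0[OF BB] per0 in \<open>auto simp: BB_def\<close>)
    show "acts_mult (f i) DD {0}"
      by (rule acts_mult_if_pw[OF f[OF i] DD subgrp_zero _ pw_DD[OF i]])
        (use subgrp_0[OF DD] per0 in \<open>auto simp: DD_def\<close>)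
    show "\<exists>m n. acts_ratmult (f i) m n NV" using acts_ratmult_NV[OF i] by blast
    show "acts_mult (f i) NC NV"
    proof (rule acts_mult_if_pw[OF f[OF i] NC NV NVC pw_NC[OF i]])
      fix x assume "x \<in> NC"
      then obtain k where "pi_number (- \<pi>) k" "int k \<cdot> x \<in> NV" using NC_periodic by blast
      then show "\<exists>k::nat. k \<ge> 1 \<and> int k \<cdot> x \<in> NV" unfolding pi_number_def by (auto simp: Suc_le_eq)
    qed
  qed
  show "\<forall>i<t. acts_ratmult (f i) (m i) (n i) NV \<and>
      (\<forall>p. prime p \<and> infinite {coset x NV | x. x \<in> sec_pcomp p NC NV} \<longrightarrow>
         acts_ratmult (f i) (m i) (n i) (comp {p} DD))"
    using acts_ratmult_NV acts_ratmult_DD by blast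
qed (rule BB DD NC NV A0_def direct \<pi>1(2) comp_A0 finite_rank_DD Qpi_module_NC NVC iso_NV)+

end

subsection \<open>Choosing the primary data\<close>

text \<open>The flag \<open>fl\<close> records whether the part of \<open>Y\<close> in the component
  is bounded over \<open>V\<close>. If so, \<open>primary_data\<close> splits the component; if not,
  \<open>primary_pw_unbounded\<close> gives multiplications on it up to finite index. The final
  clause records unboundedness, so that the primes in \<open>\<pi>\<close> can be assigned to the
  first alternative.\<close>

lemma primary_case:
  fixes f :: "nat \<Rightarrow> 'a::ab_group_add \<Rightarrow> 'a" and n m :: "nat \<Rightarrow> int"
  assumes f: "\<And>i. i < t \<Longrightarrow> endo (f i)" "\<And>i. i < t \<Longrightarrow> inertial (f i)" and p: "prime p"
    and V: "subgrp V" and tf: "\<forall>v\<in>V. \<forall>a. a \<cdot> v = 0 \<longrightarrow> a = 0 \<or> v = 0"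
    and Vfin: "almost V ((\<lambda>x. int p \<cdot> x) ` V)"
    and nm: "\<And>i v. i < t \<Longrightarrow> v \<in> V \<Longrightarrow> n i \<cdot> f i v = m i \<cdot> v"
    and fV: "\<And>i v. i < t \<Longrightarrow> v \<in> V \<Longrightarrow> f i v \<in> V"
    and Y: "subgrp Y" "V \<subseteq> Y" and pwY: "\<And>i. i < t \<Longrightarrow> pw (f i) Y V"
    and soc: "almost {x. \<exists>p::nat. prime p \<and> int p \<cdot> x \<in> Y} Y"
  shows "\<exists>B D P g fl. subgrp B \<and> subgrp D \<and> subgrp P \<and> V \<subseteq> P \<and> P \<subseteq> ppart p V \<and>
    B \<subseteq> ppart p {0} \<and> D \<subseteq> ppart p {0} \<and> B \<inter> D \<subseteq> {0} \<and>
    almost (ppart p V) (sumset (sumset B D) P) \<and>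
    (\<forall>i<t. pw (f i) B {0} \<and> pw (f i) D {0} \<and> pw (f i) P V) \<and>
    (if fl then (\<forall>x\<in>B. int p ^ g \<cdot> x = 0) \<and> (\<forall>x\<in>D. \<exists>y\<in>D. int p \<cdot> y = x) \<and> finite {x \<in> D. int p \<cdot> x = 0} \<and>
      (\<forall>x\<in>P \<inter> ppart p {0}. int p ^ g \<cdot> x = 0) \<and> (\<forall>x\<in>P. \<exists>y\<in>P. int p \<cdot> y - x \<in> V) \<and>
      ((\<forall>i<t. \<forall>x\<in>D. n i \<cdot> f i x = m i \<cdot> x) \<or> P \<subseteq> V)
     else B = {0} \<and> D = {0} \<and> \<not> (\<exists>h. \<forall>x\<in>ppart p V. int p ^ h \<cdot> x \<in> V))"
proof -
  let ?W = "ppart p V"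
  have W: "subgrp ?W" by (rule subgrp_ppart[OF V])
  let ?Y = "Y \<inter> ?W"
  have Yp: "subgrp ?Y" "V \<subseteq> ?Y" "?Y \<subseteq> ?W" using subgrp_Int[OF Y(1) W] Y(2) ppart_base by auto
  have pwYp: "pw (f i) ?Y V" if "i < t" for i by (rule pw_subset[OF pwY[OF that]]) auto
  have socp: "almost {x \<in> ?W. int p \<cdot> x \<in> ?Y} ?Y"
    by (intro almost_Int Y(1) W almost_mono[OF soc] almost_subset) (use p in auto)
  have Vp: "V \<subseteq> ?W" by (rule ppart_base)
  show ?thesis
  proof (cases "\<exists>h. \<forall>y\<in>?Y. int p ^ h \<cdot> y \<in> V")
    case True
    then obtain h where h: "\<forall>y\<in>?Y. int p ^ h \<cdot> y \<in> V" by blast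
    have f': "\<And>i. i \<in> {..<t} \<Longrightarrow> endo (f i)" "\<And>i. i \<in> {..<t} \<Longrightarrow> inertial (f i)"
      "\<And>i v. i \<in> {..<t} \<Longrightarrow> v \<in> V \<Longrightarrow> f i v \<in> V"
      "\<And>i v. i \<in> {..<t} \<Longrightarrow> v \<in> V \<Longrightarrow> n i \<cdot> f i v = m i \<cdot> v" using f fV nm by auto
    obtain D' Y0 where DY: "subgrp D'" "V \<subseteq> D'" "D' \<subseteq> ?W" "subgrp Y0" "V \<subseteq> Y0" "Y0 \<subseteq> ?Y"
      "Y0 \<inter> D' \<subseteq> V" "almost ?W (sumset D' Y0)" "\<forall>x\<in>D'. \<exists>y\<in>D'. int p \<cdot> y - x \<in> V"
      "almost {x \<in> D'. int p \<cdot> x \<in> V} V" "\<forall>i\<in>{..<t}. pw (f i) D' V"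
      by (rule primary_structure_bounded[OF f'(1,2) p V f'(3) Yp socp h])
    have Y0W: "Y0 \<subseteq> ?W" using DY(6) by blast
    have pwY0: "\<forall>i\<in>{..<t}. pw (f i) Y0 V" using pw_subset[OF pwYp DY(6) order.refl] by blast
    have bd: "\<forall>y\<in>Y0. int p ^ h \<cdot> y \<in> V" using h DY(6) by blast
    have "\<exists>B D P g. subgrp B \<and> subgrp D \<and> subgrp P \<and> V \<subseteq> P \<and> P \<subseteq> ppart p V \<and>
      B \<subseteq> ppart p {0} \<and> D \<subseteq> ppart p {0} \<and> B \<inter> D \<subseteq> {0} \<and>
      almost (ppart p V) (sumset (sumset B D) P) \<and> (\<forall>x\<in>B. int p ^ g \<cdot> x = 0) \<and>
      (\<forall>x\<in>D. \<exists>y\<in>D. int p \<cdot> y = x) \<and> finite {x \<in> D. int p \<cdot> x = 0} \<and>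
      (\<forall>i\<in>{..<t}. pw (f i) B {0} \<and> pw (f i) D {0} \<and> pw (f i) P V) \<and>
      (\<forall>x\<in>P \<inter> ppart p {0}. int p ^ g \<cdot> x = 0) \<and> (\<forall>x\<in>P. \<exists>y\<in>P. int p \<cdot> y - x \<in> V) \<and>
      ((\<forall>i\<in>{..<t}. \<forall>x\<in>D. n i \<cdot> f i x = m i \<cdot> x) \<or> P \<subseteq> V)"
      by (rule primary_data[OF f'(1) p V tf Vfin f'(4) DY(1-3) DY(4,5) Y0W DY(7-11) pwY0 bd])
    then obtain B D P g where data: "subgrp B \<and> subgrp D \<and> subgrp P \<and> V \<subseteq> P \<and> P \<subseteq> ppart p V \<and>
      B \<subseteq> ppart p {0} \<and> D \<subseteq> ppart p {0} \<and> B \<inter> D \<subseteq> {0} \<and>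
      almost (ppart p V) (sumset (sumset B D) P) \<and> (\<forall>x\<in>B. int p ^ g \<cdot> x = 0) \<and>
      (\<forall>x\<in>D. \<exists>y\<in>D. int p \<cdot> y = x) \<and> finite {x \<in> D. int p \<cdot> x = 0} \<and>
      (\<forall>i\<in>{..<t}. pw (f i) B {0} \<and> pw (f i) D {0} \<and> pw (f i) P V) \<and>
      (\<forall>x\<in>P \<inter> ppart p {0}. int p ^ g \<cdot> x = 0) \<and> (\<forall>x\<in>P. \<exists>y\<in>P. int p \<cdot> y - x \<in> V) \<and>
      ((\<forall>i\<in>{..<t}. \<forall>x\<in>D. n i \<cdot> f i x = m i \<cdot> x) \<or> P \<subseteq> V)"
      by (elim exE)
    have "(\<forall>i\<in>{..<t}. \<forall>x\<in>D. n i \<cdot> f i x = m i \<cdot> x) \<or> P \<subseteq> V" using data by (elim conjE)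
    then have iv: "(\<forall>i<t. \<forall>x\<in>D. n i \<cdot> f i x = m i \<cdot> x) \<or> P \<subseteq> V"
      by (rule disj_forward) (simp_all only: Ball_def lessThan_iff)
    show ?thesis
      by (rule exI[of _ B], rule exI[of _ D], rule exI[of _ P], rule exI[of _ g], rule exI[of _ True])
        (use data iv in simp)
  next
    case False
    then have unb: "\<forall>h. \<exists>y\<in>?Y. int p ^ h \<cdot> y \<notin> V" by blast
    have tors: "\<exists>k. int p ^ k \<cdot> x \<in> ?Y" if x: "x \<in> ?W" for x
    proof -
      obtain k where "int p ^ k \<cdot> x \<in> V" using x unfolding ppart_def by blast
      then show ?thesis using Yp(2) by blast
    qed
    obtain e where e: "\<forall>j. \<forall>x\<in>?W. \<exists>y\<in>?W. int p ^ e \<cdot> x - int p ^ (e + j) \<cdot> y \<in> ?Y"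
      "almost ?W (sumset ((\<lambda>x. int p ^ e \<cdot> x) ` ?W) ?Y)"
      by (rule finite_socle_divisible[OF W Yp(1,3) tors socp])
    \<comment> \<open>Adding \<open>?Y\<close> to this multiple gives a subgroup that almost
      contains the component and is \<open>p\<close>-divisible modulo \<open>?Y\<close>, as
      \<open>primary_pw_unbounded\<close> requires.\<close>
    let ?M = "(\<lambda>x. int p ^ e \<cdot> x) ` ?W"
    let ?Z = "sumset ?M ?Y"
    have M: "subgrp ?M" by (rule subgrp_zmult_image[OF W])
    have Z: "subgrp ?Z" by (rule subgrp_sumset[OF M Yp(1)])
    have MZ: "?M \<subseteq> ?Z" and YZ: "?Y \<subseteq> ?Z" using sumset_left[OF subgrp_0[OF Yp(1)]] sumset_right[OF subgrp_0[OF M]] by blast+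
    have ZW: "?Z \<subseteq> ?W" by (rule sumset_subset[OF W]) (use subgrp_zmult[OF W] in auto)
    have Zdiv: "\<forall>x\<in>?Z. \<exists>y\<in>?Z. x - int p \<cdot> y \<in> ?Y"
    proof
      fix x assume "x \<in> ?Z"
      then obtain w y where w: "w \<in> ?W" "y \<in> ?Y" "x = int p ^ e \<cdot> w + y" by (blast elim: sumsetE)
      obtain w' where w': "w' \<in> ?W" "int p ^ e \<cdot> w - int p ^ (e + 1) \<cdot> w' \<in> ?Y" using e(1) w(1) by blast
      have "(int p ^ e \<cdot> w - int p ^ (e + 1) \<cdot> w') + y \<in> ?Y" by (rule subgrp_add[OF Yp(1) w'(2) w(2)])
      moreover have "(int p ^ e \<cdot> w - int p ^ (e + 1) \<cdot> w') + y = x - int p \<cdot> int p ^ e \<cdot> w'"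
        unfolding w(3) by (simp add: zmult_zmult)
      ultimately have "x - int p \<cdot> int p ^ e \<cdot> w' \<in> ?Y" by (simp only:)
      moreover have "int p ^ e \<cdot> w' \<in> ?Z" using w'(1) MZ by blast
      ultimately show "\<exists>y\<in>?Z. x - int p \<cdot> y \<in> ?Y" by blast
    qed
    have We: "\<forall>x\<in>?W. int p ^ e \<cdot> x \<in> ?Z" using MZ by blast
    have pwZ: "pw (f i) ?Z V" if i: "i < t" for i
      by (rule primary_pw_unbounded[OF f(1)[OF i] f(2)[OF i] p V fV[OF i] Yp(1,2) pwYp[OF i] unb Z YZ ZW Zdiv We])
    have pw0: "pw (f i) {0} {0}" if "i < t" for i
      using endo_0[OF f(1)[OF that]] by (simp add: pw_def)
    have nb: "\<not> (\<exists>h. \<forall>x\<in>?W. int p ^ h \<cdot> x \<in> V)" using False Yp(3) by blast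
    have zero: "{0} \<subseteq> ppart p {0::'a}" by (rule ppart_base)
    have alm: "almost ?W (sumset (sumset {0} {0}) ?Z)"
      by (rule almost_mono[OF e(2) order.refl]) (rule sumset_right, simp add: sumset_def)
    have VZ: "V \<subseteq> ?Z" using Yp(2) YZ by blast
    show ?thesis
      by (rule exI[of _ "{0}"], rule exI[of _ "{0}"], rule exI[of _ ?Z], rule exI[of _ 0], rule exI[of _ False])
        (simp only: if_False simp_thms subgrp_zero Z VZ ZW zero alm nb Int_absorb order.refl, use pw0 pwZ in blast)
  qed
qed

lemma ppart_le:
  assumes "subgrp Y" "V \<subseteq> Y" "\<And>x. int p \<cdot> x \<in> Y \<Longrightarrow> x \<in> Y" shows "ppart p V \<subseteq> Y"
proof
  fix x assume "x \<in> ppart p V"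
  then obtain k where "int p ^ k \<cdot> x \<in> V" unfolding ppart_def by blast
  then have "int p ^ k \<cdot> x \<in> Y" using assms(2) by blast
  then show "x \<in> Y"
  proof (induction k arbitrary: x)
    case 0 then show ?case by (simp add: zmult_1)
  next
    case (Suc k)
    have "int p ^ k \<cdot> int p \<cdot> x \<in> Y" using Suc.prems by (simp add: zmult_zmult mult.commute)
    then have "int p \<cdot> x \<in> Y" by (rule Suc.IH)
    then show ?case by (rule assms(3))
  qed
qed

text \<open>Elements chosen for two different primes \<open>p\<close> and \<open>q\<close> are
  incongruent modulo \<open>Y\<close>, since otherwise \<open>p\<close> and \<open>q\<close> would
  both carry the same element into \<open>Y\<close>. So there are at most as many primes as cosets
  in the socle.\<close>

lemma finite_socle_primes:
  assumes Y: "subgrp Y" and soc: "almost {x. \<exists>p::nat. prime p \<and> int p \<cdot> x \<in> Y} Y"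
  shows "finite {p::nat. prime p \<and> (\<exists>x. x \<notin> Y \<and> int p \<cdot> x \<in> Y)}"
proof -
  let ?K = "{x. \<exists>p::nat. prime p \<and> int p \<cdot> x \<in> Y}" and ?S = "{p::nat. prime p \<and> (\<exists>x. x \<notin> Y \<and> int p \<cdot> x \<in> Y)}"
  have "\<exists>c. finite (c ` ?K) \<and> (\<forall>x\<in>?K. x - c x \<in> Y)" by (rule almostE[OF soc]) blast
  then obtain c where "finite (c ` ?K) \<and> (\<forall>x\<in>?K. x - c x \<in> Y)" ..
  then have c: "finite (c ` ?K)" "\<And>x. x \<in> ?K \<Longrightarrow> x - c x \<in> Y" by blast+
  define x where "x p = (SOME x. x \<notin> Y \<and> int p \<cdot> x \<in> Y)" for p :: nat
  have x: "x p \<notin> Y \<and> int p \<cdot> x p \<in> Y" if "p \<in> ?S" for p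
    unfolding x_def by (rule someI_ex) (use that in blast)
  have xK: "x p \<in> ?K" if "p \<in> ?S" for p using x[OF that] that by blast
  have "inj_on (\<lambda>p. c (x p)) ?S"
  proof (rule inj_onI, rule ccontr)
    fix p q assume p: "p \<in> ?S" and q: "q \<in> ?S" and eq: "c (x p) = c (x q)" and ne: "p \<noteq> q"
    have "(x p - c (x p)) - (x q - c (x q)) \<in> Y" by (intro subgrp_diff[OF Y] c xK p q)
    then have d: "x p - x q \<in> Y" using eq by simp
    have "int q \<cdot> (x p - x q) + int q \<cdot> x q \<in> Y" using x[OF q] by (intro subgrp_add[OF Y subgrp_zmult[OF Y d]]) blast
    then have "int q \<cdot> x p \<in> Y" by (simp add: zm.scale_right_diff_distrib)
    moreover have "coprime (int p) (int q)" using p q ne by (simp add: primes_coprime)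
    ultimately have "x p \<in> Y" using subgrp_coprime[OF Y] x[OF p] by blast
    then show False using x[OF p] by blast
  qed
  moreover have "(\<lambda>p. c (x p)) ` ?S \<subseteq> c ` ?K" using xK by blast
  ultimately show ?thesis using inj_on_finite c(1) by blast
qed

text \<open>Intersecting the subgroups found for the single maps keeps the socle finite. Outside the
  finitely many primes of this socle the component lies in the intersection, where all maps already
  act by multiplications.\<close>

lemma primary_decomposition_exists:
  fixes f :: "nat \<Rightarrow> 'a::ab_group_add \<Rightarrow> 'a" and m :: "nat \<Rightarrow> int" and n :: "nat \<Rightarrow> nat"
  assumes f: "\<And>i. i < t \<Longrightarrow> endo (f i)" "\<And>i. i < t \<Longrightarrow> inertial (f i)"
    and V: "subgrp V" and tf: "\<forall>v\<in>V. \<forall>a. a \<cdot> v = 0 \<longrightarrow> a = 0 \<or> v = 0"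
    and per: "\<And>x. \<exists>k::nat. k \<ge> 1 \<and> int k \<cdot> x \<in> V"
    and fV: "\<And>i v. i < t \<Longrightarrow> v \<in> V \<Longrightarrow> f i v \<in> V"
    and rat: "\<And>i v. i < t \<Longrightarrow> v \<in> V \<Longrightarrow> int (n i) \<cdot> f i v = m i \<cdot> v"
    and n: "\<And>i. i < t \<Longrightarrow> n i \<ge> 1" "\<And>i. i < t \<Longrightarrow> coprime (m i) (int (n i))"
    and \<pi>_eq: "\<pi> = prime_divs (\<Prod>i<t. n i)" and Vdiv: "\<And>p v. p \<in> \<pi> \<Longrightarrow> v \<in> V \<Longrightarrow> \<exists>w\<in>V. int p \<cdot> w = v"
    and Vfin: "\<And>p. prime p \<Longrightarrow> almost V ((\<lambda>x. int p \<cdot> x) ` V)" and iso: "iso_Qpi_sum \<pi> V"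
    and \<pi>_bounded: "\<And>p. p \<in> \<pi> \<Longrightarrow> \<exists>h. \<forall>x\<in>ppart p V. int p ^ h \<cdot> x \<in> V"
  shows "\<exists>\<pi>1 L B D P g. primary_decomposition f t m n V \<pi> \<pi>1 L B D P g"
proof -
  have "\<exists>Y. subgrp Y \<and> V \<subseteq> Y \<and> pw (f i) Y V \<and> almost {x. \<exists>p::nat. prime p \<and> int p \<cdot> x \<in> Y} Y" if i: "i < t" for i
  proof -
    obtain Y where "subgrp Y" "V \<subseteq> Y" "Y \<subseteq> UNIV" "pw (f i) Y V"
      "almost {x \<in> UNIV. \<exists>p::nat. prime p \<and> int p \<cdot> x \<in> Y} Y"
      by (rule inertial_pw_finite_socle[OF f(1)[OF i] f(2)[OF i] V subgrp_UNIV _ fV[OF i] _ per]) simp_all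
    then show ?thesis by (intro exI[of _ Y]) simp
  qed
  then have "\<forall>i\<in>{..<t}. \<exists>Y. subgrp Y \<and> V \<subseteq> Y \<and> pw (f i) Y V \<and> almost {x. \<exists>p::nat. prime p \<and> int p \<cdot> x \<in> Y} Y" by simp
  then obtain Ys where Ys: "\<forall>i\<in>{..<t}. subgrp (Ys i) \<and> V \<subseteq> Ys i \<and> pw (f i) (Ys i) V \<and>
      almost {x. \<exists>p::nat. prime p \<and> int p \<cdot> x \<in> Ys i} (Ys i)" by (rule bchoice[THEN exE])
  let ?Y = "\<Inter>i\<in>{..<t}. Ys i"
  have Y: "subgrp ?Y" "V \<subseteq> ?Y" using Ys by (auto intro!: subgrp_INT)
  have pwY: "pw (f i) ?Y V" if "i < t" for i
    by (rule pw_subset[of "f i" "Ys i" V]) (use Ys that in auto)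
  have soc: "almost {x. \<exists>p::nat. prime p \<and> int p \<cdot> x \<in> ?Y} ?Y"
  proof (rule almost_INT)
    show "almost {x. \<exists>p::nat. prime p \<and> int p \<cdot> x \<in> ?Y} (Ys i)" if "i \<in> {..<t}" for i
      by (rule almost_mono[of "{x. \<exists>p::nat. prime p \<and> int p \<cdot> x \<in> Ys i}"]) (use Ys that in auto)
  qed (use Ys in auto)
  let ?\<sigma> = "{p::nat. prime p \<and> (\<exists>x. x \<notin> ?Y \<and> int p \<cdot> x \<in> ?Y)}"
  have \<sigma>: "finite ?\<sigma>" by (rule finite_socle_primes[OF Y(1) soc])
  have "(\<Prod>i<t. n i) > 0" using n(1) by (intro prod_pos) (auto simp: Suc_le_eq)
  then have \<pi>: "finite \<pi>" "\<And>p. p \<in> \<pi> \<Longrightarrow> prime p"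
    unfolding \<pi>_eq prime_divs_def using finite_subset[of "{p. prime p \<and> p dvd (\<Prod>i<t. n i)}" "{..\<Prod>i<t. n i}"]
    by (auto dest: dvd_imp_le)
  \<comment> \<open>The primes of \<open>\<pi>\<close> are included so that they can belong to
    \<open>\<pi>1\<close>, a subset of \<open>L\<close>.\<close>
  define L where "L = ?\<sigma> \<union> \<pi>"
  have L: "finite L" "\<And>p. p \<in> L \<Longrightarrow> prime p" using \<sigma> \<pi> by (auto simp: L_def)
  define pd where "pd p B D P g fl \<longleftrightarrow> subgrp B \<and> subgrp D \<and> subgrp P \<and> V \<subseteq> P \<and> P \<subseteq> ppart p V \<and>
    B \<subseteq> ppart p {0} \<and> D \<subseteq> ppart p {0} \<and> B \<inter> D \<subseteq> {0} \<and>
    almost (ppart p V) (sumset (sumset B D) P) \<and>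
    (\<forall>i<t. pw (f i) B {0} \<and> pw (f i) D {0} \<and> pw (f i) P V) \<and>
    (if fl then (\<forall>x\<in>B. int p ^ g \<cdot> x = 0) \<and> (\<forall>x\<in>D. \<exists>y\<in>D. int p \<cdot> y = x) \<and> finite {x \<in> D. int p \<cdot> x = 0} \<and>
      (\<forall>x\<in>P \<inter> ppart p {0}. int p ^ g \<cdot> x = 0) \<and> (\<forall>x\<in>P. \<exists>y\<in>P. int p \<cdot> y - x \<in> V) \<and>
      ((\<forall>i<t. \<forall>x\<in>D. int (n i) \<cdot> f i x = m i \<cdot> x) \<or> P \<subseteq> V)
     else B = {0} \<and> D = {0} \<and> \<not> (\<exists>h. \<forall>x\<in>ppart p V. int p ^ h \<cdot> x \<in> V))" for p B D P g fl
  have "\<exists>q. pd p (fst q) (fst (snd q)) (fst (snd (snd q))) (fst (snd (snd (snd q)))) (snd (snd (snd (snd q))))"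
    if p: "prime p" for p
  proof -
    have "\<exists>B D P g fl. pd p B D P g fl"
      unfolding pd_def by (rule primary_case[OF f p V tf Vfin[OF p] rat fV Y pwY soc])
    then obtain B D P g fl where "pd p B D P g fl" by (elim exE)
    then show ?thesis by (intro exI[of _ "(B, D, P, g, fl)"]) simp
  qed
  then obtain q where q: "\<And>p. prime p \<Longrightarrow> pd p (fst (q p)) (fst (snd (q p))) (fst (snd (snd (q p))))
      (fst (snd (snd (snd (q p))))) (snd (snd (snd (snd (q p)))))" by metis
  define B D P g fl where "B p = fst (q p)" and "D p = fst (snd (q p))" and "P p = fst (snd (snd (q p)))"
    and "g p = fst (snd (snd (snd (q p))))" and "fl p = snd (snd (snd (snd (q p))))" for p
  have pd: "pd p (B p) (D p) (P p) (g p) (fl p)" if "prime p" for p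
    using q[OF that] by (simp only: B_def D_def P_def g_def fl_def)
  define B' where "B' p = (if p \<in> L then B p else {0})" for p
  define D' where "D' p = (if p \<in> L then D p else {0})" for p
  define P' where "P' p = (if p \<in> L then P p else ppart p V)" for p
  define \<pi>1 where "\<pi>1 = {p \<in> L. fl p}"
  have pdL: "pd p (B p) (D p) (P p) (g p) (fl p)" if "p \<in> L" for p using pd L that by blast
  have base: "subgrp (B p)" "subgrp (D p)" "subgrp (P p)" "V \<subseteq> P p" "P p \<subseteq> ppart p V" "B p \<subseteq> ppart p {0}"
    "D p \<subseteq> ppart p {0}" "B p \<inter> D p \<subseteq> {0}" "almost (ppart p V) (sumset (sumset (B p) (D p)) (P p))"
    "\<forall>i<t. pw (f i) (B p) {0} \<and> pw (f i) (D p) {0} \<and> pw (f i) (P p) V" if "p \<in> L" for p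
    using pdL[OF that] unfolding pd_def by blast+
  have yes: "\<forall>x\<in>B p. int p ^ g p \<cdot> x = 0" "\<forall>x\<in>D p. \<exists>y\<in>D p. int p \<cdot> y = x" "finite {x \<in> D p. int p \<cdot> x = 0}"
      "\<forall>x\<in>P p \<inter> ppart p {0}. int p ^ g p \<cdot> x = 0" "\<forall>x\<in>P p. \<exists>y\<in>P p. int p \<cdot> y - x \<in> V"
      "(\<forall>i<t. \<forall>x\<in>D p. int (n i) \<cdot> f i x = m i \<cdot> x) \<or> P p \<subseteq> V" if "p \<in> \<pi>1" for p
    using pdL[of p] that unfolding pd_def \<pi>1_def by simp_all
  have no: "B p = {0}" "D p = {0}" "\<not> (\<exists>h. \<forall>x\<in>ppart p V. int p ^ h \<cdot> x \<in> V)" if "p \<in> L" "p \<notin> \<pi>1" for p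
    using pdL[of p] that unfolding pd_def \<pi>1_def by simp_all
  have \<pi>\<pi>1: "\<pi> \<subseteq> \<pi>1"
  proof
    fix p assume p: "p \<in> \<pi>"
    then have "p \<in> L" by (simp add: L_def)
    then show "p \<in> \<pi>1" using no(3) \<pi>_bounded[OF p] by blast
  qed
  have PY: "ppart p V \<subseteq> ?Y" if "prime p" "p \<notin> L" for p
    by (rule ppart_le[OF Y]) (use that in \<open>auto simp: L_def\<close>)
  have zero: "{0} \<subseteq> ppart p {0::'a}" for p by (rule ppart_base)
  have pw0: "pw (f i) {0} {0}" if "i < t" for i
    using endo_0[OF f(1)[OF that]] by (simp add: pw_def)
  have \<pi>1L: "p \<in> L" if "p \<in> \<pi>1" for p using that by (simp add: \<pi>1_def)
  have "primary_decomposition f t m n V \<pi> \<pi>1 L B' D' P' g"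
  proof
    show "endo (f i)" if "i < t" for i using f(1) that .
    show "subgrp V" by (rule V)
    show "a = 0 \<or> v = 0" if "v \<in> V" "a \<cdot> v = 0" for v a using tf that by blast
    show "\<exists>k\<ge>1. int k \<cdot> x \<in> V" for x by (rule per)
    show "f i v \<in> V" if "i < t" "v \<in> V" for i v using fV that .
    show "int (n i) \<cdot> f i v = m i \<cdot> v" if "i < t" "v \<in> V" for i v using rat that .
    show "n i \<ge> 1" if "i < t" for i using n(1) that .
    show "coprime (m i) (int (n i))" if "i < t" for i using n(2) that .
    show "\<pi> = prime_divs (\<Prod>i<t. n i)" by (rule \<pi>_eq)
    show "\<exists>w\<in>V. int p \<cdot> w = v" if "p \<in> \<pi>" "v \<in> V" for p v using Vdiv that .
    show "almost V ((\<lambda>x. int p \<cdot> x) ` V)" if "prime p" for p using Vfin that .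
    show "iso_Qpi_sum \<pi> V" by (rule iso)
    show "finite L" by (rule L)
    show "prime p" if "p \<in> L" for p using L(2) that .
    show "\<pi>1 \<subseteq> L" by (auto simp: \<pi>1_def)
    show "\<pi> \<subseteq> \<pi>1" by (rule \<pi>\<pi>1)
    show "\<exists>h. \<forall>x\<in>ppart p V. int p ^ h \<cdot> x \<in> V" if "p \<in> \<pi>" for p using \<pi>_bounded that .
    show "subgrp (B' p)" if "prime p" for p using base(1) by (simp add: B'_def subgrp_zero)
    show "B' p \<subseteq> ppart p {0}" if "prime p" for p using base(6) zero by (simp add: B'_def)
    show "subgrp (D' p)" if "prime p" for p using base(2) by (simp add: D'_def subgrp_zero)
    show "D' p \<subseteq> ppart p {0}" if "prime p" for p using base(7) zero by (simp add: D'_def)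
    show "subgrp (P' p)" if "prime p" for p using base(3) subgrp_ppart[OF V] by (simp add: P'_def)
    show "V \<subseteq> P' p" if "prime p" for p using base(4) by (simp add: P'_def ppart_base)
    show "P' p \<subseteq> ppart p V" if "prime p" for p using base(5) by (simp add: P'_def)
    show "B' p \<inter> D' p \<subseteq> {0}" if "prime p" for p using base(8) by (simp add: B'_def D'_def)
    show "B' p = {0}" if "prime p" "p \<notin> \<pi>1" for p using no(1) that by (simp add: B'_def)
    show "D' p = {0}" if "prime p" "p \<notin> \<pi>1" for p using no(2) that by (simp add: D'_def)
    show "P' p = ppart p V" if "prime p" "p \<notin> L" for p using that by (simp add: P'_def)
    show "almost (ppart p V) (sumset (sumset (B' p) (D' p)) (P' p))" if "p \<in> L" for p
      using base(9)[OF that] that by (simp add: B'_def D'_def P'_def)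
    show "int p ^ g p \<cdot> x = 0" if "p \<in> \<pi>1" "x \<in> B' p" for p x
      using yes(1)[OF that(1)] that(2) \<pi>1L[OF that(1)] by (simp add: B'_def)
    show "\<exists>y\<in>D' p. int p \<cdot> y = x" if "p \<in> \<pi>1" "x \<in> D' p" for p x
      using yes(2)[OF that(1)] that(2) \<pi>1L[OF that(1)] by (simp add: D'_def)
    show "finite {x \<in> D' p. int p \<cdot> x = 0}" if "p \<in> \<pi>1" for p
      using yes(3)[OF that(1)] \<pi>1L[OF that(1)] by (simp add: D'_def)
    show "int p ^ g p \<cdot> x = 0" if "p \<in> \<pi>1" "x \<in> P' p" "x \<in> ppart p {0}" for p x
      using yes(4)[OF that(1)] that(2,3) \<pi>1L[OF that(1)] by (simp add: P'_def)
    show "\<exists>y\<in>P' p. int p \<cdot> y - x \<in> V" if "p \<in> \<pi>1" "x \<in> P' p" for p x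
      using yes(5)[OF that(1)] that(2) \<pi>1L[OF that(1)] by (simp add: P'_def)
    show "pw (f i) (B' p) {0}" if "i < t" "prime p" for i p using base(10) pw0 that by (simp add: B'_def)
    show "pw (f i) (D' p) {0}" if "i < t" "prime p" for i p using base(10) pw0 that by (simp add: D'_def)
    show "pw (f i) (P' p) V" if "i < t" "prime p" for i p
    proof (cases "p \<in> L")
      case True
      then show ?thesis using base(10) that(1) by (simp add: P'_def)
    next
      case False
      then show ?thesis using pw_subset[OF pwY[OF that(1)] PY[OF that(2) False] order.refl] by (simp add: P'_def)
    qed
    show "(\<forall>i<t. \<forall>x\<in>D' p. int (n i) \<cdot> f i x = m i \<cdot> x) \<or> P' p \<subseteq> V" if "p \<in> \<pi>1" for p
      using yes(6)[OF that(1)] \<pi>1L[OF that(1)] by (simp add: P'_def D'_def)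
  qed
  then show ?thesis by blast
qed

subsection \<open>The ratio of an inertial endomorphism\<close>

definition tors :: "'a::ab_group_add \<Rightarrow> bool" where
  "tors x \<longleftrightarrow> (\<exists>c. c \<noteq> 0 \<and> c \<cdot> x = 0)"

lemma tors_zmultD: "c \<noteq> 0 \<Longrightarrow> tors (c \<cdot> x) \<Longrightarrow> tors x"
  unfolding tors_def by (auto simp: zmult_zmult intro: exI[of _ "_ * c"])

text \<open>Among the multiples of \<open>f x\<close> two are congruent modulo the cyclic group
  generated by \<open>x\<close>.\<close>

lemma inertial_multiple:
  assumes f: "endo f" "inertial f"
  obtains k a where "k \<noteq> 0" "k \<cdot> f x = a \<cdot> x"
proof -
  let ?X = "range (\<lambda>c. c \<cdot> x)"
  have X: "subgrp ?X"
    by (rule subgrpI) (auto simp: zm.scale_left_diff_distrib[symmetric] intro: rev_image_eqI[of 0])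
  have "int k \<cdot> f x \<in> f ` ?X" for k :: nat using endo_zmult[OF f(1)] by (metis rangeI image_eqI)
  then obtain l k :: nat where lk: "l < k" "int k \<cdot> f x - int l \<cdot> f x \<in> ?X"
    using almost_pigeonhole[OF X inertialD[OF f(2) X], of 0 "\<lambda>k. int k \<cdot> f x"] by blast
  then obtain a where "(int k - int l) \<cdot> f x = a \<cdot> x" by (auto simp: zm.scale_left_diff_distrib)
  then show thesis using that[of "int k - int l"] lk(1) by simp
qed

text \<open>Two elements of infinite order have the same ratio: for independent elements this
  follows from the ratio of their sum, otherwise it is transferred along a common multiple. The last
  clause excludes proper denominators in a periodic group.\<close>

lemma inertial_ratio:
  fixes f :: "'a::ab_group_add \<Rightarrow> 'a"
  assumes f: "endo f" "inertial f"
  shows "\<exists>m n. (n::nat) \<ge> 1 \<and> coprime m (int n) \<and> (\<forall>y. tors (int n \<cdot> f y - m \<cdot> y)) \<and>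
    (n = 1 \<or> (\<exists>x::'a. \<not> tors x))"
proof (cases "\<exists>x::'a. \<not> tors x")
  case False
  then have "\<forall>y. tors (f y)" by blast
  \<comment> \<open>In a periodic group every fraction would do; \<open>0 / 1\<close> brings no
    prime into \<open>\<pi>\<close>.\<close>
  then show ?thesis by (intro exI[of _ "0::int"] exI[of _ "1::nat"]) simp
next
  case True
  then obtain x :: 'a where x: "\<not> tors x" by blast
  have x0: "a = 0" if "a \<cdot> x = 0" for a using x that unfolding tors_def by blast
  obtain K \<alpha> where K: "K \<noteq> 0" "K \<cdot> f x = \<alpha> \<cdot> x" by (rule inertial_multiple[OF f])
  have "\<exists>n m. (n::nat) \<ge> 1 \<and> coprime m (int n) \<and> m * K = \<alpha> * int n"
  proof -
    let ?g = "gcd \<alpha> K"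
    have g: "?g \<noteq> 0" using K(1) by simp
    \<comment> \<open>Lowest terms with positive denominator; the sign of \<open>K\<close> moves to
      the numerator.\<close>
    define m n where "m = sgn K * (\<alpha> div ?g)" and "n = nat (\<bar>K div ?g\<bar>)"
    have eq: "\<alpha> = \<alpha> div ?g * ?g" "K = K div ?g * ?g" by simp_all
    have Kg: "K div ?g \<noteq> 0" using eq(2) K(1) by (metis mult_zero_left)
    have sgn: "sgn (K div ?g) = sgn K"
    proof -
      have "sgn K = sgn (K div ?g) * sgn ?g" by (metis eq(2) sgn_mult)
      moreover have "sgn ?g = 1" using g by (simp add: sgn_if)
      ultimately show ?thesis by simp
    qed
    have n: "int n = sgn K * (K div ?g)" 
    proof -
      have "int n = \<bar>K div ?g\<bar>" unfolding n_def by simp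
      then show ?thesis by (metis abs_sgn mult.commute sgn)
    qed
    have "coprime (\<alpha> div ?g) (K div ?g)" using g by (intro div_gcd_coprime) auto
    then have "coprime m (int n)" unfolding m_def n using K(1) by (auto simp: sgn_if)
    moreover have "m * K = \<alpha> * int n"
    proof -
      have "m * K = sgn K * (\<alpha> div ?g) * (K div ?g * ?g)" unfolding m_def using eq(2) by simp
      also have "\<dots> = (\<alpha> div ?g * ?g) * (sgn K * (K div ?g))" by (simp only: mult_ac)
      finally show ?thesis using eq(1) n by simp
    qed
    moreover have "n \<ge> 1" using Kg by (simp add: n_def)
    ultimately show ?thesis by blast
  qed
  then obtain n :: nat and m where nm: "n \<ge> 1" "coprime m (int n)" "m * K = \<alpha> * int n" by blast
  have "tors (int n \<cdot> f y - m \<cdot> y)" for y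
  proof (cases "tors y")
    case True
    then obtain c where c: "c \<noteq> 0" "c \<cdot> y = 0" by (auto simp: tors_def)
    have "c \<cdot> (int n \<cdot> f y - m \<cdot> y) = int n \<cdot> f (c \<cdot> y) - m \<cdot> c \<cdot> y"
      using f(1) by (simp add: endo_zmult zm_simps mult_ac)
    also have "\<dots> = 0" unfolding c(2) endo_0[OF f(1)] by simp
    finally show ?thesis using c(1) unfolding tors_def by blast
  next
    case False
    then have y0: "a = 0" if "a \<cdot> y = 0" for a using that unfolding tors_def by blast
    obtain K1 b where K1: "K1 \<noteq> 0" "K1 \<cdot> f y = b \<cdot> y" by (rule inertial_multiple[OF f])
    obtain K2 c where K2: "K2 \<noteq> 0" "K2 \<cdot> f (x + y) = c \<cdot> (x + y)" by (rule inertial_multiple[OF f])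
    let ?M = "K * K1 * K2"
    have M: "?M \<noteq> 0" using K K1 K2 by simp
    define A where "A = K1 * K2 * \<alpha>"
    define B where "B = K * K2 * b"
    define C where "C = K * K1 * c"
    have fx: "?M \<cdot> f x = A \<cdot> x"
    proof -
      have "?M \<cdot> f x = (K1 * K2) \<cdot> K \<cdot> f x" by (simp only: zmult_zmult mult_ac)
      then show ?thesis unfolding K(2) A_def by (simp only: zmult_zmult)
    qed
    have fy: "?M \<cdot> f y = B \<cdot> y"
    proof -
      have "?M \<cdot> f y = (K * K2) \<cdot> K1 \<cdot> f y" by (simp only: zmult_zmult mult_ac)
      then show ?thesis unfolding K1(2) B_def by (simp only: zmult_zmult)
    qed
    have fxy: "?M \<cdot> f (x + y) = C \<cdot> (x + y)"
    proof -
      have "?M \<cdot> f (x + y) = (K * K1) \<cdot> K2 \<cdot> f (x + y)" by (simp only: zmult_zmult mult_ac)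
      then show ?thesis unfolding K2(2) C_def by (simp only: zmult_zmult)
    qed
    have rel: "(C - A) \<cdot> x + (C - B) \<cdot> y = 0"
      using fxy fx fy by (simp add: endo_add[OF f(1)] zmult_add_right zm.scale_left_diff_distrib algebra_simps)
    have "\<exists>d. d \<noteq> 0 \<and> d \<cdot> (?M \<cdot> f y - A \<cdot> y) = 0"
    \<comment> \<open>If \<open>C = B\<close>, then \<open>C = A\<close> because \<open>x\<close> is
      not torsion. Otherwise \<open>rel\<close> makes a nonzero multiple of \<open>y\<close> a
      multiple of \<open>x\<close>, and \<open>f\<close> is computed there.\<close>
    proof (cases "C = B")
      case True
      then have "(C - A) \<cdot> x = 0" using rel by simp
      then have "C = A" using x0 by fastforce
      then show ?thesis using fy True by (intro exI[of _ 1]) simp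
    next
      case False
      have dy: "(C - B) \<cdot> y = (A - C) \<cdot> x" using rel
        by (simp add: zm.scale_left_diff_distrib algebra_simps)
      have "(C - B) \<cdot> (?M \<cdot> f y - A \<cdot> y) = ?M \<cdot> f ((C - B) \<cdot> y) - A \<cdot> (C - B) \<cdot> y"
        by (simp only: endo_zmult[OF f(1)] zm.scale_right_diff_distrib zmult_zmult mult.commute)
      also have "\<dots> = (A - C) \<cdot> ?M \<cdot> f x - A \<cdot> (A - C) \<cdot> x"
        unfolding dy by (simp only: endo_zmult[OF f(1)] zmult_zmult mult.commute)
      also have "\<dots> = 0" unfolding fx by (simp only: zmult_zmult mult.commute diff_self)
      finally show ?thesis using False by (intro exI[of _ "C - B"]) simp
    qed
    then obtain d where d: "d \<noteq> 0" "d \<cdot> (?M \<cdot> f y - A \<cdot> y) = 0" by blast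
    have mM: "m * ?M = A * int n" unfolding A_def using nm(3) by (metis mult.assoc mult.commute)
    have "(d * ?M) \<cdot> (int n \<cdot> f y - m \<cdot> y) = int n \<cdot> d \<cdot> (?M \<cdot> f y - A \<cdot> y)"
    proof -
      have "(d * ?M) \<cdot> (int n \<cdot> f y - m \<cdot> y) = (int n * d * ?M) \<cdot> f y - (d * (m * ?M)) \<cdot> y"
        by (simp only: zm.scale_right_diff_distrib zmult_zmult mult_ac)
      then show ?thesis unfolding mM by (simp only: zm.scale_right_diff_distrib zmult_zmult mult_ac)
    qed
    then have "(d * ?M) \<cdot> (int n \<cdot> f y - m \<cdot> y) = 0" unfolding d(2) by simp
    then show ?thesis using d(1) M unfolding tors_def by (metis mult_eq_0_iff)
  qed
  then show ?thesis using nm x by blast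
qed

text \<open>With \<open>u * m + w * n = 1\<close> and \<open>n = p * q\<close>, the map
  \<open>q (u f + w)\<close> is \<open>1 / p\<close> wherever \<open>f\<close> is
  \<open>m / n\<close>. As an integer combination of \<open>f\<close> and the identity it inherits
  inertiality and invariant subgroups.\<close>

lemma fractional_inverse:
  assumes f: "endo f" "inertial f" and mn: "coprime m (int n)" and p: "p dvd n" "n \<noteq> 0"
  obtains \<theta> where "endo \<theta>" "inertial \<theta>" "\<forall>x. int n \<cdot> f x = m \<cdot> x \<longrightarrow> int p \<cdot> \<theta> x = x"
    "\<forall>S. subgrp S \<longrightarrow> (\<forall>x\<in>S. f x \<in> S \<longrightarrow> \<theta> x \<in> S)"
proof -
  obtain u w where uw: "u * m + w * int n = 1" by (rule bezout_coprime[OF mn])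
  obtain q where q: "n = p * q" using p(1) by (auto simp: dvd_def)
  let ?\<theta> = "\<lambda>x. (int q * u) \<cdot> f x + (int q * w) \<cdot> x"
  have "int p \<cdot> ?\<theta> x = x" if x: "int n \<cdot> f x = m \<cdot> x" for x
  proof -
    have "int p \<cdot> ?\<theta> x = u \<cdot> int n \<cdot> f x + (w * int n) \<cdot> x"
      unfolding q by (simp only: zmult_add_right zmult_zmult of_nat_mult mult_ac)
    also have "\<dots> = (u * m + w * int n) \<cdot> x" unfolding x by (simp only: zmult_add_left zmult_zmult)
    finally show ?thesis by (simp only: uw zmult_1)
  qed
  moreover have "?\<theta> x \<in> S" if "subgrp S" "x \<in> S" "f x \<in> S" for S x
    using that by (intro subgrp_add subgrp_zmult)
  ultimately show thesis
    by (intro that[of ?\<theta>] endo_combination inertial_combination f) auto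
qed

subsection \<open>Infinite torsion-free rank\<close>

text \<open>The isolator of the subgroup generated by \<open>U\<close>; it contains all torsion.
  Finite torsion-free rank means that some finite \<open>U\<close> has hull
  \<open>UNIV\<close>.\<close>

definition isolated_hull :: "'a::ab_group_add set \<Rightarrow> 'a set" where
  "isolated_hull U = {x. \<exists>c. c \<noteq> 0 \<and> c \<cdot> x \<in> zm.span U}"

lemma subgrp_isolated_hull: "subgrp (isolated_hull U)"
proof (rule subgrpI)
  show "0 \<in> isolated_hull U" unfolding isolated_hull_def using subgrp_0[OF subgrp_span] by (auto intro!: exI[of _ 1])
  fix x y assume "x \<in> isolated_hull U" "y \<in> isolated_hull U"
  then obtain c d where *: "c \<noteq> 0" "d \<noteq> 0" "c \<cdot> x \<in> zm.span U" "d \<cdot> y \<in> zm.span U" by (auto simp: isolated_hull_def)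
  have "(c * d) \<cdot> (x - y) = d \<cdot> c \<cdot> x - c \<cdot> d \<cdot> y" by (simp add: zm_simps mult.commute)
  also have "\<dots> \<in> zm.span U" by (intro subgrp_diff[OF subgrp_span] subgrp_zmult[OF subgrp_span] *)
  finally show "x - y \<in> isolated_hull U" unfolding isolated_hull_def using *(1,2) by (metis (mono_tags, lifting) mem_Collect_eq mult_eq_0_iff)
qed

lemma isolated_hull_base: "U \<subseteq> isolated_hull U"
  unfolding isolated_hull_def using zm.span_base[of _ U] by (auto intro!: exI[of _ 1] simp: zmult_1)

lemma isolated_hull_zmultD: "c \<noteq> 0 \<Longrightarrow> c \<cdot> x \<in> isolated_hull U \<Longrightarrow> x \<in> isolated_hull U"
  unfolding isolated_hull_def by (auto simp: zmult_zmult intro: exI[of _ "_ * c"])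

lemma tors_isolated_hull: "tors x \<Longrightarrow> x \<in> isolated_hull U"
  unfolding isolated_hull_def tors_def using subgrp_0[OF subgrp_span] by (metis (mono_tags, lifting) mem_Collect_eq)

text \<open>Greedy choice outside the isolator of the previous elements makes the sequence
  independent even modulo torsion. \<open>R\<close> is an extra demand on a new element in terms of
  the old ones.\<close>

lemma independent_sequence:
  assumes ex: "\<And>U. finite U \<Longrightarrow> \<exists>u. u \<notin> isolated_hull U \<and> R U u"
  obtains u :: "nat \<Rightarrow> 'a::ab_group_add" where "\<forall>k. R (u ` {..<k}) (u k)"
    "\<forall>K c. tors (\<Sum>j<K. c j \<cdot> u j) \<longrightarrow> (\<forall>k<K. c k = 0)"
proof -
  define s where "s U = (SOME u. u \<notin> isolated_hull U \<and> R U u)" for U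
  have s: "s U \<notin> isolated_hull U \<and> R U (s U)" if "finite U" for U
    unfolding s_def by (rule someI_ex[OF ex[OF that]])
  define E where "E k = ((\<lambda>E. insert (s E) E) ^^ k) {}" for k
  define u where "u k = s (E k)" for k
  have E_Suc: "E (Suc k) = insert (u k) (E k)" for k by (simp add: E_def u_def)
  have E: "E k = u ` {..<k}" for k
  proof (induction k)
    case 0 then show ?case by (simp add: E_def)
  next
    case (Suc k) then show ?case by (simp add: E_Suc lessThan_Suc)
  qed
  have u: "u k \<notin> isolated_hull (u ` {..<k}) \<and> R (u ` {..<k}) (u k)" for k
    using s[of "E k"] E[of k] by (simp add: u_def)
  have "\<forall>k<K. c k = 0" if "tors (\<Sum>j<K. c j \<cdot> u j)" for K c
    using that
  proof (induction K)
    case (Suc K)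
    let ?H = "isolated_hull (u ` {..<K})"
    have "(\<Sum>j<K. c j \<cdot> u j) \<in> ?H"
      using isolated_hull_base[of "u ` {..<K}"]
      by (intro subgrp_sum[OF subgrp_isolated_hull] subgrp_zmult[OF subgrp_isolated_hull]) blast
    then have "(\<Sum>j<Suc K. c j \<cdot> u j) - (\<Sum>j<K. c j \<cdot> u j) \<in> ?H"
      by (rule subgrp_diff[OF subgrp_isolated_hull tors_isolated_hull[OF Suc.prems]])
    then have "c K \<cdot> u K \<in> ?H" by simp
    then have cK: "c K = 0" using isolated_hull_zmultD u by blast
    then have "tors (\<Sum>j<K. c j \<cdot> u j)" using Suc.prems by simp
    then show ?case using Suc.IH cK by (auto simp: less_Suc_eq)
  qed simp
  then show thesis using that u by blast
qed

lemma span_difference_coefficient: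
  fixes u :: "nat \<Rightarrow> 'a::ab_group_add"
  assumes indep: "\<forall>K c. tors (\<Sum>j<K. c j \<cdot> u j) \<longrightarrow> (\<forall>k<K. c k = 0)"
    and w: "w \<in> zm.span (range u)" and eq: "a \<cdot> w = b \<cdot> (u k - u l)" and lk: "l < k"
  shows "a dvd b"
proof -
  obtain K' where K': "\<forall>K\<ge>K'. \<exists>c. w = (\<Sum>j<K. c j \<cdot> u j)" using span_range_sum[OF w] by blast
  define K where "K = max K' (Suc k)"
  have K: "k < K" "l < K" using lk by (auto simp: K_def)
  obtain c where c: "w = (\<Sum>j<K. c j \<cdot> u j)" using K' unfolding K_def by (meson max.cobounded1)
  let ?d = "\<lambda>j. a * c j - (if j = k then b else 0) + (if j = l then b else 0)"
  have "(\<Sum>j<K. ?d j \<cdot> u j) = (\<Sum>j<K. a \<cdot> c j \<cdot> u j) - (\<Sum>j<K. if j = k then b \<cdot> u j else 0) + (\<Sum>j<K. if j = l then b \<cdot> u j else 0)"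
    unfolding sum_subtractf[symmetric] sum.distrib[symmetric]
    by (intro sum.cong) (auto simp: zm_simps)
  also have "\<dots> = a \<cdot> w - b \<cdot> u k + b \<cdot> u l" using K by (simp add: c zm.scale_sum_right)
  also have "\<dots> = 0" unfolding eq by (simp add: zm.scale_right_diff_distrib)
  finally have "tors (\<Sum>j<K. ?d j \<cdot> u j)" unfolding tors_def by (intro exI[of _ 1]) simp
  then have "\<forall>i<K. ?d i = 0" using spec[OF spec[OF indep, of K], of ?d] by blast
  then have "?d k = 0" using K(1) by blast
  then have "b = a * c k" using lk by simp
  then show ?thesis by simp
qed

text \<open>If \<open>p\<close> divided \<open>n\<close>, the fractional inverse would divide
  infinitely many independent elements by \<open>p\<close>; a congruence modulo their span would
  make the coefficient \<open>1\<close> divisible by \<open>p\<close>.\<close>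

lemma infinite_rank_integral:
  fixes f :: "'a::ab_group_add \<Rightarrow> 'a"
  assumes f: "endo f" "inertial f" and inf: "\<And>U::'a set. finite U \<Longrightarrow> isolated_hull U \<noteq> UNIV"
    and n: "n \<ge> 1" "coprime m (int n)" and rat: "\<forall>y. tors (int n \<cdot> f y - m \<cdot> y)"
  shows "n = 1"
proof (rule ccontr)
  assume "n \<noteq> 1"
  then obtain p where p: "prime p" "p dvd n" using prime_factor_nat by blast
  obtain \<theta> where \<theta>: "endo \<theta>" "inertial \<theta>" "\<forall>x. int n \<cdot> f x = m \<cdot> x \<longrightarrow> int p \<cdot> \<theta> x = x"
    by (rule fractional_inverse[OF f n(2) p(2)]) (use n(1) in auto)
  have "\<exists>u. u \<notin> isolated_hull U \<and> int n \<cdot> f u = m \<cdot> u" if "finite U" for U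
  proof -
    obtain y where y: "y \<notin> isolated_hull U" using inf[OF \<open>finite U\<close>] by blast
    \<comment> \<open>The multiple \<open>c \<cdot> y\<close> satisfies \<open>n f = m\<close>
      exactly and stays outside the hull.\<close>
    obtain c where c: "c \<noteq> 0" "c \<cdot> (int n \<cdot> f y - m \<cdot> y) = 0" using rat by (auto simp: tors_def)
    have "int n \<cdot> f (c \<cdot> y) - m \<cdot> c \<cdot> y = c \<cdot> (int n \<cdot> f y - m \<cdot> y)"
      using f(1) by (simp add: endo_zmult zm_simps mult_ac)
    then have "int n \<cdot> f (c \<cdot> y) = m \<cdot> c \<cdot> y" unfolding c(2) by simp
    moreover have "c \<cdot> y \<notin> isolated_hull U" using isolated_hull_zmultD[OF c(1)] y by blast
    ultimately show ?thesis by blast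
  qed
  then obtain u :: "nat \<Rightarrow> 'a" where u: "\<forall>k. int n \<cdot> f (u k) = m \<cdot> u k"
    and indep: "\<forall>K c. tors (\<Sum>j<K. c j \<cdot> u j) \<longrightarrow> (\<forall>k<K. c k = 0)"
    by (rule independent_sequence[where R = "\<lambda>U u. int n \<cdot> f u = m \<cdot> u"])
  let ?X = "zm.span (range u)"
  have "\<theta> (u k) \<in> \<theta> ` ?X" for k using zm.span_base[of "u k" "range u"] by blast
  then obtain l k where lk: "l < k" "\<theta> (u k) - \<theta> (u l) \<in> ?X"
    using almost_pigeonhole[OF subgrp_span inertialD[OF \<theta>(2) subgrp_span], of 0 "\<lambda>k. \<theta> (u k)"] by blast
  have "int p \<cdot> (\<theta> (u k) - \<theta> (u l)) = 1 \<cdot> (u k - u l)"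
    using \<theta>(3) u by (simp add: zm.scale_right_diff_distrib)
  then have "int p dvd 1" using span_difference_coefficient[OF indep lk(2) _ lk(1)] by blast
  then show False using prime_gt_1_nat[OF p(1)] by simp
qed

text \<open>Otherwise there are independent \<open>u k\<close> with distinct values of
  \<open>g\<close>. By inertiality a difference of two values lies in their span, which is
  torsion-free; being torsion, it vanishes.\<close>

lemma infinite_rank_finite_image:
  fixes g :: "'a::ab_group_add \<Rightarrow> 'a"
  assumes g: "endo g" "inertial g" and inf: "\<And>U::'a set. finite U \<Longrightarrow> isolated_hull U \<noteq> UNIV" and tg: "\<forall>y. tors (g y)"
  shows "finite (range g)"
proof (rule ccontr)
  assume infg: "infinite (range g)"
  have "\<exists>u. u \<notin> isolated_hull U \<and> g u \<notin> g ` U" if U: "finite U" for U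
  proof -
    have "infinite (range g - g ` U)" using infg U by simp
    then obtain a where a: "g a \<notin> g ` U" using infinite_imp_nonempty by blast
    obtain y0 where y0: "y0 \<notin> isolated_hull U" using inf[OF U] by blast
    obtain c where c: "c \<noteq> 0" "c \<cdot> g y0 = 0" using tg by (auto simp: tors_def)
    define y where "y = c \<cdot> y0"
    have y: "y \<notin> isolated_hull U" "g y = 0" using isolated_hull_zmultD[OF c(1)] y0 c(2) endo_zmult[OF g(1)] by (auto simp: y_def)
    \<comment> \<open>\<open>a\<close> supplies a new value and \<open>y\<close>, in the kernel of
      \<open>g\<close>, moves it out of the hull: the two candidates differ by \<open>y\<close>, so
      not both are inside.\<close>
    have "a + y \<notin> isolated_hull U \<or> a + y + y \<notin> isolated_hull U"
    proof (rule ccontr)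
      assume "\<not> (a + y \<notin> isolated_hull U \<or> a + y + y \<notin> isolated_hull U)"
      then have "(a + y + y) - (a + y) \<in> isolated_hull U" by (intro subgrp_diff[OF subgrp_isolated_hull]) auto
      then show False using y(1) by simp
    qed
    moreover have "g (a + y) = g a" "g (a + y + y) = g a" using y(2) by (simp_all add: endo_add[OF g(1)])
    ultimately show ?thesis using a by metis
  qed
  then obtain u :: "nat \<Rightarrow> 'a" where u: "\<forall>k. g (u k) \<notin> g ` u ` {..<k}"
    and indep: "\<forall>K c. tors (\<Sum>j<K. c j \<cdot> u j) \<longrightarrow> (\<forall>k<K. c k = 0)"
    by (rule independent_sequence[where R = "\<lambda>U u. g u \<notin> g ` U"])
  let ?X = "zm.span (range u)"
  have "g (u k) \<in> g ` ?X" for k using zm.span_base[of "u k" "range u"] by blast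
  then obtain l k where lk: "l < k" "g (u k) - g (u l) \<in> ?X"
    using almost_pigeonhole[OF subgrp_span inertialD[OF g(2) subgrp_span], of 0 "\<lambda>k. g (u k)"] by blast
  obtain K c where c: "g (u k) - g (u l) = (\<Sum>j<K. c j \<cdot> u j)" using span_range_sum[OF lk(2)] by blast
  have "tors (g (u k) - g (u l))" using tg endo_diff[OF g(1)] by metis
  then have "\<forall>j<K. c j = 0" using indep unfolding c by blast
  then have "g (u k) - g (u l) = 0" unfolding c by (simp add: zmult_0_left)
  then have "g (u k) = g (u l)" by simp
  then have "g (u k) \<in> g ` u ` {..<k}" using lk(1) by blast
  then show False using u by blast
qed

subsection \<open>Finite torsion-free rank\<close>

text \<open>A finite set of least size with full hull is independent, since an element with nonzero
  coefficient in a relation could be dropped.\<close>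

lemma independent_generators:
  fixes U :: "'a::ab_group_add set"
  assumes "finite U" "isolated_hull U = UNIV"
  obtains r :: nat and u :: "nat \<Rightarrow> 'a" where "\<forall>x. \<exists>c. c \<noteq> 0 \<and> c \<cdot> x \<in> zm.span (u ` {..<r})"
    "\<forall>c. (\<Sum>j<r. c j \<cdot> u j) = 0 \<longrightarrow> (\<forall>j<r. c j = 0)"
proof -
  define r where "r = (LEAST r. \<exists>U::'a set. finite U \<and> isolated_hull U = UNIV \<and> card U = r)"
  have "\<exists>U::'a set. finite U \<and> isolated_hull U = UNIV \<and> card U = r"
    unfolding r_def by (rule LeastI_ex) (use assms in blast)
  then obtain U :: "'a set" where U: "finite U" "isolated_hull U = UNIV" "card U = r" by blast
  have min: "r \<le> card U'" if "finite U'" "isolated_hull U' = UNIV" for U' :: "'a set"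
    unfolding r_def by (rule Least_le) (use that in blast)
  obtain u where u: "bij_betw u {..<r} U" using ex_bij_betw_nat_finite[OF U(1)] U(3) by (auto simp: lessThan_atLeast0)
  have uU: "u ` {..<r} = U" and inj: "inj_on u {..<r}" using u by (auto simp: bij_betw_def)
  have "\<forall>x. \<exists>c. c \<noteq> 0 \<and> c \<cdot> x \<in> zm.span (u ` {..<r})" using U(2) unfolding uU isolated_hull_def by blast
  moreover have "c k = 0" if c: "(\<Sum>j<r. c j \<cdot> u j) = 0" and k: "k < r" for c k
  proof (rule ccontr)
    assume ck: "c k \<noteq> 0"
    let ?U = "U - {u k}"
    have uk: "u k \<in> U" using uU k by blast
    have "c k \<cdot> u k = - (\<Sum>j\<in>{..<r} - {k}. c j \<cdot> u j)"
      using c k by (simp add: sum.remove[of "{..<r}" k] eq_neg_iff_add_eq_0)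
    also have "\<dots> \<in> zm.span ?U"
    proof (intro subgrp_uminus[OF subgrp_span] subgrp_sum[OF subgrp_span] subgrp_zmult[OF subgrp_span] zm.span_base)
      fix j assume "j \<in> {..<r} - {k}"
      then show "u j \<in> ?U" using inj uU k by (auto simp: inj_on_def)
    qed
    finally have "u k \<in> isolated_hull ?U" unfolding isolated_hull_def using ck by blast
    moreover have "?U \<subseteq> isolated_hull ?U" by (rule isolated_hull_base)
    ultimately have "U \<subseteq> isolated_hull ?U" by blast
    then have sp: "zm.span U \<subseteq> isolated_hull ?U" by (rule span_le_subgrp[OF _ subgrp_isolated_hull])
    have "x \<in> isolated_hull ?U" for x
    proof -
      have "x \<in> isolated_hull U" using U(2) by simp
      then obtain d where "d \<noteq> 0" "d \<cdot> x \<in> zm.span U" unfolding isolated_hull_def by blast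
      then show ?thesis using isolated_hull_zmultD sp by blast
    qed
    then have "isolated_hull ?U = UNIV" by blast
    then have "r \<le> card ?U" using U(1) by (intro min) simp
    then show False using U uk k by (simp add: card_Diff_singleton)
  qed
  ultimately show thesis using that by blast
qed

lemma span_image_sum:
  assumes "w \<in> zm.span (u ` {..<r::nat})" shows "\<exists>c. w = (\<Sum>j<r. c j \<cdot> u j)"
proof -
  let ?S = "{w. \<exists>c. w = (\<Sum>j<r. c j \<cdot> u j)}"
  have "subgrp ?S"
  proof (rule subgrpI)
    have "\<exists>c. 0 = (\<Sum>j<r. c j \<cdot> u j)" by (intro exI[of _ "\<lambda>_. 0"]) simp
    then show "0 \<in> ?S" by simp
    fix v w assume "v \<in> ?S" "w \<in> ?S"
    then obtain c d where "v = (\<Sum>j<r. c j \<cdot> u j)" "w = (\<Sum>j<r. d j \<cdot> u j)" by blast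
    then have "v - w = (\<Sum>j<r. (c j - d j) \<cdot> u j)" by (simp add: zm.scale_left_diff_distrib sum_subtractf)
    then have "\<exists>b. v - w = (\<Sum>j<r. b j \<cdot> u j)" by (rule exI[of _ "\<lambda>j. c j - d j"])
    then show "v - w \<in> ?S" by simp
  qed
  moreover have "u ` {..<r} \<subseteq> ?S"
  proof clarify
    fix i assume i: "i < r"
    have "(\<Sum>j<r. (if j = i then 1 else 0) \<cdot> u j) = (\<Sum>j<r. if j = i then u j else 0)"
      by (intro sum.cong) (auto simp: zmult_1 zmult_0_left)
    also have "\<dots> = u i" using i by simp
    finally have "u i = (\<Sum>j<r. (if j = i then 1 else 0) \<cdot> u j)" by simp
    then show "\<exists>c. u i = (\<Sum>j<r. c j \<cdot> u j)" by (rule exI[of _ "\<lambda>j. if j = i then 1 else 0"])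
  qed
  ultimately show ?thesis using span_le_subgrp assms by blast
qed

section \<open>Free modules over the rationals with \<open>\<pi>\<close>-denominators\<close>

lemma divisible_pi_number:
  assumes V: "subgrp V" and div: "\<And>p v. p \<in> \<pi> \<Longrightarrow> v \<in> V \<Longrightarrow> \<exists>w\<in>V. int p \<cdot> w = v"
    and k: "pi_number \<pi> k" and v: "v \<in> V"
  shows "\<exists>w\<in>V. int k \<cdot> w = v"
proof -
  have "V \<subseteq> sumset {0} ((\<lambda>x. int k \<cdot> x) ` V)"
  proof (rule multiplication_generates[OF subgrp_zero _ V _ k])
    show "{0} \<subseteq> V" using subgrp_0[OF V] by simp
    show "V \<subseteq> sumset {0} ((\<lambda>x. int p \<cdot> x) ` V)" if "p \<in> \<pi>" for p
    proof
      fix v assume "v \<in> V"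
      then obtain w where "w \<in> V" "int p \<cdot> w = v" using div[OF \<open>p \<in> \<pi>\<close>] by blast
      then have "0 + v \<in> sumset {0} ((\<lambda>x. int p \<cdot> x) ` V)" by (intro sumsetI) auto
      then show "v \<in> sumset {0} ((\<lambda>x. int p \<cdot> x) ` V)" by simp
    qed
  qed
  then show ?thesis using v by (fastforce elim!: sumsetE)
qed

text \<open>\<open>rel g v\<close> expresses that \<open>v\<close> is the combination of the
  \<open>w j\<close> with coefficients \<open>g j\<close>, cleared by a common denominator
  \<open>k\<close> because \<open>V\<close> carries no explicit scalar multiplication by rationals.
  It is the graph of the isomorphism.\<close>

lemma iso_Qpi_sum_if_generated:
  fixes w :: "nat \<Rightarrow> 'a::ab_group_add"
  assumes V: "subgrp V" and wV: "\<forall>j<r. w j \<in> V"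
    and tf: "\<forall>v\<in>V. \<forall>a. a \<cdot> v = 0 \<longrightarrow> a = 0 \<or> v = 0"
    and div: "\<And>p v. p \<in> \<pi> \<Longrightarrow> v \<in> V \<Longrightarrow> \<exists>x\<in>V. int p \<cdot> x = v"
    and gen: "\<forall>v\<in>V. \<exists>k. pi_number \<pi> k \<and> int k \<cdot> v \<in> zm.span (w ` {..<r})"
    and indep: "\<forall>c. (\<Sum>j<r. c j \<cdot> w j) = 0 \<longrightarrow> (\<forall>j<r. c j = 0)"
  shows "iso_Qpi_sum \<pi> V"
proof -
  define rel where "rel g v \<longleftrightarrow> v \<in> V \<and> (\<exists>k a. pi_number \<pi> k \<and> (\<forall>j<r. of_nat k * g j = (of_int (a j) :: rat)) \<and>
    int k \<cdot> v = (\<Sum>j<r. a j \<cdot> w j))" for g v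
  have ex: "\<exists>v. rel g v" if g: "g \<in> Qpi_vec \<pi> r" for g
  proof -
    have "\<forall>j\<in>{..<r}. \<exists>q. pi_number \<pi> (snd q) \<and> g j = of_int (fst q) / of_nat (snd q)"
    proof
      fix j assume "j \<in> {..<r}"
      then obtain a b where "g j = of_int a / of_nat b" "pi_number \<pi> b" using g unfolding Qpi_vec_def Qpi_def by blast
      then show "\<exists>q. pi_number \<pi> (snd q) \<and> g j = of_int (fst q) / of_nat (snd q)" by (intro exI[of _ "(a, b)"]) simp
    qed
    then obtain q where q: "\<forall>j\<in>{..<r}. pi_number \<pi> (snd (q j)) \<and> g j = of_int (fst (q j)) / of_nat (snd (q j))"
      by (rule bchoice[THEN exE])
    let ?b = "\<lambda>j. snd (q j)"
    let ?k = "\<Prod>j<r. ?b j"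
    have k: "pi_number \<pi> ?k" using q by (auto simp: pi_number_def prime_dvd_prod_iff)
    define a where "a j = fst (q j) * int (\<Prod>i\<in>{..<r} - {j}. ?b i)" for j
    have ka: "of_nat ?k * g j = of_int (a j)" if j: "j < r" for j
    proof -
      have "?k = ?b j * (\<Prod>i\<in>{..<r} - {j}. ?b i)" using j by (intro prod.remove) auto
      moreover have "?b j \<noteq> 0" using q j by (auto simp: pi_number_def)
      moreover have "g j = of_int (fst (q j)) / of_nat (?b j)" using q j by simp
      ultimately show ?thesis by (simp add: a_def field_simps)
    qed
    have "(\<Sum>j<r. a j \<cdot> w j) \<in> V" using wV by (intro subgrp_sum[OF V] subgrp_zmult[OF V]) auto
    then obtain v where "v \<in> V" "int ?k \<cdot> v = (\<Sum>j<r. a j \<cdot> w j)" using divisible_pi_number[OF V div k] by blast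
    then show ?thesis unfolding rel_def using k ka by blast
  qed
  have mult: "(\<Sum>j<r. (b * a j) \<cdot> w j) = b \<cdot> (\<Sum>j<r. a j \<cdot> w j)" for a b
    by (simp add: zm.scale_sum_right zmult_zmult)
  have relE: thesis if r: "rel g v" "rel g' v'"
    and step: "\<And>k a k' a'. pi_number \<pi> k \<Longrightarrow> \<forall>j<r. of_nat k * g j = of_int (a j) \<Longrightarrow> int k \<cdot> v = (\<Sum>j<r. a j \<cdot> w j) \<Longrightarrow>
      pi_number \<pi> k' \<Longrightarrow> \<forall>j<r. of_nat k' * g' j = of_int (a' j) \<Longrightarrow> int k' \<cdot> v' = (\<Sum>j<r. a' j \<cdot> w j) \<Longrightarrow>
      v \<in> V \<Longrightarrow> v' \<in> V \<Longrightarrow> thesis" for g v g' v' thesis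
  proof -
    obtain k a where "pi_number \<pi> k" "\<forall>j<r. of_nat k * g j = of_int (a j)" "int k \<cdot> v = (\<Sum>j<r. a j \<cdot> w j)" "v \<in> V"
      using r(1) unfolding rel_def by blast
    moreover obtain k' a' where "pi_number \<pi> k'" "\<forall>j<r. of_nat k' * g' j = of_int (a' j)" "int k' \<cdot> v' = (\<Sum>j<r. a' j \<cdot> w j)" "v' \<in> V"
      using r(2) unfolding rel_def by blast
    ultimately show thesis using step by blast
  qed
  have uniq: "v = v'" if r: "rel g v" "rel g v'" for g v v'
  proof -
    obtain k a k' a' where *: "pi_number \<pi> k" "\<forall>j<r. of_nat k * g j = of_int (a j)" "int k \<cdot> v = (\<Sum>j<r. a j \<cdot> w j)"
      "pi_number \<pi> k'" "\<forall>j<r. of_nat k' * g j = of_int (a' j)" "int k' \<cdot> v' = (\<Sum>j<r. a' j \<cdot> w j)" "v \<in> V" "v' \<in> V"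
      by (rule relE[OF r])
    have "int k' * a j = int k * a' j" if "j < r" for j
    proof -
      have "(of_int (int k' * a j) :: rat) = of_nat k' * (of_nat k * g j)" using *(2) that by simp
      also have "\<dots> = of_nat k * (of_nat k' * g j)" by simp
      also have "\<dots> = of_int (int k * a' j)" using *(5) that by simp
      finally show ?thesis by (simp only: of_int_eq_iff)
    qed
    then have "(\<Sum>j<r. (int k' * a j) \<cdot> w j) = (\<Sum>j<r. (int k * a' j) \<cdot> w j)" by (intro sum.cong) auto
    then have "int k' \<cdot> int k \<cdot> v = int k \<cdot> int k' \<cdot> v'" unfolding mult *(3,6) .
    then have "int (k * k') \<cdot> (v - v') = 0" by (simp add: zm.scale_right_diff_distrib zmult_zmult mult.commute)
    then have "int (k * k') = 0 \<or> v - v' = 0" using tf subgrp_diff[OF V *(7,8)] by blast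
    then show ?thesis using *(1,4) by (auto simp: pi_number_def)
  qed
  define h where "h g = (THE v. rel g v)" for g
  have h: "rel g (h g)" if "g \<in> Qpi_vec \<pi> r" for g
    unfolding h_def by (rule theI') (use ex[OF that] uniq in blast)
  have hI: "h g = v" if "rel g v" for g v unfolding h_def
    by (rule the_equality) (use that uniq in blast)+
  have closed: "(\<lambda>j. g j + g' j) \<in> Qpi_vec \<pi> r" if "g \<in> Qpi_vec \<pi> r" "g' \<in> Qpi_vec \<pi> r" for g g'
    using that by (auto simp: Qpi_vec_def Qpi_add)
  have add: "h (\<lambda>j. g j + g' j) = h g + h g'" if g: "g \<in> Qpi_vec \<pi> r" "g' \<in> Qpi_vec \<pi> r" for g g'
  proof (rule hI)
    obtain k a k' a' where *: "pi_number \<pi> k" "\<forall>j<r. of_nat k * g j = of_int (a j)" "int k \<cdot> h g = (\<Sum>j<r. a j \<cdot> w j)"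
      "pi_number \<pi> k'" "\<forall>j<r. of_nat k' * g' j = of_int (a' j)" "int k' \<cdot> h g' = (\<Sum>j<r. a' j \<cdot> w j)" "h g \<in> V" "h g' \<in> V"
      by (rule relE[OF h[OF g(1)] h[OF g(2)]])
    let ?c = "\<lambda>j. int k' * a j + int k * a' j"
    have "of_nat (k * k') * (g j + g' j) = of_int (?c j)" if "j < r" for j
    proof -
      have "of_nat (k * k') * (g j + g' j) = of_nat k' * (of_nat k * g j) + of_nat k * (of_nat k' * g' j)"
        by (simp add: algebra_simps)
      then show ?thesis using *(2,5) that by simp
    qed
    moreover have "int (k * k') \<cdot> (h g + h g') = (\<Sum>j<r. ?c j \<cdot> w j)"
    proof -
      have "(\<Sum>j<r. ?c j \<cdot> w j) = int k' \<cdot> int k \<cdot> h g + int k \<cdot> int k' \<cdot> h g'"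
        unfolding *(3,6) mult[symmetric] by (simp add: zmult_add_left sum.distrib)
      then show ?thesis by (simp add: zmult_add_right zmult_zmult mult.commute)
    qed
    ultimately show "rel (\<lambda>j. g j + g' j) (h g + h g')" unfolding rel_def using * subgrp_add[OF V *(7,8)]
      by (intro conjI exI[of _ "k * k'"] exI[of _ ?c]) (auto simp: pi_number_mult)
  qed
  have "inj_on h (Qpi_vec \<pi> r)"
  proof (rule inj_onI)
    fix g g' assume g: "g \<in> Qpi_vec \<pi> r" "g' \<in> Qpi_vec \<pi> r" and eq: "h g = h g'"
    obtain k a k' a' where *: "pi_number \<pi> k" "\<forall>j<r. of_nat k * g j = of_int (a j)" "int k \<cdot> h g = (\<Sum>j<r. a j \<cdot> w j)"
      "pi_number \<pi> k'" "\<forall>j<r. of_nat k' * g' j = of_int (a' j)" "int k' \<cdot> h g = (\<Sum>j<r. a' j \<cdot> w j)"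
      by (rule relE[OF h[OF g(1)] h[OF g(2)], unfolded eq[symmetric]]) blast
    have "(\<Sum>j<r. (int k' * a j - int k * a' j) \<cdot> w j) = int k' \<cdot> int k \<cdot> h g - int k \<cdot> int k' \<cdot> h g"
      unfolding *(3,6) mult[symmetric] by (simp add: zm.scale_left_diff_distrib sum_subtractf)
    also have "\<dots> = 0" by (simp add: zmult_zmult mult.commute)
    finally have 0: "\<forall>j<r. int k' * a j - int k * a' j = 0"
      using spec[OF indep, of "\<lambda>j. int k' * a j - int k * a' j"] by blast
    show "g = g'"
    proof
      fix j
      show "g j = g' j"
      proof (cases "j < r")
        case True
        then have "int k' * a j = int k * a' j" using 0 by simp
        then have "(of_int (int k' * a j) :: rat) = of_int (int k * a' j)" by (simp only:)
        then have "of_nat k' * (of_nat k * g j) = of_nat k * (of_nat k' * g' j)" using *(2,5) True by simp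
        moreover have "k \<noteq> 0" "k' \<noteq> 0" using *(1,4) by (auto simp: pi_number_def)
        ultimately show ?thesis by simp
      next
        case False
        then show ?thesis using g by (simp add: Qpi_vec_def)
      qed
    qed
  qed
  moreover have "h ` Qpi_vec \<pi> r = V"
  proof
    show "h ` Qpi_vec \<pi> r \<subseteq> V" using h unfolding rel_def by blast
    show "V \<subseteq> h ` Qpi_vec \<pi> r"
    proof
      fix v assume v: "v \<in> V"
      obtain k where k: "pi_number \<pi> k" "int k \<cdot> v \<in> zm.span (w ` {..<r})" using gen v by blast
      obtain a where a: "int k \<cdot> v = (\<Sum>j<r. a j \<cdot> w j)" using span_image_sum[OF k(2)] by blast
      define g where "g j = (if j < r then of_int (a j) / of_nat k else 0 :: rat)" for j
      have "g \<in> Qpi_vec \<pi> r" unfolding Qpi_vec_def Qpi_def g_def using k(1) by auto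
      moreover have "rel g v" unfolding rel_def
        using v k(1) a by (intro conjI exI[of _ k] exI[of _ a]) (auto simp: g_def pi_number_def)
      ultimately show "v \<in> h ` Qpi_vec \<pi> r" using hI by blast
    qed
  qed
  ultimately have "bij_betw h (Qpi_vec \<pi> r) V" by (simp add: bij_betw_def)
  then show ?thesis unfolding iso_Qpi_sum_def using add by blast
qed

section \<open>The torsion-free subgroup on which all maps are fractions\<close>

lemma pi_torsion_free:
  assumes H: "subgrp H" and tf: "\<And>p z. p \<in> \<pi> \<Longrightarrow> z \<in> H \<Longrightarrow> int p \<cdot> z = 0 \<Longrightarrow> z = 0"
    and k: "pi_number \<pi> k" and z: "z \<in> H" "int k \<cdot> z = 0"
  shows "z = 0"
  using k z
proof (induction k arbitrary: z rule: less_induct)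
  case (less k)
  show ?case
  proof (cases "k = 1")
    case True
    then show ?thesis using less.prems by (simp add: zmult_1)
  next
    case False
    have "k \<ge> 1" using less.prems(1) by (simp add: pi_number_def)
    then obtain p k' where k: "prime p" "p dvd k" "k = p * k'" "k' < k" "k' \<ge> 1"
      by (rule prime_factor_split[OF _ False])
    have p: "p \<in> \<pi>" using less.prems(1) k(1,2) by (auto simp: pi_number_def)
    have k': "pi_number \<pi> k'" using less.prems(1) unfolding k(3) by (simp add: pi_number_mult)
    have "int p \<cdot> int k' \<cdot> z = 0" using less.prems(3) unfolding k(3) by (simp add: zmult_zmult)
    then have "int k' \<cdot> z = 0" by (rule tf[OF p subgrp_zmult[OF H less.prems(2)]])
    then show ?thesis by (rule less.IH[OF k(4) k' less.prems(2)])
  qed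
qed

text \<open>A multiple of a non-torsion element satisfies \<open>n f = m\<close> exactly, so the
  fractional inverse divides it by \<open>p\<close> and \<open>torsion_bounded_if_fractional\<close>
  applies.\<close>

lemma torsion_bounded_if_denominator:
  fixes f :: "'a::ab_group_add \<Rightarrow> 'a"
  assumes f: "endo f" "inertial f" and mn: "n \<ge> 1" "coprime m (int n)" and rat: "\<forall>y. tors (int n \<cdot> f y - m \<cdot> y)"
    and nt: "n = 1 \<or> (\<exists>x::'a. \<not> tors x)" and p: "prime p" "p dvd n"
  shows "\<exists>e. \<forall>y\<in>ppart p {0::'a}. int p ^ e \<cdot> y = 0"
proof -
  have "n \<noteq> 1" using p by auto
  then obtain x0 :: 'a where x0: "\<not> tors x0" using nt by blast
  obtain c where c: "c \<noteq> 0" "c \<cdot> (int n \<cdot> f x0 - m \<cdot> x0) = 0" using rat unfolding tors_def by blast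
  have "int n \<cdot> f (c \<cdot> x0) - m \<cdot> c \<cdot> x0 = c \<cdot> (int n \<cdot> f x0 - m \<cdot> x0)"
    using f(1) by (simp add: endo_zmult zm_simps zm.scale_right_diff_distrib mult_ac)
  then have x: "int n \<cdot> f (c \<cdot> x0) = m \<cdot> c \<cdot> x0" unfolding c(2) by simp
  have "\<not> tors (c \<cdot> x0)" using tors_zmultD[OF c(1)] x0 by blast
  then have tf: "\<forall>a. a \<cdot> c \<cdot> x0 = 0 \<longrightarrow> a = 0" unfolding tors_def by blast
  obtain \<theta> where \<theta>: "endo \<theta>" "inertial \<theta>" "\<forall>x. int n \<cdot> f x = m \<cdot> x \<longrightarrow> int p \<cdot> \<theta> x = x"
    by (rule fractional_inverse[OF f mn(2) p(2)]) (use mn(1) in auto)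
  obtain e where "\<forall>y\<in>ppart p {0::'a}. int p ^ e \<cdot> y = 0"
    by (rule torsion_bounded_if_fractional[OF \<theta>(1,2) p(1) _ tf]) (use \<theta>(3) x in blast)
  then show ?thesis ..
qed

lemma almost_mult_if_iso:
  assumes iso: "iso_Qpi_sum \<pi> V" and V: "subgrp V" and p: "prime p"
  shows "almost V ((\<lambda>x. int p \<cdot> x) ` V)"
proof -
  obtain k :: nat and co where co: "\<forall>j<k. additive_on V (co j)" "\<forall>x\<in>V. (\<forall>j<k. co j x = 0) \<longrightarrow> x = 0"
    "\<forall>j<k. \<forall>x\<in>V. \<exists>b. pi_number \<pi> b \<and> of_nat b * co j x \<in> \<int>"
    by (rule coordinates_if_iso[OF iso V])
  show ?thesis by (rule almost_mult_coordinates[OF p V, of k co]) (use co in auto)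
qed

text \<open>\<open>V\<close> is built inside a multiple of the group free of
  \<open>\<pi>\<close>-torsion: a maximal independent set is multiplied into it and into the kernels
  of all \<open>n i f i - m i\<close>, and \<open>V\<close> is the \<open>\<pi>\<close>-isolator of
  its span there. Closing under division by \<open>\<pi>\<close>-numbers makes \<open>V\<close>
  invariant and \<open>\<pi>\<close>-divisible.\<close>

lemma mixed_structure_exists:
  fixes f :: "nat \<Rightarrow> 'a::ab_group_add \<Rightarrow> 'a" and m :: "nat \<Rightarrow> int" and n :: "nat \<Rightarrow> nat" and U :: "'a set"
  assumes f: "\<And>i. i < t \<Longrightarrow> endo (f i)" "\<And>i. i < t \<Longrightarrow> inertial (f i)"
    and U: "finite U" "isolated_hull U = UNIV"
    and n: "\<And>i. i < t \<Longrightarrow> n i \<ge> 1" "\<And>i. i < t \<Longrightarrow> coprime (m i) (int (n i))"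
    and rat: "\<And>i. i < t \<Longrightarrow> \<forall>y. tors (int (n i) \<cdot> f i y - m i \<cdot> y)"
    and nt: "\<And>i. i < t \<Longrightarrow> n i = 1 \<or> (\<exists>x::'a. \<not> tors x)"
  shows "\<exists>\<pi> V \<pi>1 L B D P g. primary_decomposition f t m n V \<pi> \<pi>1 L B D P g"
proof -
  define \<pi> where "\<pi> = prime_divs (\<Prod>i<t. n i)"
  have prod: "(\<Prod>i<t. n i) \<noteq> 0" using n(1) by fastforce
  have fin: "finite \<pi>" unfolding \<pi>_def prime_divs_def
    by (rule finite_subset[OF _ finite_divisors_nat[of "\<Prod>i<t. n i"]]) (use prod in auto)
  have \<pi>: "prime p \<and> (\<exists>i<t. p dvd n i)" if "p \<in> \<pi>" for p
    using that unfolding \<pi>_def prime_divs_def by (auto simp: prime_dvd_prod_iff)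
  have "\<forall>p\<in>\<pi>. \<exists>e. \<forall>y\<in>ppart p {0::'a}. int p ^ e \<cdot> y = 0"
    using \<pi> torsion_bounded_if_denominator[OF f n rat nt] by blast
  then obtain e where e: "\<forall>p\<in>\<pi>. \<forall>y\<in>ppart p {0::'a}. int p ^ e p \<cdot> y = 0" by (rule bchoice[THEN exE])
  \<comment> \<open>\<open>N\<close> kills the torsion at the finitely many primes of
    \<open>\<pi>\<close>, which is bounded for each of them.\<close>
  define N where "N = (\<Prod>p\<in>\<pi>. int p ^ e p)"
  have "0 \<notin> \<pi>" using \<pi>[of 0] not_prime_0 by blast
  then have N: "N \<noteq> 0" unfolding N_def using fin by auto
  let ?R = "range (\<lambda>x::'a. N \<cdot> x)"
  have R: "subgrp ?R" by (intro subgrp_image endo_zmult_const subgrp_UNIV)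
  have fR: "f i x \<in> ?R" if x: "x \<in> ?R" and i: "i < t" for x i
  proof -
    obtain y where y: "x = N \<cdot> y" using x by blast
    then have "f i x = N \<cdot> f i y" using endo_zmult[OF f(1)[OF i]] by blast
    then show ?thesis by blast
  qed
  have Rtf1: "z = 0" if p: "p \<in> \<pi>" and z: "z \<in> ?R" and pz: "int p \<cdot> z = 0" for p z
  proof -
    obtain y where y: "z = N \<cdot> y" using z by blast
    define M where "M = (\<Prod>q\<in>\<pi> - {p}. int q ^ e q)"
    have NM: "N = int p ^ e p * M" unfolding N_def M_def by (rule prod.remove[OF fin p])
    have "int p ^ Suc (e p) \<cdot> M \<cdot> y = int p \<cdot> z" unfolding y NM by (simp add: zmult_zmult mult_ac)
    then have "int p ^ Suc (e p) \<cdot> M \<cdot> y \<in> {0}" unfolding pz by blast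
    then have "M \<cdot> y \<in> ppart p {0}" unfolding ppart_def by blast
    then have "int p ^ e p \<cdot> M \<cdot> y = 0" using e p by blast
    then show ?thesis unfolding y NM by (simp add: zmult_zmult)
  qed
  have Rtf: "z = 0" if "pi_number \<pi> k" "z \<in> ?R" "int k \<cdot> z = 0" for k z
    by (rule pi_torsion_free[OF R Rtf1 that])

  obtain r :: nat and u :: "nat \<Rightarrow> 'a" where u: "\<forall>x. \<exists>c. c \<noteq> 0 \<and> c \<cdot> x \<in> zm.span (u ` {..<r})"
    and indep: "\<forall>c. (\<Sum>j<r. c j \<cdot> u j) = 0 \<longrightarrow> (\<forall>j<r. c j = 0)"
    by (rule independent_generators[OF U])
  have "\<forall>ij\<in>{..<t} \<times> {..<r}. \<exists>c. c \<noteq> 0 \<and> c \<cdot> (int (n (fst ij)) \<cdot> f (fst ij) (u (snd ij)) - m (fst ij) \<cdot> u (snd ij)) = 0"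
    using rat unfolding tors_def by auto
  then obtain c where c: "\<forall>ij\<in>{..<t} \<times> {..<r}. c ij \<noteq> 0 \<and>
      c ij \<cdot> (int (n (fst ij)) \<cdot> f (fst ij) (u (snd ij)) - m (fst ij) \<cdot> u (snd ij)) = 0" by (rule bchoice[THEN exE])
  \<comment> \<open>The factor \<open>N\<close> puts \<open>w j\<close> into \<open>?R\<close>; the
    product of the \<open>c\<close> makes all fractions exact.\<close>
  define E where "E = N * (\<Prod>ij\<in>{..<t} \<times> {..<r}. c ij)"
  have E: "E \<noteq> 0" unfolding E_def using N c by auto
  define w where "w j = E \<cdot> u j" for j
  have wR: "w j \<in> ?R" for j unfolding w_def E_def zmult_zmult[symmetric] by blast
  have wK: "int (n i) \<cdot> f i (w j) = m i \<cdot> w j" if i: "i < t" and j: "j < r" for i j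
  proof -
    have ij: "(i, j) \<in> {..<t} \<times> {..<r}" using i j by auto
    have "c (i, j) dvd E" unfolding E_def using ij by (intro dvd_mult dvd_prodI) auto
    then obtain d where d: "E = d * c (i, j)" by (auto simp: dvd_def mult.commute)
    have "int (n i) \<cdot> f i (w j) - m i \<cdot> w j = d \<cdot> c (i, j) \<cdot> (int (n i) \<cdot> f i (u j) - m i \<cdot> u j)"
      unfolding w_def d endo_zmult[OF f(1)[OF i]] by (simp add: zmult_zmult zm.scale_right_diff_distrib mult_ac)
    also have "c (i, j) \<cdot> (int (n i) \<cdot> f i (u j) - m i \<cdot> u j) = 0" using c ij by force
    finally show ?thesis by simp
  qed
  have windep: "\<forall>j<r. a j = 0" if "(\<Sum>j<r. a j \<cdot> w j) = 0" for a
  proof -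
    have "(\<Sum>j<r. (a j * E) \<cdot> u j) = 0" using that unfolding w_def by (simp add: zmult_zmult)
    then have "\<forall>j<r. a j * E = 0" using spec[OF indep, of "\<lambda>j. a j * E"] by blast
    then show ?thesis using E by simp
  qed

  let ?W = "zm.span (w ` {..<r})"
  have W: "subgrp ?W" by (rule subgrp_span)
  have WR: "?W \<subseteq> ?R" by (rule span_le_subgrp[OF _ R]) (use wR in blast)
  have Wtf: "a = 0 \<or> x = 0" if x: "x \<in> ?W" and a: "a \<cdot> x = 0" for x a
  proof -
    obtain b where b: "x = (\<Sum>j<r. b j \<cdot> w j)" using span_image_sum[OF x] by blast
    have "(\<Sum>j<r. (a * b j) \<cdot> w j) = 0" using a unfolding b by (simp add: zm.scale_sum_right zmult_zmult)
    then have "\<forall>j<r. a * b j = 0" by (rule windep)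
    then show ?thesis unfolding b by (cases "a = 0") (auto intro!: sum.neutral)
  qed
  have WK: "int (n i) \<cdot> f i x = m i \<cdot> x" if i: "i < t" and x: "x \<in> ?W" for i x
  proof -
    have "endo (\<lambda>x. int (n i) \<cdot> f i x + (- m i) \<cdot> x)" by (rule endo_combination[OF f(1)[OF i]])
    then have S: "subgrp ((\<lambda>x. int (n i) \<cdot> f i x + (- m i) \<cdot> x) -` {0})" by (rule subgrp_vimage[OF _ subgrp_zero])
    have "?W \<subseteq> (\<lambda>x. int (n i) \<cdot> f i x + (- m i) \<cdot> x) -` {0}"
      by (rule span_le_subgrp[OF _ S]) (use wK[OF i] in auto)
    then show ?thesis using x by auto
  qed

  define V where "V = {x \<in> ?R. \<exists>k. pi_number \<pi> k \<and> int k \<cdot> x \<in> ?W}"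
  have V: "subgrp V"
  proof (rule subgrpI)
    show "0 \<in> V" unfolding V_def using subgrp_0[OF R] subgrp_0[OF W] pi_number_1 by (auto intro!: exI[of _ 1])
    fix x y assume "x \<in> V" "y \<in> V"
    then obtain k l where *: "x \<in> ?R" "pi_number \<pi> k" "int k \<cdot> x \<in> ?W" "y \<in> ?R" "pi_number \<pi> l" "int l \<cdot> y \<in> ?W"
      unfolding V_def by blast
    have "int (k * l) \<cdot> (x - y) = int l \<cdot> int k \<cdot> x - int k \<cdot> int l \<cdot> y"
      by (simp add: zmult_zmult zm.scale_right_diff_distrib mult.commute)
    also have "\<dots> \<in> ?W" by (rule subgrp_diff[OF W subgrp_zmult[OF W *(3)] subgrp_zmult[OF W *(6)]])
    finally show "x - y \<in> V" unfolding V_def using subgrp_diff[OF R *(1,4)] *(2,5) pi_number_mult by blast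
  qed
  have WV: "?W \<subseteq> V" unfolding V_def using WR pi_number_1 by (auto intro!: exI[of _ 1] simp: zmult_1)
  have VI: "x \<in> V" if "x \<in> ?R" "pi_number \<pi> k" "int k \<cdot> x \<in> ?W" for x k using that unfolding V_def by blast
  have VE: "x \<in> ?R \<and> (\<exists>k. pi_number \<pi> k \<and> int k \<cdot> x \<in> ?W)" if "x \<in> V" for x using that unfolding V_def by blast
  have kpos: "int k \<noteq> 0" if "pi_number \<pi> k" for k using that by (simp add: pi_number_def)
  have Vtf: "\<forall>v\<in>V. \<forall>a. a \<cdot> v = 0 \<longrightarrow> a = 0 \<or> v = 0"
  proof (intro ballI allI impI)
    fix v a assume v: "v \<in> V" and a: "a \<cdot> v = 0"
    obtain k where k: "pi_number \<pi> k" "int k \<cdot> v \<in> ?W" using VE[OF v] by blast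
    have "a \<cdot> int k \<cdot> v = int k \<cdot> a \<cdot> v" by (simp only: zmult_zmult mult.commute)
    then have "a \<cdot> int k \<cdot> v = 0" unfolding a by simp
    then have "a = 0 \<or> int k \<cdot> v = 0" by (rule Wtf[OF k(2)])
    then show "a = 0 \<or> v = 0" using Rtf[OF k(1)] VE[OF v] by blast
  qed
  have Vrat: "int (n i) \<cdot> f i v = m i \<cdot> v" if i: "i < t" and v: "v \<in> V" for i v
  proof -
    obtain k where k: "v \<in> ?R" "pi_number \<pi> k" "int k \<cdot> v \<in> ?W" using VE[OF v] by blast
    have "int k \<cdot> (int (n i) \<cdot> f i v - m i \<cdot> v) = int (n i) \<cdot> f i (int k \<cdot> v) - m i \<cdot> int k \<cdot> v"
      unfolding endo_zmult[OF f(1)[OF i]] by (simp add: zmult_zmult zm.scale_right_diff_distrib mult.commute)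
    also have "\<dots> = 0" using WK[OF i k(3)] by simp
    finally have "int (n i) \<cdot> f i v - m i \<cdot> v = 0"
      by (rule Rtf[OF k(2) subgrp_diff[OF R subgrp_zmult[OF R fR[OF k(1) i]] subgrp_zmult[OF R k(1)]]])
    then show ?thesis by simp
  qed
  have fV: "f i v \<in> V" if i: "i < t" and v: "v \<in> V" for i v
  proof -
    obtain k where k: "v \<in> ?R" "pi_number \<pi> k" "int k \<cdot> v \<in> ?W" using VE[OF v] by blast
    have "p \<in> \<pi>" if "prime p" "p dvd n i" for p
      unfolding \<pi>_def prime_divs_def using that i by (auto simp: prime_dvd_prod_iff)
    then have ni: "pi_number \<pi> (n i)" using n(1)[OF i] by (auto simp: pi_number_def)
    have "int (k * n i) \<cdot> f i v = int k \<cdot> int (n i) \<cdot> f i v" by (simp add: zmult_zmult)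
    also have "\<dots> = m i \<cdot> int k \<cdot> v" unfolding Vrat[OF i v] by (simp only: zmult_zmult mult.commute)
    also have "\<dots> \<in> ?W" by (rule subgrp_zmult[OF W k(3)])
    finally show ?thesis using k(2) ni by (intro VI[of _ "k * n i"] fR[OF k(1) i]) (auto simp: pi_number_mult)
  qed
  \<comment> \<open>The witness is the fractional inverse of a map whose denominator is divisible by
    \<open>p\<close>.\<close>
  have Vdiv: "\<exists>w\<in>V. int p \<cdot> w = v" if p: "p \<in> \<pi>" and v: "v \<in> V" for p v
  proof -
    obtain i where i: "i < t" "p dvd n i" using \<pi>[OF p] by blast
    have ni: "n i \<noteq> 0" using n(1)[OF i(1)] by simp
    obtain \<theta> where \<theta>: "endo \<theta>" "inertial \<theta>" "\<forall>x. int (n i) \<cdot> f i x = m i \<cdot> x \<longrightarrow> int p \<cdot> \<theta> x = x"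
      "\<forall>S. subgrp S \<longrightarrow> (\<forall>x\<in>S. f i x \<in> S \<longrightarrow> \<theta> x \<in> S)"
      by (rule fractional_inverse[OF f(1)[OF i(1)] f(2)[OF i(1)] n(2)[OF i(1)] i(2) ni])
    have "int p \<cdot> \<theta> v = v" using \<theta>(3) Vrat[OF i(1) v] by blast
    moreover have "\<theta> v \<in> V" using \<theta>(4) V v fV[OF i(1) v] by blast
    ultimately show ?thesis by blast
  qed
  have per: "\<exists>k::nat. k \<ge> 1 \<and> int k \<cdot> x \<in> V" for x
  proof -
    obtain c where c: "c \<noteq> 0" "c \<cdot> x \<in> zm.span (u ` {..<r})" using u by blast
    obtain a where a: "c \<cdot> x = (\<Sum>j<r. a j \<cdot> u j)" using span_image_sum[OF c(2)] by blast
    have "(E * c) \<cdot> x = E \<cdot> c \<cdot> x" by (simp only: zmult_zmult)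
    also have "\<dots> = (\<Sum>j<r. a j \<cdot> w j)" unfolding a w_def by (simp add: zm.scale_sum_right zmult_zmult mult.commute)
    also have "\<dots> \<in> V" using WV zm.span_base[of _ "w ` {..<r}"] by (intro subgrp_sum[OF V] subgrp_zmult[OF V]) auto
    finally have "sgn (E * c) \<cdot> (E * c) \<cdot> x \<in> V" by (rule subgrp_zmult[OF V])
    then have "(E * c * sgn (E * c)) \<cdot> x \<in> V" by (simp only: zmult_zmult mult.commute)
    then have "int (nat \<bar>E * c\<bar>) \<cdot> x \<in> V" unfolding abs_sgn[symmetric] by simp
    moreover have "nat \<bar>E * c\<bar> \<ge> 1" using E c(1) by (simp add: Suc_le_eq)
    ultimately show ?thesis by blast
  qed
  have iso: "iso_Qpi_sum \<pi> V"
    by (rule iso_Qpi_sum_if_generated[OF V, of r w])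
      (use WV zm.span_base[of _ "w ` {..<r}"] Vtf Vdiv VE windep in \<open>blast+\<close>)
  have bounded: "\<exists>h. \<forall>x\<in>ppart p V. int p ^ h \<cdot> x \<in> V" if p: "p \<in> \<pi>" for p
  proof (intro exI[of _ "e p"] ballI)
    fix x assume "x \<in> ppart p V"
    then obtain k where k: "int p ^ k \<cdot> x \<in> V" unfolding ppart_def by blast
    have pp: "prime p" using \<pi>[OF p] by blast
    have "q = p" if "prime q" "q dvd p ^ k" for q
      using prime_dvd_power[OF that] primes_dvd_imp_eq[OF that(1) pp] by blast
    then have "pi_number \<pi> (p ^ k)" using p pp unfolding pi_number_def by (auto simp: prime_gt_0_nat)
    \<comment> \<open>Dividing inside \<open>V\<close> shows that \<open>x\<close> differs from an
      element of \<open>V\<close> by \<open>p\<close>-torsion, which \<open>p ^ e p\<close>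
      kills.\<close>
    then obtain v where v: "v \<in> V" "int (p ^ k) \<cdot> v = int p ^ k \<cdot> x" using divisible_pi_number[OF V Vdiv _ k] by blast
    then have "int p ^ k \<cdot> (x - v) = 0" by (simp add: zm.scale_right_diff_distrib)
    then have "x - v \<in> ppart p {0}" unfolding ppart_def by blast
    then have "int p ^ e p \<cdot> (x - v) = 0" using e p by blast
    then have "int p ^ e p \<cdot> x = int p ^ e p \<cdot> v" by (simp add: zm.scale_right_diff_distrib)
    then show "int p ^ e p \<cdot> x \<in> V" using subgrp_zmult[OF V v(1)] by simp
  qed
  have "\<exists>\<pi>1 L B D P g. primary_decomposition f t m n V \<pi> \<pi>1 L B D P g"
    by (rule primary_decomposition_exists[OF f V Vtf per fV Vrat n \<pi>_def Vdiv almost_mult_if_iso[OF iso V] iso bounded])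
  then show ?thesis by blast
qed

text \<open>\<open>?A\<close> is the common kernel of the maps \<open>f i - m i\<close>, whose
  images are finite.\<close>

lemma integral_if_infinite_rank:
  fixes f :: "nat \<Rightarrow> 'a::ab_group_add \<Rightarrow> 'a" and m :: "nat \<Rightarrow> int" and n :: "nat \<Rightarrow> nat"
  assumes f: "\<And>i. i < t \<Longrightarrow> endo (f i)" "\<And>i. i < t \<Longrightarrow> inertial (f i)"
    and inf: "\<And>U::'a set. finite U \<Longrightarrow> isolated_hull U \<noteq> UNIV"
    and n: "\<And>i. i < t \<Longrightarrow> n i \<ge> 1" "\<And>i. i < t \<Longrightarrow> coprime (m i) (int (n i))"
    and rat: "\<And>i. i < t \<Longrightarrow> \<forall>y. tors (int (n i) \<cdot> f i y - m i \<cdot> y)"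
  shows "\<exists>A0. subgrp A0 \<and> finite_index A0 \<and> (\<forall>i<t. \<forall>x\<in>A0. f i x = m i \<cdot> x)"
proof -
  let ?g = "\<lambda>i x. 1 \<cdot> f i x + (- m i) \<cdot> x"
  let ?A = "\<Inter>i\<in>{..<t}. ?g i -` {0}"
  have g: "endo (?g i)" "inertial (?g i)" if "i < t" for i
    by (rule endo_combination inertial_combination f that)+
  have A: "subgrp ?A" using g by (intro subgrp_INT subgrp_vimage subgrp_zero) auto
  have "almost UNIV (?g i -` {0})" if i: "i < t" for i
  proof -
    have "n i = 1" by (rule infinite_rank_integral[OF f[OF i] inf n[OF i] rat[OF i]])
    then have tg: "\<forall>y. tors (?g i y)" using rat[OF i] by (simp add: zmult_1)
    have "finite (range (?g i))" by (rule infinite_rank_finite_image[OF g[OF i] _ tg]) (rule inf)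
    then show ?thesis by (intro almost_vimage g i subgrp_zero almost_finite) auto
  qed
  then have "almost UNIV ?A" using g by (intro almost_INT subgrp_vimage subgrp_zero) auto
  then have "finite_index ?A" using finite_index_iff[OF A] by simp
  moreover have "\<forall>i<t. \<forall>x\<in>?A. f i x = m i \<cdot> x" by (auto simp: zmult_1)
  ultimately show ?thesis using A by blast
qed

section \<open>The split by torsion-free rank, and the converse\<close>

lemma structure_if_inertial:
  fixes phi :: "nat \<Rightarrow> 'a::ab_group_add \<Rightarrow> 'a"
  assumes f: "\<And>i. i < t \<Longrightarrow> endo (phi i)" "\<And>i. i < t \<Longrightarrow> inertial (phi i)"
  shows "(\<exists>m A0. subgrp A0 \<and> finite_index A0 \<and> (\<forall>i<t. \<forall>x\<in>A0. phi i x = m i \<cdot> x)) \<or>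
    (\<exists>m n \<pi> V \<pi>1 L B D P g. primary_decomposition phi t m n V \<pi> \<pi>1 L B D P g)"
proof -
  have "\<forall>i\<in>{..<t}. \<exists>q. snd q \<ge> 1 \<and> coprime (fst q) (int (snd q)) \<and>
      (\<forall>y. tors (int (snd q) \<cdot> phi i y - fst q \<cdot> y)) \<and> (snd q = 1 \<or> (\<exists>x::'a. \<not> tors x))"
    using inertial_ratio[OF f] by auto
  then obtain q where q: "\<forall>i\<in>{..<t}. snd (q i) \<ge> 1 \<and> coprime (fst (q i)) (int (snd (q i))) \<and>
      (\<forall>y. tors (int (snd (q i)) \<cdot> phi i y - fst (q i) \<cdot> y)) \<and> (snd (q i) = 1 \<or> (\<exists>x::'a. \<not> tors x))"
    by (rule bchoice[THEN exE])
  define m n where "m i = fst (q i)" and "n i = snd (q i)" for i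
  have mn: "n i \<ge> 1" "coprime (m i) (int (n i))" "\<forall>y. tors (int (n i) \<cdot> phi i y - m i \<cdot> y)"
    "n i = 1 \<or> (\<exists>x::'a. \<not> tors x)" if "i < t" for i
    using q that by (auto simp: m_def n_def)
  show ?thesis
  proof (cases "\<exists>U::'a set. finite U \<and> isolated_hull U = UNIV")
    case True
    then obtain U :: "'a set" where U: "finite U" "isolated_hull U = UNIV" by blast
    have "\<exists>\<pi> V \<pi>1 L B D P g. primary_decomposition phi t m n V \<pi> \<pi>1 L B D P g"
      by (rule mixed_structure_exists[OF f U mn])
    then show ?thesis by blast
  next
    case False
    then have inf: "isolated_hull U \<noteq> UNIV" if "finite U" for U :: "'a set" using that by blast
    have "\<exists>A0. subgrp A0 \<and> finite_index A0 \<and> (\<forall>i<t. \<forall>x\<in>A0. phi i x = m i \<cdot> x)"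
      by (rule integral_if_infinite_rank[OF f inf mn(1-3)])
    then show ?thesis by blast
  qed
qed

lemma inertial_if_integral:
  assumes f: "endo f" and A0: "subgrp A0" "finite_index A0" and m: "\<forall>x\<in>A0. f x = m \<cdot> x"
  shows "inertial f"
proof (rule inertial_from_finite_index[OF f A0(1)])
  show "almost UNIV A0" using A0 finite_index_iff by blast
  show "inertial_on f A0" unfolding inertial_on_def
  proof (intro allI impI almost_subset)
    fix X assume "subgrp X" "X \<subseteq> A0"
    then show "f ` X \<subseteq> X" using m subgrp_zmult by fastforce
  qed
qed

lemma inertial_if_multiplication_structure:
  assumes "multiplication_structure f B D C V \<pi> \<pi>1 m n" "finite_index (sumset (sumset B D) C)"
  shows "inertial f"
proof -
  interpret multiplication_structure f B D C V \<pi> \<pi>1 m n by (rule assms(1))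
  have A0: "subgrp (sumset (sumset B D) C)" by (intro subgrp_sumset B D C)
  show ?thesis
    by (rule inertial_from_finite_index[OF f A0 _ inertial_on_structure]) (use assms(2) finite_index_iff[OF A0] in blast)
qed

theorem theoremA:
  fixes phi :: "nat \<Rightarrow> 'a::ab_group_add \<Rightarrow> 'a" and t :: nat
  assumes endos: "\<forall>i<t. endo (phi i)"
  shows "(\<forall>i<t. inertial (phi i)) \<longleftrightarrow>
    (\<exists>A0. subgrp A0 \<and> finite_index A0 \<and>
      ((\<exists>m::nat \<Rightarrow> int. \<forall>i<t. \<forall>x\<in>A0. phi i x = zmult (m i) x)
       \<or>
       (\<exists>B D C (\<pi>::nat set) \<pi>1 V.
          subgrp B \<and> subgrp D \<and> subgrp C \<and>
          A0 = sumset (sumset B D) C \<and> direct3 B D C \<and>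
          finite \<pi>1 \<and> \<pi> \<subseteq> \<pi>1 \<and> (\<forall>p\<in>\<pi>1. prime p) \<and>
          \<comment> \<open>(i)\<close>
          sumset B D = comp \<pi>1 A0 \<and> bounded_grp B \<and>
          divisible_grp D \<and> pi_group (- \<pi>) D \<and> finite_rank D \<and>
          \<comment> \<open>(ii)\<close>
          Qpi_module \<pi> C \<and> (\<forall>i<t. phi i ` C \<subseteq> C) \<and>
          subgrp V \<and> V \<subseteq> C \<and> pi_divisible \<pi> V \<and> iso_Qpi_sum \<pi> V \<and>
          (\<forall>x\<in>C. \<exists>n. pi_number (- \<pi>) n \<and> zmult (int n) x \<in> V) \<and>
          (\<forall>p\<in>\<pi>1. \<forall>x\<in>C. \<exists>y\<in>C. zmult (int p) y - x \<in> V) \<and>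
          \<comment> \<open>(iii)\<close>
          (\<forall>i<t. acts_mult (phi i) B {0} \<and> acts_mult (phi i) D {0} \<and>
                 (\<exists>m n. acts_ratmult (phi i) m n V) \<and> acts_mult (phi i) C V) \<and>
          \<comment> \<open>(iv)\<close>
          (\<exists>(m::nat \<Rightarrow> int) (n::nat \<Rightarrow> nat).
             (\<forall>i<t. acts_ratmult (phi i) (m i) (n i) V \<and>
                (\<forall>p. prime p \<and> infinite {coset x V | x. x \<in> sec_pcomp p C V} \<longrightarrow>
                   acts_ratmult (phi i) (m i) (n i) (comp {p} D))) \<and>
             \<pi> = prime_divs (\<Prod>i<t. n i)))))"
proof
  let "_ \<longleftrightarrow> ?R" = ?thesis
  assume inert: "\<forall>i<t. inertial (phi i)"
  have f: "endo (phi i)" "inertial (phi i)" if "i < t" for i using endos inert that by auto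
  have "(\<exists>m A0. subgrp A0 \<and> finite_index A0 \<and> (\<forall>i<t. \<forall>x\<in>A0. phi i x = m i \<cdot> x)) \<or>
      (\<exists>m n \<pi> V \<pi>1 L B D P g. primary_decomposition phi t m n V \<pi> \<pi>1 L B D P g)"
    by (rule structure_if_inertial[OF f])
  then show ?R
  proof (elim disjE exE)
    fix m A0 assume "subgrp A0 \<and> finite_index A0 \<and> (\<forall>i<t. \<forall>x\<in>A0. phi i x = m i \<cdot> x)"
    then show ?R by blast
  next
    fix m n \<pi> V \<pi>1 L B D P g assume "primary_decomposition phi t m n V \<pi> \<pi>1 L B D P g"
    then interpret primary_decomposition phi t m n V \<pi> \<pi>1 L B D P g .
    show ?R
      apply (insert mixed_structure \<pi>_eq)
      apply (elim conjE)
      apply (rule exI[of _ A0], intro conjI, assumption, assumption, rule disjI2)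
      apply (rule exI[of _ BB], rule exI[of _ DD], rule exI[of _ NC], rule exI[of _ \<pi>], rule exI[of _ \<pi>1], rule exI[of _ NV])
      apply (intro conjI; (assumption | (rule exI[of _ m], rule exI[of _ n], intro conjI; assumption)))
      done
  qed
next
  let "_ \<longleftrightarrow> ?R" = ?thesis
  assume ?R
  then show "\<forall>i<t. inertial (phi i)"
  proof (elim exE conjE disjE, goal_cases)
    case (1 A0 m)
    then show ?case using endos inertial_if_integral by blast
  next
    case (2 A0 B D C \<pi> \<pi>1 V m n)
    show ?case
    proof (intro allI impI)
      fix i assume i: "i < t"
      have n: "prime_divs (n i) \<subseteq> \<pi>" using i unfolding 2(26) prime_divs_def by (auto simp: prime_dvd_prod_iff)
      have acts: "acts_mult (phi i) B {0}" "acts_mult (phi i) D {0}" "acts_mult (phi i) C V"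
        "acts_ratmult (phi i) (m i) (n i) V" using 2(24,25) i by blast+
      have ratD: "acts_ratmult (phi i) (m i) (n i) (comp {p} D)"
        if "prime p" "infinite {coset x V | x. x \<in> sec_pcomp p C V}" for p using 2(25) i that by blast
      have "multiplication_structure (phi i) B D C V \<pi> \<pi>1 (m i) (n i)"
        by (rule multiplication_structure.intro[OF endos[rule_format, OF i] 2(3-5,7,9,10) 2(11)[unfolded 2(6)]
              2(12,14,15,18,19,21-23) acts ratD n])
      then show "inertial (phi i)" by (rule inertial_if_multiplication_structure) (rule 2(2)[unfolded 2(6)])
    qed
  qed
qed

end
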